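(* Let $G\subset\mathbb{C}$ be a Jordan domain bounded by a rectifiable curve $L$ of length $l$, let $\zeta\in G$, and let $\phi$ be the conformal mapping of $G$ onto a disk $D_R=\{w:|w|<R\}$ with $\phi(\zeta)=0$, $\phi'(\zeta)=1$. Let $p\in\mathbb{N}$ and, for $n\in\mathbb{N}$, let $Q_{n,p}$ be a polynomial minimizing $\|P_n\|_p$ among all polynomials $P_n$ of degree at most $n$ with $P_n(\zeta)=1$, and let $$J_{n,p}(z)=\int_\zeta^z (Q_{n,p}(t))^p\,dt .$$ Then $$\|\phi-J_{n,p}\|_{\infty}\le \frac12\left((2\pi R)^{1/p}+l^{1/p}\right)^{p-1}\left\|(\phi')^{1/p}-Q_{n,p}\right\|_p .$$ Hence $\|\phi-J_{n,p}\|_\infty\to 0$ as $n\to\infty$ when $G$ is a Smirnov domain.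
   Context: For $0<p<\infty$, $E_p(G)$ denotes the Smirnov space of analytic functions $f$ in $G$ (equivalently, those with $(f\circ\psi)(\psi')^{1/p}$ in the Hardy space $H^p(D_R)$, where $\psi=\phi^{-1}$), normed (quasi-normed if $p<1$) by their boundary values: $\|f\|_p=\left(\int_L|f(z)|^p|dz|\right)^{1/p}$. The radius $R$ is determined by $G$ and $\zeta$ through the normalization of $\phi$. $(\phi')^{1/p}$ is the analytic branch in $G$ equal to $1$ at $\zeta$; it belongs to $E_p(G)$. $\|\cdot\|_\infty$ is the supremum norm on $\overline G$ ($\phi$ being extended continuously to $\overline G$). $G$ is called a Smirnov domain if polynomials are dense in norm in $E_p(G)$; this is equivalent to $\log|\psi'|$ being representable in $D_R$ by the Poisson integral of its boundary values, and so does not depend on $p$. *)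

theory Defs
  imports "HOL-Complex_Analysis.Complex_Analysis" "HOL-Computational_Algebra.Polynomial"
begin

definition inscribed_lengths :: "(real \<Rightarrow> complex) \<Rightarrow> real \<Rightarrow> real \<Rightarrow> real set" where
  "inscribed_lengths \<gamma> a b =
     {(\<Sum>i<n. dist (\<gamma> (t i)) (\<gamma> (t (Suc i)))) | (n::nat) (t::nat \<Rightarrow> real).
        (\<forall>i\<le>n. t i \<in> {a..b}) \<and> (\<forall>i<n. t i \<le> t (Suc i))}"

definition rectifiable :: "(real \<Rightarrow> complex) \<Rightarrow> bool" where
  "rectifiable \<gamma> \<longleftrightarrow> bdd_above (inscribed_lengths \<gamma> 0 1)"

definition curve_length :: "(real \<Rightarrow> complex) \<Rightarrow> real \<Rightarrow> real \<Rightarrow> real" where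
  "curve_length \<gamma> a b = Sup (inscribed_lengths \<gamma> a b)"

definition rectifiable_jordan_curve :: "(real \<Rightarrow> complex) \<Rightarrow> bool" where
  "rectifiable_jordan_curve \<gamma> \<longleftrightarrow>
     simple_path \<gamma> \<and> pathfinish \<gamma> = pathstart \<gamma> \<and> rectifiable \<gamma>"

text \<open>For a rectifiable Jordan curve the length of the piece from 0 to t is continuous and strictly
  increasing in t, so it can be inverted; the result is the parametrization by arc length on
  the interval from 0 to the total length.\<close>

definition arc_length_param :: "(real \<Rightarrow> complex) \<Rightarrow> real \<Rightarrow> complex" where
  "arc_length_param \<gamma> s = \<gamma> (inv_into {0..1} (curve_length \<gamma> 0) s)"

definition arc_length_integral :: "(real \<Rightarrow> complex) \<Rightarrow> (complex \<Rightarrow> real) \<Rightarrow> real" where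
  "arc_length_integral \<gamma> f =
     integral\<^sup>L (lebesgue_on {0..curve_length \<gamma> 0 1}) (\<lambda>s. f (arc_length_param \<gamma> s))"

text \<open>At a boundary point where the curve has a tangent (hence almost everywhere), the approach
  regions below are, near that point, comparable with the angles in G symmetric about the inner normal,
  so the limit is the usual angular one. The regions can fail to accumulate at z only for z in a
  set of length zero; there the boundary value is unspecified.\<close>

definition approach_region :: "complex set \<Rightarrow> complex \<Rightarrow> real \<Rightarrow> complex set" where
  "approach_region G z \<alpha> = {w \<in> G. dist w z < (1 + \<alpha>) * infdist w (frontier G)}"

definition has_nontangential_limit ::
  "complex set \<Rightarrow> (complex \<Rightarrow> complex) \<Rightarrow> complex \<Rightarrow> complex \<Rightarrow> bool" where
  "has_nontangential_limit G f z c \<longleftrightarrow>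
     (\<forall>\<alpha>>0. (f \<longlongrightarrow> c) (at z within approach_region G z \<alpha>))"

definition boundary_value :: "complex set \<Rightarrow> (complex \<Rightarrow> complex) \<Rightarrow> complex \<Rightarrow> complex" where
  "boundary_value G f z = (THE c. has_nontangential_limit G f z c)"

definition conformal_onto_disk :: "(complex \<Rightarrow> complex) \<Rightarrow> complex set \<Rightarrow> real \<Rightarrow> bool" where
  "conformal_onto_disk \<phi> G R \<longleftrightarrow> \<phi> holomorphic_on G \<and> bij_betw \<phi> G (ball 0 R)"

text \<open>g is an analytic branch of the power with exponent a of the zero-free function f on S.\<close>

definition power_branch_on ::
  "complex set \<Rightarrow> (complex \<Rightarrow> complex) \<Rightarrow> real \<Rightarrow> (complex \<Rightarrow> complex) \<Rightarrow> bool" where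
  "power_branch_on S f a g \<longleftrightarrow>
     (\<exists>h. h holomorphic_on S \<and>
          (\<forall>z\<in>S. exp (h z) = f z \<and> g z = exp (of_real a * h z)))"

definition hardy_space :: "real \<Rightarrow> real \<Rightarrow> (complex \<Rightarrow> complex) set" where
  "hardy_space p R =
     {g. g holomorphic_on ball 0 R \<and>
         bdd_above ((\<lambda>r. integral {0..2*pi} (\<lambda>\<theta>. cmod (g (of_real r * cis \<theta>)) powr p)) ` {0<..<R})}"

text \<open>The space does not depend on the conformal map used to define it.\<close>

definition smirnov_space ::
  "real \<Rightarrow> complex set \<Rightarrow> (complex \<Rightarrow> complex) \<Rightarrow> real \<Rightarrow> (complex \<Rightarrow> complex) set" where
  "smirnov_space p G \<phi> R =
     {f. f holomorphic_on G \<and>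
         (let \<psi> = inv_into G \<phi> in
          \<exists>k. power_branch_on (ball 0 R) (deriv \<psi>) (1/p) k \<and>
              (\<lambda>w. f (\<psi> w) * k w) \<in> hardy_space p R)}"

definition smirnov_norm :: "real \<Rightarrow> (real \<Rightarrow> complex) \<Rightarrow> (complex \<Rightarrow> complex) \<Rightarrow> real" where
  "smirnov_norm p \<gamma> f =
     (arc_length_integral \<gamma>
        (\<lambda>z. cmod (boundary_value (inside (path_image \<gamma>)) f z) powr p)) powr (1/p)"

text \<open>The property does not depend on p, by its equivalence with the representability of the logarithm of
  the modulus of the derivative of the inverse map as a Poisson integral.\<close>

definition smirnov_domain ::
  "real \<Rightarrow> (real \<Rightarrow> complex) \<Rightarrow> (complex \<Rightarrow> complex) \<Rightarrow> real \<Rightarrow> bool" where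
  "smirnov_domain p \<gamma> \<phi> R \<longleftrightarrow>
     (\<forall>f\<in>smirnov_space p (inside (path_image \<gamma>)) \<phi> R. \<forall>\<epsilon>>0. \<exists>P.
        smirnov_norm p \<gamma> (\<lambda>z. f z - poly P z) < \<epsilon>)"

definition extremal_poly ::
  "real \<Rightarrow> (real \<Rightarrow> complex) \<Rightarrow> complex \<Rightarrow> nat \<Rightarrow> complex poly \<Rightarrow> bool" where
  "extremal_poly p \<gamma> \<zeta> n Q \<longleftrightarrow>
     degree Q \<le> n \<and> poly Q \<zeta> = 1 \<and>
     (\<forall>P. degree P \<le> n \<and> poly P \<zeta> = 1 \<longrightarrow>
          smirnov_norm p \<gamma> (poly Q) \<le> smirnov_norm p \<gamma> (poly P))"

text \<open>The integrand is entire, so integrating along the segment loses no generality even when the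
  segment leaves the domain.\<close>

definition J_poly :: "nat \<Rightarrow> complex \<Rightarrow> complex poly \<Rightarrow> complex \<Rightarrow> complex" where
  "J_poly p \<zeta> Q z = contour_integral (linepath \<zeta> z) (\<lambda>t. poly Q t ^ p)"

definition sup_norm_on :: "complex set \<Rightarrow> (complex \<Rightarrow> complex) \<Rightarrow> real" where
  "sup_norm_on S f = (SUP z\<in>S. cmod (f z))"

end

theory Submission
  imports Defs "HOL-Computational_Algebra.Fundamental_Theorem_Algebra"
begin

text \<open>By the theorem of F. and M. Riesz, \<phi> is absolutely continuous along the arc length
  parametrization \<sigma>, and the angular limits of g satisfy g ^ p =
  (\<phi> \<circ> \<sigma>)' / \<sigma>' almost everywhere. Two points of the curve bound two arcs, so
  \<phi> - J varies between them by at most half of the integral of cmod (g ^ p - Q ^ p); since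
  \<phi> - J vanishes at the centre, the maximum principle turns this into a bound of its modulus.
  Factoring g ^ p - Q ^ p, Hoelder's inequality and the comparison of Q with the constant
  1 give the estimate.

  For the convergence let \<psi> be the inverse of \<phi> and H the function
  (Q \<circ> \<psi>) ^ p * \<psi>', so that H is 1 at 0. Polynomials close to g,
  normalized at the centre, show that the mean of cmod H over circles tends to 1. Dividing out
  the zeros shows that the mean of sqrt (cmod H) is at least 1. Hence H tends to 1 in the
  mean, and integrating 1 - H along circles bounds \<phi> - J uniformly.\<close>

text \<open>The curve is only rectifiable, so no boundary regularity can be assumed and every
  boundary fact is first put in integrated form. Absolute continuity of the angle
  \<open>\<tau>\<close> comes from mean values of logarithms of difference quotients of the inverse
  map. After that \<open>deriv \<phi>\<close> is a Cauchy integral over the curve, and its angular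
  limits are read off at Lebesgue points by comparing a point with its mirror image in the tangent.
  The same comparison with 1 in place of \<open>deriv \<phi>\<close> tells on which side of the
  tangent \<open>G\<close> lies. The convergence does not go through the estimate: convergence of
  \<open>Q n\<close> to \<open>g\<close> in norm is never established. Only the norms are
  controlled; their p-th powers are eventually below every number greater than
  \<open>2 * pi * R\<close>, the value for \<open>g\<close>. The mean of \<open>cmod H\<close> being
  close to that of \<open>H\<close> makes \<open>H\<close> nearly positive, and comparing it with
  the mean of the square root makes \<open>cmod H\<close> nearly constant.\<close>

section \<open>Boundary correspondence\<close>

text \<open>Powers of \<^term>\<open>r / (t - b)\<close>, where b lies outside the closure and close to the piece, are large near the
  piece and bounded by 1 on the part of the frontier where f need not vanish.\<close>

lemma holomorphic_zero_on_boundary_piece: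
  assumes G: "open G" "connected G" "bounded G"
    and f: "f holomorphic_on G" "continuous_on (closure G) f"
    and z0: "z0 \<in> frontier G" "z0 \<in> closure (- closure G)" and e: "e > 0"
    and zero: "\<And>t. t \<in> frontier G \<Longrightarrow> dist t z0 < e \<Longrightarrow> f t = 0"
    and z: "z \<in> G"
  shows "f z = 0"
proof -
  obtain b where b: "b \<in> - closure G" "dist b z0 < e/4"
    using z0(2) e by (metis closure_approachable divide_pos_pos zero_less_numeral)
  \<comment> \<open>\<open>b\<close> is within \<open>e/4\<close> of \<open>z0\<close>. Frontier
    points at distance at least \<open>e\<close> from \<open>z0\<close> are therefore at least
    \<open>3 * e / 4\<close> away from \<open>b\<close>, and points within \<open>e/4\<close> of
    \<open>z0\<close> are less than \<open>e/2\<close> away from it: the quotient is at most 1 on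
    the former and at least 3/2 on the latter.\<close>
  define r where "r = 3 * e / 4"
  have "compact (closure G)" using G by (simp add: compact_closure)
  then have "bounded (f ` closure G)" using f(2) compact_continuous_image compact_imp_bounded by blast
  then obtain M where M: "M > 0" "\<And>t. t \<in> closure G \<Longrightarrow> cmod (f t) \<le> M"
    by (auto simp: bounded_pos)
  have cl: "t \<noteq> b" if "t \<in> closure G" for t using b that by auto
  have sub: "G \<subseteq> closure G" by (rule closure_subset)
  have near: "f a = 0" if a: "a \<in> G" "dist a z0 < e/4" for a
  proof -
    have bound: "cmod (f a * (r / (a - b)) ^ N) \<le> M" for N
    proof (rule maximum_modulus_frontier[where S = G and f = "\<lambda>t. f t * (r / (t - b)) ^ N"])
      show "(\<lambda>t. f t * (r / (t - b)) ^ N) holomorphic_on interior G"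
        using G f cl sub by (auto simp: interior_open intro!: holomorphic_intros)
      show "continuous_on (closure G) (\<lambda>t. f t * (r / (t - b)) ^ N)"
        using f cl by (auto intro!: continuous_intros)
      fix t assume t: "t \<in> frontier G"
      show "cmod (f t * (r / (t - b)) ^ N) \<le> M"
      proof (cases "dist t z0 < e")
        case True
        then show ?thesis using zero t M by simp
      next
        case False
        have "dist t z0 \<le> dist t b + dist b z0" by (rule dist_triangle)
        then have "r \<le> cmod (t - b)" using False b r_def by (simp add: dist_norm)
        moreover have "r > 0" using e r_def by simp
        ultimately have "cmod (r / (t - b)) \<le> 1" by (simp add: norm_divide divide_le_eq)
        then have "cmod (r / (t - b)) ^ N \<le> 1" by (simp add: power_le_one)
        moreover have "cmod (f t) \<le> M" using M t by (simp add: frontier_def)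
        ultimately have "cmod (f t) * cmod (r / (t - b)) ^ N \<le> M * 1"
          using M(1) by (intro mult_mono) auto
        then show ?thesis by (simp add: norm_mult norm_power)
      qed
    qed (use G a in auto)
    have "dist a b \<le> dist a z0 + dist b z0" by (metis dist_triangle3 dist_commute)
    then have ab: "cmod (a - b) < e / 2" using a b by (simp add: dist_norm)
    have ab0: "cmod (a - b) > 0" using cl a sub by auto
    have "3/2 * cmod (a - b) \<le> r" using ab unfolding r_def by linarith
    then have "3/2 \<le> cmod (r / (a - b))"
      using ab0 e r_def unfolding norm_divide by (simp only: le_divide_eq norm_of_real) simp
    then have pw: "(3/2) ^ N \<le> cmod (r / (a - b)) ^ N" for N by (simp add: power_mono)
    show ?thesis
    proof (rule ccontr)
      assume "f a \<noteq> 0"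
      then obtain N where N: "M / cmod (f a) < (3/2) ^ N"
        using real_arch_pow[of "3/2" "M / cmod (f a)"] by auto
      have "M < cmod (f a) * (3/2) ^ N" using N \<open>f a \<noteq> 0\<close> by (simp add: field_simps)
      also have "\<dots> \<le> cmod (f a) * cmod (r / (a - b)) ^ N" using pw by (simp add: mult_left_mono)
      also have "\<dots> \<le> M" using bound[of N] by (simp add: norm_mult norm_power)
      finally show False by simp
    qed
  qed
  have "z0 \<in> closure G" using z0 by (simp add: frontier_def)
  then obtain a where a: "a \<in> G" "dist a z0 < e/4"
    using e by (metis closure_approachable divide_pos_pos zero_less_numeral)
  show ?thesis
  proof (rule analytic_continuation_open[of "G \<inter> ball z0 (e/4)" G f "\<lambda>_. 0" z])
    show "G \<inter> ball z0 (e/4) \<noteq> {}" using a by (auto simp: dist_commute)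
  qed (use G f near z in \<open>auto simp: dist_commute\<close>)
qed

text \<open>If the boundary value lay in the open disk, the inverse map, continuous there, would
  carry the images of a sequence converging to \<open>z\<close> back to a limit in
  \<open>G\<close>.\<close>

lemma frontier_to_sphere:
  assumes G: "open G" and hol: "\<phi> holomorphic_on G" and bij: "bij_betw \<phi> G (ball 0 R)"
    and cont: "continuous_on (closure G) \<phi>" and z: "z \<in> frontier G"
  shows "cmod (\<phi> z) = R"
proof -
  have zc: "z \<in> closure G" and zG: "z \<notin> G" using z G by (auto simp: frontier_def interior_open)
  have "\<phi> z \<in> closure (\<phi> ` G)"
    using image_closure_subset[OF cont closed_closure closure_subset] zc by auto
  moreover have im: "\<phi> ` G = ball 0 R" using bij by (simp add: bij_betw_def)
  ultimately have le: "cmod (\<phi> z) \<le> R"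
    by (metis ball_subset_cball closed_cball closure_minimal mem_cball_0 subsetD)
  moreover have "\<not> cmod (\<phi> z) < R"
  proof
    assume lt: "cmod (\<phi> z) < R"
    obtain \<psi> where psi: "\<psi> holomorphic_on (\<phi> ` G)" "\<And>z. z \<in> G \<Longrightarrow> \<psi> (\<phi> z) = z"
      using holomorphic_has_inverse[OF hol G] bij by (metis bij_betw_def)
    obtain x where x: "\<And>n. x n \<in> G" "x \<longlonglongrightarrow> z" using zc closure_sequential by metis
    have "(\<lambda>n. \<phi> (x n)) \<longlonglongrightarrow> \<phi> z"
      by (rule continuous_on_tendsto_compose[OF cont x(2) zc]) (simp add: subsetD[OF closure_subset x(1)])
    moreover have "isCont \<psi> (\<phi> z)"
      using psi(1) lt im by (metis continuous_on_eq_continuous_at holomorphic_on_imp_continuous_on mem_ball_0 open_ball)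
    ultimately have "(\<lambda>n. \<psi> (\<phi> (x n))) \<longlonglongrightarrow> \<psi> (\<phi> z)" by (rule isCont_tendsto_compose[rotated])
    then have "x \<longlonglongrightarrow> \<psi> (\<phi> z)" using psi x by simp
    then have "z = \<psi> (\<phi> z)" using x LIMSEQ_unique by blast
    moreover have "\<psi> (\<phi> z) \<in> G" using im lt psi(2) by (metis imageE mem_ball_0)
    ultimately show False using zG by simp
  qed
  ultimately show ?thesis by simp
qed

text \<open>If two points of the curve had the same image u, then a crosscut of G that separates them would be mapped
  to a set at positive distance from u, although the disk near u is connected.\<close>

lemma boundary_injective:
  assumes gam: "simple_path \<gamma>" "pathfinish \<gamma> = pathstart \<gamma>" and G: "G = inside (path_image \<gamma>)"
    and hol: "\<phi> holomorphic_on G" and bij: "bij_betw \<phi> G (ball 0 R)"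
    and cont: "continuous_on (closure G) \<phi>"
    and z12: "z1 \<in> path_image \<gamma>" "z2 \<in> path_image \<gamma>" "z1 \<noteq> z2"
  shows "\<phi> z1 \<noteq> \<phi> z2"
proof
  assume eq: "\<phi> z1 = \<phi> z2"
  define u0 where "u0 = \<phi> z1"
  let ?L = "path_image \<gamma>"
  note J = Jordan_inside_outside[OF gam]
  have oG: "open G" and cG: "connected G" and bG: "bounded G" and fG: "frontier G = ?L"
    and neG: "G \<noteq> {}" using J G by auto
  have clG: "closure G = G \<union> ?L" using fG oG by (metis closure_Un_frontier)
  have ext: "z \<in> closure (- closure G)" if "z \<in> ?L" for z
  proof -
    have "G \<inter> outside ?L = {}" "outside ?L \<inter> ?L = {}"
      unfolding G by (simp_all add: inside_Int_outside outside_no_overlap)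
    then have "outside ?L \<subseteq> - closure G" unfolding clG by blast
    moreover have "z \<in> closure (outside ?L)" using J that by (auto simp: frontier_def)
    ultimately show ?thesis using closure_mono by blast
  qed
  have sph: "cmod (\<phi> z) = R" if "z \<in> ?L" for z
    using frontier_to_sphere[OF oG hol bij cont] that fG by simp
  have inj: "inj_on \<phi> G" and im: "\<phi> ` G = ball 0 R" using bij by (auto simp: bij_betw_def)
  obtain \<psi> where psi: "\<psi> holomorphic_on (\<phi> ` G)" "\<And>z. z \<in> G \<Longrightarrow> \<psi> (\<phi> z) = z"
    using holomorphic_has_inverse[OF hol oG inj] by metis
  \<comment> \<open>The crosscut has to end at points where \<open>\<phi>\<close> differs from
    \<open>u0\<close>, so every piece of the curve must contain such points. The vanishing lemma
    applies because each point of the curve is a limit of exterior points.\<close>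
  have nonconst: "\<exists>t\<in>V. \<phi> t \<noteq> u0" if V: "openin (top_of_set ?L) V" "V \<noteq> {}" for V
  proof (rule ccontr)
    assume c: "\<not> ?thesis"
    obtain t0 where "t0 \<in> V" using V by auto
    then obtain e where e: "e > 0" "ball t0 e \<inter> ?L \<subseteq> V" and t0L: "t0 \<in> ?L"
      using V by (metis openin_contains_ball openin_imp_subset subsetD)
    have "\<phi> z - u0 = 0" if "z \<in> G" for z
    proof (rule holomorphic_zero_on_boundary_piece[OF oG cG bG _ _ _ _ e(1) _ that, of _ t0])
      show "(\<lambda>z. \<phi> z - u0) holomorphic_on G" using hol by (intro holomorphic_intros)
      show "continuous_on (closure G) (\<lambda>z. \<phi> z - u0)" using cont by (intro continuous_intros)
      show "\<phi> t - u0 = 0" if "t \<in> frontier G" "dist t t0 < e" for t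
        using that e fG c by (auto simp: dist_commute)
    qed (use t0L ext fG in auto)
    then have "u0 \<in> ball 0 R" using neG im by auto
    then show False using sph[OF z12(1)] u0_def by simp
  qed
  obtain c1 c2 where c12: "arc c1" "arc c2" "pathstart c1 = z1" "pathfinish c1 = z2"
      "pathstart c2 = z2" "pathfinish c2 = z1" "path_image c1 \<inter> path_image c2 = {z1,z2}"
      "path_image c1 \<union> path_image c2 = ?L"
    using exists_double_arc[OF gam z12] by metis
  define A1 where "A1 = ?L - path_image c2"
  define A2 where "A2 = ?L - path_image c1"
  have A12: "A1 \<inter> A2 = {}" "A1 \<union> A2 = ?L - {z1,z2}" using c12 A1_def A2_def by blast+
  have A1eq: "A1 = path_image c1 - {z1,z2}" "A2 = path_image c2 - {z1,z2}"
    using c12 A1_def A2_def by blast+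
  have opA: "openin (top_of_set ?L) A1" "openin (top_of_set ?L) A2"
    unfolding A1_def A2_def Diff_eq using c12
    by (auto intro!: openin_open_Int open_Compl closed_path_image arc_imp_path)
  have neA: "A1 \<noteq> {}" "A2 \<noteq> {}"
  proof -
    show "A1 \<noteq> {}" "A2 \<noteq> {}"
      using nonempty_simple_path_endless[OF arc_imp_simple_path[OF c12(1)]]
        nonempty_simple_path_endless[OF arc_imp_simple_path[OF c12(2)]] unfolding A1eq c12(3-6)
      by (simp_all add: insert_commute)
  qed
  define U where "U = {t\<in>A1. \<phi> t \<noteq> u0}"
  define V where "V = {t\<in>A2. \<phi> t \<noteq> u0}"
  have contL: "continuous_on ?L \<phi>" using cont clG by (metis continuous_on_subset Un_upper2)
  have opne: "openin (top_of_set ?L) {t\<in>?L. \<phi> t \<noteq> u0}"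
    using continuous_openin_preimage_gen[OF contL, of "- {u0}"] by (auto simp: vimage_def Int_def)
  have UV: "openin (top_of_set ?L) U" "openin (top_of_set ?L) V" "U \<noteq> {}" "V \<noteq> {}"
  proof -
    have "U = A1 \<inter> {t\<in>?L. \<phi> t \<noteq> u0}" "V = A2 \<inter> {t\<in>?L. \<phi> t \<noteq> u0}"
      using A12 U_def V_def by auto
    then show "openin (top_of_set ?L) U" "openin (top_of_set ?L) V"
      using opA opne by (auto intro: openin_Int)
    show "U \<noteq> {}" "V \<noteq> {}" using nonconst opA neA U_def V_def by blast+
  qed
  have "U \<noteq> V" using UV A12 U_def V_def by blast
  \<comment> \<open>Points accessible from \<open>G\<close> are dense on the curve, so a crosscut
    can start in one of the open arcs between \<open>z1\<close> and \<open>z2\<close> and end in the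
    other.\<close>
  obtain c where c: "arc c" "pathstart c \<in> U" "pathfinish c \<in> V" "c ` {0<..<1} \<subseteq> G"
    using dense_accessible_frontier_point_pairs[OF oG cG, unfolded fG, OF UV \<open>U \<noteq> V\<close>] by metis
  define a where "a = pathstart c"
  define b where "b = pathfinish c"
  have aA: "a \<in> A1" "\<phi> a \<noteq> u0" and bA: "b \<in> A2" "\<phi> b \<noteq> u0"
    using c U_def V_def a_def b_def by auto
  have ab: "a \<noteq> b" using aA bA A12 by auto
  have abL: "a \<in> ?L" "b \<in> ?L" using aA bA A12 by auto
  have pc: "path_image c = c ` {0<..<1} \<union> {a,b}"
  proof -
    have "{0..1::real} = {0<..<1} \<union> {0,1}" by auto
    then show ?thesis by (auto simp: path_image_def a_def b_def pathstart_def pathfinish_def)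
  qed
  have GL: "G \<inter> ?L = {}" using G J by (metis inside_no_overlap)
  obtain d1 d2 where d12: "arc d1" "arc d2" "pathstart d1 = a" "pathfinish d1 = b"
      "pathstart d2 = b" "pathfinish d2 = a" "path_image d1 \<inter> path_image d2 = {a,b}"
      "path_image d1 \<union> path_image d2 = ?L"
    using exists_double_arc[OF gam abL ab] by metis
  have z12ab: "{z1,z2} \<inter> {a,b} = {}" using aA bA A12 by blast
  \<comment> \<open>\<open>A1\<close> and \<open>A2\<close> are disjoint and relatively open, so a
    connected piece of the curve from \<open>a\<close> to \<open>b\<close> must contain
    \<open>z1\<close> or \<open>z2\<close>. Used for both arcs between \<open>a\<close> and
    \<open>b\<close>, this puts \<open>z1\<close> and \<open>z2\<close> on different ones.\<close>
  have sep: "path_image d \<inter> {z1,z2} \<noteq> {}"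
    if d: "arc d" "path_image d \<subseteq> ?L" "a \<in> path_image d" "b \<in> path_image d" for d
  proof
    assume "path_image d \<inter> {z1,z2} = {}"
    then have sub: "path_image d \<subseteq> A1 \<union> A2" using d A12 by blast
    obtain O1 O2 where "open O1" "A1 = ?L \<inter> O1" "open O2" "A2 = ?L \<inter> O2"
      using opA by (auto simp: openin_open)
    moreover have "connected (path_image d)" using d by (simp add: connected_arc_image)
    ultimately show False
      using sub d aA bA A12 connectedD[of "path_image d" O1 O2] by blast
  qed
  have "(z1 \<in> path_image d1 \<and> z2 \<in> path_image d2) \<or> (z2 \<in> path_image d1 \<and> z1 \<in> path_image d2)"
  proof -
    have "a \<in> path_image d1" "b \<in> path_image d1" "a \<in> path_image d2" "b \<in> path_image d2"
      using d12 by blast+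
    then have "path_image d1 \<inter> {z1,z2} \<noteq> {}" "path_image d2 \<inter> {z1,z2} \<noteq> {}"
      using sep d12 by blast+
    moreover have "path_image d1 \<inter> path_image d2 \<inter> {z1,z2} = {}" using d12 z12ab by blast
    ultimately show ?thesis by blast
  qed
  then obtain y1 y2 where y: "y1 \<in> path_image d1" "y2 \<in> path_image d2" "\<phi> y1 = u0" "\<phi> y2 = u0"
    using eq u0_def by metis
  let ?D2 = "reversepath d2"
  have cd: "path_image d1 \<inter> path_image c = {a,b}" "path_image ?D2 \<inter> path_image c = {a,b}"
  proof -
    have "?L \<inter> path_image c = {a,b}" using pc GL c(4) abL by blast
    moreover have "{a,b} \<subseteq> path_image d1" "{a,b} \<subseteq> path_image d2" "path_image d1 \<subseteq> ?L" "path_image d2 \<subseteq> ?L"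
      using d12 by blast+
    ultimately show "path_image d1 \<inter> path_image c = {a,b}" "path_image ?D2 \<inter> path_image c = {a,b}"
      unfolding path_image_reversepath by blast+
  qed
  have inG: "inside (path_image d1 \<union> path_image ?D2) = G" using d12 G by simp
  have "c (1/2) \<in> G" "c (1/2) \<in> path_image c" using c(4) pc by auto
  then have neG': "path_image c \<inter> inside (path_image d1 \<union> path_image ?D2) \<noteq> {}" using inG by blast
  have D2: "simple_path ?D2" "pathstart ?D2 = a" "pathfinish ?D2 = b" "path_image d1 \<inter> path_image ?D2 = {a,b}"
    using d12 by (simp_all add: arc_imp_simple_path simple_path_reversepath)
  obtain sp1: "inside (path_image d1 \<union> path_image c) \<inter> inside (path_image ?D2 \<union> path_image c) = {}"
    and sp2: "inside (path_image d1 \<union> path_image c) \<union> inside (path_image ?D2 \<union> path_image c) \<union>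
           (path_image c - {a,b}) = inside (path_image d1 \<union> path_image ?D2)"
    by (rule split_inside_simple_closed_curve[OF arc_imp_simple_path[OF d12(1)] d12(3,4) D2(1-3)
        arc_imp_simple_path[OF c(1)] a_def[symmetric] b_def[symmetric] ab D2(4) cd neG'])
  define G1 where "G1 = inside (path_image d1 \<union> path_image c)"
  define G2 where "G2 = inside (path_image d2 \<union> path_image c)"
  have sp: "G1 \<inter> G2 = {}" "G1 \<union> G2 \<union> (path_image c - {a,b}) = G"
    using sp1 sp2 G1_def G2_def inG by simp_all
  have jc: "open (inside (path_image d \<union> path_image c)) \<and> frontier (inside (path_image d \<union> path_image c)) = path_image d \<union> path_image c"
    if "arc d" "pathstart d = a" "pathfinish d = b" "path_image d \<inter> path_image c = {a,b}" for d
  proof -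
    have "simple_path (d +++ reversepath c)"
      using that c(1) a_def b_def by (simp add: simple_path_join_loop_eq arc_reversepath)
    moreover have "pathfinish (d +++ reversepath c) = pathstart (d +++ reversepath c)"
      using that a_def by simp
    moreover have "path_image (d +++ reversepath c) = path_image d \<union> path_image c"
      using that b_def by (simp add: path_image_join)
    ultimately show ?thesis using Jordan_inside_outside by metis
  qed
  have oG12: "open G1" "open G2" "y1 \<in> closure G1" "y2 \<in> closure G2"
  proof -
    have 1: "open G1 \<and> frontier G1 = path_image d1 \<union> path_image c"
      unfolding G1_def using jc d12 cd by blast
    have 2: "open G2 \<and> frontier G2 = path_image d2 \<union> path_image c"
      unfolding G2_def using jc[of ?D2] d12 cd by (simp add: arc_reversepath)
    show "open G1" "open G2" "y1 \<in> closure G1" "y2 \<in> closure G2"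
      using 1 2 y by (auto simp: frontier_def)
  qed
  have "u0 \<notin> \<phi> ` path_image c"
  proof
    assume "u0 \<in> \<phi> ` path_image c"
    then obtain t where t: "t \<in> path_image c" "\<phi> t = u0" by auto
    then have "t \<in> G" using pc aA bA c(4) by auto
    then have "cmod u0 < R" using im t by auto
    then show False using sph[OF z12(1)] u0_def by simp
  qed
  moreover have cpt: "compact (\<phi> ` path_image c)"
  proof (rule compact_continuous_image)
    show "continuous_on (path_image c) \<phi>"
      by (rule continuous_on_subset[OF cont]) (use pc abL c(4) clG in auto)
    show "compact (path_image c)" using c(1) by (simp add: compact_arc_image)
  qed
  ultimately have "\<exists>r>0. ball u0 r \<subseteq> - \<phi> ` path_image c"
    using open_contains_ball_eq[OF open_Compl[OF compact_imp_closed[OF cpt]], of u0] by simp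
  then obtain r where r: "r > 0" "\<phi> ` path_image c \<inter> ball u0 r = {}" by blast
  \<comment> \<open>An intersection of two disks is convex, so its image under \<open>\<psi>\<close>
    is connected. By the choice of \<open>r\<close> that image avoids the crosscut.\<close>
  define S where "S = ball u0 r \<inter> ball 0 R"
  have "connected (\<psi> ` S)"
  proof (rule connected_continuous_image)
    show "continuous_on S \<psi>"
      using psi(1) im S_def by (metis holomorphic_on_imp_continuous_on continuous_on_subset inf_le2)
    show "connected S" unfolding S_def by (intro convex_connected convex_Int) auto
  qed
  moreover have sub: "\<psi> ` S \<subseteq> G1 \<union> G2"
  proof
    fix t assume "t \<in> \<psi> ` S"
    then obtain u where u: "u \<in> S" "t = \<psi> u" by auto
    have "u \<in> \<phi> ` G" using u(1) S_def im by simp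
    then obtain w where w: "w \<in> G" "u = \<phi> w" by blast
    have "t = w" using u w psi by simp
    moreover have "w \<notin> path_image c" using r(2) u w S_def by auto
    ultimately show "t \<in> G1 \<union> G2" using w sp by auto
  qed
  moreover have meet: "H \<inter> \<psi> ` S \<noteq> {}" if H: "H \<subseteq> G" "y \<in> closure H" "\<phi> y = u0" for H y
  proof -
    have yc: "y \<in> closure G" using H closure_mono by blast
    have "\<exists>d>0. \<forall>x\<in>closure G. dist x y < d \<longrightarrow> dist (\<phi> x) (\<phi> y) < r"
      using cont r(1) yc by (simp add: continuous_on_iff)
    then obtain d where d: "d > 0" "\<And>x. x \<in> closure G \<Longrightarrow> dist x y < d \<Longrightarrow> dist (\<phi> x) u0 < r"
      using H by auto
    obtain x where x: "x \<in> H" "dist x y < d" using H d by (metis closure_approachable)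
    have "x \<in> G" "x \<in> closure G" using x H closure_subset by blast+
    then have "\<phi> x \<in> S" using d x im unfolding S_def by (auto simp: dist_commute)
    moreover have "\<psi> (\<phi> x) = x" using psi \<open>x \<in> G\<close> by simp
    ultimately show ?thesis using x by (metis Int_iff emptyE imageI)
  qed
  ultimately show False
    using connectedD[of "\<psi> ` S" G1 G2] oG12 sp y meet[of G1 y1] meet[of G2 y2] by blast
qed

section \<open>Arc length\<close>

lemma inscribed_lengths_mono:
  "a' \<le> a \<Longrightarrow> b \<le> b' \<Longrightarrow> inscribed_lengths \<gamma> a b \<subseteq> inscribed_lengths \<gamma> a' b'"
  using atLeastatMost_subset_iff[of a b a' b'] unfolding inscribed_lengths_def by blast

lemma inscribed_lengths_nonempty: "a \<le> b \<Longrightarrow> inscribed_lengths \<gamma> a b \<noteq> {}"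
  unfolding inscribed_lengths_def by (fastforce intro: exI[of _ 0] exI[of _ "\<lambda>_. a"])

lemma curve_length_bdd:
  assumes "rectifiable \<gamma>" "0 \<le> a" "b \<le> 1"
  shows "bdd_above (inscribed_lengths \<gamma> a b)"
  using assms bdd_above_mono[OF _ inscribed_lengths_mono[of 0 a b 1 \<gamma>]]
  unfolding rectifiable_def by simp

text \<open>A polygon inscribed in the piece up to \<open>a\<close>, prolonged by the vertices at
  \<open>a\<close> and \<open>b\<close>, is inscribed in the piece up to \<open>b\<close>. Together
  with \<open>curve_length_le\<close> this takes the place of additivity of length.\<close>

lemma curve_length_add_chord:
  assumes rect: "rectifiable \<gamma>" and ab: "0 \<le> a" "a \<le> b" "b \<le> 1"
  shows "curve_length \<gamma> 0 a + dist (\<gamma> a) (\<gamma> b) \<le> curve_length \<gamma> 0 b"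
proof -
  have "x \<le> curve_length \<gamma> 0 b - dist (\<gamma> a) (\<gamma> b)" if x: "x \<in> inscribed_lengths \<gamma> 0 a" for x
  proof -
    obtain n t where t: "x = (\<Sum>i<n. dist (\<gamma> (t i)) (\<gamma> (t (Suc i))))"
      "\<forall>i\<le>n. t i \<in> {0..a}" "\<forall>i<n. t i \<le> t (Suc i)" using x unfolding inscribed_lengths_def by auto
    define t' where "t' = (\<lambda>i::nat. if i \<le> n then t i else if i = Suc n then a else b)"
    have "(\<Sum>i<Suc (Suc n). dist (\<gamma> (t' i)) (\<gamma> (t' (Suc i)))) =
        (\<Sum>i<n. dist (\<gamma> (t' i)) (\<gamma> (t' (Suc i)))) + dist (\<gamma> (t n)) (\<gamma> a) + dist (\<gamma> a) (\<gamma> b)"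
      by (simp add: t'_def)
    also have "(\<Sum>i<n. dist (\<gamma> (t' i)) (\<gamma> (t' (Suc i)))) = x"
      unfolding t by (rule sum.cong) (auto simp: t'_def)
    finally have "x + dist (\<gamma> a) (\<gamma> b) \<le> (\<Sum>i<Suc (Suc n). dist (\<gamma> (t' i)) (\<gamma> (t' (Suc i))))"
      by simp
    also have "\<dots> \<in> inscribed_lengths \<gamma> 0 b"
    proof -
      have "\<forall>i\<le>Suc (Suc n). t' i \<in> {0..b}"
        using t(2) ab unfolding t'_def by (force simp: le_Suc_eq)
      moreover have "\<forall>i<Suc (Suc n). t' i \<le> t' (Suc i)"
        using t ab unfolding t'_def by (auto simp: less_Suc_eq)
      ultimately show ?thesis unfolding inscribed_lengths_def by blast
    qed
    then have "(\<Sum>i<Suc (Suc n). dist (\<gamma> (t' i)) (\<gamma> (t' (Suc i)))) \<le> curve_length \<gamma> 0 b"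
      unfolding curve_length_def using curve_length_bdd[OF rect, of 0 b] ab by (intro cSup_upper) auto
    finally show ?thesis by simp
  qed
  then have "curve_length \<gamma> 0 a \<le> curve_length \<gamma> 0 b - dist (\<gamma> a) (\<gamma> b)"
    unfolding curve_length_def[of \<gamma> 0 a] using ab inscribed_lengths_nonempty by (intro cSup_least) auto
  then show ?thesis by simp
qed

text \<open>The chord bounds telescope along a partition. In this form the length function is the
  smallest one whose increments dominate the chords; continuity of length and unit speed of the arc
  length parametrization are both drawn from this minimality.\<close>

lemma curve_length_le:
  assumes b: "0 \<le> b" and W: "\<And>x y. 0 \<le> x \<Longrightarrow> x \<le> y \<Longrightarrow> y \<le> b \<Longrightarrow> dist (\<gamma> x) (\<gamma> y) \<le> W y - W x"
  shows "curve_length \<gamma> 0 b \<le> W b - (W 0 :: real)"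
  unfolding curve_length_def
proof (rule cSup_least)
  show "inscribed_lengths \<gamma> 0 b \<noteq> {}" using b by (rule inscribed_lengths_nonempty)
  fix x assume "x \<in> inscribed_lengths \<gamma> 0 b"
  then obtain n t where t: "x = (\<Sum>i<n. dist (\<gamma> (t i)) (\<gamma> (t (Suc i))))"
      "\<forall>i\<le>n. t i \<in> {0..b}" "\<forall>i<n. t i \<le> t (Suc i)" unfolding inscribed_lengths_def by auto
  have Wm: "W x \<le> W y" if "0 \<le> x" "x \<le> y" "y \<le> b" for x y
    using W[OF that] zero_le_dist[of "\<gamma> x" "\<gamma> y"] by linarith
  have "x \<le> (\<Sum>i<n. W (t (Suc i)) - W (t i))"
    unfolding t(1) using t W by (intro sum_mono) auto
  also have "\<dots> = W (t n) - W (t 0)" by (rule sum_lessThan_telescope)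
  also have "\<dots> \<le> W b - W 0" using Wm[of "t n" b] Wm[of 0 "t 0"] t by fastforce
  finally show "x \<le> W b - W 0" .
qed

lemma curve_length_0: "curve_length \<gamma> 0 0 = 0"
proof -
  have "inscribed_lengths \<gamma> 0 0 \<subseteq> {0}" by (auto simp: inscribed_lengths_def intro!: sum.neutral)
  then have "inscribed_lengths \<gamma> 0 0 = {0}" using inscribed_lengths_nonempty[of 0 0 \<gamma>] by auto
  then show ?thesis by (simp add: curve_length_def)
qed

text \<open>If the length jumped by \<open>J\<close> at \<open>t0\<close>, lowering it by
  \<open>J\<close> from there on would give a function \<open>W\<close> that still dominates all
  chords, because \<open>\<gamma>\<close> itself does not jump. This contradicts minimality. Jumps
  from the right and from the left are treated separately.\<close>

lemma curve_length_continuous: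
  assumes rect: "rectifiable \<gamma>" and cont: "continuous_on {0..1} \<gamma>"
  shows "continuous_on {0..1} (curve_length \<gamma> 0)"
proof -
  define V where "V = curve_length \<gamma> 0"
  have chord: "V a + dist (\<gamma> a) (\<gamma> b) \<le> V b" if "0 \<le> a" "a \<le> b" "b \<le> 1" for a b
    using curve_length_add_chord[OF rect that] V_def by simp
  have mono: "V a \<le> V b" if "0 \<le> a" "a \<le> b" "b \<le> 1" for a b
    using chord[OF that] zero_le_dist[of "\<gamma> a" "\<gamma> b"] by linarith
  have near: "\<exists>d>0. \<forall>z\<in>{0..1}. \<bar>z - t0\<bar> < d \<longrightarrow> dist (\<gamma> t0) (\<gamma> z) < J" if "t0 \<in> {0..1}" "J > 0" for t0 J
    using cont that unfolding continuous_on_iff by (metis dist_commute dist_real_def)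
  have right: "\<exists>z. t0 < z \<and> z \<le> 1 \<and> V z < V t0 + J" if t0: "0 \<le> t0" "t0 < 1" and J: "J > 0" for t0 J
  proof (rule ccontr)
    assume "\<not> ?thesis"
    then have jump: "V z \<ge> V t0 + J" if "t0 < z" "z \<le> 1" for z using that by force
    define W where "W = (\<lambda>x. if t0 < x then V x - J else V x)"
    have "V 1 \<le> W 1 - W 0" unfolding V_def
    proof (rule curve_length_le)
      fix x y :: real assume xy: "0 \<le> x" "x \<le> y" "y \<le> 1"
      show "dist (\<gamma> x) (\<gamma> y) \<le> W y - W x"
      proof (cases "x \<le> t0 \<and> t0 < y")
        case False
        then show ?thesis using chord[OF xy] xy by (auto simp: W_def)
      next
        case True
        show ?thesis
        proof (rule field_le_epsilon)
          fix e :: real assume e: "e > 0"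
          obtain d where d: "d > 0" "\<And>z. z \<in> {0..1} \<Longrightarrow> \<bar>z - t0\<bar> < d \<Longrightarrow> dist (\<gamma> t0) (\<gamma> z) < e"
            using near[of t0 e] t0 e by auto
          \<comment> \<open>A chord across the jump is broken at \<open>t0\<close> and at a point
            \<open>z\<close> just beyond. The middle piece is shorter than \<open>e\<close> by
            continuity of \<open>\<gamma>\<close>, and the jump is contained in the increment of
            \<open>V\<close> from \<open>t0\<close> to \<open>z\<close>, so subtracting
            \<open>J\<close> costs nothing.\<close>
          define z where "z = min y (t0 + d/2)"
          have z: "t0 < z" "z \<le> y" "\<bar>z - t0\<bar> < d" using True d by (auto simp: z_def min_def)
          have "dist (\<gamma> x) (\<gamma> y) \<le> dist (\<gamma> x) (\<gamma> t0) + dist (\<gamma> t0) (\<gamma> z) + dist (\<gamma> z) (\<gamma> y)"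
            using dist_triangle[of "\<gamma> x" "\<gamma> y" "\<gamma> t0"] dist_triangle[of "\<gamma> t0" "\<gamma> y" "\<gamma> z"] by linarith
          also have "dist (\<gamma> x) (\<gamma> t0) \<le> V t0 - V x" using chord[of x t0] xy True t0 by simp
          also have "dist (\<gamma> t0) (\<gamma> z) \<le> e" using d(2)[of z] z t0 xy by simp
          also have "dist (\<gamma> z) (\<gamma> y) \<le> V y - V z" using chord[of z y] xy z t0 by simp
          finally show "dist (\<gamma> x) (\<gamma> y) \<le> W y - W x + e"
            using jump[of z] z xy True by (simp add: W_def)
        qed
      qed
    qed simp
    then show False using t0 J curve_length_0[of \<gamma>] by (simp add: W_def V_def)
  qed
  have left: "\<exists>z. 0 \<le> z \<and> z < t0 \<and> V z > V t0 - J" if t0: "0 < t0" "t0 \<le> 1" and J: "J > 0" for t0 J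
  proof (rule ccontr)
    assume "\<not> ?thesis"
    then have jump: "V z \<le> V t0 - J" if "0 \<le> z" "z < t0" for z using that by force
    define W where "W = (\<lambda>x. if t0 \<le> x then V x - J else V x)"
    have "V 1 \<le> W 1 - W 0" unfolding V_def
    proof (rule curve_length_le)
      fix x y :: real assume xy: "0 \<le> x" "x \<le> y" "y \<le> 1"
      show "dist (\<gamma> x) (\<gamma> y) \<le> W y - W x"
      proof (cases "x < t0 \<and> t0 \<le> y")
        case False
        then show ?thesis using chord[OF xy] xy by (auto simp: W_def)
      next
        case True
        show ?thesis
        proof (rule field_le_epsilon)
          fix e :: real assume e: "e > 0"
          obtain d where d: "d > 0" "\<And>z. z \<in> {0..1} \<Longrightarrow> \<bar>z - t0\<bar> < d \<Longrightarrow> dist (\<gamma> t0) (\<gamma> z) < e"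
            using near[of t0 e] t0 e by auto
          define z where "z = max x (t0 - d/2)"
          have z: "z < t0" "x \<le> z" "\<bar>z - t0\<bar> < d" using True d by (auto simp: z_def max_def)
          have "dist (\<gamma> x) (\<gamma> y) \<le> dist (\<gamma> x) (\<gamma> z) + dist (\<gamma> t0) (\<gamma> z) + dist (\<gamma> t0) (\<gamma> y)"
            using dist_triangle[of "\<gamma> x" "\<gamma> y" "\<gamma> z"] dist_triangle[of "\<gamma> z" "\<gamma> y" "\<gamma> t0"] by (simp add: dist_commute)
          also have "dist (\<gamma> x) (\<gamma> z) \<le> V z - V x" using chord[of x z] xy z t0 by simp
          also have "dist (\<gamma> t0) (\<gamma> z) \<le> e" using d(2)[of z] z t0 xy by simp
          also have "dist (\<gamma> t0) (\<gamma> y) \<le> V y - V t0" using chord[of t0 y] xy True t0 by simp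
          finally show "dist (\<gamma> x) (\<gamma> y) \<le> W y - W x + e"
            using jump[of z] z xy True by (simp add: W_def)
        qed
      qed
    qed simp
    then show False using t0 J curve_length_0[of \<gamma>] by (simp add: W_def V_def)
  qed
  show ?thesis unfolding V_def[symmetric] continuous_on_iff
  proof (intro ballI allI impI)
    fix t0 e :: real assume t0: "t0 \<in> {0..1}" and e: "e > 0"
    obtain d1 where d1: "d1 > 0" "\<And>z. z \<in> {0..1} \<Longrightarrow> t0 \<le> z \<Longrightarrow> z < t0 + d1 \<Longrightarrow> V z < V t0 + e"
    proof (cases "t0 < 1")
      case True
      then obtain z where z: "t0 < z" "z \<le> 1" "V z < V t0 + e" using right[of t0 e] t0 e by auto
      show ?thesis
        by (rule that[of "z - t0"]) (use z mono t0 in \<open>auto intro: order_le_less_trans[OF mono[of _ z]]\<close>)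
    next
      case False
      then show ?thesis using that[of 1] t0 e by force
    qed
    obtain d2 where d2: "d2 > 0" "\<And>z. z \<in> {0..1} \<Longrightarrow> z \<le> t0 \<Longrightarrow> t0 - d2 < z \<Longrightarrow> V z > V t0 - e"
    proof (cases "0 < t0")
      case True
      then obtain z where z: "0 \<le> z" "z < t0" "V z > V t0 - e" using left[of t0 e] t0 e by auto
      show ?thesis
        by (rule that[of "t0 - z"]) (use z mono t0 in \<open>auto intro: order_less_le_trans[OF _ mono[of z]]\<close>)
    next
      case False
      then show ?thesis using that[of 1] t0 e by force
    qed
    show "\<exists>d>0. \<forall>x'\<in>{0..1}. dist x' t0 < d \<longrightarrow> dist (V x') (V t0) < e"
    proof (intro exI[of _ "min d1 d2"] conjI ballI impI)
      fix z assume z: "z \<in> {0..1}" "dist z t0 < min d1 d2"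
      show "dist (V z) (V t0) < e"
      proof (cases "t0 \<le> z")
        case True
        then show ?thesis using d1(2)[of z] z mono[of t0 z] t0 by (simp add: dist_real_def)
      next
        case False
        then show ?thesis using d2(2)[of z] z mono[of z t0] t0 by (simp add: dist_real_def)
      qed
    qed (use d1 d2 in simp)
  qed
qed

text \<open>The length function is a continuous strictly increasing bijection onto
  \<open>{0..l}\<close>, and each claim is transported through it. The Lipschitz bound only says
  that \<open>\<sigma>\<close> is not longer than \<open>l\<close>; the last claim, which is
  \<open>curve_length_le\<close> again, records that it is not shorter.\<close>

lemma arc_length_param_properties:
  assumes curve: "rectifiable_jordan_curve \<gamma>" and l: "l = curve_length \<gamma> 0 1"
    and \<sigma>: "\<sigma> = arc_length_param \<gamma>"
  shows "l > 0"
    and "\<And>a b. a \<in> {0..l} \<Longrightarrow> b \<in> {0..l} \<Longrightarrow> dist (\<sigma> a) (\<sigma> b) \<le> \<bar>a - b\<bar>"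
    and "\<sigma> l = \<sigma> 0" and "inj_on \<sigma> {0..<l}" and "\<sigma> ` {0..l} = path_image \<gamma>"
    and "\<And>W. (\<And>a b. 0 \<le> a \<Longrightarrow> a \<le> b \<Longrightarrow> b \<le> l \<Longrightarrow> dist (\<sigma> a) (\<sigma> b) \<le> W b - W a) \<Longrightarrow> l \<le> W l - (W 0 :: real)"
proof -
  have simple: "simple_path \<gamma>" and loop: "\<gamma> 1 = \<gamma> 0" and rect: "rectifiable \<gamma>"
    using curve by (auto simp: rectifiable_jordan_curve_def pathfinish_def pathstart_def)
  define V where "V = curve_length \<gamma> 0"
  have cont: "continuous_on {0..1} \<gamma>" using simple by (simp add: simple_path_def path_def)
  have contV: "continuous_on {0..1} V" unfolding V_def by (rule curve_length_continuous[OF rect cont])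
  have V0: "V 0 = 0" by (simp add: V_def curve_length_0)
  have V1: "V 1 = l" by (simp add: V_def l)
  have chord: "V a + dist (\<gamma> a) (\<gamma> b) \<le> V b" if "0 \<le> a" "a \<le> b" "b \<le> 1" for a b
    using curve_length_add_chord[OF rect that] V_def by simp
  have mono: "V a \<le> V b" if "0 \<le> a" "a \<le> b" "b \<le> 1" for a b
    using chord[OF that] zero_le_dist[of "\<gamma> a" "\<gamma> b"] by linarith
  have inj: "x = y \<or> x = 0 \<and> y = 1 \<or> x = 1 \<and> y = 0" if "x \<in> {0..1}" "y \<in> {0..1}" "\<gamma> x = \<gamma> y" for x y
    using simple that unfolding simple_path_def loop_free_def by auto
  have strict: "V a < V b" if ab: "0 \<le> a" "a < b" "b \<le> 1" for a b
  proof -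
    \<comment> \<open>The midpoint avoids the case \<open>a = 0\<close>, \<open>b = 1\<close>, in
      which the ends of the chord coincide.\<close>
    define c where "c = (a + b) / 2"
    have c: "a < c" "c < b" using ab c_def by auto
    have "\<gamma> a \<noteq> \<gamma> c" using inj[of a c] ab c by auto
    then have "V a < V c" using chord[of a c] ab c zero_less_dist_iff[of "\<gamma> a" "\<gamma> c"] by linarith
    also have "\<dots> \<le> V b" using mono[of c b] ab c by simp
    finally show ?thesis .
  qed
  have injV: "inj_on V {0..1}"
    by (rule linorder_inj_onI) (use strict in force)+
  have imV: "V ` {0..1} = {0..l}"
  proof
    show "V ` {0..1} \<subseteq> {0..l}" using mono[of 0] mono[of _ 1] V0 V1 by auto
    show "{0..l} \<subseteq> V ` {0..1}"
    proof
      fix s assume "s \<in> {0..l}"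
      then obtain x where "0 \<le> x" "x \<le> 1" "V x = s"
        using IVT'[of V 0 s 1] contV V0 V1 by auto
      then show "s \<in> V ` {0..1}" by auto
    qed
  qed
  have sV: "\<sigma> (V t) = \<gamma> t" if "t \<in> {0..1}" for t
    using that injV by (simp add: \<sigma> arc_length_param_def V_def[symmetric] inv_into_f_f)
  have ex: "\<exists>t\<in>{0..1}. s = V t" if "s \<in> {0..l}" for s using that imV by auto
  show lpos: "l > 0" using strict[of 0 1] V0 V1 by simp
  have lip: "dist (\<sigma> a) (\<sigma> b) \<le> b - a" if "a \<in> {0..l}" "b \<in> {0..l}" "a \<le> b" for a b
  proof -
    note ab = that
    obtain x y where xy: "x \<in> {0..1}" "y \<in> {0..1}" "a = V x" "b = V y" using ex[OF ab(1)] ex[OF ab(2)] by blast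
    then have "x \<le> y" using ab strict[of y x] by force
    then show ?thesis using xy chord[of x y] sV by simp
  qed
  show "dist (\<sigma> a) (\<sigma> b) \<le> \<bar>a - b\<bar>" if "a \<in> {0..l}" "b \<in> {0..l}" for a b
    using lip[of a b] lip[of b a] that by (cases "a \<le> b") (auto simp: dist_commute)
  show "\<sigma> l = \<sigma> 0" using sV[of 0] sV[of 1] V0 V1 loop by simp
  show "inj_on \<sigma> {0..<l}"
  proof (rule inj_onI)
    fix a b assume ab: "a \<in> {0..<l}" "b \<in> {0..<l}" "\<sigma> a = \<sigma> b"
    then obtain x y where xy: "x \<in> {0..1}" "y \<in> {0..1}" "a = V x" "b = V y"
      using ex[of a] ex[of b] by auto
    then have "x \<noteq> 1" "y \<noteq> 1" "\<gamma> x = \<gamma> y" using ab V1 sV by auto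
    then show "a = b" using inj[of x y] xy by auto
  qed
  show "\<sigma> ` {0..l} = path_image \<gamma>"
    unfolding imV[symmetric] path_image_def image_image by (rule image_cong) (auto simp: sV)
  show "l \<le> W l - W 0" if W: "\<And>a b. 0 \<le> a \<Longrightarrow> a \<le> b \<Longrightarrow> b \<le> l \<Longrightarrow> dist (\<sigma> a) (\<sigma> b) \<le> W b - W a" for W :: "real \<Rightarrow> real"
  proof -
    have "curve_length \<gamma> 0 1 \<le> (W \<circ> V) 1 - (W \<circ> V) 0"
    proof (rule curve_length_le)
      fix x y :: real assume xy: "0 \<le> x" "x \<le> y" "y \<le> 1"
      then have "V x \<in> {0..l}" "V y \<in> {0..l}" using imV by auto
      then show "dist (\<gamma> x) (\<gamma> y) \<le> (W \<circ> V) y - (W \<circ> V) x"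
        using W[of "V x" "V y"] mono[OF xy] xy sV by simp
    qed simp
    then show ?thesis using l V0 V1 by simp
  qed
qed

section \<open>Densities and Lebesgue points\<close>

text \<open>The image \<open>N\<close> of Lebesgue measure under the inverse \<open>h\<close> gives
  a set the measure of its image under \<open>f\<close>. Compact null sets suffice in the hypothesis
  because the finite Borel measure \<open>N\<close> is inner regular, so \<open>N\<close> is
  absolutely continuous. The formula computes an integral against \<open>N\<close> once through its
  Radon-Nikodym density and once as an image measure.\<close>

lemma strictly_increasing_has_density:
  fixes f h :: "real \<Rightarrow> real"
  assumes ab: "a < b" and cont: "continuous_on {a..b} f"
    and strict: "\<And>x y. a \<le> x \<Longrightarrow> x < y \<Longrightarrow> y \<le> b \<Longrightarrow> f x < f y"
    and null: "\<And>K. compact K \<Longrightarrow> K \<subseteq> {a..b} \<Longrightarrow> emeasure lborel K = 0 \<Longrightarrow> emeasure lborel (f ` K) = 0"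
    and h: "\<And>x. x \<in> {a..b} \<Longrightarrow> h (f x) = x"
  obtains \<rho> where "\<rho> \<in> borel_measurable borel" "\<And>x. \<rho> x \<ge> (0::real)" "integrable lborel \<rho>"
    "\<And>x. x \<notin> {a..b} \<Longrightarrow> \<rho> x = 0"
    "\<And>g :: real \<Rightarrow> complex. g \<in> borel_measurable borel \<Longrightarrow>
       (LINT s|lborel. \<rho> s *\<^sub>R g s) = (LINT \<theta>:{f a..f b}|lborel. g (h \<theta>))"
proof -
  let ?J = "{f a..f b}"
  have mono: "f x \<le> f y" if "a \<le> x" "x \<le> y" "y \<le> b" for x y
    using strict[of x y] that by (cases "x = y") auto
  have im: "f ` {a..b} = ?J"
  proof
    show "f ` {a..b} \<subseteq> ?J" using mono by auto
    show "?J \<subseteq> f ` {a..b}"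
    proof
      fix y assume "y \<in> ?J"
      then obtain x where "a \<le> x" "x \<le> b" "f x = y" using IVT'[of f a y b] cont ab by auto
      then show "y \<in> f ` {a..b}" by auto
    qed
  qed
  have conth: "continuous_on ?J h"
    using continuous_on_inv[OF cont, of h] h im by auto
  have hJ: "h y \<in> {a..b}" "f (h y) = y" if "y \<in> ?J" for y
  proof -
    have "y \<in> f ` {a..b}" using that im by simp
    then obtain x where "x \<in> {a..b}" "y = f x" by blast
    then show "h y \<in> {a..b}" "f (h y) = y" using h by auto
  qed
  define M where "M = restrict_space lborel ?J"
  define N where "N = distr M borel h"
  have hM: "h \<in> borel_measurable M"
    unfolding M_def using borel_measurable_continuous_on_restrict[OF conth]
    by (simp cong: measurable_cong_sets sets_restrict_space_cong)
  interpret M: finite_measure M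
    unfolding M_def by (rule finite_measureI) (use mono[of a b] ab in \<open>simp add: emeasure_restrict_space space_restrict_space\<close>)
  interpret N: finite_measure N unfolding N_def by (rule M.finite_measure_distr[OF hM])
  have setsN [simp]: "sets N = sets borel" by (simp add: N_def)
  have NE: "emeasure N E = emeasure lborel (h -` E \<inter> ?J)" if "E \<in> sets borel" for E
    using that hM unfolding N_def by (simp add: emeasure_distr M_def emeasure_restrict_space space_restrict_space)
  have ac: "absolutely_continuous lborel N"
    unfolding absolutely_continuous_def
  proof
    fix E :: "real set" assume "E \<in> null_sets lborel"
    then have E: "E \<in> sets borel" "emeasure lborel E = 0" by auto
    have "emeasure N K = 0" if K: "K \<subseteq> E" "compact K" for K
    proof -
      have "emeasure lborel (K \<inter> {a..b}) \<le> emeasure lborel E"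
        using K E by (intro emeasure_mono) auto
      then have "emeasure lborel (f ` (K \<inter> {a..b})) = 0"
        using E K by (intro null) (auto intro: compact_Int)
      moreover have "h -` K \<inter> ?J = f ` (K \<inter> {a..b})"
      proof (intro equalityI subsetI)
        fix y assume "y \<in> h -` K \<inter> ?J"
        then show "y \<in> f ` (K \<inter> {a..b})" using hJ[of y] by (intro image_eqI[of _ _ "h y"]) auto
      qed (use h mono in auto)
      ultimately show ?thesis using NE[of K] K by (simp add: borel_compact)
    qed
    then have "emeasure N E = 0"
      using inner_regular[of N E] E N.emeasure_finite by (auto intro!: antisym SUP_least)
    then show "E \<in> null_sets N" using E by (simp add: null_sets_def)
  qed
  obtain D where D: "D \<in> borel_measurable lborel" "AE x in lborel. RN_deriv lborel N x = ennreal (D x)"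
    "\<And>x. 0 \<le> D x"
    using sigma_finite_measure.real_RN_deriv[OF sigma_finite_lborel N.finite_measure_axioms ac] by auto
  define \<rho> where "\<rho> x = indicator {a..b} x * D x" for x
  have \<rho>: "\<rho> \<in> borel_measurable borel" "\<And>x. \<rho> x \<ge> 0" "\<And>x. x \<notin> {a..b} \<Longrightarrow> \<rho> x = 0"
    using D by (auto simp: \<rho>_def[abs_def])
  have Nout: "AE x in N. x \<in> {a..b}"
  proof (rule AE_I)
    have "h -` (- {a..b}) \<inter> ?J = {}" using hJ by auto
    then show "emeasure N (- {a..b}) = 0" using NE[of "- {a..b}"] by simp
  qed auto
  have dens: "N = density lborel (\<lambda>x. ennreal (D x))"
  proof -
    have "N = density lborel (RN_deriv lborel N)"
      using sigma_finite_measure.density_RN_deriv[OF sigma_finite_lborel ac] by simp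
    also have "\<dots> = density lborel (\<lambda>x. ennreal (D x))"
      using D by (intro density_cong) auto
    finally show ?thesis .
  qed
  have "AE x in lborel. D x \<noteq> 0 \<longrightarrow> x \<in> {a..b}"
    using Nout D unfolding dens by (subst (asm) AE_density) (auto simp: less_le)
  then have eqD: "AE x in lborel. \<rho> x = D x" by eventually_elim (auto simp: \<rho>_def)
  have dens': "N = density lborel (\<lambda>x. ennreal (\<rho> x))"
    unfolding dens using eqD D \<rho> by (intro density_cong) auto
  have main: "(LINT s|lborel. \<rho> s *\<^sub>R g s) = (LINT \<theta>:?J|lborel. g (h \<theta>))"
    if g: "g \<in> borel_measurable borel" for g :: "real \<Rightarrow> complex"
  proof -
    have "(LINT s|lborel. \<rho> s *\<^sub>R g s) = integral\<^sup>L N g"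
      unfolding dens' using g \<rho> by (intro integral_density[symmetric]) auto
    also have "\<dots> = integral\<^sup>L M (\<lambda>\<theta>. g (h \<theta>))"
      unfolding N_def using g hM by (intro integral_distr) auto
    also have "\<dots> = (LINT \<theta>:?J|lborel. g (h \<theta>))"
      unfolding M_def set_lebesgue_integral_def by (rule integral_restrict_space) auto
    finally show ?thesis .
  qed
  have "integrable lborel \<rho>"
  proof (rule integrableI_nonneg)
    have "(\<integral>\<^sup>+ x. ennreal (\<rho> x) \<partial>lborel) = emeasure N UNIV"
      unfolding dens' using \<rho> by (subst emeasure_density) auto
    then show "(\<integral>\<^sup>+ x. ennreal (\<rho> x) \<partial>lborel) < \<infinity>" using N.emeasure_finite[of UNIV] by (simp flip: top.not_eq_extremum)
  qed (use \<rho> in auto)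
  then show ?thesis using that \<rho> main by blast
qed

lemma set_integrable_norm_diff_const:
  fixes f :: "real \<Rightarrow> complex"
  assumes f: "integrable lborel f"
  shows "set_integrable lborel {c..d} (\<lambda>x. cmod (f x - q))"
proof -
  have "set_integrable lborel {c..d} f"
    unfolding set_integrable_def by (rule integrable_mult_indicator[OF _ f]) simp
  moreover have "set_integrable lborel {c..d} (\<lambda>x. q)"
    by (rule borel_integrable_atLeastAtMost') simp
  ultimately show ?thesis by (rule set_integrable_norm[OF set_integral_diff(1)])
qed

text \<open>Lebesgue differentiation is applied to \<open>cmod (f t - q)\<close> for the countably
  many \<open>q\<close> of a dense set, so that one null set serves all of them; then
  \<open>q\<close> is taken close to \<open>f s\<close>. Intervals to the right of \<open>s\<close>
  are handled directly, those to the left through the reflected function.\<close>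

lemma lebesgue_points_AE:
  fixes f :: "real \<Rightarrow> complex"
  assumes f: "integrable lborel f"
  shows "AE s in lborel. \<forall>e>0. \<exists>d>0. \<forall>r. 0 < r \<and> r < d \<longrightarrow>
    (LINT t:{s-r..s+r}|lborel. cmod (f t - f s)) \<le> e * r"
proof -
  obtain D :: "complex set" where D: "countable D" "\<And>X. open X \<Longrightarrow> X \<noteq> {} \<Longrightarrow> \<exists>d\<in>D. d \<in> X"
    using countable_dense_setE by metis
  note int = set_integrable_norm_diff_const[OF f]
  have "integrable lborel (\<lambda>x. f (-x))" using lborel_integrable_real_affine[OF f, of "-1" 0] by simp
  note int' = set_integrable_norm_diff_const[OF this]
  have ex: "\<exists>N. negligible N \<and> (\<forall>x e. x \<notin> N \<longrightarrow> 0 < e \<longrightarrow>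
      (\<exists>d>0. \<forall>h. 0 < h \<and> h < d \<longrightarrow> \<bar>(LINT t:{x..x+h}|lborel. g t) / h - g x\<bar> < e))"
    if g: "\<And>c d. set_integrable lborel {c..d} g" for g :: "real \<Rightarrow> real"
  proof -
    have io: "g integrable_on cbox c d" for c d
      using set_borel_integral_eq_integral(1)[OF g] by simp
    obtain N where N: "negligible N" "\<And>x e. \<lbrakk>x \<notin> N; 0 < e\<rbrakk> \<Longrightarrow>
               \<exists>d>0. \<forall>h. 0 < h \<and> h < d \<longrightarrow> norm(integral (cbox x (x + h *\<^sub>R One)) g /\<^sub>R h ^ DIM(real) - g x) < e"
      using integrable_ccontinuous_explicit[OF io] by metis
    show ?thesis
      by (rule exI[of _ N])
         (use N in \<open>simp add: set_borel_integral_eq_integral(2)[OF g] field_simps\<close>)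
  qed
  have "\<forall>q. \<exists>N. negligible N \<and> (\<forall>x e. x \<notin> N \<longrightarrow> 0 < e \<longrightarrow>
      (\<exists>d>0. \<forall>h. 0 < h \<and> h < d \<longrightarrow> \<bar>(LINT t:{x..x+h}|lborel. cmod (f t - q)) / h - cmod (f x - q)\<bar> < e))"
    using ex[OF int] by blast
  then obtain N where N: "\<And>q. negligible (N q)" "\<And>q x e. x \<notin> N q \<Longrightarrow> 0 < e \<Longrightarrow>
      (\<exists>d>0. \<forall>h. 0 < h \<and> h < d \<longrightarrow> \<bar>(LINT t:{x..x+h}|lborel. cmod (f t - q)) / h - cmod (f x - q)\<bar> < e)"
    by metis
  have "\<forall>q. \<exists>N. negligible N \<and> (\<forall>x e. x \<notin> N \<longrightarrow> 0 < e \<longrightarrow>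
      (\<exists>d>0. \<forall>h. 0 < h \<and> h < d \<longrightarrow> \<bar>(LINT t:{x..x+h}|lborel. cmod (f (-t) - q)) / h - cmod (f (-x) - q)\<bar> < e))"
    using ex[OF int'] by blast
  then obtain N' where N': "\<And>q. negligible (N' q)" "\<And>q x e. x \<notin> N' q \<Longrightarrow> 0 < e \<Longrightarrow>
      (\<exists>d>0. \<forall>h. 0 < h \<and> h < d \<longrightarrow> \<bar>(LINT t:{x..x+h}|lborel. cmod (f (-t) - q)) / h - cmod (f (-x) - q)\<bar> < e)"
    by metis
  have refl: "(LINT t:{-x..-x+h}|lborel. cmod (f (-t) - q)) = (LINT t:{x-h..x}|lborel. cmod (f t - q))" for x h q
  proof -
    have "(LINT t:{x-h..x}|lborel. cmod (f t - q)) = (LINT t|lborel. indicator {x-h..x} (-t) *\<^sub>R cmod (f (-t) - q))"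
      unfolding set_lebesgue_integral_def using lborel_integral_real_affine[of "-1" "\<lambda>t. indicator {x-h..x} t *\<^sub>R cmod (f t - q)" 0] by simp
    also have "\<dots> = (LINT t:{-x..-x+h}|lborel. cmod (f (-t) - q))"
      unfolding set_lebesgue_integral_def by (intro Bochner_Integration.integral_cong) (auto simp: indicator_def)
    finally show ?thesis by simp
  qed
  define Z where "Z = (\<Union>q\<in>D. N q) \<union> (\<Union>q\<in>D. uminus ` N' q)"
  have "negligible (\<Union>q\<in>D. N q)" "negligible (\<Union>q\<in>D. uminus ` N' q)"
  proof -
    have "negligible (uminus ` N' q)" for q
    proof (rule negligible_locally_Lipschitz_image[OF _ N'(1)])
      show "\<exists>T B. open T \<and> x \<in> T \<and> (\<forall>y\<in>N' q \<inter> T. norm (- y - - x) \<le> B * norm (y - x))" for x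
        by (rule exI[of _ UNIV], rule exI[of _ 1]) (auto simp: abs_minus_commute)
    qed simp
    then show "negligible (\<Union>q\<in>D. N q)" "negligible (\<Union>q\<in>D. uminus ` N' q)"
      using D N N' by (auto intro!: negligible_countable_Union)
  qed
  then have "negligible Z" by (simp add: Z_def)
  then have "AE s in lebesgue. s \<notin> Z" by (simp add: negligible_iff_null_sets AE_not_in)
  then have "AE s in lborel. s \<notin> Z" by (simp add: AE_completion_iff)
  then show ?thesis
  proof eventually_elim
    fix s assume s: "s \<notin> Z"
    show "\<forall>e>0. \<exists>d>0. \<forall>r. 0 < r \<and> r < d \<longrightarrow>
      (LINT t:{s-r..s+r}|lborel. cmod (f t - f s)) \<le> e * r"
    proof (intro allI impI)
      fix e :: real assume e: "e > 0"
      \<comment> \<open>With \<open>f s\<close> within \<open>e/8\<close> of \<open>q\<close>, each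
        one-sided mean of \<open>cmod (f t - q)\<close> is below \<open>e/4\<close>. Replacing
        \<open>q\<close> by \<open>f s\<close> costs \<open>e/8\<close> on an interval of length
        \<open>2 * r\<close>, and the total stays below \<open>e * r\<close>.\<close>
      obtain q where q: "q \<in> D" "q \<in> ball (f s) (e/8)" using D(2)[of "ball (f s) (e/8)"] e by auto
      have qs: "cmod (f s - q) < e/8" using q by (simp add: dist_norm)
      have "s \<notin> N q" "- s \<notin> N' q" using s q unfolding Z_def by force+
      then obtain d1 d2 where d: "d1 > 0" "d2 > 0"
        "\<And>h. 0 < h \<and> h < d1 \<Longrightarrow> \<bar>(LINT t:{s..s+h}|lborel. cmod (f t - q)) / h - cmod (f s - q)\<bar> < e/8"
        "\<And>h. 0 < h \<and> h < d2 \<Longrightarrow> \<bar>(LINT t:{-s..-s+h}|lborel. cmod (f (-t) - q)) / h - cmod (f (-(-s)) - q)\<bar> < e/8"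
        using N(2)[of s q "e/8"] N'(2)[of "-s" q "e/8"] e by (metis zero_less_divide_iff zero_less_numeral)
      show "\<exists>d>0. \<forall>r. 0 < r \<and> r < d \<longrightarrow> (LINT t:{s-r..s+r}|lborel. cmod (f t - f s)) \<le> e * r"
      proof (intro exI[of _ "min d1 d2"] conjI allI impI)
        fix r assume r: "0 < r \<and> r < min d1 d2"
        have 1: "(LINT t:{s..s+r}|lborel. cmod (f t - q)) \<le> (e/4) * r"
        proof -
          have "(LINT t:{s..s+r}|lborel. cmod (f t - q)) / r < e/4" using d(3)[of r] r qs by linarith
          then show ?thesis using r by (simp add: field_simps)
        qed
        have 2: "(LINT t:{s-r..s}|lborel. cmod (f t - q)) \<le> (e/4) * r"
        proof -
          have "(LINT t:{s-r..s}|lborel. cmod (f t - q)) / r < e/4"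
            using d(4)[of r] r qs unfolding refl minus_minus by linarith
          then show ?thesis using r by (simp add: field_simps)
        qed
        have int8: "set_integrable lborel {s-r..s+r} (\<lambda>t. e/8)"
          by (rule borel_integrable_atLeastAtMost') simp
        have "(LINT t:{s-r..s+r}|lborel. cmod (f t - f s)) \<le> (LINT t:{s-r..s+r}|lborel. cmod (f t - q) + e/8)"
        proof (rule set_integral_mono)
          fix t show "cmod (f t - f s) \<le> cmod (f t - q) + e/8"
            using norm_triangle_ineq4[of "f t - q" "f s - q"] qs by simp
        qed (use int int8 in auto)
        also have "\<dots> = (LINT t:{s-r..s+r}|lborel. cmod (f t - q)) + (LINT t:{s-r..s+r}|lborel. e/8)"
          by (rule set_integral_add(2)[OF int int8])
        also have "(LINT t:{s-r..s+r}|lborel. e/8) = e/8 * (2 * r)"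
          using r by (simp add: set_lebesgue_integral_def)
        also have "(LINT t:{s-r..s+r}|lborel. cmod (f t - q)) =
            (LINT t:{s-r..s}|lborel. cmod (f t - q)) + (LINT t:{s..s+r}|lborel. cmod (f t - q))"
        proof -
          have "integral {s-r..s+r} (\<lambda>t. cmod (f t - q)) = integral {s-r..s} (\<lambda>t. cmod (f t - q)) + integral {s..s+r} (\<lambda>t. cmod (f t - q))"
            using r set_borel_integral_eq_integral(1)[OF int] by (intro Henstock_Kurzweil_Integration.integral_combine[symmetric]) auto
          then show ?thesis using int by (simp add: set_borel_integral_eq_integral(2))
        qed
        also have "\<dots> + e/8 * (2*r) \<le> (e/4) * r + (e/4) * r + e/8 * (2*r)" using 1 2 by simp
        also have "\<dots> \<le> e * r" using e r by simp
        finally show "(LINT t:{s-r..s+r}|lborel. cmod (f t - f s)) \<le> e * r" .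
      qed (use d in auto)
    qed
  qed
qed

text \<open>Dyadic decomposition: up to distance \<open>d\<close> the Poisson-like kernel is
  dominated by the multiples \<open>4 / (4 ^ k * \<delta>)\<close> of the indicators of intervals of
  radius \<open>2 ^ k * \<delta>\<close>, beyond it by \<open>4 * \<delta> / d^2\<close>. At a
  Lebesgue point the k-th interval contributes at most \<open>4 * e / 2 ^ k\<close>, a geometric
  series with sum at most \<open>8 * e\<close>.\<close>

lemma lebesgue_point_kernel_le:
  fixes f :: "real \<Rightarrow> complex"
  assumes f: "integrable lborel f" and e: "e > 0" and d: "d > 0"
    and leb: "\<And>r. 0 < r \<Longrightarrow> r < d \<Longrightarrow> (LINT t:{s-r..s+r}|lborel. cmod (f t - f s)) \<le> e * r"
    and M: "(LINT t:{a..b}|lborel. cmod (f t - f s)) \<le> M"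
    and \<delta>: "0 < \<delta>" "\<delta> < d"
  shows "(LINT t:{a..b}|lborel. cmod (f t - f s) * (\<delta> / (\<bar>t - s\<bar> + \<delta>)\<^sup>2)) \<le> 8 * e + 4 * \<delta> * M / d\<^sup>2"
proof -
  let ?u = "\<lambda>t. cmod (f t - f s)"
  note int = set_integrable_norm_diff_const[OF f]
  have "\<exists>K::nat. d \<le> 2 ^ K * \<delta>"
    using real_arch_pow[of 2 "d / \<delta>"] \<delta> by (auto simp: field_simps intro: less_imp_le)
  then obtain j :: nat where j: "d \<le> 2 ^ j * \<delta>" "\<And>i. i < j \<Longrightarrow> \<not> d \<le> 2 ^ i * \<delta>"
    using exists_least_iff[of "\<lambda>K::nat. d \<le> 2 ^ K * \<delta>"] by auto
  have "j \<noteq> 0" using j(1) \<delta> by (intro notI) simp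
  then have "\<exists>K::nat. d \<le> 2 ^ (Suc K) * \<delta> \<and> 2 ^ K * \<delta> < d"
    using j(1) j(2)[of "j - 1"] by (intro exI[of _ "j - 1"]) (simp add: not_le)
  then obtain K :: nat where K: "d \<le> 2 ^ (Suc K) * \<delta>" "2 ^ K * \<delta> < d" by blast
  let ?I = "\<lambda>k::nat. {s - 2 ^ k * \<delta>..s + 2 ^ k * \<delta>}"
  have pw: "\<delta> / (\<bar>t - s\<bar> + \<delta>)\<^sup>2 \<le> (\<Sum>k\<le>K. 4 / (4 ^ k * \<delta>) * indicator (?I k) t) + 4 * \<delta> / d\<^sup>2" for t
  proof (cases "\<bar>t - s\<bar> \<le> 2 ^ K * \<delta>")
    case True
    define k where "k = (LEAST k. \<bar>t - s\<bar> \<le> 2 ^ k * \<delta>)"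
    have k: "\<bar>t - s\<bar> \<le> 2 ^ k * \<delta>" unfolding k_def by (rule LeastI[of _ K]) (rule True)
    have kK: "k \<le> K" unfolding k_def by (rule Least_le) (rule True)
    have "\<delta> / (\<bar>t - s\<bar> + \<delta>)\<^sup>2 \<le> 4 / (4 ^ k * \<delta>)"
    proof -
      \<comment> \<open>By minimality of \<open>k\<close> the distance exceeds half the radius of
        the k-th interval; for \<open>k = 0\<close> the summand \<open>\<delta>\<close> alone is
        enough.\<close>
      have le: "2 ^ k * \<delta> \<le> 2 * (\<bar>t - s\<bar> + \<delta>)"
      proof (cases k)
        case (Suc j)
        then have "\<not> \<bar>t - s\<bar> \<le> 2 ^ j * \<delta>" using not_less_Least[of j "\<lambda>k. \<bar>t - s\<bar> \<le> 2 ^ k * \<delta>"] k_def by simp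
        then show ?thesis using Suc \<delta> by simp
      qed (use \<delta> in simp)
      have "(2 ^ k * \<delta>)\<^sup>2 \<le> (2 * (\<bar>t - s\<bar> + \<delta>))\<^sup>2" using le \<delta> by (intro power_mono) auto
      moreover have "(2 ^ k * \<delta>)\<^sup>2 = 4 ^ k * \<delta> * \<delta>"
        using power_mult_distrib[of "2::real" 2 k] by (simp add: power2_eq_square)
      moreover have "(2 * (\<bar>t - s\<bar> + \<delta>))\<^sup>2 = 4 * (\<bar>t - s\<bar> + \<delta>)\<^sup>2"
        by (simp only: power_mult_distrib) simp
      ultimately have "4 ^ k * \<delta> * \<delta> \<le> 4 * (\<bar>t - s\<bar> + \<delta>)\<^sup>2" by simp
      moreover have "(\<bar>t - s\<bar> + \<delta>)\<^sup>2 > 0" using \<delta> by (simp add: add_nonneg_pos)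
      ultimately show ?thesis using \<delta> by (simp add: field_simps)
    qed
    also have "\<dots> = 4 / (4 ^ k * \<delta>) * indicator (?I k) t" using k by (auto simp: indicator_def abs_le_iff)
    also have "\<dots> \<le> (\<Sum>k\<le>K. 4 / (4 ^ k * \<delta>) * indicator (?I k) t)"
      using kK \<delta> by (intro member_le_sum) auto
    also have "\<dots> \<le> \<dots> + 4 * \<delta> / d\<^sup>2" using \<delta> by simp
    finally show ?thesis .
  next
    case False
    have "d / 2 \<le> 2 ^ K * \<delta>" using K by simp
    then have "d / 2 \<le> \<bar>t - s\<bar> + \<delta>" using False \<delta> by linarith
    then have "(d/2)\<^sup>2 \<le> (\<bar>t - s\<bar> + \<delta>)\<^sup>2" using d by (intro power_mono) auto
    then have "\<delta> / (\<bar>t - s\<bar> + \<delta>)\<^sup>2 \<le> \<delta> / (d/2)\<^sup>2" using d \<delta> by (intro divide_left_mono) (auto intro!: mult_pos_pos)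
    also have "\<dots> = 4 * \<delta> / d\<^sup>2" by (simp add: power2_eq_square)
    also have "\<dots> \<le> (\<Sum>k\<le>K. 4 / (4 ^ k * \<delta>) * indicator (?I k) t) + 4 * \<delta> / d\<^sup>2"
      using \<delta> by (simp add: sum_nonneg)
    finally show ?thesis .
  qed
  have meas: "f \<in> borel_measurable borel" using f by auto
  have Iu: "(LINT t:?I k|lborel. ?u t) \<le> e * (2 ^ k * \<delta>)" if "k \<le> K" for k
  proof (rule leb)
    have "2 ^ k * \<delta> \<le> 2 ^ K * \<delta>" using that \<delta> by (intro mult_right_mono power_increasing) auto
    then show "2 ^ k * \<delta> < d" using K by simp
  qed (use \<delta> in simp)
  have intS: "set_integrable lborel {a..b} (\<lambda>t. 4 / (4 ^ k * \<delta>) * indicator (?I k) t * ?u t)" for k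
  proof -
    have "set_integrable lborel ({a..b} \<inter> ?I k) ?u"
      by (rule set_integrable_subset[OF int[of a b]]) auto
    then have "set_integrable lborel ({a..b} \<inter> ?I k) (\<lambda>t. 4 / (4 ^ k * \<delta>) * ?u t)"
      by simp
    moreover have "indicator ({a..b} \<inter> ?I k) t *\<^sub>R (4 / (4 ^ k * \<delta>) * ?u t) =
        indicator {a..b} t *\<^sub>R (4 / (4 ^ k * \<delta>) * indicator (?I k) t * ?u t)" for t
      by (simp add: indicator_def)
    ultimately show ?thesis unfolding set_integrable_def by (simp only:)
  qed
  have intSum: "set_integrable lborel {a..b} (\<lambda>t. \<Sum>k\<le>K. 4 / (4 ^ k * \<delta>) * indicator (?I k) t * ?u t)"
    unfolding set_integrable_def scaleR_sum_right
    by (rule Bochner_Integration.integrable_sum) (rule intS[unfolded set_integrable_def])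
  have int'': "set_integrable lborel {a..b} (\<lambda>t. 4 * \<delta> / d\<^sup>2 * ?u t)" using int by simp
  have Seq: "(LINT t:{a..b}|lborel. (\<Sum>k\<le>K. 4 / (4 ^ k * \<delta>) * indicator (?I k) t * ?u t)) =
     (\<Sum>k\<le>K. LINT t:{a..b}|lborel. 4 / (4 ^ k * \<delta>) * indicator (?I k) t * ?u t)"
    unfolding set_lebesgue_integral_def scaleR_sum_right
    by (rule Bochner_Integration.integral_sum) (rule intS[unfolded set_integrable_def])
  have "(LINT t:{a..b}|lborel. ?u t * (\<delta> / (\<bar>t - s\<bar> + \<delta>)\<^sup>2))
     \<le> (LINT t:{a..b}|lborel. (\<Sum>k\<le>K. 4 / (4 ^ k * \<delta>) * indicator (?I k) t * ?u t) + 4 * \<delta> / d\<^sup>2 * ?u t)"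
  proof (rule set_integral_mono)
    have b1: "?u t * (\<delta> / (\<bar>t - s\<bar> + \<delta>)\<^sup>2) \<le> ?u t * (1 / \<delta>)" for t
    proof (rule mult_left_mono)
      have "\<delta> * \<delta> \<le> (\<bar>t - s\<bar> + \<delta>)\<^sup>2" unfolding power2_eq_square using \<delta> by (intro mult_mono) auto
      moreover have "(\<bar>t - s\<bar> + \<delta>)\<^sup>2 > 0" using \<delta> by (simp add: add_nonneg_pos)
      ultimately show "\<delta> / (\<bar>t - s\<bar> + \<delta>)\<^sup>2 \<le> 1 / \<delta>" using \<delta> by (simp add: field_simps)
    qed simp
    have b2: "set_integrable lborel {a..b} (\<lambda>t. ?u t * (1 / \<delta>))" using int by simp
    show "set_integrable lborel {a..b} (\<lambda>t. ?u t * (\<delta> / (\<bar>t - s\<bar> + \<delta>)\<^sup>2))"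
    proof (rule set_integrable_bound[OF b2])
      show "set_borel_measurable lborel {a..b} (\<lambda>t. ?u t * (\<delta> / (\<bar>t - s\<bar> + \<delta>)\<^sup>2))"
        unfolding set_borel_measurable_def using meas by measurable
      have "norm (?u t * (\<delta> / (\<bar>t - s\<bar> + \<delta>)\<^sup>2)) \<le> norm (?u t * (1 / \<delta>))" for t
        using b1[of t] \<delta> by (simp only: real_norm_def abs_mult abs_norm_cancel) simp
      then show "AE t in lborel. t \<in> {a..b} \<longrightarrow> norm (?u t * (\<delta> / (\<bar>t - s\<bar> + \<delta>)\<^sup>2)) \<le> norm (?u t * (1 / \<delta>))"
        by simp
    qed
    show "set_integrable lborel {a..b} (\<lambda>t. (\<Sum>k\<le>K. 4 / (4 ^ k * \<delta>) * indicator (?I k) t * ?u t) + 4 * \<delta> / d\<^sup>2 * ?u t)"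
      using intSum int by simp
    fix t
    have "?u t * (\<delta> / (\<bar>t - s\<bar> + \<delta>)\<^sup>2) \<le> ?u t * ((\<Sum>k\<le>K. 4 / (4 ^ k * \<delta>) * indicator (?I k) t) + 4 * \<delta> / d\<^sup>2)"
      using pw by (intro mult_left_mono) auto
    then show "?u t * (\<delta> / (\<bar>t - s\<bar> + \<delta>)\<^sup>2) \<le> (\<Sum>k\<le>K. 4 / (4 ^ k * \<delta>) * indicator (?I k) t * ?u t) + 4 * \<delta> / d\<^sup>2 * ?u t"
      by (simp add: algebra_simps sum_distrib_left sum_distrib_right)
  qed
  also have "\<dots> = (\<Sum>k\<le>K. LINT t:{a..b}|lborel. 4 / (4 ^ k * \<delta>) * indicator (?I k) t * ?u t) + 4 * \<delta> / d\<^sup>2 * (LINT t:{a..b}|lborel. ?u t)"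
    unfolding Seq[symmetric] set_integral_add(2)[OF intSum int''] by simp
  also have "(\<Sum>k\<le>K. LINT t:{a..b}|lborel. 4 / (4 ^ k * \<delta>) * indicator (?I k) t * ?u t) \<le> (\<Sum>k\<le>K. 4 * e * (1/2) ^ k)"
  proof (rule sum_mono)
    fix k assume "k \<in> {..K}"
    then have k: "k \<le> K" by simp
    have "(LINT t:{a..b}|lborel. 4 / (4 ^ k * \<delta>) * indicator (?I k) t * ?u t)
        = 4 / (4 ^ k * \<delta>) * (LINT t|lborel. indicator {a..b} t * indicator (?I k) t * ?u t)"
      unfolding set_lebesgue_integral_def
      by (subst integral_mult_right_zero[symmetric]) (intro Bochner_Integration.integral_cong, auto)
    also have "\<dots> \<le> 4 / (4 ^ k * \<delta>) * (LINT t:?I k|lborel. ?u t)"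
    proof (rule mult_left_mono)
      show "(LINT t|lborel. indicator {a..b} t * indicator (?I k) t * ?u t) \<le> (LINT t:?I k|lborel. ?u t)"
        unfolding set_lebesgue_integral_def
      proof (rule integral_mono')
        show "integrable lborel (\<lambda>t. indicator (?I k) t *\<^sub>R ?u t)" using int unfolding set_integrable_def .
      qed (auto simp: indicator_def)
    qed (use \<delta> in simp)
    also have "\<dots> \<le> 4 / (4 ^ k * \<delta>) * (e * (2 ^ k * \<delta>))" using Iu[OF k] \<delta> by (intro mult_left_mono) auto
    also have "\<dots> = 4 * e * (1/2) ^ k"
    proof -
      have "(4::real) ^ k = 2 ^ k * 2 ^ k" by (simp flip: power_mult_distrib)
      then show ?thesis using \<delta> by (simp add: power_one_over field_simps)
    qed
    finally show "(LINT t:{a..b}|lborel. 4 / (4 ^ k * \<delta>) * indicator (?I k) t * ?u t) \<le> 4 * e * (1/2) ^ k" .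
  qed
  also have "(\<Sum>k\<le>K. 4 * e * (1/2) ^ k) \<le> 8 * e"
  proof -
    have "(\<Sum>k\<le>K. (1/2::real) ^ k) \<le> 2" by (simp add: sum_gp0)
    then have "4 * e * (\<Sum>k\<le>K. (1/2::real) ^ k) \<le> 4 * e * 2" using e by (intro mult_left_mono) auto
    then show ?thesis by (simp add: sum_distrib_left)
  qed
  also have "4 * \<delta> / d\<^sup>2 * (LINT t:{a..b}|lborel. ?u t) \<le> 4 * \<delta> / d\<^sup>2 * M"
    using M \<delta> by (intro mult_left_mono) auto
  finally show ?thesis by simp
qed

text \<open>The density is tested against \<open>k\<close> composed with \<open>f\<close> and cut
  off to \<open>{x..y}\<close>. Since \<open>f\<close> is increasing, the cut-off becomes the
  interval \<open>{f x..f y}\<close> after the change of variable.\<close>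

lemma strictly_increasing_density_properties:
  fixes f h :: "real \<Rightarrow> real"
  assumes ab: "a < b" and cont: "continuous_on {a..b} f"
    and strict: "\<And>x y. a \<le> x \<Longrightarrow> x < y \<Longrightarrow> y \<le> b \<Longrightarrow> f x < f y"
    and null: "\<And>K. compact K \<Longrightarrow> K \<subseteq> {a..b} \<Longrightarrow> emeasure lborel K = 0 \<Longrightarrow> emeasure lborel (f ` K) = 0"
  obtains \<rho> where "\<rho> \<in> borel_measurable borel" "\<And>x. \<rho> x \<ge> (0::real)" "integrable lborel \<rho>"
    "\<And>x. x \<notin> {a..b} \<Longrightarrow> \<rho> x = 0"
    "\<And>x y. a \<le> x \<Longrightarrow> x \<le> y \<Longrightarrow> y \<le> b \<Longrightarrow> (LINT s:{x..y}|lborel. \<rho> s) = f y - f x"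
    "\<And>x y k :: real \<Rightarrow> complex. a \<le> x \<Longrightarrow> x \<le> y \<Longrightarrow> y \<le> b \<Longrightarrow> continuous_on {f a..f b} k \<Longrightarrow>
       (LINT s:{x..y}|lborel. \<rho> s *\<^sub>R k (f s)) = (LINT \<theta>:{f x..f y}|lborel. k \<theta>)"
proof -
  have mono: "f x \<le> f y" if "a \<le> x" "x \<le> y" "y \<le> b" for x y
    using strict[of x y] that by (cases "x = y") auto
  have inj: "inj_on f {a..b}"
    by (rule linorder_inj_onI) (use strict in force)+
  define h where "h = inv_into {a..b} f"
  have h: "h (f x) = x" if "x \<in> {a..b}" for x using that inj by (simp add: h_def)
  obtain \<rho> where \<rho>: "\<rho> \<in> borel_measurable borel" "\<And>x. \<rho> x \<ge> (0::real)" "integrable lborel \<rho>"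
    "\<And>x. x \<notin> {a..b} \<Longrightarrow> \<rho> x = 0"
    "\<And>g :: real \<Rightarrow> complex. g \<in> borel_measurable borel \<Longrightarrow>
       (LINT s|lborel. \<rho> s *\<^sub>R g s) = (LINT \<theta>:{f a..f b}|lborel. g (h \<theta>))"
    using strictly_increasing_has_density[OF ab cont strict null h] by blast
  have k: "(LINT s:{x..y}|lborel. \<rho> s *\<^sub>R k (f s)) = (LINT \<theta>:{f x..f y}|lborel. k \<theta>)"
    if xy: "a \<le> x" "x \<le> y" "y \<le> b" and k: "continuous_on {f a..f b} k" for x y and k :: "real \<Rightarrow> complex"
  proof -
    define g where "g = (\<lambda>s. indicator {x..y} s *\<^sub>R k (f s))"
    have "continuous_on {x..y} (\<lambda>s. k (f s))"
      by (rule continuous_on_compose2[OF k continuous_on_subset[OF cont]]) (use xy mono in auto)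
    then have g: "g \<in> borel_measurable borel"
      unfolding g_def by (rule borel_measurable_continuous_on_indicator[rotated]) simp
    have "(LINT s:{x..y}|lborel. \<rho> s *\<^sub>R k (f s)) = (LINT s|lborel. \<rho> s *\<^sub>R g s)"
      unfolding set_lebesgue_integral_def g_def by (intro Bochner_Integration.integral_cong) auto
    also have "\<dots> = (LINT \<theta>:{f a..f b}|lborel. g (h \<theta>))" by (rule \<rho>(5)[OF g])
    also have "\<dots> = (LINT \<theta>:{f x..f y}|lborel. k \<theta>)"
      unfolding set_lebesgue_integral_def
    proof (rule Bochner_Integration.integral_cong)
      fix \<theta>
      show "indicator {f a..f b} \<theta> *\<^sub>R g (h \<theta>) = indicator {f x..f y} \<theta> *\<^sub>R k \<theta>"
      proof (cases "\<theta> \<in> {f a..f b}")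
        case True
        then obtain s where s: "a \<le> s" "s \<le> b" "f s = \<theta>" using IVT'[of f a \<theta> b] cont ab by auto
        have "x \<le> s \<longleftrightarrow> f x \<le> f s" using mono[of x s] strict[of s x] s xy by force
        moreover have "s \<le> y \<longleftrightarrow> f s \<le> f y" using mono[of s y] strict[of y s] s xy by force
        moreover have "h \<theta> = s" using h s by auto
        ultimately show ?thesis using True s by (auto simp: g_def indicator_def)
      next
        case False
        then show ?thesis using mono[of a x] mono[of y b] xy by (auto simp: indicator_def)
      qed
    qed simp
    finally show ?thesis .
  qed
  have "(LINT s:{x..y}|lborel. \<rho> s) = f y - f x" if xy: "a \<le> x" "x \<le> y" "y \<le> b" for x y
  proof -
    have "complex_of_real (LINT s:{x..y}|lborel. \<rho> s) = (LINT s:{x..y}|lborel. \<rho> s *\<^sub>R (1::complex))"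
      unfolding set_integral_complex_of_real[symmetric] by (simp add: scaleR_conv_of_real)
    also have "\<dots> = (LINT \<theta>:{f x..f y}|lborel. 1)" using k[OF xy, of "\<lambda>_. 1"] by simp
    also have "\<dots> = complex_of_real (f y - f x)"
      using mono[OF xy] by (simp add: set_lebesgue_integral_def scaleR_conv_of_real)
    finally show ?thesis using of_real_eq_iff by blast
  qed
  then show ?thesis using that[of \<rho>] \<rho>(1-4) k by blast
qed

text \<open>Adding \<open>2 * x\<close> makes the function strictly increasing while it stays
  Lipschitz, now with constant 3, so it maps null sets to null sets. The density 2 of the added term
  is subtracted at the end.\<close>

lemma lipschitz_real_has_density:
  fixes f :: "real \<Rightarrow> real"
  assumes ab: "a < b" and lip: "\<And>x y. x \<in> {a..b} \<Longrightarrow> y \<in> {a..b} \<Longrightarrow> \<bar>f x - f y\<bar> \<le> \<bar>x - y\<bar>"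
  obtains v where "v \<in> borel_measurable borel" "integrable lborel v"
    "\<And>x. x \<notin> {a..b} \<Longrightarrow> v x = 0"
    "\<And>x y. a \<le> x \<Longrightarrow> x \<le> y \<Longrightarrow> y \<le> b \<Longrightarrow> (LINT s:{x..y}|lborel. v s) = f y - f x"
proof -
  define F where "F x = f x + 2 * x" for x
  have lipF: "\<bar>F x - F y\<bar> \<le> 3 * \<bar>x - y\<bar>" if "x \<in> {a..b}" "y \<in> {a..b}" for x y
    using lip[OF that] unfolding F_def by (auto simp: abs_if split: if_splits)
  have cont: "continuous_on {a..b} F"
  proof (rule lipschitz_on_continuous_on)
    show "3-lipschitz_on {a..b} F" using lipF by (auto simp: lipschitz_on_def dist_real_def)
  qed
  have strict: "F x < F y" if "a \<le> x" "x < y" "y \<le> b" for x y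
    using lip[of x y] that by (simp add: F_def abs_le_iff)
  have null: "emeasure lborel (F ` K) = 0" if K: "compact K" "K \<subseteq> {a..b}" "emeasure lborel K = 0" for K
  proof -
    have "K \<in> null_sets lborel" using K by (auto simp: null_sets_def borel_compact)
    then have "negligible K" by (simp add: negligible_iff_null_sets null_sets_completionI)
    then have "negligible (F ` K)"
    proof (rule negligible_locally_Lipschitz_image[rotated])
      show "\<exists>T B. open T \<and> x \<in> T \<and> (\<forall>y\<in>K \<inter> T. norm (F y - F x) \<le> B * norm (y - x))" if "x \<in> K" for x
        by (rule exI[of _ UNIV], rule exI[of _ 3]) (use lipF that K in \<open>auto intro!: lipF\<close>)
    qed simp
    moreover have "compact (F ` K)"
      using K cont by (intro compact_continuous_image) (auto intro: continuous_on_subset)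
    ultimately show ?thesis
      using borel_compact[of "F ` K"] null_sets_completion_iff[of "F ` K" lborel]
      by (auto simp: negligible_iff_null_sets null_sets_def)
  qed
  obtain \<rho> where \<rho>: "\<rho> \<in> borel_measurable borel" "integrable lborel \<rho>"
    "\<And>x. x \<notin> {a..b} \<Longrightarrow> \<rho> x = (0::real)"
    "\<And>x y. a \<le> x \<Longrightarrow> x \<le> y \<Longrightarrow> y \<le> b \<Longrightarrow> (LINT s:{x..y}|lborel. \<rho> s) = F y - F x"
    by (rule strictly_increasing_density_properties[OF ab cont strict null]) blast+
  define v where "v s = \<rho> s - 2 * indicator {a..b} s" for s
  have int2: "integrable lborel (\<lambda>s. 2 * indicator {a..b} s :: real)"
    using borel_integrable_atLeastAtMost'[of a b "\<lambda>_. 2::real"] by (simp add: set_integrable_def mult.commute)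
  show ?thesis
  proof
    show "v \<in> borel_measurable borel" unfolding v_def[abs_def] using \<rho>(1) by measurable
    show "integrable lborel v" unfolding v_def[abs_def] using \<rho>(2) int2 by (rule Bochner_Integration.integrable_diff)
    show "v x = 0" if "x \<notin> {a..b}" for x using that \<rho>(3) by (simp add: v_def)
    show "(LINT s:{x..y}|lborel. v s) = f y - f x" if xy: "a \<le> x" "x \<le> y" "y \<le> b" for x y
    proof -
      have "set_integrable lborel {x..y} \<rho>" "set_integrable lborel {x..y} (\<lambda>s. 2 * indicator {a..b} s :: real)"
        unfolding set_integrable_def by (rule integrable_mult_indicator, simp, fact)+
      then have "(LINT s:{x..y}|lborel. v s) = (LINT s:{x..y}|lborel. \<rho> s) - (LINT s:{x..y}|lborel. 2 * indicator {a..b} s)"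
        unfolding v_def by (rule set_integral_diff(2))
      also have "(LINT s:{x..y}|lborel. 2 * indicator {a..b} s) = (LINT s:{x..y}|lborel. (2::real))"
        by (rule set_lebesgue_integral_cong) (use xy in auto)
      also have "\<dots> = 2 * (y - x)" using xy by (simp add: set_lebesgue_integral_def)
      finally show ?thesis using \<rho>(4)[OF xy] by (simp add: F_def)
    qed
  qed
qed

section \<open>Mean values on circles\<close>

text \<open>Near \<open>z0\<close> the imaginary part of \<open>g\<close> varies by less than
  \<open>pi\<close>, so there \<open>g\<close> is a constant plus the principal logarithm of
  \<open>f z / f z0\<close>.\<close>

lemma continuous_logarithm_holomorphic:
  fixes f g :: "complex \<Rightarrow> complex"
  assumes S: "open S" and g: "continuous_on S g" and f: "f holomorphic_on S"
    and eq: "\<And>z. z \<in> S \<Longrightarrow> f z = exp (g z)"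
  shows "g holomorphic_on S"
  unfolding holomorphic_on_def
proof
  fix z0 assume z0: "z0 \<in> S"
  have "isCont g z0" using g S z0 by (simp add: continuous_on_eq_continuous_at)
  then obtain d where d: "d > 0" "\<And>z. dist z z0 < d \<Longrightarrow> dist (g z) (g z0) < pi"
    unfolding continuous_at_eps_delta using pi_gt_zero by metis
  obtain e where e: "e > 0" "ball z0 e \<subseteq> S" using S z0 by (auto simp: open_contains_ball)
  let ?U = "ball z0 (min d e)"
  have eqn: "g z = g z0 + Ln (f z / f z0)" if "z \<in> ?U" for z
  proof -
    have "\<bar>Im (g z - g z0)\<bar> < pi"
      using d(2)[of z] that abs_Im_le_cmod[of "g z - g z0"] by (simp add: dist_norm norm_minus_commute[of z0 z])
    then have "Ln (exp (g z - g z0)) = g z - g z0" by (intro Ln_exp) auto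
    moreover have "f z / f z0 = exp (g z - g z0)"
      using eq[of z] eq[OF z0] that e by (auto simp: exp_diff)
    ultimately show ?thesis by simp
  qed
  have "f z0 \<noteq> 0" using eq[OF z0] by simp
  have "(\<lambda>z. g z0 + Ln (f z / f z0)) field_differentiable at z0"
  proof -
    have "f field_differentiable at z0" using f S z0 holomorphic_on_imp_differentiable_at by blast
    moreover have "f z0 / f z0 \<notin> \<real>\<^sub>\<le>\<^sub>0" using \<open>f z0 \<noteq> 0\<close> by simp
    ultimately obtain f' where "(f has_field_derivative f') (at z0)" "f z0 / f z0 \<notin> \<real>\<^sub>\<le>\<^sub>0"
      by (auto simp: field_differentiable_def)
    then show ?thesis unfolding field_differentiable_def
      by (intro exI) (rule derivative_eq_intros refl | use \<open>f z0 \<noteq> 0\<close> in simp)+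
  qed
  then have "g field_differentiable at z0"
  proof (rule field_differentiable_transform_within[rotated 3])
    show "0 < min d e" using d e by simp
    show "g z0 + Ln (f z / f z0) = g z" if "dist z z0 < min d e" for z
      using eqn[of z] that by (simp add: dist_commute)
  qed auto
  then show "g field_differentiable at z0 within S" by (rule field_differentiable_at_within)
qed

text \<open>The circle is run through from an arbitrary angle \<open>a\<close> because the angle
  \<open>\<tau> 0\<close> of the base point is arbitrary. Rotating \<open>f\<close> and
  \<open>b\<close> by \<open>cis a\<close> reduces this to the standard circle path;
  \<open>f'\<close> is the rotated function, not a derivative.\<close>

lemma circle_cauchy:
  fixes f :: "complex \<Rightarrow> complex"
  assumes f: "continuous_on (cball 0 R) f" "f holomorphic_on ball 0 R" and b: "cmod b < R"
  shows "((\<lambda>t. f (R * cis t) * (R * cis t / (R * cis t - b))) has_integral (2 * pi * f b)) {a..a + 2 * pi}"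
proof -
  define f' where "f' u = f (cis a * u)" for u
  define b' where "b' = cis (-a) * b"
  have R: "R > 0" using b norm_ge_zero[of b] by linarith
  have fb: "f' b' = f b" by (simp add: f'_def b'_def mult.assoc[symmetric] cis_mult)
  have "continuous_on (cball 0 R) f'" unfolding f'_def
    by (rule continuous_on_compose2[OF f(1)]) (auto intro!: continuous_intros simp: norm_mult)
  moreover have "f' holomorphic_on ball 0 R" unfolding f'_def
    by (rule holomorphic_on_compose_gen[OF _ f(2), unfolded o_def]) (auto intro!: holomorphic_intros simp: norm_mult)
  moreover have "cmod (b' - 0) < R" using b by (simp add: b'_def norm_mult)
  ultimately have "((\<lambda>u. f' u / (u - b')) has_contour_integral (2 * of_real pi * \<i> * f' b')) (circlepath 0 R)"
    by (rule Cauchy_integral_circlepath)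
  then have "((\<lambda>t. f' (0 + R * cis t) / (0 + R * cis t - b') * R * \<i> * cis t) has_integral (2 * of_real pi * \<i> * f b)) {0..2*pi}"
    unfolding circlepath_def fb by (subst (asm) has_contour_integral_part_circlepath_iff) auto
  then have "((\<lambda>t. (- \<i>) * (f' (0 + R * cis t) / (0 + R * cis t - b') * R * \<i> * cis t)) has_integral ((-\<i>) * (2 * of_real pi * \<i> * f b))) {0..2*pi}"
    by (rule has_integral_mult_right)
  moreover have "(- \<i>) * (f' (0 + R * cis t) / (0 + R * cis t - b') * R * \<i> * cis t)
      = f (R * cis (t + a)) * (R * cis (t + a) / (R * cis (t + a) - b))" for t
  proof -
    have c: "cis (t + a) = cis a * cis t" by (simp add: cis_mult add.commute)
    have "cis (t+a) * R - b = cis a * (R * cis t - b')"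
      by (simp add: b'_def c algebra_simps mult.assoc[symmetric] cis_mult)
    then have "R * cis (t + a) / (R * cis (t + a) - b) = R * cis t / (R * cis t - b')"
      unfolding c by (simp add: mult_ac)
    then show ?thesis by (simp add: f'_def c mult_ac)
  qed
  moreover have "(-\<i>) * (2 * of_real pi * \<i> * f b) = 2 * pi * f b" by simp
  ultimately have "((\<lambda>t. f (R * cis (t + a)) * (R * cis (t + a) / (R * cis (t + a) - b))) has_integral (2 * pi * f b)) {0..2*pi}"
    by (simp only:)
  then show ?thesis
    using has_integral_shift_Icc_real[of "\<lambda>t. f (R * cis t) * (R * cis t / (R * cis t - b))" a "2 * pi * f b" 0 "2*pi"]
    by (simp add: add.commute o_def)
qed

lemma circle_mean_value:
  fixes f :: "complex \<Rightarrow> complex"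
  assumes f: "continuous_on (cball 0 R) f" "f holomorphic_on ball 0 R" and R: "R > 0"
  shows "((\<lambda>t. f (R * cis t)) has_integral (2 * pi * f 0)) {a..a + 2 * pi}"
  using circle_cauchy[OF f, of 0 a] R by simp

text \<open>The logarithm of the modulus is the real part of a holomorphic logarithm. With no zeros
  up to the circle, no limit of radii is involved.\<close>

lemma log_mean_value:
  fixes f :: "complex \<Rightarrow> complex"
  assumes f: "continuous_on (cball 0 R) f" "f holomorphic_on ball 0 R" and R: "R > 0"
    and nz: "\<And>z. z \<in> cball 0 R \<Longrightarrow> f z \<noteq> 0"
  shows "((\<lambda>t. ln (cmod (f (R * cis t)))) has_integral (2 * pi * ln (cmod (f 0)))) {a..a + 2 * pi}"
proof -
  obtain g where g: "continuous_on (cball 0 R) g" "\<And>z. z \<in> cball 0 R \<Longrightarrow> f z = exp (g z)"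
    using continuous_logarithm_on_cball[OF f(1) nz] by metis
  have "g holomorphic_on ball 0 R"
    by (rule continuous_logarithm_holomorphic[OF _ continuous_on_subset[OF g(1)] f(2)]) (use g(2) in auto)
  then have "((\<lambda>t. g (R * cis t)) has_integral (2 * pi * g 0)) {a..a + 2 * pi}"
    by (rule circle_mean_value[OF g(1) _ R])
  then have "((\<lambda>t. Re (g (R * cis t))) has_integral Re (2 * pi * g 0)) {a..a + 2 * pi}"
    by (rule has_integral_Re)
  moreover have "Re (g z) = ln (cmod (f z))" if "z \<in> cball 0 R" for z
    using g(2)[OF that] by simp
  ultimately show ?thesis using R by (simp add: norm_mult)
qed

text \<open>Such quotients, built from the inverse map or its rotated differences, will be the
  zero-free functions that possess logarithms. Their integrals are taken on the circle itself, which
  is why continuity is claimed on the closed disk.\<close>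

lemma removable_quotient:
  fixes f :: "complex \<Rightarrow> complex"
  assumes f: "continuous_on (cball 0 R) f" "f holomorphic_on ball 0 R" and b: "cmod b < R"
  defines "D \<equiv> \<lambda>u. if u = b then deriv f b else (f u - f b) / (u - b)"
  shows "continuous_on (cball 0 R) D" "D holomorphic_on ball 0 R"
proof -
  show hol: "D holomorphic_on ball 0 R" unfolding D_def by (rule pole_lemma_open[OF f(2)]) simp
  show "continuous_on (cball 0 R) D"
    unfolding continuous_on_eq_continuous_within
  proof
    fix u :: complex assume u: "u \<in> cball 0 R"
    show "continuous (at u within cball 0 R) D"
    proof (cases "u = b")
      case True
      have "isCont D b" using holomorphic_on_imp_continuous_on[OF hol] b
        by (simp add: continuous_on_eq_continuous_at)
      then show ?thesis using True continuous_at_imp_continuous_at_within by blast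
    next
      case False
      have "continuous (at u within cball 0 R) (\<lambda>u. (f u - f b) / (u - b))"
        using f(1) u False unfolding continuous_on_eq_continuous_within by (intro continuous_intros) auto
      then show ?thesis
        by (rule continuous_transform_within[of _ _ _ "dist u b"]) (use u False in \<open>auto simp: D_def dist_commute\<close>)
    qed
  qed
qed

section \<open>Absolute continuity of the boundary correspondence\<close>

text \<open>\<sigma> is the arc length parametrization and \<tau> the angle of its image under \<phi>. The assumption len says that the
  length is at least l; it forces the derivative of \<sigma> to have modulus 1 almost everywhere.\<close>

locale jordan_disk =
  fixes \<sigma> :: "real \<Rightarrow> complex" and l R :: real and G :: "complex set"
    and \<phi> \<psi> :: "complex \<Rightarrow> complex" and \<tau> :: "real \<Rightarrow> real"
  assumes l: "0 < l" and R: "0 < R"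
    and lip: "\<And>a b. a \<in> {0..l} \<Longrightarrow> b \<in> {0..l} \<Longrightarrow> dist (\<sigma> a) (\<sigma> b) \<le> \<bar>a - b\<bar>"
    and loop: "\<sigma> l = \<sigma> 0" and inj: "inj_on \<sigma> {0..<l}"
    and len: "\<And>W. (\<And>a b. 0 \<le> a \<Longrightarrow> a \<le> b \<Longrightarrow> b \<le> l \<Longrightarrow> dist (\<sigma> a) (\<sigma> b) \<le> W b - W a) \<Longrightarrow> l \<le> W l - (W 0 :: real)"
    and openG: "open G" and clG: "closure G = G \<union> \<sigma> ` {0..l}" and GL: "G \<inter> \<sigma> ` {0..l} = {}"
    and hol\<phi>: "\<phi> holomorphic_on G" and cont\<phi>: "continuous_on (closure G) \<phi>"
    and hol\<psi>: "\<psi> holomorphic_on ball 0 R" and cont\<psi>: "continuous_on (cball 0 R) \<psi>"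
    and \<psi>\<phi>: "\<And>z. z \<in> closure G \<Longrightarrow> \<psi> (\<phi> z) = z"
    and \<phi>\<psi>: "\<And>u. u \<in> cball 0 R \<Longrightarrow> \<phi> (\<psi> u) = u"
    and \<phi>G: "\<And>z. z \<in> G \<Longrightarrow> cmod (\<phi> z) < R" and \<psi>G: "\<And>u. cmod u < R \<Longrightarrow> \<psi> u \<in> G"
    and cont\<tau>: "continuous_on {0..l} \<tau>" and strict\<tau>: "\<And>x y. 0 \<le> x \<Longrightarrow> x < y \<Longrightarrow> y \<le> l \<Longrightarrow> \<tau> x < \<tau> y"
    and \<tau>l: "\<tau> l = \<tau> 0 + 2 * pi"
    and \<phi>\<sigma>: "\<And>s. s \<in> {0..l} \<Longrightarrow> \<phi> (\<sigma> s) = R * cis (\<tau> s)"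
begin

lemma \<psi>cis: "s \<in> {0..l} \<Longrightarrow> \<psi> (R * cis (\<tau> s)) = \<sigma> s"
  using \<phi>\<sigma>[of s] \<psi>\<phi>[of "\<sigma> s"] clG by auto

lemma mono\<tau>: "0 \<le> x \<Longrightarrow> x \<le> y \<Longrightarrow> y \<le> l \<Longrightarrow> \<tau> x \<le> \<tau> y"
  using strict\<tau>[of x y] by (cases "x = y") auto

lemma less\<tau>: "x \<in> {0..l} \<Longrightarrow> y \<in> {0..l} \<Longrightarrow> \<tau> x < \<tau> y \<longleftrightarrow> x < y"
  using strict\<tau>[of x y] mono\<tau>[of y x] by (auto simp: not_less[symmetric])

lemma le\<tau>: "x \<in> {0..l} \<Longrightarrow> y \<in> {0..l} \<Longrightarrow> \<tau> x \<le> \<tau> y \<longleftrightarrow> x \<le> y"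
  using less\<tau>[of y x] by (auto simp: not_less[symmetric])

lemma surj\<tau>: "\<theta> \<in> {\<tau> 0..\<tau> 0 + 2 * pi} \<Longrightarrow> \<exists>s\<in>{0..l}. \<tau> s = \<theta>"
  using IVT'[of \<tau> 0 \<theta> l] cont\<tau> l \<tau>l by auto

lemma cont\<sigma>: "continuous_on {0..l} \<sigma>"
proof (rule lipschitz_on_continuous_on)
  show "1-lipschitz_on {0..l} \<sigma>" using lip by (auto simp: lipschitz_on_def dist_real_def)
qed

text \<open>These are the curve parameters whose image angle lies in a half-open interval modulo
  \<open>2 * pi\<close>. Half-open intervals let consecutive arcs of a subdivision of the circle cut
  the curve into disjoint pieces.\<close>

definition arc_preimage :: "real \<Rightarrow> real \<Rightarrow> real set" where
  "arc_preimage \<theta> h = {s \<in> {0..l}. \<exists>k::int. \<theta> < \<tau> s + 2 * pi * k \<and> \<tau> s + 2 * pi * k \<le> \<theta> + h}"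

lemma arc_preimage_shift: "arc_preimage (\<theta> + 2 * pi * of_int m) h = arc_preimage \<theta> h"
proof -
  have "arc_preimage \<theta> h \<subseteq> arc_preimage (\<theta> + 2 * pi * of_int m) h" for \<theta> and m :: int
  proof
    fix s assume "s \<in> arc_preimage \<theta> h"
    then obtain k :: int where "s \<in> {0..l}" "\<theta> < \<tau> s + 2 * pi * k" "\<tau> s + 2 * pi * k \<le> \<theta> + h"
      unfolding arc_preimage_def by auto
    then show "s \<in> arc_preimage (\<theta> + 2 * pi * of_int m) h"
      unfolding arc_preimage_def by (auto intro!: exI[of _ "k + m"] simp: algebra_simps)
  qed
  from this[of \<theta> m] this[of "\<theta> + 2 * pi * of_int m" "- m"] show ?thesis by auto
qed

text \<open>All \<open>N\<close> arcs lie in one half-open turn of length \<open>2 * pi\<close>, so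
  the same multiple of \<open>2 * pi\<close> is added to \<open>\<tau> s\<close> in both
  memberships; the intervals themselves are disjoint.\<close>

lemma arc_preimage_disjoint:
  assumes "s \<in> arc_preimage (\<theta> + real i * h) h" "s \<in> arc_preimage (\<theta> + real j * h) h"
    and "0 < h" "real N * h = 2 * pi" "i < N" "j < N"
  shows "i = j"
proof -
  obtain k m :: int where k: "\<theta> + i * h < \<tau> s + 2 * pi * k" "\<tau> s + 2 * pi * k \<le> \<theta> + i * h + h"
    and m: "\<theta> + j * h < \<tau> s + 2 * pi * m" "\<tau> s + 2 * pi * m \<le> \<theta> + j * h + h"
    using assms(1,2) unfolding arc_preimage_def by auto
  have "real i * h + h \<le> real N * h" "real j * h + h \<le> real N * h"
    using assms mult_right_mono[of "real i + 1" "real N" h] mult_right_mono[of "real j + 1" "real N" h]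
    by (simp_all add: algebra_simps)
  moreover have "0 \<le> real i * h" "0 \<le> real j * h" using assms by simp_all
  ultimately have "2 * pi * k - 2 * pi * m < 2 * pi" "2 * pi * m - 2 * pi * k < 2 * pi"
    using k m assms(4) by linarith+
  then have "2 * pi * (real_of_int (k - m)) < 2 * pi * 1" "2 * pi * (real_of_int (m - k)) < 2 * pi * 1"
    by (simp_all add: algebra_simps)
  then have "real_of_int (k - m) < 1" "real_of_int (m - k) < 1"
    by (simp_all only: mult_less_cancel_left_pos[OF mult_pos_pos[OF zero_less_numeral pi_gt_zero]])
  then have "k = m" by linarith
  then have "real i * h < (real j + 1) * h" "real j * h < (real i + 1) * h"
    using k m by (simp_all add: algebra_simps)
  then have "real i < real j + 1" "real j < real i + 1" using \<open>0 < h\<close> by simp_all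
  then show ?thesis by linarith
qed

text \<open>The second case is an arc that passes the base point, where the parameter jumps from
  \<open>l\<close> to 0 and the piece of curve splits in two. Inclusions suffice, since the sets
  serve as domains in upper bounds for integrals of nonnegative functions.\<close>

lemma arc_preimage_eq:
  assumes a: "a \<in> {0..l}" and h: "0 < h" "h < 2 * pi"
  obtains b where "b \<in> {0..l}" "a \<le> b" "\<tau> b = \<tau> a + h" "{a<..b} \<subseteq> arc_preimage (\<tau> a) h"
  | b where "b \<in> {0..l}" "b < a" "\<tau> b = \<tau> a + h - 2 * pi" "{a<..l} \<union> {0<..b} \<subseteq> arc_preimage (\<tau> a) h"
proof (cases "\<tau> a + h \<le> \<tau> l")
  case True
  then obtain b where b: "b \<in> {0..l}" "\<tau> b = \<tau> a + h"
    using surj\<tau>[of "\<tau> a + h"] mono\<tau>[of 0 a] a h \<tau>l by auto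
  moreover have "a \<le> b" using b h less\<tau>[of a b] a by simp
  moreover have "{a<..b} \<subseteq> arc_preimage (\<tau> a) h"
  proof
    fix s assume s: "s \<in> {a<..b}"
    then have "s \<in> {0..l}" using a b by auto
    then show "s \<in> arc_preimage (\<tau> a) h"
      using less\<tau>[of a s] le\<tau>[of s b] a b s unfolding arc_preimage_def by (auto intro!: exI[of _ "0::int"])
  qed
  ultimately show ?thesis using that(1) by blast
next
  case False
  have "\<tau> a \<le> \<tau> l" using mono\<tau>[of a l] a by simp
  then obtain b where b: "b \<in> {0..l}" "\<tau> b = \<tau> a + h - 2 * pi"
    using surj\<tau>[of "\<tau> a + h - 2 * pi"] a h \<tau>l False by auto
  have ba: "b < a" using b h less\<tau>[of b a] a by simp
  have "{a<..l} \<union> {0<..b} \<subseteq> arc_preimage (\<tau> a) h"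
  proof
    fix s assume s: "s \<in> {a<..l} \<union> {0<..b}"
    then have sl: "s \<in> {0..l}" using a b by auto
    show "s \<in> arc_preimage (\<tau> a) h"
    proof (cases "s \<in> {a<..l}")
      case True
      then show ?thesis using less\<tau>[of a s] le\<tau>[of s l] l a sl \<tau>l False unfolding arc_preimage_def
        by (auto intro!: exI[of _ "0::int"])
    next
      case F: False
      then have "\<tau> 0 < \<tau> s" "\<tau> s \<le> \<tau> b" using s less\<tau>[of 0 s] le\<tau>[of s b] l b sl by auto
      then show ?thesis using b sl \<tau>l \<open>\<tau> a \<le> \<tau> l\<close> unfolding arc_preimage_def
        by (auto intro!: exI[of _ "1::int"])
    qed
  qed
  then show ?thesis using that(2) b ba by blast
qed

lemma arc_preimage_measurable [measurable]: "arc_preimage \<theta> h \<in> sets borel"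
proof -
  define T where "T = (\<lambda>s. indicator {0..l} s *\<^sub>R \<tau> s)"
  have [measurable]: "T \<in> borel_measurable borel"
    unfolding T_def by (rule borel_measurable_continuous_on_indicator[OF _ cont\<tau>]) simp
  have "arc_preimage \<theta> h = {s \<in> space borel. s \<in> {0..l} \<and> (\<exists>k::int. \<theta> < T s + 2 * pi * k \<and> T s + 2 * pi * k \<le> \<theta> + h)}"
    unfolding arc_preimage_def by (auto simp: T_def)
  also have "\<dots> \<in> sets borel" by measurable
  finally show ?thesis .
qed

text \<open>This turns a bound for increments along the curve into one for increments between angles
  on the circle; an arc through the base point is split there, which is possible because
  \<open>\<sigma> l = \<sigma> 0\<close>. It is used with the identity for \<open>X\<close>, for
  difference quotients of \<open>\<psi>\<close>, and with the primitive of a power of a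
  polynomial.\<close>

lemma arc_increment_le:
  fixes X :: "complex \<Rightarrow> complex" and w :: "real \<Rightarrow> real"
  assumes w: "integrable lborel w" "\<And>s. w s \<ge> 0"
    and X: "\<And>a b. 0 \<le> a \<Longrightarrow> a \<le> b \<Longrightarrow> b \<le> l \<Longrightarrow> cmod (X (\<sigma> b) - X (\<sigma> a)) \<le> (LINT s:{a..b}|lborel. w s)"
    and h: "0 < h" "h < 2 * pi"
  shows "cmod (X (\<psi> (R * cis (\<theta> + h))) - X (\<psi> (R * cis \<theta>))) \<le> (LINT s:arc_preimage \<theta> h|lborel. w s)"
proof -
  have half: "(LINT s:{a..b}|lborel. w s) = (LINT s:{a<..b}|lborel. w s)" for a b
    unfolding set_lebesgue_integral_def
  proof (rule integral_cong_AE)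
    show "AE s in lborel. indicator {a..b} s *\<^sub>R w s = indicator {a<..b} s *\<^sub>R w s"
      using AE_lborel_singleton[of a] by eventually_elim (auto simp: indicator_def)
  qed (use w in measurable)
  have intw: "set_integrable lborel A w" if "A \<in> sets borel" for A
    unfolding set_integrable_def by (rule integrable_mult_indicator) (use that w in auto)
  have mono: "(LINT s:A|lborel. w s) \<le> (LINT s:B|lborel. w s)" if "A \<subseteq> B" "A \<in> sets borel" "B \<in> sets borel" for A B
    unfolding set_lebesgue_integral_def
    by (rule integral_mono) (use intw that w in \<open>auto simp: set_integrable_def indicator_def\<close>)
  have base: "cmod (X (\<psi> (R * cis (\<tau> a + h))) - X (\<psi> (R * cis (\<tau> a)))) \<le> (LINT s:arc_preimage (\<tau> a) h|lborel. w s)"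
    if a: "a \<in> {0..l}" for a
    using a h
  proof (cases rule: arc_preimage_eq)
    case (1 b)
    then have "cmod (X (\<psi> (R * cis (\<tau> a + h))) - X (\<psi> (R * cis (\<tau> a)))) = cmod (X (\<sigma> b) - X (\<sigma> a))"
      using \<psi>cis[of b] \<psi>cis[of a] a by simp
    also have "\<dots> \<le> (LINT s:{a<..b}|lborel. w s)" using X[of a b] 1 a half by auto
    also have "\<dots> \<le> (LINT s:arc_preimage (\<tau> a) h|lborel. w s)" by (rule mono) (use 1 in auto)
    finally show ?thesis .
  next
    case (2 b)
    have "cis (\<tau> a + h) = cis (\<tau> b)"
      using 2(3) by (metis cis_2pi cis_mult diff_add_cancel mult.right_neutral)
    then have "cmod (X (\<psi> (R * cis (\<tau> a + h))) - X (\<psi> (R * cis (\<tau> a)))) = cmod ((X (\<sigma> b) - X (\<sigma> 0)) + (X (\<sigma> l) - X (\<sigma> a)))"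
      using \<psi>cis[of b] \<psi>cis[of a] a 2 loop by simp
    also have "\<dots> \<le> cmod (X (\<sigma> b) - X (\<sigma> 0)) + cmod (X (\<sigma> l) - X (\<sigma> a))" by (rule norm_triangle_ineq)
    also have "\<dots> \<le> (LINT s:{0<..b}|lborel. w s) + (LINT s:{a<..l}|lborel. w s)"
      using X[of 0 b] X[of a l] 2 a half by auto
    also have "\<dots> = (LINT s:{0<..b} \<union> {a<..l}|lborel. w s)"
      by (rule set_integral_Un[symmetric]) (use 2 intw in auto)
    also have "\<dots> \<le> (LINT s:arc_preimage (\<tau> a) h|lborel. w s)" by (rule mono) (use 2 in auto)
    finally show ?thesis .
  qed
  define m where "m = \<lfloor>(\<theta> - \<tau> 0) / (2 * pi)\<rfloor>"
  have m: "of_int m \<le> (\<theta> - \<tau> 0) / (2 * pi)" "(\<theta> - \<tau> 0) / (2 * pi) \<le> of_int m + 1"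
    unfolding m_def by linarith+
  have "2 * pi * of_int m \<le> \<theta> - \<tau> 0" "\<theta> - \<tau> 0 \<le> 2 * pi * of_int m + 2 * pi"
    using m by (simp_all add: field_simps)
  then obtain a where a: "a \<in> {0..l}" "\<tau> a = \<theta> - 2 * pi * of_int m" using surj\<tau>[of "\<theta> - 2 * pi * of_int m"] by auto
  have cisp: "cis (x + 2 * pi * of_int m) = cis x" for x
    by (simp add: cis_mult[symmetric] cis_multiple_2pi)
  have "\<theta> = \<tau> a + 2 * pi * of_int m" using a by simp
  then have "cis \<theta> = cis (\<tau> a)" "cis (\<theta> + h) = cis (\<tau> a + h)" "arc_preimage \<theta> h = arc_preimage (\<tau> a) h"
    using cisp[of "\<tau> a"] cisp[of "\<tau> a + h"] arc_preimage_shift[of "\<tau> a" m h] by (simp_all add: add_ac)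
  then show ?thesis using base[OF a(1)] by simp
qed

lemma deriv_\<psi>_nz: "deriv \<psi> 0 \<noteq> 0"
proof
  assume 0: "deriv \<psi> 0 = 0"
  have "inj_on \<psi> (ball 0 R)" by (rule inj_on_inverseI[of _ \<phi>]) (use \<phi>\<psi> in auto)
  then show False using holomorphic_injective_imp_regular[OF hol\<psi> open_ball, of 0] R 0 by simp
qed

text \<open>The difference quotients of \<psi> along circles have no zeros, so the mean of the logarithm of their modulus is
  fixed by the derivative at 0. They are dominated by difference quotients of the arc length, which over the angles in the
  image of K tend to 0 in the mean if K is a null set; by concavity of the logarithm, positive measure of that image would make
  the mean arbitrarily small.\<close>

lemma null_\<tau>_image:
  assumes K: "compact K" "K \<subseteq> {0..l}" "emeasure lborel K = 0"
  shows "emeasure lborel (\<tau> ` K) = 0"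
proof (rule ccontr)
  assume pos: "emeasure lborel (\<tau> ` K) \<noteq> 0"
  define K' where "K' = \<tau> ` K"
  define J where "J = {\<tau> 0..\<tau> 0 + 2 * pi}"
  have cK': "compact K'" unfolding K'_def
    using K cont\<tau> by (intro compact_continuous_image) (auto intro: continuous_on_subset)
  then have [measurable]: "K' \<in> sets borel" by (rule borel_compact)
  have K'J: "K' \<subseteq> J" unfolding K'_def J_def using K(2) mono\<tau> \<tau>l by fastforce
  have fin: "emeasure lborel K' < \<infinity>" using cK' by (rule emeasure_compact_finite)
  define m where "m = measure lborel K'"
  have m: "m > 0" using pos fin unfolding m_def K'_def[symmetric]
    by (simp add: emeasure_eq_ennreal_measure zero_less_measure_iff less_top[symmetric])
  define T where "T = (\<lambda>s. indicator {0..l} s *\<^sub>R \<tau> s)"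
  have T [measurable]: "T \<in> borel_measurable borel"
    unfolding T_def by (rule borel_measurable_continuous_on_indicator[OF _ cont\<tau>]) simp
  \<comment> \<open>For angles in one period and steps below \<open>2 * pi\<close> only the shifts 0
    and \<open>2 * pi\<close> can occur. Writing the membership with these two and with the Borel
    function \<open>T\<close> makes it jointly measurable, as Tonelli's theorem requires.\<close>
  define A where "A h \<theta> s \<longleftrightarrow> s \<in> {0..l} \<and> (\<theta> < T s \<and> T s \<le> \<theta> + h \<or> \<theta> < T s + 2 * pi \<and> T s + 2 * pi \<le> \<theta> + h)" for h \<theta> s
  define H where "H n = 1 / (real n + 1)" for n
  have H: "0 < H n" "H n < 2 * pi" "H n \<le> 1" for n
  proof -
    show h1: "H n \<le> 1" and "0 < H n" by (auto simp: H_def)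
    then show "H n < 2 * pi" using pi_gt3 by linarith
  qed
  have apA: "{s. A (H n) \<theta> s} = arc_preimage \<theta> (H n)" if "\<theta> \<in> J" for \<theta> n
  proof (intro equalityI subsetI)
    fix s assume "s \<in> {s. A (H n) \<theta> s}"
    then show "s \<in> arc_preimage \<theta> (H n)" unfolding A_def arc_preimage_def T_def
      by (auto intro: exI[of _ "0::int"] exI[of _ "1::int"])
  next
    fix s assume "s \<in> arc_preimage \<theta> (H n)"
    then obtain k :: int where s: "s \<in> {0..l}" and k: "\<theta> < \<tau> s + 2 * pi * k" "\<tau> s + 2 * pi * k \<le> \<theta> + H n"
      unfolding arc_preimage_def by auto
    have ts: "\<tau> 0 \<le> \<tau> s" "\<tau> s \<le> \<tau> 0 + 2 * pi" using mono\<tau>[of 0 s] mono\<tau>[of s l] s \<tau>l by auto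
    have "2 * pi * (-1) < 2 * pi * real_of_int k" "2 * pi * real_of_int k < 2 * pi * 2"
      using k ts that[unfolded J_def atLeastAtMost_iff] H[of n] by linarith+
    then have "-1 < real_of_int k" "real_of_int k < 2"
      by (simp_all only: mult_less_cancel_left_pos[OF mult_pos_pos[OF zero_less_numeral pi_gt_zero]])
    then have "k = 0 \<or> k = 1" by linarith
    then show "s \<in> {s. A (H n) \<theta> s}" using k s unfolding A_def T_def by auto
  qed
  define q where "q n \<theta> = cmod (\<psi> (R * cis (\<theta> + H n)) - \<psi> (R * cis \<theta>)) / H n" for n \<theta>
  have contq: "continuous_on UNIV (q n)" for n
    unfolding q_def using R H[of n]
    by (intro continuous_intros continuous_on_compose2[OF cont\<psi>]) (auto simp: norm_mult)
  have [measurable]: "q n \<in> borel_measurable borel" for n using contq by (rule borel_measurable_continuous_onI)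
  have q0: "q n \<theta> \<ge> 0" for n \<theta> using H[of n] by (simp add: q_def)
  have intq: "set_integrable lborel J (q n)" for n unfolding J_def
    by (rule borel_integrable_atLeastAtMost') (rule continuous_on_subset[OF contq], simp)
  have qle: "ennreal (q n \<theta>) \<le> (\<integral>\<^sup>+ s. indicator {s. A (H n) \<theta> s} s \<partial>lborel) / H n" if "\<theta> \<in> J" for n \<theta>
  proof -
    let ?w = "\<lambda>s. indicator {0..l} s :: real"
    have w: "integrable lborel ?w"
      using borel_integrable_atLeastAtMost'[of 0 l "\<lambda>_. 1::real"] by (simp add: set_integrable_def)
    have "cmod (\<psi> (R * cis (\<theta> + H n)) - \<psi> (R * cis \<theta>)) \<le> (LINT s:arc_preimage \<theta> (H n)|lborel. ?w s)"
    proof (rule arc_increment_le[where X = "\<lambda>z. z", OF w _ _ H(1,2)])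
      fix a b :: real assume ab: "0 \<le> a" "a \<le> b" "b \<le> l"
      have "(LINT s:{a..b}|lborel. ?w s) = (LINT s:{a..b}|lborel. 1)"
        by (rule set_lebesgue_integral_cong) (use ab in auto)
      then show "cmod (\<sigma> b - \<sigma> a) \<le> (LINT s:{a..b}|lborel. ?w s)"
        using lip[of b a] ab by (simp add: dist_norm set_lebesgue_integral_def)
    qed simp
    also have "\<dots> = measure lborel (arc_preimage \<theta> (H n))"
    proof -
      have "(LINT s:arc_preimage \<theta> (H n)|lborel. ?w s) = (LINT s|lborel. indicator (arc_preimage \<theta> (H n)) s)"
        unfolding set_lebesgue_integral_def
        by (rule Bochner_Integration.integral_cong) (auto simp: indicator_def arc_preimage_def)
      then show ?thesis by simp
    qed
    finally have le: "cmod (\<psi> (R * cis (\<theta> + H n)) - \<psi> (R * cis \<theta>)) \<le> measure lborel (arc_preimage \<theta> (H n))" .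
    have "emeasure lborel (arc_preimage \<theta> (H n)) \<le> emeasure lborel {0..l}"
      by (rule emeasure_mono) (auto simp: arc_preimage_def)
    then have "emeasure lborel (arc_preimage \<theta> (H n)) < \<infinity>"
      by (rule le_less_trans) (simp add: emeasure_lborel_Icc_eq)
    then have "(\<integral>\<^sup>+ s. indicator {s. A (H n) \<theta> s} s \<partial>lborel) = ennreal (measure lborel (arc_preimage \<theta> (H n)))"
      unfolding apA[OF that] by (simp add: emeasure_eq_ennreal_measure)
    then show ?thesis using le H[of n] unfolding q_def
      by (simp add: divide_ennreal ennreal_leI divide_right_mono)
  qed
  \<comment> \<open>The quotient at \<open>\<theta>\<close> is at most the length of curve over the
    arc starting at \<open>\<theta>\<close>, divided by the step. Exchanging the integrations leads,
    for each point of the curve, to the measure of the starting angles in \<open>B\<close> whose arc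
    reaches it.\<close>
  have swap: "(\<integral>\<^sup>+ \<theta>. indicator B \<theta> * ennreal (q n \<theta>) \<partial>lborel)
      \<le> (\<integral>\<^sup>+ s. (\<integral>\<^sup>+ \<theta>. indicator B \<theta> * indicator {s. A (H n) \<theta> s} s \<partial>lborel) / H n \<partial>lborel)"
    if B: "B \<subseteq> J" and [measurable]: "B \<in> sets borel" for B n
  proof -
    have [measurable]: "Measurable.pred (lborel \<Otimes>\<^sub>M lborel) (\<lambda>(\<theta>, s). A (H n) \<theta> s)"
      unfolding A_def by measurable
    have meas [measurable]: "(\<lambda>(\<theta>, s). indicator B \<theta> * indicator {s. A (H n) \<theta> s} s / ennreal (H n)) \<in> borel_measurable (lborel \<Otimes>\<^sub>M lborel)"
      by (simp add: indicator_def split_beta') measurable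
    have m1: "(\<lambda>s. indicator {s. A (H n) \<theta> s} s :: ennreal) \<in> borel_measurable lborel" for \<theta>
      unfolding A_def by measurable
    have m2: "(\<lambda>\<theta>. indicator B \<theta> * indicator {s. A (H n) \<theta> s} s :: ennreal) \<in> borel_measurable lborel" for s
      unfolding A_def by measurable
    have "(\<integral>\<^sup>+ \<theta>. indicator B \<theta> * ennreal (q n \<theta>) \<partial>lborel)
        \<le> (\<integral>\<^sup>+ \<theta>. indicator B \<theta> * ((\<integral>\<^sup>+ s. indicator {s. A (H n) \<theta> s} s \<partial>lborel) / H n) \<partial>lborel)"
      by (rule nn_integral_mono) (use qle B in \<open>auto simp: indicator_def\<close>)
    also have "\<dots> = (\<integral>\<^sup>+ \<theta>. (\<integral>\<^sup>+ s. indicator B \<theta> * indicator {s. A (H n) \<theta> s} s / ennreal (H n) \<partial>lborel) \<partial>lborel)"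
    proof (rule nn_integral_cong)
      fix \<theta> :: real
      show "indicator B \<theta> * ((\<integral>\<^sup>+ s. indicator {s. A (H n) \<theta> s} s \<partial>lborel) / H n) = (\<integral>\<^sup>+ s. indicator B \<theta> * indicator {s. A (H n) \<theta> s} s / ennreal (H n) \<partial>lborel)"
        using m1[of \<theta>] by (cases "\<theta> \<in> B") (simp_all add: nn_integral_divide)
    qed
    also have "\<dots> = (\<integral>\<^sup>+ s. (\<integral>\<^sup>+ \<theta>. indicator B \<theta> * indicator {s. A (H n) \<theta> s} s / ennreal (H n) \<partial>lborel) \<partial>lborel)"
      by (rule lborel_pair.Fubini'[OF meas, symmetric])
    also have "\<dots> = (\<integral>\<^sup>+ s. (\<integral>\<^sup>+ \<theta>. indicator B \<theta> * indicator {s. A (H n) \<theta> s} s \<partial>lborel) / H n \<partial>lborel)"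
      using m2 by (intro nn_integral_cong) (simp add: nn_integral_divide)
    finally show ?thesis .
  qed
  \<comment> \<open>For fixed \<open>s\<close> these angles lie in two intervals of length
    \<open>H n\<close>, one for each shift.\<close>
  have inner: "(\<integral>\<^sup>+ \<theta>. indicator B \<theta> * indicator {s. A (H n) \<theta> s} s \<partial>lborel) / H n \<le> 2 * indicator {0..l} s" for B n s
  proof (cases "s \<in> {0..l}")
    case True
    have "(\<integral>\<^sup>+ \<theta>. indicator B \<theta> * indicator {s. A (H n) \<theta> s} s \<partial>lborel)
      \<le> (\<integral>\<^sup>+ \<theta>. indicator {T s - H n..T s} \<theta> + indicator {T s + 2 * pi - H n..T s + 2 * pi} \<theta> \<partial>lborel)"
      by (rule nn_integral_mono) (auto simp: A_def indicator_def)
    also have "\<dots> = ennreal (H n) + ennreal (H n)" using H[of n] by (subst nn_integral_add) auto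
    also have "\<dots> = ennreal (2 * H n)" using H[of n] by (simp flip: ennreal_plus)
    finally have "(\<integral>\<^sup>+ \<theta>. indicator B \<theta> * indicator {s. A (H n) \<theta> s} s \<partial>lborel) / H n \<le> ennreal (2 * H n) / ennreal (H n)"
      by (rule divide_right_mono_ennreal)
    also have "\<dots> = 2" using H[of n] by (simp add: divide_ennreal)
    finally show ?thesis using True by simp
  next
    case False
    then have "(\<lambda>\<theta>. indicator B \<theta> * indicator {s. A (H n) \<theta> s} s :: ennreal) = (\<lambda>_. 0)" by (auto simp: A_def)
    then show ?thesis using False by simp
  qed
  have Jbound: "(LINT \<theta>:J|lborel. q n \<theta>) \<le> 2 * l" for n
  proof -
    have "ennreal (LINT \<theta>:J|lborel. q n \<theta>) = (\<integral>\<^sup>+ \<theta>. ennreal (indicator J \<theta> *\<^sub>R q n \<theta>) \<partial>lborel)"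
      unfolding set_lebesgue_integral_def
      by (rule nn_integral_eq_integral[symmetric]) (use intq q0 in \<open>auto simp: set_integrable_def\<close>)
    also have "\<dots> = (\<integral>\<^sup>+ \<theta>. indicator J \<theta> * ennreal (q n \<theta>) \<partial>lborel)"
      by (intro nn_integral_cong) (auto simp: indicator_def)
    also have "\<dots> \<le> (\<integral>\<^sup>+ s. (\<integral>\<^sup>+ \<theta>. indicator J \<theta> * indicator {s. A (H n) \<theta> s} s \<partial>lborel) / H n \<partial>lborel)"
      by (rule swap) (auto simp: J_def)
    also have "\<dots> \<le> (\<integral>\<^sup>+ s. 2 * indicator {0..l} s \<partial>lborel)" by (rule nn_integral_mono) (rule inner)
    also have "\<dots> = ennreal (2 * l)" using l by (simp add: nn_integral_cmult ennreal_mult)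
    finally show ?thesis using l by simp
  qed
  \<comment> \<open>For \<open>s\<close> outside \<open>K\<close> the angle \<open>\<tau> s\<close>
    has positive distance from the compact set \<open>K'\<close>, so short arcs starting in
    \<open>K'\<close> do not reach it. The point \<open>s = 0\<close> is left out as a null set,
    because its angle recurs at the end of the period.\<close>
  have lim0: "(\<lambda>n. \<integral>\<^sup>+ s. (\<integral>\<^sup>+ \<theta>. indicator K' \<theta> * indicator {s. A (H n) \<theta> s} s \<partial>lborel) / H n \<partial>lborel) \<longlonglongrightarrow> integral\<^sup>N (lborel :: real measure) (\<lambda>_. 0)"
  proof (rule nn_integral_dominated_convergence[of
      "\<lambda>n s. (\<integral>\<^sup>+ \<theta>. indicator K' \<theta> * indicator {s. A (H n) \<theta> s} s \<partial>lborel) / H n" lborel "\<lambda>_. 0" "\<lambda>s. 2 * indicator {0..l} s"])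
    show "(\<lambda>s. (\<integral>\<^sup>+ \<theta>. indicator K' \<theta> * indicator {s. A (H n) \<theta> s} s \<partial>lborel) / H n) \<in> borel_measurable lborel" for n
      unfolding A_def by measurable
    show "(\<integral>\<^sup>+ s. 2 * indicator {0..l} s \<partial>lborel) < \<infinity>"
      using l by (simp add: nn_integral_cmult ennreal_mult_less_top)
    show "AE s in lborel. (\<integral>\<^sup>+ \<theta>. indicator K' \<theta> * indicator {s. A (H n) \<theta> s} s \<partial>lborel) / H n \<le> 2 * indicator {0..l} s" for n
      using inner by simp
    have "K \<in> null_sets lborel" using K by (auto simp: null_sets_def borel_compact)
    then have "AE s in lborel. s \<notin> K" by (rule AE_not_in)
    then show "AE s in lborel. (\<lambda>n. (\<integral>\<^sup>+ \<theta>. indicator K' \<theta> * indicator {s. A (H n) \<theta> s} s \<partial>lborel) / H n) \<longlonglongrightarrow> 0"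
      using AE_lborel_singleton[of 0]
    proof eventually_elim
      fix s :: real assume s: "s \<notin> K" "s \<noteq> 0"
      have HN: "eventually (\<lambda>n. H n < e) sequentially" if "e > 0" for e
      proof -
        have "H \<longlonglongrightarrow> 0" unfolding H_def[abs_def] by real_asymp
        then show ?thesis using that by (auto dest: order_tendstoD)
      qed
      show "(\<lambda>n. (\<integral>\<^sup>+ \<theta>. indicator K' \<theta> * indicator {s. A (H n) \<theta> s} s \<partial>lborel) / H n) \<longlonglongrightarrow> 0"
      proof (cases "s \<in> {0..l}")
        case True
        have "\<tau> s \<notin> K'"
        proof
          assume "\<tau> s \<in> K'"
          then obtain t where "t \<in> K" "\<tau> t = \<tau> s" by (auto simp: K'_def)
          then show False using less\<tau>[of s t] less\<tau>[of t s] True K(2) s(1) by (metis less_irrefl linorder_less_linear subsetD)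
        qed
        then obtain e where e: "e > 0" "ball (\<tau> s) e \<subseteq> - K'"
          using compact_imp_closed[OF cK'] by (metis Compl_iff open_Compl open_contains_ball)
        have ts: "\<tau> 0 < \<tau> s" using less\<tau>[of 0 s] True s(2) by auto
        have "eventually (\<lambda>n. H n < min e (\<tau> s - \<tau> 0)) sequentially" using HN[OF e(1)] HN[of "\<tau> s - \<tau> 0"] ts by (simp add: eventually_conj)
        then have "eventually (\<lambda>n. (\<integral>\<^sup>+ \<theta>. indicator K' \<theta> * indicator {s. A (H n) \<theta> s} s \<partial>lborel) / H n = 0) sequentially"
        proof eventually_elim
          fix n assume n: "H n < min e (\<tau> s - \<tau> 0)"
          have z0: "indicator K' \<theta> * indicator {s. A (H n) \<theta> s} s = (0::ennreal)" for \<theta>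
          proof (rule ccontr)
            assume "\<not> ?thesis"
            then have \<theta>: "\<theta> \<in> K'" "A (H n) \<theta> s" by (auto simp: indicator_def split: if_splits)
            have "\<theta> \<in> J" using \<theta>(1) K'J by auto
            moreover have "\<theta> \<notin> ball (\<tau> s) e" using \<theta>(1) e by auto
            ultimately show False using \<theta>(2) n True unfolding A_def T_def J_def by (auto simp: dist_real_def)
          qed
          show "(\<integral>\<^sup>+ \<theta>. indicator K' \<theta> * indicator {s. A (H n) \<theta> s} s \<partial>lborel) / H n = 0" unfolding z0 by simp
        qed
        then show ?thesis by (rule tendsto_eventually)
      next
        case False
        then have z0: "indicator K' \<theta> * indicator {s. A (H n) \<theta> s} s = (0::ennreal)" for \<theta> n by (auto simp: A_def indicator_def)
        show ?thesis unfolding z0 by simp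
      qed
    qed
  qed auto
  have intqK: "set_integrable lborel K' (q n)" for n
    by (rule set_integrable_subset[OF intq]) (use K'J in auto)
  have limK: "(\<lambda>n. LINT \<theta>:K'|lborel. q n \<theta>) \<longlonglongrightarrow> 0"
  proof -
    have "ennreal (LINT \<theta>:K'|lborel. q n \<theta>) \<le> (\<integral>\<^sup>+ s. (\<integral>\<^sup>+ \<theta>. indicator K' \<theta> * indicator {s. A (H n) \<theta> s} s \<partial>lborel) / H n \<partial>lborel)" for n
    proof -
      have "ennreal (LINT \<theta>:K'|lborel. q n \<theta>) = (\<integral>\<^sup>+ \<theta>. ennreal (indicator K' \<theta> *\<^sub>R q n \<theta>) \<partial>lborel)"
        unfolding set_lebesgue_integral_def
        by (rule nn_integral_eq_integral[symmetric]) (use intqK q0 in \<open>auto simp: set_integrable_def\<close>)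
      also have "\<dots> = (\<integral>\<^sup>+ \<theta>. indicator K' \<theta> * ennreal (q n \<theta>) \<partial>lborel)"
        by (intro nn_integral_cong) (auto simp: indicator_def)
      also note swap[OF K'J, of n]
      finally show ?thesis by simp
    qed
    then have "(\<lambda>n. ennreal (LINT \<theta>:K'|lborel. q n \<theta>)) \<longlonglongrightarrow> 0"
      by (intro tendsto_sandwich[OF _ _ tendsto_const lim0[unfolded nn_integral_const, simplified]]) auto
    then show ?thesis
      using q0 by (subst (asm) ennreal_0[symmetric], subst (asm) tendsto_ennreal_iff) (auto simp: set_lebesgue_integral_def intro!: integral_nonneg_AE)
  qed
  \<comment> \<open>The 2 in the denominator comes from \<open>cmod (cis h - 1) \<ge> h / 2\<close>
    for \<open>0 < h \<le> 1\<close>; it makes the lower bound independent of the step.\<close>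
  define c0 where "c0 = 2 * pi * ln (R * cmod (deriv \<psi> 0) / 2)"
  have D0: "cmod (deriv \<psi> 0) > 0" using deriv_\<psi>_nz by simp
  have inj\<psi>: "\<psi> u \<noteq> \<psi> v" if "u \<in> cball 0 R" "v \<in> cball 0 R" "u \<noteq> v" for u v
    using \<phi>\<psi> that by metis
  have cis1: "cis (H n) \<noteq> 1" for n
  proof
    assume "cis (H n) = 1"
    then have "cos (H n) = 1" by (simp add: complex_eq_iff)
    then obtain k :: int where k: "H n = of_int k * 2 * pi" by (auto simp: cos_one_2pi_int)
    have "2 * pi * real_of_int k > 2 * pi * 0" "2 * pi * real_of_int k < 2 * pi * 1"
      using H[of n] k by (simp_all add: mult_ac)
    then have "real_of_int k > 0" "real_of_int k < 1"
      by (simp_all only: mult_less_cancel_left_pos[OF mult_pos_pos[OF zero_less_numeral pi_gt_zero]])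
    then show False by simp
  qed
  have qpos: "q n \<theta> > 0" for n \<theta>
  proof -
    have "cis (\<theta> + H n) \<noteq> cis \<theta>" using cis1[of n] by (simp add: cis_mult[symmetric])
    then have "\<psi> (R * cis (\<theta> + H n)) \<noteq> \<psi> (R * cis \<theta>)"
      using R by (intro inj\<psi>) (auto simp: norm_mult)
    then show ?thesis using H[of n] by (simp add: q_def)
  qed
  have intln: "set_integrable lborel J (\<lambda>\<theta>. ln (q n \<theta>))" for n unfolding J_def
  proof (rule borel_integrable_atLeastAtMost')
    show "continuous_on {\<tau> 0..\<tau> 0 + 2 * pi} (\<lambda>\<theta>. ln (q n \<theta>))"
      using qpos[of n] continuous_on_subset[OF contq, of _ n]
      by (intro continuous_on_ln) (auto simp: less_imp_neq[THEN not_sym])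
  qed
  have lower: "c0 \<le> (LINT \<theta>:J|lborel. ln (q n \<theta>))" for n
  proof -
    let ?h = "H n"
    \<comment> \<open>By injectivity of \<open>\<psi>\<close> this difference vanishes only at 0,
      and simply there, so its quotient by \<open>u\<close> is zero-free and the logarithm has the
      mean value property.\<close>
    define f where "f u = \<psi> (cis ?h * u) - \<psi> u" for u
    have f: "continuous_on (cball 0 R) f" "f holomorphic_on ball 0 R"
    proof -
      show "continuous_on (cball 0 R) f" unfolding f_def
        by (intro continuous_intros continuous_on_compose2[OF cont\<psi>]) (auto simp: norm_mult cont\<psi>)
      have "(\<lambda>u. \<psi> (cis ?h * u)) holomorphic_on ball 0 R"
        by (rule holomorphic_on_compose_gen[OF _ hol\<psi>, unfolded o_def]) (auto intro!: holomorphic_intros simp: norm_mult)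
      then show "f holomorphic_on ball 0 R" unfolding f_def using hol\<psi> by (rule holomorphic_on_diff)
    qed
    have f0: "f 0 = 0" by (simp add: f_def)
    have df: "deriv f 0 = deriv \<psi> 0 * (cis ?h - 1)"
    proof (rule DERIV_imp_deriv)
      have d: "(\<psi> has_field_derivative deriv \<psi> 0) (at 0)"
        using hol\<psi> R by (intro holomorphic_derivI[of _ "ball 0 R"]) auto
      then have d2: "(\<psi> has_field_derivative deriv \<psi> 0) (at (cis ?h * 0))" by simp
      have "((\<lambda>u. \<psi> (cis ?h * u)) has_field_derivative deriv \<psi> 0 * cis ?h) (at 0)"
        by (rule DERIV_chain2[where f = \<psi> and g = "\<lambda>u. cis ?h * u", OF d2]) (auto intro!: derivative_eq_intros)
      then have "(f has_field_derivative deriv \<psi> 0 * cis ?h - deriv \<psi> 0) (at 0)"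
        unfolding f_def using d by (rule DERIV_diff)
      then show "(f has_field_derivative deriv \<psi> 0 * (cis ?h - 1)) (at 0)" by (simp add: algebra_simps)
    qed
    define D where "D = (\<lambda>u. if u = 0 then deriv f 0 else (f u - f 0) / (u - 0))"
    have D: "continuous_on (cball 0 R) D" "D holomorphic_on ball 0 R"
      unfolding D_def by (rule removable_quotient[OF f]; use R in simp)+
    have nz: "D u \<noteq> 0" if u: "u \<in> cball 0 R" for u
    proof (cases "u = 0")
      case True
      then show ?thesis using df cis1[of n] deriv_\<psi>_nz by (simp add: D_def)
    next
      case False
      have "\<psi> (cis ?h * u) \<noteq> \<psi> u" using u False cis1[of n] by (intro inj\<psi>) (auto simp: norm_mult)
      then show ?thesis using False f0 by (simp add: D_def f_def)
    qed
    have int: "((\<lambda>t. ln (cmod (D (R * cis t)))) has_integral (2 * pi * ln (cmod (D 0)))) J"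
      unfolding J_def by (rule log_mean_value[OF D R nz])
    have lnq: "ln (q n t) = ln (cmod (D (R * cis t))) + ln (R / ?h)" for t
    proof -
      have "cmod (D (R * cis t)) = q n t * ?h / R"
      proof -
        have "cis ?h * (complex_of_real R * cis t) = R * cis (t + ?h)" by (simp add: cis_mult add.commute)
        then have "f (R * cis t) = \<psi> (R * cis (t + ?h)) - \<psi> (R * cis t)" unfolding f_def by (simp only:)
        then show ?thesis using R H[of n] f0 by (simp add: D_def q_def norm_divide norm_mult)
      qed
      then have e: "q n t = cmod (D (R * cis t)) * (R / ?h)" using R H[of n] by (simp add: field_simps)
      have "cmod (D (R * cis t)) > 0" using nz[of "R * cis t"] R by (simp add: norm_mult)
      then show ?thesis unfolding e using R H[of n] by (intro ln_mult_pos) auto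
    qed
    have "((\<lambda>t. ln (cmod (D (R * cis t))) + ln (R / ?h)) has_integral (2 * pi * ln (cmod (D 0)) + 2 * pi * ln (R / ?h))) J"
      using has_integral_const_real[of "ln (R / ?h)" "\<tau> 0" "\<tau> 0 + 2 * pi"]
      by (intro has_integral_add[OF int]) (simp add: J_def)
    then have "integral J (\<lambda>\<theta>. ln (q n \<theta>)) = 2 * pi * ln (cmod (D 0)) + 2 * pi * ln (R / ?h)"
      unfolding lnq by (rule integral_unique)
    then have "(LINT \<theta>:J|lborel. ln (q n \<theta>)) = 2 * pi * ln (cmod (D 0)) + 2 * pi * ln (R / ?h)"
      unfolding set_borel_integral_eq_integral(2)[OF intln] .
    also have "\<dots> = 2 * pi * ln (cmod (D 0) * (R / ?h))"
      using nz[of 0] R H[of n] by (subst ln_mult_pos) (auto simp: algebra_simps)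
    also have "\<dots> \<ge> c0"
    proof -
      have "\<bar>sin ?h - (\<Sum>m<3. sin_coeff m * ?h ^ m)\<bar> \<le> inverse (fact 3) * \<bar>?h\<bar> ^ 3"
        by (rule Maclaurin_sin_bound)
      then have "\<bar>sin ?h - ?h\<bar> \<le> \<bar>?h\<bar> ^ 3 / 6"
        by (simp add: numeral_eq_Suc sin_coeff_def fact_numeral)
      moreover have "?h ^ 3 \<le> ?h" using H[of n] power_decreasing[of 1 3 ?h] by simp
      moreover have "\<bar>?h\<bar> = ?h" using H[of n] by simp
      ultimately have "\<bar>sin ?h - ?h\<bar> \<le> ?h / 6" by simp
      then have "sin ?h \<ge> ?h / 2" using H(1)[of n] unfolding abs_le_iff by linarith
      also have "sin ?h \<le> cmod (cis ?h - 1)" using abs_Im_le_cmod[of "cis ?h - 1"] by simp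
      finally have h2: "1 / 2 \<le> cmod (cis ?h - 1) / ?h" using H[of n] by (simp add: field_simps)
      have "R * cmod (deriv \<psi> 0) / 2 \<le> R * cmod (deriv \<psi> 0) * (cmod (cis ?h - 1) / ?h)"
        using mult_left_mono[OF h2, of "R * cmod (deriv \<psi> 0)"] R by simp
      also have "\<dots> = cmod (D 0) * (R / ?h)" by (simp add: D_def df norm_mult)
      finally have le: "R * cmod (deriv \<psi> 0) / 2 \<le> cmod (D 0) * (R / ?h)" .
      have "0 < R * cmod (deriv \<psi> 0) / 2" using R D0 by simp
      then have "ln (R * cmod (deriv \<psi> 0) / 2) \<le> ln (cmod (D 0) * (R / ?h))"
        using le by (subst ln_le_cancel_iff) linarith+
      then show ?thesis unfolding c0_def by (intro mult_left_mono) auto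
    qed
    finally show ?thesis .
  qed
  \<comment> \<open>Off \<open>K'\<close> the logarithm is bounded by \<open>q\<close> itself, on
    \<open>K'\<close> by its tangent line at \<open>c\<close>. As \<open>n\<close> grows, the
    integral of the quotient over \<open>K'\<close> disappears and only \<open>m * ln c\<close>
    remains of the second bound, which is unbounded below as \<open>c\<close> tends to 0.\<close>
  have main: "c0 \<le> 2 * l + (1 / c) * (LINT \<theta>:K'|lborel. q n \<theta>) + m * ln c" if c: "c > 0" for c n
  proof -
    have pw: "ln (q n \<theta>) \<le> q n \<theta> + indicator K' \<theta> * (q n \<theta> / c + ln c)" for \<theta>
    proof -
      have 1: "ln (q n \<theta>) \<le> q n \<theta>" using ln_le_minus_one[OF qpos[of n \<theta>]] by linarith
      have "ln (q n \<theta> / c) \<le> q n \<theta> / c - 1" using c qpos[of n \<theta>] by (intro ln_le_minus_one) simp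
      then have 2: "ln (q n \<theta>) \<le> q n \<theta> / c + ln c" using c qpos[of n \<theta>] by (simp add: ln_div)
      show ?thesis using 1 2 q0[of n \<theta>] by (cases "\<theta> \<in> K'") auto
    qed
    have i2: "set_integrable lborel J (\<lambda>\<theta>. indicator K' \<theta> * (q n \<theta> / c + ln c))"
      and e2: "(LINT \<theta>:J|lborel. indicator K' \<theta> * (q n \<theta> / c + ln c)) = (LINT \<theta>:K'|lborel. q n \<theta> / c + ln c)"
      and i3: "set_integrable lborel K' (\<lambda>\<theta>. q n \<theta> / c)" and i4: "set_integrable lborel K' (\<lambda>\<theta>. ln c)"
    proof -
      have eq: "indicator J \<theta> *\<^sub>R (indicator K' \<theta> * (q n \<theta> / c + ln c)) = indicator K' \<theta> *\<^sub>R (q n \<theta> / c + ln c)" for \<theta>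
        using K'J by (auto simp: indicator_def)
      show i3: "set_integrable lborel K' (\<lambda>\<theta>. q n \<theta> / c)" using intqK by simp
      show i4: "set_integrable lborel K' (\<lambda>\<theta>. ln c)"
        using fin unfolding set_integrable_def by simp
      show "set_integrable lborel J (\<lambda>\<theta>. indicator K' \<theta> * (q n \<theta> / c + ln c))"
        unfolding set_integrable_def eq using set_integral_add(1)[OF i3 i4] unfolding set_integrable_def .
      show "(LINT \<theta>:J|lborel. indicator K' \<theta> * (q n \<theta> / c + ln c)) = (LINT \<theta>:K'|lborel. q n \<theta> / c + ln c)"
        unfolding set_lebesgue_integral_def eq ..
    qed
    have "c0 \<le> (LINT \<theta>:J|lborel. ln (q n \<theta>))" by (rule lower)
    also have "\<dots> \<le> (LINT \<theta>:J|lborel. q n \<theta> + indicator K' \<theta> * (q n \<theta> / c + ln c))"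
      using set_integral_add(1)[OF intq i2] intln pw by (intro set_integral_mono) auto
    also have "\<dots> = (LINT \<theta>:J|lborel. q n \<theta>) + (LINT \<theta>:K'|lborel. q n \<theta> / c + ln c)"
      unfolding set_integral_add(2)[OF intq i2] e2 ..
    also have "(LINT \<theta>:K'|lborel. q n \<theta> / c + ln c) = (LINT \<theta>:K'|lborel. q n \<theta>) / c + m * ln c"
      unfolding set_integral_add(2)[OF i3 i4] by (simp add: m_def set_lebesgue_integral_def)
    finally show ?thesis using Jbound[of n] by simp
  qed
  have "c0 \<le> 2 * l + m * ln c" if c: "c > 0" for c
  proof (rule LIMSEQ_le_const)
    show "(\<lambda>n. 2 * l + (1 / c) * (LINT \<theta>:K'|lborel. q n \<theta>) + m * ln c) \<longlonglongrightarrow> 2 * l + m * ln c"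
      using limK c by (auto intro!: tendsto_eq_intros)
  qed (use main[OF c] in auto)
  \<comment> \<open>For this \<open>c\<close> the right-hand side is \<open>c0 - 1\<close>.\<close>
  from this[of "exp ((c0 - 2 * l - 1) / m)"] show False using m by simp
qed

end

section \<open>Velocity of the curve and integrals along it\<close>

lemma set_integral_singleton:
  fixes f :: "real \<Rightarrow> 'a :: {banach, second_countable_topology}"
  shows "(LINT s:{a}|lborel. f s) = 0"
  unfolding set_lebesgue_integral_def
proof (rule integral_eq_zero_AE)
  show "AE s in lborel. indicator {a} s *\<^sub>R f s = 0"
    using AE_lborel_singleton[of a] by eventually_elim auto
qed

lemma set_integral_combine:
  fixes f :: "real \<Rightarrow> 'a :: euclidean_space"
  assumes "set_integrable lborel {a..c} f" "a \<le> b" "b \<le> c"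
  shows "(LINT s:{a..c}|lborel. f s) = (LINT s:{a..b}|lborel. f s) + (LINT s:{b..c}|lborel. f s)"
proof -
  have i: "set_integrable lborel {a..b} f" "set_integrable lborel {b..c} f"
    using assms by (auto intro: set_integrable_subset)
  have "integral {a..c} f = integral {a..b} f + integral {b..c} f"
    using assms set_borel_integral_eq_integral(1)[OF assms(1)]
    by (intro Henstock_Kurzweil_Integration.integral_combine[symmetric]) auto
  then show ?thesis
    unfolding set_borel_integral_eq_integral(2)[OF assms(1)] set_borel_integral_eq_integral(2)[OF i(1)] set_borel_integral_eq_integral(2)[OF i(2)] .
qed

text \<open>Distinct values with the same exponential are at least \<open>2 * pi\<close> apart, so
  the range is discrete.\<close>

lemma continuous_exp_const_imp_const:
  fixes h :: "real \<Rightarrow> complex"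
  assumes h: "continuous_on {a..b} h" and e: "\<And>s. s \<in> {a..b} \<Longrightarrow> exp (h s) = c" and ab: "a \<le> b"
  shows "h b = h a"
proof -
  have "h constant_on {a..b}"
  proof (rule continuous_discrete_range_constant[OF _ h])
    fix x assume x: "x \<in> {a..b}"
    show "\<exists>e>0. \<forall>y. y \<in> {a..b} \<and> h y \<noteq> h x \<longrightarrow> e \<le> cmod (h y - h x)"
    proof (intro exI[of _ "2*pi"] conjI allI impI)
      fix y assume y: "y \<in> {a..b} \<and> h y \<noteq> h x"
      then have "exp (h y) = exp (h x)" using e x by simp
      then obtain n :: int where n: "h y = h x + of_int (2 * n) * pi * \<i>" by (auto simp: exp_eq)
      then have "n \<noteq> 0" using y by auto
      then have "1 \<le> \<bar>real_of_int n\<bar>" by linarith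
      have "h y - h x = of_real (2 * pi * n) * \<i>" using n by simp
      then have "cmod (h y - h x) = \<bar>2 * pi * n\<bar>" by (simp add: norm_mult abs_mult)
      also have "\<dots> = 2 * pi * \<bar>real_of_int n\<bar>" by (simp add: abs_mult)
      also have "\<dots> \<ge> 2 * pi * 1" using \<open>1 \<le> \<bar>real_of_int n\<bar>\<close> by (intro mult_left_mono) auto
      finally show "2 * pi \<le> cmod (h y - h x)" by simp
    qed simp
  qed simp
  then show ?thesis using ab unfolding constant_on_def by auto
qed

text \<open>Quadratic increments have derivative 0 at every point. This evaluates integrals along a
  rectifiable curve without a fundamental theorem for functions that are differentiable only almost
  everywhere.\<close>

lemma quadratic_increment_imp_const:
  fixes E :: "real \<Rightarrow> complex"
  assumes E: "\<And>s t. s \<in> {a..b} \<Longrightarrow> t \<in> {a..b} \<Longrightarrow> s \<le> t \<Longrightarrow> t - s \<le> d \<Longrightarrow> cmod (E t - E s) \<le> C * (t - s)\<^sup>2"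
    and d: "d > 0" and C: "C > 0" and x: "x \<in> {a..b}" "y \<in> {a..b}"
  shows "E x = E y"
proof -
  have "(E has_vector_derivative 0) (at t within {a..b})" if t: "t \<in> {a..b}" for t
    unfolding has_vector_derivative_def has_derivative_within_alt
  proof (intro conjI allI impI)
    fix e :: real assume e: "e > 0"
    show "\<exists>d>0. \<forall>y\<in>{a..b}. norm (y - t) < d \<longrightarrow> norm (E y - E t - (y - t) *\<^sub>R 0) \<le> e * norm (y - t)"
    proof (intro exI[of _ "min d (e / C)"] conjI ballI impI)
      fix y assume y: "y \<in> {a..b}" "norm (y - t) < min d (e / C)"
      have "cmod (E y - E t) \<le> C * \<bar>y - t\<bar>\<^sup>2"
        using E[of t y] E[of y t] y t by (cases "t \<le> y") (auto simp: norm_minus_commute power2_commute)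
      also have "\<dots> = (C * \<bar>y - t\<bar>) * \<bar>y - t\<bar>" by (simp add: power2_eq_square)
      also have "\<dots> \<le> e * \<bar>y - t\<bar>"
        using y C by (intro mult_right_mono) (auto simp: field_simps)
      finally show "norm (E y - E t - (y - t) *\<^sub>R 0) \<le> e * norm (y - t)" by simp
    qed (use d e C in auto)
  qed simp
  then obtain c where "\<And>t. t \<in> {a..b} \<Longrightarrow> E t = c"
    using has_vector_derivative_zero_constant[of "{a..b}" E] by auto
  then show ?thesis using x by simp
qed

text \<open>\<rho> and v are the derivatives of \<tau> and \<sigma>.\<close>

locale jordan_disk_density = jordan_disk +
  fixes \<rho> :: "real \<Rightarrow> real" and v :: "real \<Rightarrow> complex"
  assumes \<rho>: "\<rho> \<in> borel_measurable borel" "\<And>s. \<rho> s \<ge> 0" "integrable lborel \<rho>"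
    and \<rho>_int: "\<And>x y. 0 \<le> x \<Longrightarrow> x \<le> y \<Longrightarrow> y \<le> l \<Longrightarrow> (LINT s:{x..y}|lborel. \<rho> s) = \<tau> y - \<tau> x"
    and \<rho>_subst: "\<And>x y k :: real \<Rightarrow> complex. 0 \<le> x \<Longrightarrow> x \<le> y \<Longrightarrow> y \<le> l \<Longrightarrow> continuous_on {\<tau> 0..\<tau> l} k \<Longrightarrow>
       (LINT s:{x..y}|lborel. \<rho> s *\<^sub>R k (\<tau> s)) = (LINT \<theta>:{\<tau> x..\<tau> y}|lborel. k \<theta>)"
    and v: "v \<in> borel_measurable borel" "integrable lborel v" "\<And>s. cmod (v s) \<le> 1"
    and v_norm: "AE s in lborel. s \<in> {0..l} \<longrightarrow> cmod (v s) = 1"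
    and v_int: "\<And>x y. 0 \<le> x \<Longrightarrow> x \<le> y \<Longrightarrow> y \<le> l \<Longrightarrow> (LINT s:{x..y}|lborel. v s) = \<sigma> y - \<sigma> x"

text \<open>The velocity \<open>v\<close> is assembled from the densities of the real and imaginary
  parts of \<open>\<sigma>\<close>. At a Lebesgue point its modulus is at most 1, because
  \<open>\<sigma>\<close> moves by at most \<open>2 * r\<close> on an interval of that length.
  Equality almost everywhere follows by integration from \<open>len\<close>.\<close>

lemma (in jordan_disk) density_exists: "\<exists>\<rho> v. jordan_disk_density \<sigma> l R G \<phi> \<psi> \<tau> \<rho> v"
proof -
  obtain \<rho> where \<rho>: "\<rho> \<in> borel_measurable borel" "\<And>x. \<rho> x \<ge> (0::real)" "integrable lborel \<rho>"
    "\<And>x. x \<notin> {0..l} \<Longrightarrow> \<rho> x = 0"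
    "\<And>x y. 0 \<le> x \<Longrightarrow> x \<le> y \<Longrightarrow> y \<le> l \<Longrightarrow> (LINT s:{x..y}|lborel. \<rho> s) = \<tau> y - \<tau> x"
    "\<And>x y k :: real \<Rightarrow> complex. 0 \<le> x \<Longrightarrow> x \<le> y \<Longrightarrow> y \<le> l \<Longrightarrow> continuous_on {\<tau> 0..\<tau> l} k \<Longrightarrow>
       (LINT s:{x..y}|lborel. \<rho> s *\<^sub>R k (\<tau> s)) = (LINT \<theta>:{\<tau> x..\<tau> y}|lborel. k \<theta>)"
    by (rule strictly_increasing_density_properties[OF l cont\<tau> strict\<tau> null_\<tau>_image]) blast+
  have lipR: "\<bar>Re (\<sigma> x) - Re (\<sigma> y)\<bar> \<le> \<bar>x - y\<bar>" "\<bar>Im (\<sigma> x) - Im (\<sigma> y)\<bar> \<le> \<bar>x - y\<bar>"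
    if "x \<in> {0..l}" "y \<in> {0..l}" for x y
    using lip[OF that] abs_Re_le_cmod[of "\<sigma> x - \<sigma> y"] abs_Im_le_cmod[of "\<sigma> x - \<sigma> y"] by (auto simp: dist_norm)
  obtain v1 where v1: "v1 \<in> borel_measurable borel" "integrable lborel v1"
    "\<And>x. x \<notin> {0..l} \<Longrightarrow> v1 x = 0"
    "\<And>x y. 0 \<le> x \<Longrightarrow> x \<le> y \<Longrightarrow> y \<le> l \<Longrightarrow> (LINT s:{x..y}|lborel. v1 s) = Re (\<sigma> y) - Re (\<sigma> x)"
    using lipschitz_real_has_density[OF l lipR(1)] by blast
  obtain v2 where v2: "v2 \<in> borel_measurable borel" "integrable lborel v2"
    "\<And>x. x \<notin> {0..l} \<Longrightarrow> v2 x = 0"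
    "\<And>x y. 0 \<le> x \<Longrightarrow> x \<le> y \<Longrightarrow> y \<le> l \<Longrightarrow> (LINT s:{x..y}|lborel. v2 s) = Im (\<sigma> y) - Im (\<sigma> x)"
    using lipschitz_real_has_density[OF l lipR(2)] by blast
  define v where "v s = complex_of_real (v1 s) + \<i> * complex_of_real (v2 s)" for s
  have v: "v \<in> borel_measurable borel" "integrable lborel v" "\<And>x. x \<notin> {0..l} \<Longrightarrow> v x = 0"
    using v1 v2 by (auto simp: v_def[abs_def])
  have v_int: "(LINT s:{x..y}|lborel. v s) = \<sigma> y - \<sigma> x" if xy: "0 \<le> x" "x \<le> y" "y \<le> l" for x y
  proof -
    have i: "set_integrable lborel {x..y} (\<lambda>s. complex_of_real (v1 s))" "set_integrable lborel {x..y} (\<lambda>s. \<i> * complex_of_real (v2 s))"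
      unfolding set_integrable_def using v1 v2 by (auto intro!: integrable_mult_indicator)
    have "(LINT s:{x..y}|lborel. v s) = complex_of_real (LINT s:{x..y}|lborel. v1 s) + \<i> * complex_of_real (LINT s:{x..y}|lborel. v2 s)"
      unfolding v_def set_integral_add(2)[OF i] by (simp add: set_integral_complex_of_real)
    then show ?thesis using v1(4)[OF xy] v2(4)[OF xy] by (simp add: complex_eq_iff)
  qed
  have inv: "set_integrable lborel {x..y} v" for x y
    unfolding set_integrable_def using v(2) by (rule integrable_mult_indicator[rotated]) simp
  have "AE s in lborel. s \<in> {0..l} \<longrightarrow> cmod (v s) \<le> 1"
    using lebesgue_points_AE[OF v(2)] AE_lborel_singleton[of 0] AE_lborel_singleton[of l]
  proof eventually_elim
    fix s assume leb: "\<forall>e>0. \<exists>d>0. \<forall>r. 0 < r \<and> r < d \<longrightarrow> (LINT t:{s-r..s+r}|lborel. cmod (v t - v s)) \<le> e * r"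
      and "s \<noteq> 0" "s \<noteq> l"
    show "s \<in> {0..l} \<longrightarrow> cmod (v s) \<le> 1"
    proof
      assume "s \<in> {0..l}"
      then have s: "0 < s" "s < l" using \<open>s \<noteq> 0\<close> \<open>s \<noteq> l\<close> by auto
      show "cmod (v s) \<le> 1"
      proof (rule field_le_epsilon)
        fix e :: real assume "e > 0"
        then obtain d where d: "d > 0" "\<And>r. 0 < r \<and> r < d \<Longrightarrow> (LINT t:{s-r..s+r}|lborel. cmod (v t - v s)) \<le> e * r"
          using leb by blast
        define r where "r = min (d/2) (min s (l - s))"
        have r: "0 < r" "r < d" "r \<le> s" "r \<le> l - s" using d s by (auto simp: r_def)
        have ic: "set_integrable lborel {s-r..s+r} (\<lambda>t. v s)" by (rule borel_integrable_atLeastAtMost') simp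
        have "(LINT t:{s-r..s+r}|lborel. v t - v s) = (\<sigma> (s+r) - \<sigma> (s-r)) - (2 * r) *\<^sub>R v s"
          unfolding set_integral_diff(2)[OF inv ic] using v_int[of "s-r" "s+r"] r by (simp add: set_lebesgue_integral_def)
        moreover have "cmod (LINT t:{s-r..s+r}|lborel. v t - v s) \<le> (LINT t:{s-r..s+r}|lborel. cmod (v t - v s))"
          by (rule set_integral_norm_bound) (rule set_integral_diff(1)[OF inv ic])
        ultimately have "cmod ((\<sigma> (s+r) - \<sigma> (s-r)) - (2 * r) *\<^sub>R v s) \<le> e * r" using d(2)[of r] r by simp
        moreover have "cmod (\<sigma> (s+r) - \<sigma> (s-r)) \<le> 2 * r" using lip[of "s+r" "s-r"] r by (simp add: dist_norm)
        moreover have "cmod ((2 * r) *\<^sub>R v s) \<le> cmod (\<sigma> (s+r) - \<sigma> (s-r)) + cmod ((\<sigma> (s+r) - \<sigma> (s-r)) - (2 * r) *\<^sub>R v s)"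
          using norm_triangle_ineq4[of "\<sigma> (s+r) - \<sigma> (s-r)" "(\<sigma> (s+r) - \<sigma> (s-r)) - (2 * r) *\<^sub>R v s"] by simp
        ultimately have "2 * r * cmod (v s) \<le> 2 * r + e * r" using r by simp
        then have "r * (2 * cmod (v s)) \<le> r * (2 + e)" by (simp add: algebra_simps)
        then have "2 * cmod (v s) \<le> 2 + e" using r by simp
        then show "cmod (v s) \<le> 1 + e" using \<open>e > 0\<close> by simp
      qed
    qed
  qed
  then have le1: "AE s in lborel. cmod (v s) \<le> 1"
    by eventually_elim (use v(3) in force)
  have inn: "set_integrable lborel {x..y} (\<lambda>s. cmod (v s))" for x y using inv by (rule set_integrable_norm)
  \<comment> \<open>The increments of this integral dominate the chords, so by \<open>len\<close>
    its total is at least \<open>l\<close>; a function bounded by 1 almost everywhere can reach that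
    only by being 1 almost everywhere.\<close>
  define W where "W t = (LINT s:{0..t}|lborel. cmod (v s))" for t
  have "l \<le> W l - W 0"
  proof (rule len)
    fix a b assume ab: "0 \<le> a" "a \<le> b" "b \<le> l"
    have "dist (\<sigma> a) (\<sigma> b) = cmod (LINT s:{a..b}|lborel. v s)" using v_int[OF ab] by (simp add: dist_norm norm_minus_commute)
    also have "\<dots> \<le> (LINT s:{a..b}|lborel. cmod (v s))" by (rule set_integral_norm_bound[OF inv])
    also have "\<dots> = W b - W a"
      using set_integral_combine[OF inn ab(1,2)] by (simp add: W_def)
    finally show "dist (\<sigma> a) (\<sigma> b) \<le> W b - W a" .
  qed
  moreover have "W 0 = 0" by (simp add: W_def set_integral_singleton)
  ultimately have Wl: "l \<le> W l" by simp
  have v_norm: "AE s in lborel. s \<in> {0..l} \<longrightarrow> cmod (v s) = 1"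
  proof -
    let ?f = "\<lambda>s. indicator {0..l} s *\<^sub>R (1 - cmod (v s))"
    have i1: "set_integrable lborel {0..l} (\<lambda>s. 1::real)" by (rule borel_integrable_atLeastAtMost') simp
    have int: "integrable lborel ?f" using set_integral_diff(1)[OF i1 inn] unfolding set_integrable_def .
    have nn: "AE s in lborel. 0 \<le> ?f s" using le1 by eventually_elim (auto simp: indicator_def)
    have "integral\<^sup>L lborel ?f = (LINT s:{0..l}|lborel. 1) - W l"
      using set_integral_diff(2)[OF i1 inn] unfolding W_def set_lebesgue_integral_def by simp
    also have "\<dots> \<le> 0" using Wl l by (simp add: set_lebesgue_integral_def)
    finally have "integral\<^sup>L lborel ?f = 0" using integral_nonneg_AE[OF nn] by simp
    then have "AE s in lborel. ?f s = 0" using integral_nonneg_eq_0_iff_AE[OF int nn] by simp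
    then show ?thesis by eventually_elim (auto simp: indicator_def)
  qed
  \<comment> \<open>A change on a null set makes the bound by 1 hold everywhere, which simplifies
    all later estimates.\<close>
  define v' where "v' s = (if cmod (v s) \<le> 1 then v s else 0)" for s
  have v'v: "AE s in lborel. v' s = v s" using le1 by eventually_elim (simp add: v'_def)
  have mv': "v' \<in> borel_measurable borel" unfolding v'_def[abs_def] using v(1) by measurable
  have "jordan_disk_density \<sigma> l R G \<phi> \<psi> \<tau> \<rho> v'"
  proof (unfold_locales)
    show "integrable lborel v'" using v(2) v'v mv' v(1) by (subst integrable_cong_AE[of _ _ v]) auto
    show "AE s in lborel. s \<in> {0..l} \<longrightarrow> cmod (v' s) = 1" using v_norm v'v by eventually_elim simp
    show "(LINT s:{x..y}|lborel. v' s) = \<sigma> y - \<sigma> x" if "0 \<le> x" "x \<le> y" "y \<le> l" for x y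
      unfolding v_int[OF that, symmetric] set_lebesgue_integral_def
      by (rule integral_cong_AE) (use v'v mv' v(1) in auto)
  qed (use \<rho> mv' in \<open>auto simp: v'_def\<close>)
  then show ?thesis by blast
qed

context jordan_disk_density
begin

lemma set_integrable_v: "set_integrable lborel {x..y} v"
  unfolding set_integrable_def using v(2) by (rule integrable_mult_indicator[rotated]) simp

lemma set_integrable_mult_v:
  assumes k: "continuous_on {x..y} k"
  shows "set_integrable lborel {x..y} (\<lambda>s. v s * k s)"
proof (rule set_integrable_bound)
  show "set_integrable lborel {x..y} k" using k by (rule borel_integrable_atLeastAtMost')
  show "set_borel_measurable lborel {x..y} (\<lambda>s. v s * k s)"
  proof -
    have "(\<lambda>s. indicator {x..y} s *\<^sub>R k s) \<in> borel_measurable borel"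
      by (rule borel_measurable_continuous_on_indicator[OF _ k]) simp
    then have "(\<lambda>s. v s * (indicator {x..y} s *\<^sub>R k s)) \<in> borel_measurable borel"
      using v(1) by measurable
    then show ?thesis unfolding set_borel_measurable_def by (simp add: mult.left_commute mult_scaleR_right)
  qed
  show "AE s in lborel. s \<in> {x..y} \<longrightarrow> cmod (v s * k s) \<le> cmod (k s)"
    using v(3) by (auto simp: norm_mult intro!: mult_left_le_one_le)
qed

lemma norm_integral_mult_v_le:
  assumes k: "continuous_on {x..y} k" and B: "\<And>s. s \<in> {x..y} \<Longrightarrow> cmod (k s) \<le> B" and xy: "x \<le> y"
  shows "cmod (LINT s:{x..y}|lborel. v s * k s) \<le> B * (y - x)"
proof -
  have "cmod (LINT s:{x..y}|lborel. v s * k s) \<le> (LINT s:{x..y}|lborel. cmod (v s * k s))"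
    by (rule set_integral_norm_bound[OF set_integrable_mult_v[OF k]])
  also have "\<dots> \<le> (LINT s:{x..y}|lborel. B)"
  proof (rule set_integral_mono)
    show "set_integrable lborel {x..y} (\<lambda>s. cmod (v s * k s))"
      by (rule set_integrable_norm[OF set_integrable_mult_v[OF k]])
    show "set_integrable lborel {x..y} (\<lambda>s. B)" by (rule borel_integrable_atLeastAtMost') simp
    fix s assume s: "s \<in> {x..y}"
    have "cmod (v s * k s) \<le> cmod (k s)" using v(3)[of s] by (simp add: norm_mult mult_left_le_one_le)
    then show "cmod (v s * k s) \<le> B" using B[OF s] by simp
  qed
  also have "\<dots> = B * (y - x)" using xy by (simp add: set_lebesgue_integral_def)
  finally show ?thesis .
qed

lemma curve_dist_pos:
  assumes w: "w \<notin> \<sigma> ` {0..l}"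
  obtains c where "c > 0" "\<And>s. s \<in> {0..l} \<Longrightarrow> c \<le> cmod (\<sigma> s - w)"
proof -
  have "compact (\<sigma> ` {0..l})" using cont\<sigma> by (simp add: compact_continuous_image)
  then obtain c where "c > 0" "\<And>z. z \<in> \<sigma> ` {0..l} \<Longrightarrow> c \<le> dist w z"
    using separate_point_closed[OF compact_imp_closed w] by metis
  then show ?thesis using that[of c] by (auto simp: dist_norm norm_minus_commute[of w])
qed

text \<open>With \<Lambda> the integral up to a variable end point,
  \<open>(\<sigma> s - w) * exp (- \<Lambda> s)\<close> has quadratic increments and is constant.
  Hence \<Lambda> differs from any continuous logarithm of \<open>\<sigma> s - w\<close> by a
  constant.\<close>

lemma winding_log_increment:
  assumes w: "w \<notin> \<sigma> ` {0..l}" and m: "continuous_on {0..l} m" "\<And>s. s \<in> {0..l} \<Longrightarrow> \<sigma> s - w = exp (m s)"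
  shows "(LINT s:{0..l}|lborel. v s * (1 / (\<sigma> s - w))) = m l - m 0"
proof -
  obtain c where c: "c > 0" "\<And>s. s \<in> {0..l} \<Longrightarrow> c \<le> cmod (\<sigma> s - w)" using curve_dist_pos[OF w] by blast
  have nz: "\<sigma> s - w \<noteq> 0" if "s \<in> {0..l}" for s using c(2)[OF that] c(1) by auto
  have ck: "continuous_on {x..y} (\<lambda>s. 1 / (\<sigma> s - w))" if "{x..y} \<subseteq> {0..l}" for x y
    using continuous_on_subset[OF cont\<sigma> that] nz that by (auto intro!: continuous_intros)
  define \<Lambda> where "\<Lambda> t = (LINT s:{0..t}|lborel. v s * (1 / (\<sigma> s - w)))" for t
  have inc: "\<Lambda> t - \<Lambda> s = (LINT r:{s..t}|lborel. v r * (1 / (\<sigma> r - w)))" if "0 \<le> s" "s \<le> t" "t \<le> l" for s t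
  proof -
    have "\<Lambda> t = \<Lambda> s + (LINT r:{s..t}|lborel. v r * (1 / (\<sigma> r - w)))"
      unfolding \<Lambda>_def by (rule set_integral_combine[OF set_integrable_mult_v[OF ck]]) (use that in auto)
    then show ?thesis by simp
  qed
  have bound: "cmod (\<Lambda> t - \<Lambda> s) \<le> (1 / c) * (t - s)" if st: "0 \<le> s" "s \<le> t" "t \<le> l" for s t
    unfolding inc[OF st]
  proof (rule norm_integral_mult_v_le)
    show "continuous_on {s..t} (\<lambda>r. 1 / (\<sigma> r - w))" by (rule ck) (use st in auto)
    show "cmod (1 / (\<sigma> r - w)) \<le> 1 / c" if "r \<in> {s..t}" for r
      using c(2)[of r] c(1) that st by (simp add: norm_divide frac_le)
  qed (use st in simp)
  have "compact (\<sigma> ` {0..l})" using cont\<sigma> by (simp add: compact_continuous_image)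
  then obtain M0 where M0: "\<And>s. s \<in> {0..l} \<Longrightarrow> cmod (\<sigma> s) \<le> M0" by (meson bounded_iff compact_imp_bounded image_eqI)
  define M where "M = \<bar>M0\<bar> + cmod w"
  have M: "cmod (\<sigma> s - w) \<le> M" if "s \<in> {0..l}" for s
    using M0[OF that] norm_triangle_ineq4[of "\<sigma> s" w] by (simp add: M_def)
  have M_pos: "M \<ge> 0" by (simp add: M_def)
  have cont\<Lambda>: "continuous_on {0..l} \<Lambda>"
  proof (rule lipschitz_on_continuous_on)
    have "dist (\<Lambda> s) (\<Lambda> t) \<le> (1/c) * dist s t" if "s \<in> {0..l}" "t \<in> {0..l}" for s t
      using bound[of s t] bound[of t s] that by (cases "s \<le> t") (auto simp: dist_norm norm_minus_commute)
    then show "(1/c)-lipschitz_on {0..l} \<Lambda>" using c(1) by (auto simp: lipschitz_on_def)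
  qed
  have "compact ((\<lambda>s. exp (- \<Lambda> s)) ` {0..l})"
    by (rule compact_continuous_image) (auto intro!: continuous_intros cont\<Lambda>)
  then obtain B where B: "\<And>s. s \<in> {0..l} \<Longrightarrow> cmod (exp (- \<Lambda> s)) \<le> B" by (meson bounded_iff compact_imp_bounded image_eqI)
  have B0: "B > 0" using B[of 0] l by (auto intro: less_le_trans[of _ "cmod (exp (- \<Lambda> 0))"])
  define E where "E s = (\<sigma> s - w) * exp (- \<Lambda> s)" for s
  define K where "K = B * (M * (exp 1 * (1/c)\<^sup>2) + 1/c + 1/c)"
  have EE: "cmod (E t - E s) \<le> K * (t - s)\<^sup>2" if st: "s \<in> {0..l}" "t \<in> {0..l}" "s \<le> t" "t - s \<le> c" for s t
  proof -
    define I where "I = \<Lambda> t - \<Lambda> s"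
    have I: "cmod I \<le> (1/c) * (t - s)" using bound[of s t] st I_def by simp
    then have I1: "cmod I \<le> 1" using st(4) c(1) by (auto intro: order_trans)
    have "cmod (exp (-I) - (\<Sum>k\<le>1. (-I) ^ k / fact k)) \<le> exp \<bar>Re (-I)\<bar> * cmod (-I) ^ Suc 1 / fact 1"
      by (rule Taylor_exp)
    then have "cmod (exp (-I) - 1 + I) \<le> exp \<bar>Re I\<bar> * (cmod I)\<^sup>2" by (simp add: power2_eq_square algebra_simps)
    also have "\<dots> \<le> exp 1 * ((1/c) * (t - s))\<^sup>2"
      using I1 abs_Re_le_cmod[of I] I by (intro mult_mono power_mono) auto
    finally have ex: "cmod (exp (-I) - 1 + I) \<le> exp 1 * (1/c)\<^sup>2 * (t - s)\<^sup>2" by (simp add: power_mult_distrib power_divide)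
    have e1: "cmod ((\<sigma> s - w) * I - (\<sigma> t - \<sigma> s)) \<le> (1/c) * (t - s)\<^sup>2"
    proof -
      have cont1: "continuous_on {s..t} (\<lambda>r. (\<sigma> s - \<sigma> r) / (\<sigma> r - w))"
        using continuous_on_subset[OF cont\<sigma>, of "{s..t}"] nz st by (auto intro!: continuous_intros)
      have "(\<sigma> s - w) * I = (LINT r:{s..t}|lborel. (\<sigma> s - w) * (v r * (1 / (\<sigma> r - w))))"
        using inc[of s t] st unfolding I_def by (simp only: set_integral_mult_right atLeastAtMost_iff)
      also have "\<dots> = (LINT r:{s..t}|lborel. v r + v r * ((\<sigma> s - \<sigma> r) / (\<sigma> r - w)))"
      proof (rule set_lebesgue_integral_cong)
        have "(\<sigma> s - w) * (v r * (1 / (\<sigma> r - w))) = v r + v r * ((\<sigma> s - \<sigma> r) / (\<sigma> r - w))" if "r \<in> {s..t}" for r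
          using nz[of r] that st by (simp add: field_simps)
        then show "\<forall>r. r \<in> {s..t} \<longrightarrow> (\<sigma> s - w) * (v r * (1 / (\<sigma> r - w))) = v r + v r * ((\<sigma> s - \<sigma> r) / (\<sigma> r - w))" by blast
      qed simp
      also have "\<dots> = (\<sigma> t - \<sigma> s) + (LINT r:{s..t}|lborel. v r * ((\<sigma> s - \<sigma> r) / (\<sigma> r - w)))"
        unfolding set_integral_add(2)[OF set_integrable_v set_integrable_mult_v[OF cont1]] using v_int[of s t] st by simp
      finally have "cmod ((\<sigma> s - w) * I - (\<sigma> t - \<sigma> s)) = cmod (LINT r:{s..t}|lborel. v r * ((\<sigma> s - \<sigma> r) / (\<sigma> r - w)))" by simp
      also have "\<dots> \<le> ((t - s) / c) * (t - s)"
      proof (rule norm_integral_mult_v_le[OF cont1])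
        fix r assume r: "r \<in> {s..t}"
        have "cmod (\<sigma> s - \<sigma> r) \<le> t - s" using lip[of s r] r st by (auto simp: dist_norm)
        then show "cmod ((\<sigma> s - \<sigma> r) / (\<sigma> r - w)) \<le> (t - s) / c"
          using c(2)[of r] c(1) r st by (simp add: norm_divide frac_le)
      qed (use st in simp)
      finally show ?thesis by (simp add: power2_eq_square)
    qed
    have "E t - E s = exp (- \<Lambda> s) * ((\<sigma> t - w) * exp (-I) - (\<sigma> s - w))"
      by (simp add: E_def I_def algebra_simps flip: exp_add)
    \<comment> \<open>Three errors of second order: the exponential against its linear part, the
      product of two increments, and the variation of the Cauchy kernel over the interval. The
      constant \<open>K\<close> collects them.\<close>
    also have "(\<sigma> t - w) * exp (-I) - (\<sigma> s - w) =
      (\<sigma> t - w) * (exp (-I) - 1 + I) - (\<sigma> t - \<sigma> s) * I - ((\<sigma> s - w) * I - (\<sigma> t - \<sigma> s))" by (simp add: algebra_simps)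
    finally have "cmod (E t - E s) = cmod (exp (- \<Lambda> s)) * cmod ((\<sigma> t - w) * (exp (-I) - 1 + I) - (\<sigma> t - \<sigma> s) * I - ((\<sigma> s - w) * I - (\<sigma> t - \<sigma> s)))"
      by (simp only: norm_mult)
    also have "\<dots> \<le> B * (M * (exp 1 * (1/c)\<^sup>2 * (t - s)\<^sup>2) + (t - s) * ((1/c) * (t - s)) + (1/c) * (t - s)\<^sup>2)"
    proof (rule mult_mono)
      have "cmod ((\<sigma> t - w) * (exp (-I) - 1 + I)) \<le> M * (exp 1 * (1/c)\<^sup>2 * (t - s)\<^sup>2)"
        unfolding norm_mult using M[of t] ex st M_pos by (intro mult_mono) auto
      moreover have "cmod ((\<sigma> t - \<sigma> s) * I) \<le> (t - s) * ((1/c) * (t - s))"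
        unfolding norm_mult using lip[of t s] I st by (intro mult_mono) (auto simp: dist_norm)
      ultimately show "cmod ((\<sigma> t - w) * (exp (-I) - 1 + I) - (\<sigma> t - \<sigma> s) * I - ((\<sigma> s - w) * I - (\<sigma> t - \<sigma> s)))
          \<le> M * (exp 1 * (1/c)\<^sup>2 * (t - s)\<^sup>2) + (t - s) * ((1/c) * (t - s)) + (1/c) * (t - s)\<^sup>2"
        using e1 norm_triangle_ineq4[of "(\<sigma> t - w) * (exp (-I) - 1 + I) - (\<sigma> t - \<sigma> s) * I" "(\<sigma> s - w) * I - (\<sigma> t - \<sigma> s)"]
          norm_triangle_ineq4[of "(\<sigma> t - w) * (exp (-I) - 1 + I)" "(\<sigma> t - \<sigma> s) * I"] by linarith
    qed (use B[of s] st B0 in auto)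
    also have "\<dots> = K * (t - s)\<^sup>2"
    proof -
      have "B * (M * (exp 1 * q\<^sup>2 * (t - s)\<^sup>2) + (t - s) * (q * (t - s)) + q * (t - s)\<^sup>2)
          = B * (M * (exp 1 * q\<^sup>2) + q + q) * (t - s)\<^sup>2" for q
        by (simp add: power2_eq_square algebra_simps)
      then show ?thesis unfolding K_def .
    qed
    finally show ?thesis .
  qed
  have Kpos: "K > 0" unfolding K_def using B0 c(1) M_pos by (intro mult_pos_pos add_nonneg_pos) auto
  have Econst: "E s = E 0" if "s \<in> {0..l}" for s
    by (rule quadratic_increment_imp_const[OF EE c(1) Kpos]) (use that l in auto)
  have "\<Lambda> 0 = 0" by (simp add: \<Lambda>_def set_integral_singleton)
  have "m l - \<Lambda> l = m 0 - \<Lambda> 0"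
  proof (rule continuous_exp_const_imp_const[where h = "\<lambda>s. m s - \<Lambda> s"])
    show "continuous_on {0..l} (\<lambda>s. m s - \<Lambda> s)" by (intro continuous_intros m cont\<Lambda>)
    show "exp (m s - \<Lambda> s) = E 0" if "s \<in> {0..l}" for s
      using Econst[OF that] m(2)[OF that] by (simp add: E_def exp_diff exp_minus field_simps)
  qed (use l in simp)
  then show ?thesis using \<open>\<Lambda> 0 = 0\<close> by (simp add: \<Lambda>_def algebra_simps)
qed

end

section \<open>Cauchy transforms on the curve\<close>

lemma lebesgue_point_kernel_tendsto:
  fixes f :: "real \<Rightarrow> complex"
  assumes f: "integrable lborel f"
    and leb: "\<forall>e>0. \<exists>d>0. \<forall>r. 0 < r \<and> r < d \<longrightarrow> (LINT t:{s-r..s+r}|lborel. cmod (f t - f s)) \<le> e * r"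
    and e: "e > 0"
  obtains \<delta>0 where "\<delta>0 > 0" "\<And>\<delta>. 0 < \<delta> \<Longrightarrow> \<delta> < \<delta>0 \<Longrightarrow>
     (LINT t:{a..b}|lborel. cmod (f t - f s) * (\<delta> / (\<bar>t - s\<bar> + \<delta>)\<^sup>2)) \<le> e"
proof -
  define M where "M = max 1 (LINT t:{a..b}|lborel. cmod (f t - f s))"
  have M: "M > 0" "(LINT t:{a..b}|lborel. cmod (f t - f s)) \<le> M" by (auto simp: M_def)
  obtain d where d: "d > 0" "\<And>r. 0 < r \<Longrightarrow> r < d \<Longrightarrow> (LINT t:{s-r..s+r}|lborel. cmod (f t - f s)) \<le> (e/16) * r"
    using leb e by (metis divide_pos_pos zero_less_numeral)
  show ?thesis
  proof (rule that[of "min d (e * d\<^sup>2 / (8 * M))"])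
    show "min d (e * d\<^sup>2 / (8 * M)) > 0" using d e M by simp
    fix \<delta> assume \<delta>: "0 < \<delta>" "\<delta> < min d (e * d\<^sup>2 / (8 * M))"
    have "(LINT t:{a..b}|lborel. cmod (f t - f s) * (\<delta> / (\<bar>t - s\<bar> + \<delta>)\<^sup>2)) \<le> 8 * (e/16) + 4 * \<delta> * M / d\<^sup>2"
      by (rule lebesgue_point_kernel_le[OF f _ d(1) d(2) M(2)]) (use e \<delta> in auto)
    also have "4 * \<delta> * M / d\<^sup>2 \<le> e / 2"
      using \<delta> d M by (simp add: field_simps)
    finally show "(LINT t:{a..b}|lborel. cmod (f t - f s) * (\<delta> / (\<bar>t - s\<bar> + \<delta>)\<^sup>2)) \<le> e" by simp
  qed
qed

context jordan_disk_density
begin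

text \<open>The derivative of \<phi> along \<sigma>.\<close>

definition \<eta> :: "real \<Rightarrow> complex" where
  "\<eta> s = indicator {0..l} s *\<^sub>R (\<rho> s *\<^sub>R (R * \<i> * cis (\<tau> s)))"

lemma \<eta>_measurable: "\<eta> \<in> borel_measurable borel"
proof -
  have "(\<lambda>s. indicator {0..l} s *\<^sub>R (R * \<i> * cis (\<tau> s))) \<in> borel_measurable borel"
    by (rule borel_measurable_continuous_on_indicator) (auto intro!: continuous_intros cont\<tau>)
  then have "(\<lambda>s. \<rho> s *\<^sub>R (indicator {0..l} s *\<^sub>R (R * \<i> * cis (\<tau> s)))) \<in> borel_measurable borel"
    using \<rho>(1) by measurable
  then show ?thesis unfolding \<eta>_def[abs_def] by (simp add: mult.commute)
qed

lemma norm_\<eta>: "s \<in> {0..l} \<Longrightarrow> cmod (\<eta> s) = R * \<rho> s"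
  using R \<rho>(2)[of s] by (simp add: \<eta>_def norm_mult)

lemma \<eta>_integrable: "integrable lborel \<eta>"
proof (rule Bochner_Integration.integrable_bound)
  show "integrable lborel (\<lambda>s. R * \<rho> s)" using \<rho>(3) by simp
  show "AE s in lborel. norm (\<eta> s) \<le> norm (R * \<rho> s)"
    using R \<rho>(2) by (auto simp: \<eta>_def norm_mult indicator_def abs_mult)
qed (use \<eta>_measurable in simp)

lemma \<eta>_subst:
  assumes xy: "0 \<le> x" "x \<le> y" "y \<le> l" and k: "continuous_on {\<tau> 0..\<tau> l} k"
  shows "(LINT s:{x..y}|lborel. \<eta> s * k (\<tau> s)) = (LINT \<theta>:{\<tau> x..\<tau> y}|lborel. R * \<i> * cis \<theta> * k \<theta>)"
proof -
  have "(LINT s:{x..y}|lborel. \<eta> s * k (\<tau> s)) = (LINT s:{x..y}|lborel. \<rho> s *\<^sub>R (R * \<i> * cis (\<tau> s) * k (\<tau> s)))"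
    by (rule set_lebesgue_integral_cong) (use xy in \<open>auto simp: \<eta>_def\<close>)
  also have "\<dots> = (LINT \<theta>:{\<tau> x..\<tau> y}|lborel. R * \<i> * cis \<theta> * k \<theta>)"
    by (rule \<rho>_subst[OF xy]) (intro continuous_intros k)
  finally show ?thesis .
qed

lemma \<eta>_int:
  assumes xy: "0 \<le> x" "x \<le> y" "y \<le> l"
  shows "(LINT s:{x..y}|lborel. \<eta> s) = \<phi> (\<sigma> y) - \<phi> (\<sigma> x)"
proof -
  have "(LINT s:{x..y}|lborel. \<eta> s) = (LINT \<theta>:{\<tau> x..\<tau> y}|lborel. R * \<i> * cis \<theta>)"
    using \<eta>_subst[OF xy, of "\<lambda>_. 1"] by simp
  also have "\<dots> = integral {\<tau> x..\<tau> y} (\<lambda>\<theta>. R * \<i> * cis \<theta>)"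
    by (intro set_borel_integral_eq_integral(2) borel_integrable_atLeastAtMost') (intro continuous_intros)
  also have "\<dots> = R * cis (\<tau> y) - R * cis (\<tau> x)"
  proof (rule integral_unique, rule fundamental_theorem_of_calculus)
    show "\<tau> x \<le> \<tau> y" using mono\<tau> xy by simp
    show "((\<lambda>\<theta>. R * cis \<theta>) has_vector_derivative R * \<i> * cis t) (at t within {\<tau> x..\<tau> y})" for t
    proof -
      have "((\<lambda>z. R * exp (\<i> * z)) has_field_derivative R * \<i> * exp (\<i> * of_real t)) (at (of_real t))"
        by (auto intro!: derivative_eq_intros)
      then have "((\<lambda>\<theta>. R * exp (\<i> * of_real \<theta>)) has_vector_derivative R * \<i> * exp (\<i> * of_real t)) (at t within {\<tau> x..\<tau> y})"
        by (rule has_vector_derivative_real_field)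
      then show ?thesis by (simp add: cis_conv_exp)
    qed
  qed
  finally show ?thesis using \<phi>\<sigma> xy by simp
qed

lemma deriv_inverse: "z \<in> G \<Longrightarrow> deriv \<psi> (\<phi> z) * deriv \<phi> z = 1"
proof -
  assume z: "z \<in> G"
  have d\<phi>: "(\<phi> has_field_derivative deriv \<phi> z) (at z)" using hol\<phi> openG z by (rule holomorphic_derivI)
  have d\<psi>: "(\<psi> has_field_derivative deriv \<psi> (\<phi> z)) (at (\<phi> z))"
    using hol\<psi> open_ball by (rule holomorphic_derivI) (use \<phi>G z in simp)
  have "((\<lambda>z. \<psi> (\<phi> z)) has_field_derivative deriv \<psi> (\<phi> z) * deriv \<phi> z) (at z)"
    by (rule DERIV_chain2[OF d\<psi> d\<phi>])
  moreover have "((\<lambda>z. \<psi> (\<phi> z)) has_field_derivative 1) (at z)"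
    by (rule has_field_derivative_transform_within_open[OF DERIV_ident openG z]) (use \<psi>\<phi> clG in auto)
  ultimately show ?thesis by (rule DERIV_unique)
qed

lemma on_circle: "s \<in> {0..l} \<Longrightarrow> R * cis (\<tau> s) \<in> cball 0 R" "complex_of_real R * cis t \<in> cball 0 R"
  using R by (auto simp: norm_mult)

lemma cont_\<psi>_circle: "continuous_on A (\<lambda>t. \<psi> (R * cis t))"
  by (rule continuous_on_compose2[OF cont\<psi>]) (use R in \<open>auto intro!: continuous_intros simp: norm_mult\<close>)

lemma \<psi>_eq_iff: "w \<in> closure G \<Longrightarrow> u \<in> cball 0 R \<Longrightarrow> \<psi> u = w \<longleftrightarrow> u = \<phi> w"
  using \<psi>\<phi> \<phi>\<psi> by auto

text \<open>\<open>\<eta>\<close> is \<open>R * \<i> * cis (\<tau> s)\<close> times the density of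
  \<open>\<tau>\<close>, so taking the angle as variable moves the integral from the curve to the
  circle.\<close>

lemma cauchy_transform_aux:
  assumes "\<And>t. \<psi> (R * cis t) \<noteq> w"
    and "((\<lambda>t. R * cis t / (\<psi> (R * cis t) - w)) has_integral I) {\<tau> 0..\<tau> 0 + 2 * pi}"
  shows "(LINT s:{0..l}|lborel. \<eta> s * (1 / (\<sigma> s - w))) = \<i> * I"
proof -
  have ck: "continuous_on A (\<lambda>t. 1 / (\<psi> (R * cis t) - w))" for A
    using assms(1) by (intro continuous_intros cont_\<psi>_circle) auto
  have "(LINT s:{0..l}|lborel. \<eta> s * (1 / (\<sigma> s - w))) = (LINT s:{0..l}|lborel. \<eta> s * (1 / (\<psi> (R * cis (\<tau> s)) - w)))"
    by (rule set_lebesgue_integral_cong) (auto simp: \<psi>cis)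
  also have "\<dots> = (LINT \<theta>:{\<tau> 0..\<tau> l}|lborel. R * \<i> * cis \<theta> * (1 / (\<psi> (R * cis \<theta>) - w)))"
    by (rule \<eta>_subst[OF _ _ _ ck]) (use l in auto)
  also have "\<dots> = integral {\<tau> 0..\<tau> l} (\<lambda>\<theta>. R * \<i> * cis \<theta> * (1 / (\<psi> (R * cis \<theta>) - w)))"
    by (intro set_borel_integral_eq_integral(2) borel_integrable_atLeastAtMost') (intro continuous_intros ck)
  also have "\<dots> = integral {\<tau> 0..\<tau> 0 + 2 * pi} (\<lambda>\<theta>. \<i> * (R * cis \<theta> / (\<psi> (R * cis \<theta>) - w)))"
    by (simp add: \<tau>l mult_ac)
  also have "\<dots> = \<i> * I" by (rule integral_unique[OF has_integral_mult_right[OF assms(2)]])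
  finally show ?thesis .
qed

text \<open>On the circle the integrand becomes \<open>u / (\<psi> u - w)\<close>, which is
  holomorphic in the disk and 0 at its centre.\<close>

lemma cauchy_transform_outside:
  assumes w: "w \<notin> closure G"
  shows "(LINT s:{0..l}|lborel. \<eta> s * (1 / (\<sigma> s - w))) = 0"
proof -
  have nz: "\<psi> u - w \<noteq> 0" if "u \<in> cball 0 R" for u
  proof (cases "cmod u < R")
    case True
    then show ?thesis using \<psi>G[of u] w closure_subset[of G] by auto
  next
    case False
    have "\<psi> u \<in> closure G"
    proof -
      have "u \<in> closure (ball 0 R)" using that R by simp
      moreover have "\<psi> ` closure (ball 0 R) \<subseteq> closure G"
      proof (rule image_closure_subset)
        show "continuous_on (closure (ball 0 R)) \<psi>" using cont\<psi> R by simp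
        show "\<psi> ` ball 0 R \<subseteq> closure G" using \<psi>G closure_subset[of G] by auto
      qed simp
      ultimately show ?thesis by auto
    qed
    then show ?thesis using w by auto
  qed
  define f where "f u = u / (\<psi> u - w)" for u
  have f: "continuous_on (cball 0 R) f" "f holomorphic_on ball 0 R"
    unfolding f_def using nz cont\<psi> hol\<psi> by (auto intro!: continuous_intros holomorphic_intros)
  have "((\<lambda>t. f (R * cis t)) has_integral (2 * pi * f 0)) {\<tau> 0..\<tau> 0 + 2 * pi}"
    by (rule circle_mean_value[OF f R])
  then have "((\<lambda>t. R * cis t / (\<psi> (R * cis t) - w)) has_integral 0) {\<tau> 0..\<tau> 0 + 2 * pi}"
    by (simp add: f_def)
  then show ?thesis using cauchy_transform_aux[of w 0] nz[OF on_circle(2)] by auto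
qed

text \<open>With \<open>b = \<phi> w\<close>, the difference \<open>\<psi> u - w\<close> is
  \<open>(u - b) * D u\<close> for a zero-free \<open>D\<close>, so Cauchy's formula for
  \<open>1 / D\<close> applies, and \<open>1 / D b\<close> is \<open>deriv \<phi> w\<close>. Thus
  \<open>deriv \<phi>\<close> is the Cauchy integral of its boundary density.\<close>

lemma cauchy_transform_inside:
  assumes w: "w \<in> G"
  shows "(LINT s:{0..l}|lborel. \<eta> s * (1 / (\<sigma> s - w))) = 2 * pi * \<i> * deriv \<phi> w"
proof -
  define b where "b = \<phi> w"
  have b: "cmod b < R" using \<phi>G w b_def by simp
  have wc: "w \<in> closure G" using w closure_subset by blast
  have \<psi>b: "\<psi> b = w" using \<psi>\<phi> wc b_def by simp
  define D where "D = (\<lambda>u. if u = b then deriv \<psi> b else (\<psi> u - \<psi> b) / (u - b))"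
  have D: "continuous_on (cball 0 R) D" "D holomorphic_on ball 0 R"
    unfolding D_def by (rule removable_quotient[OF cont\<psi> hol\<psi> b])+
  have nz: "D u \<noteq> 0" if "u \<in> cball 0 R" for u
    using that \<psi>_eq_iff[OF wc that] deriv_inverse[OF w] \<psi>b by (auto simp: D_def b_def)
  define f where "f u = 1 / D u" for u
  have f: "continuous_on (cball 0 R) f" "f holomorphic_on ball 0 R"
    unfolding f_def using nz D by (auto intro!: continuous_intros holomorphic_intros)
  have nb: "R * cis t \<noteq> b" for t using b R by (auto simp: norm_mult)
  have "((\<lambda>t. f (R * cis t) * (R * cis t / (R * cis t - b))) has_integral (2 * pi * f b)) {\<tau> 0..\<tau> 0 + 2 * pi}"
    by (rule circle_cauchy[OF f b])
  moreover have "f (R * cis t) * (R * cis t / (R * cis t - b)) = R * cis t / (\<psi> (R * cis t) - w)" for t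
    using nb[of t] \<psi>b by (simp add: f_def D_def)
  moreover have "f b = deriv \<phi> w"
  proof -
    have "deriv \<psi> (\<phi> w) \<noteq> 0" using deriv_inverse[OF w] by auto
    then show ?thesis using deriv_inverse[OF w] by (simp add: f_def D_def b_def field_simps)
  qed
  ultimately have I: "((\<lambda>t. R * cis t / (\<psi> (R * cis t) - w)) has_integral (2 * pi * deriv \<phi> w)) {\<tau> 0..\<tau> 0 + 2 * pi}"
    by simp
  have "\<psi> (R * cis t) \<noteq> w" for t using \<psi>_eq_iff[OF wc on_circle(2), of t] nb[of t] b_def by simp
  then have "(LINT s:{0..l}|lborel. \<eta> s * (1 / (\<sigma> s - w))) = \<i> * (2 * pi * deriv \<phi> w)"
    by (rule cauchy_transform_aux[OF _ I])
  then show ?thesis by (simp add: mult_ac)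
qed

text \<open>\<open>\<psi> u - w\<close> has a continuous logarithm on the whole closed disk, and
  this logarithm returns to its value after a circuit of the circle.\<close>

lemma winding_outside:
  assumes w: "w \<notin> closure G"
  shows "(LINT s:{0..l}|lborel. v s * (1 / (\<sigma> s - w))) = 0"
proof -
  have im: "\<psi> u \<in> closure G" if "u \<in> cball 0 R" for u
  proof -
    have "\<psi> ` closure (ball 0 R) \<subseteq> closure G"
    proof (rule image_closure_subset)
      show "continuous_on (closure (ball 0 R)) \<psi>" using cont\<psi> R by simp
      show "\<psi> ` ball 0 R \<subseteq> closure G" using \<psi>G closure_subset[of G] by auto
    qed simp
    then show ?thesis using that R by auto
  qed
  obtain m where m: "continuous_on (cball 0 R) m" "\<And>u. u \<in> cball 0 R \<Longrightarrow> \<psi> u - w = exp (m u)"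
  proof (rule continuous_logarithm_on_cball)
    show "continuous_on (cball 0 R) (\<lambda>u. \<psi> u - w)" by (intro continuous_intros cont\<psi>)
    show "\<psi> u - w \<noteq> 0" if "u \<in> cball 0 R" for u using im[OF that] w by auto
  qed blast
  have "(LINT s:{0..l}|lborel. v s * (1 / (\<sigma> s - w))) = m (R * cis (\<tau> l)) - m (R * cis (\<tau> 0))"
  proof (rule winding_log_increment[where m = "\<lambda>s. m (R * cis (\<tau> s))"])
    show "w \<notin> \<sigma> ` {0..l}" using w clG by auto
    show "continuous_on {0..l} (\<lambda>s. m (R * cis (\<tau> s)))"
      by (rule continuous_on_compose2[OF m(1)]) (use R in \<open>auto intro!: continuous_intros cont\<tau> simp: norm_mult\<close>)
    show "\<sigma> s - w = exp (m (R * cis (\<tau> s)))" if "s \<in> {0..l}" for s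
      using m(2)[OF on_circle(1)[OF that]] \<psi>cis[OF that] by simp
  qed
  also have "\<dots> = 0" using \<tau>l by (simp add: cis_mult[symmetric])
  finally show ?thesis .
qed

text \<open>On the circle \<open>\<psi> u - w\<close> is \<open>(u - b) * D u\<close>. The zero-free
  factor \<open>D\<close> has a continuous logarithm on the disk, so the increment comes from
  \<open>u - b\<close> alone.\<close>

lemma winding_inside:
  assumes w: "w \<in> G"
  shows "(LINT s:{0..l}|lborel. v s * (1 / (\<sigma> s - w))) = 2 * pi * \<i>"
proof -
  define b where "b = \<phi> w"
  have b: "cmod b < R" using \<phi>G w b_def by simp
  have wc: "w \<in> closure G" using w closure_subset by blast
  have \<psi>b: "\<psi> b = w" using \<psi>\<phi> wc b_def by simp
  define D where "D = (\<lambda>u. if u = b then deriv \<psi> b else (\<psi> u - \<psi> b) / (u - b))"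
  have D: "continuous_on (cball 0 R) D" "D holomorphic_on ball 0 R"
    unfolding D_def by (rule removable_quotient[OF cont\<psi> hol\<psi> b])+
  have nz: "D u \<noteq> 0" if "u \<in> cball 0 R" for u
    using that \<psi>_eq_iff[OF wc that] deriv_inverse[OF w] \<psi>b by (auto simp: D_def b_def)
  obtain m where m: "continuous_on (cball 0 R) m" "\<And>u. u \<in> cball 0 R \<Longrightarrow> D u = exp (m u)"
    using continuous_logarithm_on_cball[OF D(1) nz] by metis
  \<comment> \<open>\<open>R * cis t - b\<close> equals \<open>R * cis t * c t\<close>, and
    \<open>c t\<close> has positive real part, where the principal logarithm is continuous. Only the
    term \<open>\<i> * \<tau> s\<close> of \<open>M\<close> changes over one circuit.\<close>
  define c where "c t = 1 - (b / R) * cis (- t)" for t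
  have c: "c t \<notin> \<real>\<^sub>\<le>\<^sub>0" for t
  proof -
    have "cmod ((b / R) * cis (- t)) < 1" using b R by (simp add: norm_mult norm_divide)
    then have "Re ((b / R) * cis (- t)) < 1" using complex_Re_le_cmod[of "(b / R) * cis (- t)"] by linarith
    then have "Re (c t) > 0" unfolding c_def minus_complex.sel by simp
    then show ?thesis by (auto simp: complex_nonpos_Reals_iff)
  qed
  define M where "M s = ln R + \<i> * \<tau> s + Ln (c (\<tau> s)) + m (R * cis (\<tau> s))" for s
  have "(LINT s:{0..l}|lborel. v s * (1 / (\<sigma> s - w))) = M l - M 0"
  proof (rule winding_log_increment)
    show "w \<notin> \<sigma> ` {0..l}" using w GL by auto
    have c1: "continuous_on {0..l} (\<lambda>s. Ln (c (\<tau> s)))"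
      using c R unfolding c_def by (auto intro!: continuous_intros cont\<tau>)
    have c2: "continuous_on {0..l} (\<lambda>s. m (R * cis (\<tau> s)))"
      by (rule continuous_on_compose2[OF m(1)]) (use R in \<open>auto intro!: continuous_intros cont\<tau> simp: norm_mult\<close>)
    show "continuous_on {0..l} M" unfolding M_def
      by (rule continuous_on_add[OF continuous_on_add[OF _ c1] c2]) (intro continuous_intros cont\<tau>)
    fix s assume s: "s \<in> {0..l}"
    let ?u = "complex_of_real R * cis (\<tau> s)"
    have "c (\<tau> s) \<noteq> 0" using c[of "\<tau> s"] by auto
    then have "exp (M s) = ?u * c (\<tau> s) * D ?u"
      using R m(2)[OF on_circle(1)[OF s]] by (simp add: M_def exp_add cis_conv_exp exp_of_real[symmetric] del: of_real_exp)
        (simp add: exp_of_real)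
    also have "?u * c (\<tau> s) = ?u - b" using R by (simp add: c_def algebra_simps cis_mult)
    also have "(?u - b) * D ?u = \<sigma> s - w"
    proof -
      have "?u \<noteq> b" using b R by (auto simp: norm_mult)
      then show ?thesis using \<psi>cis[OF s] \<psi>b by (simp add: D_def)
    qed
    finally show "\<sigma> s - w = exp (M s)" by simp
  qed
  also have "\<dots> = 2 * pi * \<i>"
  proof -
    have "cis (\<tau> l) = cis (\<tau> 0)" using \<tau>l by (simp add: cis_mult[symmetric])
    moreover from this have "cis (- \<tau> l) = cis (- \<tau> 0)" by (metis cis_cnj)
    ultimately have "c (\<tau> l) = c (\<tau> 0)" "cis (\<tau> l) = cis (\<tau> 0)" by (simp_all add: c_def)
    then show ?thesis by (simp add: M_def \<tau>l algebra_simps)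
  qed
  finally show ?thesis .
qed

end

section \<open>Nontangential limits of the derivative\<close>

text \<open>The imaginary part of \<omega> is the signed distance of pt \<omega> from the tangent at z0, positive on the side of G; the
  constant c0 will be the angular limit of the derivative of \<phi>.\<close>

locale good_boundary_point = jordan_disk_density +
  fixes s0 :: real
  assumes s0: "0 < s0" "s0 < l"
    and leb_v: "\<forall>e>0. \<exists>d>0. \<forall>r. 0 < r \<and> r < d \<longrightarrow> (LINT t:{s0-r..s0+r}|lborel. cmod (v t - v s0)) \<le> e * r"
    and leb_\<eta>: "\<forall>e>0. \<exists>d>0. \<forall>r. 0 < r \<and> r < d \<longrightarrow>
        (LINT t:{s0-r..s0+r}|lborel. cmod ((\<eta> t - \<eta> s0 / v s0 * v t) - (\<eta> s0 - \<eta> s0 / v s0 * v s0))) \<le> e * r"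
    and v0: "cmod (v s0) = 1"
begin

definition "z0 = \<sigma> s0"
definition "c0 = \<eta> s0 / v s0"
definition "pt \<omega> = z0 + v s0 * \<omega>"

lemma v0_nz: "v s0 \<noteq> 0" using v0 by auto

text \<open>The deviation is the integral of \<open>v t - v s0\<close> between \<open>s0\<close> and
  \<open>s\<close>, small compared with the length of the interval at a Lebesgue point of
  \<open>v\<close>.\<close>

lemma tangent:
  assumes q: "q > 0"
  obtains r where "r > 0" "r \<le> s0" "r \<le> l - s0"
    "\<And>s. \<bar>s - s0\<bar> < r \<Longrightarrow> cmod (\<sigma> s - z0 - v s0 * (s - s0)) \<le> q * \<bar>s - s0\<bar>"
proof -
  obtain d where d: "d > 0" "\<And>r. 0 < r \<Longrightarrow> r < d \<Longrightarrow> (LINT t:{s0-r..s0+r}|lborel. cmod (v t - v s0)) \<le> q * r"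
    using leb_v q by metis
  show ?thesis
  proof (rule that[of "min d (min s0 (l - s0))"])
    fix s assume s: "\<bar>s - s0\<bar> < min d (min s0 (l - s0))"
    show "cmod (\<sigma> s - z0 - v s0 * (s - s0)) \<le> q * \<bar>s - s0\<bar>"
    proof (cases "s = s0")
      case False
      define r where "r = \<bar>s - s0\<bar>"
      have r: "0 < r" "r < d" using False s by (auto simp: r_def)
      have ss: "\<bar>s - s0\<bar> < s0" "\<bar>s - s0\<bar> < l - s0" using s by simp_all
      define a b where "a = min s s0" "b = max s s0"
      have ab: "0 \<le> a" "a \<le> b" "b \<le> l" "{a..b} \<subseteq> {s0-r..s0+r}" "b - a = r"
        using ss s0 by (auto simp: a_b_def r_def min_def max_def)
      have ic: "set_integrable lborel {a..b} (\<lambda>t. v s0)" by (rule borel_integrable_atLeastAtMost') simp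
      have in1: "set_integrable lborel {x..y} (\<lambda>t. cmod (v t - v s0))" for x y
        by (rule set_integrable_norm_diff_const[OF v(2)])
      have "(LINT t:{a..b}|lborel. v t - v s0) = (\<sigma> b - \<sigma> a) - v s0 * (b - a)"
        unfolding set_integral_diff(2)[OF set_integrable_v ic] v_int[OF ab(1-3)]
        using ab by (simp add: set_lebesgue_integral_def scaleR_conv_of_real mult.commute)
      then have "cmod ((\<sigma> b - \<sigma> a) - v s0 * (b - a)) \<le> (LINT t:{a..b}|lborel. cmod (v t - v s0))"
        using set_integral_norm_bound[OF set_integral_diff(1)[OF set_integrable_v ic]] by simp
      also have "\<dots> \<le> (LINT t:{s0-r..s0+r}|lborel. cmod (v t - v s0))"
        unfolding set_lebesgue_integral_def
        by (rule integral_mono) (use in1 ab(4) in \<open>auto simp: set_integrable_def indicator_def\<close>)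
      also have "\<dots> \<le> q * r" by (rule d(2)[OF r])
      finally have le: "cmod ((\<sigma> b - \<sigma> a) - v s0 * (b - a)) \<le> q * r" .
      show ?thesis
      proof (cases "s \<le> s0")
        case True
        then have "\<sigma> s - z0 - v s0 * (s - s0) = - ((\<sigma> b - \<sigma> a) - v s0 * (b - a))"
          by (simp add: a_b_def z0_def min_def max_def algebra_simps)
        then have "cmod (\<sigma> s - z0 - v s0 * (s - s0)) = cmod ((\<sigma> b - \<sigma> a) - v s0 * (b - a))"
          by (simp only: norm_minus_cancel)
        then show ?thesis using le r_def by simp
      next
        case F: False
        then show ?thesis using le by (simp add: a_b_def z0_def r_def min_def max_def)
      qed
    qed (simp add: z0_def)
  qed (use d s0 in auto)
qed

text \<open>Near \<open>s0\<close> the tangent gives the constant 1/2; the rest of the curve is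
  compact and, by injectivity, stays away from \<open>z0\<close>.\<close>

lemma chord_arc:
  obtains c where "c > 0" "\<And>s. s \<in> {0..l} \<Longrightarrow> c * \<bar>s - s0\<bar> \<le> cmod (\<sigma> s - z0)"
proof -
  obtain r where r: "r > 0" "\<And>s. \<bar>s - s0\<bar> < r \<Longrightarrow> cmod (\<sigma> s - z0 - v s0 * (s - s0)) \<le> (1/2) * \<bar>s - s0\<bar>"
    using tangent[of "1/2"] by auto
  have near: "(1/2) * \<bar>s - s0\<bar> \<le> cmod (\<sigma> s - z0)" if "\<bar>s - s0\<bar> < r" for s
  proof -
    have "cmod (v s0 * (s - s0)) \<le> cmod (\<sigma> s - z0) + cmod (\<sigma> s - z0 - v s0 * (s - s0))"
      using norm_triangle_ineq4[of "\<sigma> s - z0" "\<sigma> s - z0 - v s0 * (s - s0)"] by simp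
    moreover have "cmod (v s0 * (s - s0)) = \<bar>s - s0\<bar>" using v0 by (simp add: norm_mult flip: of_real_diff)
    moreover have "1 / 2 * x \<le> B" if "A \<le> B + C" "A = x" "C \<le> 1 / 2 * x" for A B C x :: real
      using that by linarith
    ultimately show ?thesis using r(2)[OF that] by blast
  qed
  define S where "S = {0..l} - {s0 - r<..<s0 + r}"
  have "compact S" unfolding S_def by (intro compact_diff) auto
  then have "compact (\<sigma> ` S)" by (rule compact_continuous_image[rotated]) (rule continuous_on_subset[OF cont\<sigma>], auto simp: S_def)
  moreover have "z0 \<notin> \<sigma> ` S"
  proof
    assume "z0 \<in> \<sigma> ` S"
    then obtain s where s: "s \<in> S" "\<sigma> s = \<sigma> s0" by (auto simp: z0_def)
    then have ne: "s \<noteq> s0" "s \<in> {0..l}" using r by (auto simp: S_def)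
    define s' where "s' = (if s = l then 0 else s)"
    have "\<sigma> s' = \<sigma> s0" "s' \<in> {0..<l}" "s' \<noteq> s0" using s ne loop s0 l by (auto simp: s'_def)
    then show False using inj s0 unfolding inj_on_def by auto
  qed
  ultimately obtain m where m: "m > 0" "\<And>z. z \<in> \<sigma> ` S \<Longrightarrow> m \<le> dist z0 z"
    using separate_point_closed[OF compact_imp_closed] by metis
  show ?thesis
  proof (rule that[of "min (1/2) (m / l)"])
    show "min (1/2) (m/l) > 0" using m l by simp
    fix s assume s: "s \<in> {0..l}"
    show "min (1/2) (m/l) * \<bar>s - s0\<bar> \<le> cmod (\<sigma> s - z0)"
    proof (cases "\<bar>s - s0\<bar> < r")
      case True
      have "min (1/2) (m/l) * \<bar>s - s0\<bar> \<le> (1/2) * \<bar>s - s0\<bar>" by (rule mult_right_mono[OF min.cobounded1]) simp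
      then show ?thesis using near[OF True] by linarith
    next
      case False
      then have "s \<in> S" using s by (auto simp: S_def abs_if split: if_splits)
      then have "m \<le> cmod (\<sigma> s - z0)" using m(2)[of "\<sigma> s"] by (simp add: dist_norm norm_minus_commute)
      moreover have "min (1/2) (m/l) * \<bar>s - s0\<bar> \<le> (m/l) * l"
        using s s0 m l by (intro mult_mono) auto
      ultimately show ?thesis using l by simp
    qed
  qed
qed

text \<open>Imaginary parts bound \<open>k * cmod \<omega>\<close> by the distance; the triangle
  inequality then bounds \<open>k * \<bar>t\<bar>\<close> by twice the distance. The sum of the two
  explains the 3.\<close>

lemma sector_dist:
  assumes k: "0 < k" "k \<le> 1" and y: "k * cmod \<omega> \<le> \<bar>Im \<omega>\<bar>"
  shows "k / 3 * (\<bar>t\<bar> + cmod \<omega>) \<le> cmod (of_real t - \<omega>)"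
proof -
  have 1: "k * cmod \<omega> \<le> cmod (of_real t - \<omega>)"
    using y abs_Im_le_cmod[of "of_real t - \<omega>"] by simp
  have "\<bar>t\<bar> \<le> cmod (of_real t - \<omega>) + cmod \<omega>"
    using norm_triangle_ineq[of "of_real t - \<omega>" \<omega>] by simp
  then have "k * \<bar>t\<bar> \<le> k * cmod (of_real t - \<omega>) + k * cmod \<omega>"
    using mult_left_mono[of "\<bar>t\<bar>" "cmod (of_real t - \<omega>) + cmod \<omega>" k] k by (simp add: algebra_simps)
  moreover have "k * cmod (of_real t - \<omega>) \<le> cmod (of_real t - \<omega>)"
    using k by (intro mult_left_le_one_le) auto
  ultimately have "k * \<bar>t\<bar> + k * cmod \<omega> \<le> 3 * cmod (of_real t - \<omega>)" using 1 by linarith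
  then show ?thesis by (simp add: algebra_simps)
qed

text \<open>Near \<open>s0\<close> the curve is replaced by its tangent, at a cost of half of the
  bound \<open>k / 3\<close> of \<open>sector_dist\<close>. Far from \<open>s0\<close> the point
  \<open>pt \<omega>\<close> is close to \<open>z0\<close> and \<open>chord_arc\<close>
  decides.\<close>

lemma curve_dist_sector:
  assumes k: "0 < k" "k \<le> 1"
  obtains c d where "c > 0" "d > 0"
    "\<And>\<omega> s. 0 < cmod \<omega> \<Longrightarrow> cmod \<omega> < d \<Longrightarrow> k * cmod \<omega> \<le> \<bar>Im \<omega>\<bar> \<Longrightarrow> s \<in> {0..l} \<Longrightarrow>
      c * (\<bar>s - s0\<bar> + cmod \<omega>) \<le> cmod (\<sigma> s - pt \<omega>)"
proof -
  obtain r where r: "r > 0" "\<And>s. \<bar>s - s0\<bar> < r \<Longrightarrow> cmod (\<sigma> s - z0 - v s0 * (s - s0)) \<le> (k/6) * \<bar>s - s0\<bar>"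
  proof -
    have "k / 6 > 0" using k by simp
    then show ?thesis using tangent that by blast
  qed
  obtain c1 where c1: "c1 > 0" "\<And>s. s \<in> {0..l} \<Longrightarrow> c1 * \<bar>s - s0\<bar> \<le> cmod (\<sigma> s - z0)"
    using chord_arc by blast
  show ?thesis
  proof (rule that[of "min (k/6) (c1/4)" "min r (c1 * r / 2)"])
    fix \<omega> s assume w: "0 < cmod \<omega>" "cmod \<omega> < min r (c1 * r / 2)" "k * cmod \<omega> \<le> \<bar>Im \<omega>\<bar>" and s: "s \<in> {0..l}"
    let ?t = "s - s0"
    have nv: "cmod (v s0 * x) = cmod x" for x using v0 by (simp add: norm_mult)
    show "min (k/6) (c1/4) * (\<bar>s - s0\<bar> + cmod \<omega>) \<le> cmod (\<sigma> s - pt \<omega>)"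
    proof (cases "\<bar>?t\<bar> < r")
      case True
      have "k / 3 * (\<bar>?t\<bar> + cmod \<omega>) \<le> cmod (of_real ?t - \<omega>)" by (rule sector_dist[OF k w(3)])
      also have "\<dots> = cmod (v s0 * (of_real ?t - \<omega>))" by (simp only: nv)
      also have "v s0 * (of_real ?t - \<omega>) = (\<sigma> s - pt \<omega>) - (\<sigma> s - z0 - v s0 * ?t)"
        by (simp add: pt_def algebra_simps)
      also have "cmod \<dots> \<le> cmod (\<sigma> s - pt \<omega>) + cmod (\<sigma> s - z0 - v s0 * ?t)" by (rule norm_triangle_ineq4)
      also have "cmod (\<sigma> s - z0 - v s0 * ?t) \<le> (k/6) * \<bar>?t\<bar>" using r(2)[OF True] by simp
      also have "(k/6) * \<bar>?t\<bar> \<le> (k/6) * (\<bar>?t\<bar> + cmod \<omega>)" using k by (intro mult_left_mono) auto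
      finally have "(k/6) * (\<bar>?t\<bar> + cmod \<omega>) \<le> cmod (\<sigma> s - pt \<omega>)" by simp
      moreover have "min (k/6) (c1/4) * (\<bar>?t\<bar> + cmod \<omega>) \<le> (k/6) * (\<bar>?t\<bar> + cmod \<omega>)" by (intro mult_right_mono) auto
      ultimately show ?thesis by linarith
    next
      case False
      have "c1 * \<bar>?t\<bar> \<le> cmod (\<sigma> s - z0)" by (rule c1(2)[OF s])
      also have "\<sigma> s - z0 = (\<sigma> s - pt \<omega>) + v s0 * \<omega>" by (simp add: pt_def)
      also have "cmod \<dots> \<le> cmod (\<sigma> s - pt \<omega>) + cmod \<omega>" using norm_triangle_ineq[of "\<sigma> s - pt \<omega>" "v s0 * \<omega>"] by (simp only: nv)
      finally have "c1 * \<bar>?t\<bar> - cmod \<omega> \<le> cmod (\<sigma> s - pt \<omega>)" by simp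
      moreover have "c1 * r \<le> c1 * \<bar>?t\<bar>" using False c1 by (intro mult_left_mono) auto
      moreover have "(c1/4) * (\<bar>?t\<bar> + cmod \<omega>) \<le> (c1/4) * (2 * \<bar>?t\<bar>)" using False w c1 by (intro mult_left_mono) auto
      moreover have "min (k/6) (c1/4) * (\<bar>?t\<bar> + cmod \<omega>) \<le> (c1/4) * (\<bar>?t\<bar> + cmod \<omega>)" by (intro mult_right_mono) auto
      ultimately show ?thesis using w by simp
    qed
  qed (use k c1 r in auto)
qed

text \<open>The points \<^term>\<open>pt \<omega>\<close> and \<^term>\<open>pt (cnj \<omega>)\<close> are mirror images in the tangent line; the difference of their
  Cauchy kernels decays like a Poisson kernel.\<close>

definition "mirror_kernel \<omega> s = 1 / (\<sigma> s - pt \<omega>) - 1 / (\<sigma> s - pt (cnj \<omega>))"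

text \<open>Both denominators are bounded below by
  \<open>c * (\<bar>s - s0\<bar> + cmod \<omega>)\<close> and the numerator is at most
  \<open>2 * cmod \<omega>\<close>. The kernel is thus dominated by \<open>2 / c^2\<close> times the
  kernel of \<open>lebesgue_point_kernel_tendsto\<close>, which explains the tolerance
  \<open>e * c^2 / 2\<close>.\<close>

lemma mirror_kernel_integral_small:
  assumes k: "0 < k" "k \<le> 1" and f: "integrable lborel f"
    and leb: "\<forall>e>0. \<exists>d>0. \<forall>r. 0 < r \<and> r < d \<longrightarrow> (LINT t:{s0-r..s0+r}|lborel. cmod (f t - f s0)) \<le> e * r"
    and e: "e > 0"
  obtains d where "d > 0" "\<And>\<omega>. 0 < cmod \<omega> \<Longrightarrow> cmod \<omega> < d \<Longrightarrow> k * cmod \<omega> \<le> \<bar>Im \<omega>\<bar> \<Longrightarrow>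
      pt \<omega> \<notin> \<sigma> ` {0..l} \<and> pt (cnj \<omega>) \<notin> \<sigma> ` {0..l} \<and>
      set_integrable lborel {0..l} (\<lambda>s. (f s - f s0) * mirror_kernel \<omega> s) \<and>
      cmod (LINT s:{0..l}|lborel. (f s - f s0) * mirror_kernel \<omega> s) \<le> e"
proof -
  obtain c d where cd: "c > 0" "d > 0" and cdist:
    "\<And>\<omega> s. 0 < cmod \<omega> \<Longrightarrow> cmod \<omega> < d \<Longrightarrow> k * cmod \<omega> \<le> \<bar>Im \<omega>\<bar> \<Longrightarrow> s \<in> {0..l} \<Longrightarrow>
      c * (\<bar>s - s0\<bar> + cmod \<omega>) \<le> cmod (\<sigma> s - pt \<omega>)" using curve_dist_sector[OF k] by blast
  have "e * c\<^sup>2 / 2 > 0" using e cd by simp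
  then obtain d2 where d2: "d2 > 0" "\<And>\<delta>. 0 < \<delta> \<Longrightarrow> \<delta> < d2 \<Longrightarrow>
     (LINT t:{0..l}|lborel. cmod (f t - f s0) * (\<delta> / (\<bar>t - s0\<bar> + \<delta>)\<^sup>2)) \<le> e * c\<^sup>2 / 2"
    using lebesgue_point_kernel_tendsto[OF f leb] by blast
  show ?thesis
  proof (rule that[of "min d d2"])
    fix \<omega> assume w: "0 < cmod \<omega>" "cmod \<omega> < min d d2" "k * cmod \<omega> \<le> \<bar>Im \<omega>\<bar>"
    let ?d = "cmod \<omega>"
    have A: "c * (\<bar>s - s0\<bar> + ?d) \<le> cmod (\<sigma> s - pt \<omega>)" if "s \<in> {0..l}" for s
      using cdist[of \<omega> s] w that by simp
    have B: "c * (\<bar>s - s0\<bar> + ?d) \<le> cmod (\<sigma> s - pt (cnj \<omega>))" if "s \<in> {0..l}" for s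
      using cdist[of "cnj \<omega>" s] w that by simp
    have P: "0 < c * (\<bar>s - s0\<bar> + ?d)" for s using cd w by (intro mult_pos_pos add_nonneg_pos) auto
    have nz: "\<sigma> s - pt \<omega> \<noteq> 0" "\<sigma> s - pt (cnj \<omega>) \<noteq> 0" if "s \<in> {0..l}" for s
      using A[OF that] B[OF that] P[of s] by auto
    have off: "pt \<omega> \<notin> \<sigma> ` {0..l}" "pt (cnj \<omega>) \<notin> \<sigma> ` {0..l}" using nz by (metis imageE right_minus_eq)+
    have gen: "2 * ?d / (a * b) \<le> 2 * ?d / (X * X)" if "X \<le> a" "X \<le> b" "0 < X" for a b X :: real
      using that w by (intro divide_left_mono mult_mono mult_pos_pos) auto
    have K: "cmod (mirror_kernel \<omega> s) \<le> 2 / c\<^sup>2 * (?d / (\<bar>s - s0\<bar> + ?d)\<^sup>2)" if s: "s \<in> {0..l}" for s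
    proof -
      have "mirror_kernel \<omega> s = (pt \<omega> - pt (cnj \<omega>)) / ((\<sigma> s - pt \<omega>) * (\<sigma> s - pt (cnj \<omega>)))"
        using nz[OF s] by (simp add: mirror_kernel_def field_simps)
      then have "cmod (mirror_kernel \<omega> s) = cmod (pt \<omega> - pt (cnj \<omega>)) / (cmod (\<sigma> s - pt \<omega>) * cmod (\<sigma> s - pt (cnj \<omega>)))"
        by (simp add: norm_divide norm_mult)
      also have "pt \<omega> - pt (cnj \<omega>) = v s0 * (\<omega> - cnj \<omega>)" by (simp add: pt_def algebra_simps)
      also have "cmod \<dots> \<le> 2 * ?d" using norm_triangle_ineq4[of \<omega> "cnj \<omega>"] v0 by (simp add: norm_mult)
      also have "2 * ?d / (cmod (\<sigma> s - pt \<omega>) * cmod (\<sigma> s - pt (cnj \<omega>)))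
          \<le> 2 * ?d / ((c * (\<bar>s - s0\<bar> + ?d)) * (c * (\<bar>s - s0\<bar> + ?d)))"
        by (rule gen[OF A[OF s] B[OF s] P])
      also have "\<dots> = 2 / c\<^sup>2 * (?d / (\<bar>s - s0\<bar> + ?d)\<^sup>2)" by (simp add: power2_eq_square field_simps)
      finally show ?thesis by (simp add: divide_right_mono)
    qed
    have cK: "continuous_on {0..l} (mirror_kernel \<omega>)"
      unfolding mirror_kernel_def using nz by (auto intro!: continuous_intros cont\<sigma>)
    have fm: "f \<in> borel_measurable borel" using f by auto
    have Km: "(\<lambda>s. indicator {0..l} s *\<^sub>R mirror_kernel \<omega> s) \<in> borel_measurable borel"
      by (rule borel_measurable_continuous_on_indicator[OF _ cK]) simp
    have m1: "set_borel_measurable lborel {0..l} (\<lambda>s. (f s - f s0) * mirror_kernel \<omega> s)"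
    proof -
      have "(\<lambda>s. (f s - f s0) * (indicator {0..l} s *\<^sub>R mirror_kernel \<omega> s)) \<in> borel_measurable borel"
        using fm Km by measurable
      then show ?thesis unfolding set_borel_measurable_def by simp
    qed
    have wpos: "(\<bar>s - s0\<bar> + ?d)\<^sup>2 > 0" for s
      by (rule zero_less_power, rule add_nonneg_pos) (use w in auto)
    have i2: "set_integrable lborel {0..l} (\<lambda>s. 2 / c\<^sup>2 * (cmod (f s - f s0) * (?d / (\<bar>s - s0\<bar> + ?d)\<^sup>2)))"
    proof -
      have i1: "set_integrable lborel {0..l} (\<lambda>s. cmod (f s - f s0) * (?d / (\<bar>s - s0\<bar> + ?d)\<^sup>2))"
      proof (rule set_integrable_bound)
        show "set_integrable lborel {0..l} (\<lambda>s. cmod (f s - f s0) * (1 / ?d))"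
          using set_integrable_norm_diff_const[OF f] by simp
        show "set_borel_measurable lborel {0..l} (\<lambda>s. cmod (f s - f s0) * (?d / (\<bar>s - s0\<bar> + ?d)\<^sup>2))"
          unfolding set_borel_measurable_def using fm by measurable
        have "norm (cmod (f s - f s0) * (?d / (\<bar>s - s0\<bar> + ?d)\<^sup>2)) \<le> norm (cmod (f s - f s0) * (1 / ?d))" for s
        proof -
          have "?d * ?d \<le> (\<bar>s - s0\<bar> + ?d)\<^sup>2" unfolding power2_eq_square by (intro mult_mono) auto
          then have "?d / (\<bar>s - s0\<bar> + ?d)\<^sup>2 \<le> 1 / ?d" using w wpos[of s] by (simp add: field_simps)
          then have "cmod (f s - f s0) * (?d / (\<bar>s - s0\<bar> + ?d)\<^sup>2) \<le> cmod (f s - f s0) * (1 / ?d)"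
            by (intro mult_left_mono) auto
          then show ?thesis by (simp add: abs_mult)
        qed
        then show "AE s in lborel. s \<in> {0..l} \<longrightarrow> norm (cmod (f s - f s0) * (?d / (\<bar>s - s0\<bar> + ?d)\<^sup>2)) \<le> norm (cmod (f s - f s0) * (1 / ?d))"
          by simp
      qed
      show ?thesis by (rule set_integrable_mult_right) (rule i1)
    qed
    have b: "cmod ((f s - f s0) * mirror_kernel \<omega> s) \<le> 2 / c\<^sup>2 * (cmod (f s - f s0) * (?d / (\<bar>s - s0\<bar> + ?d)\<^sup>2))"
      if "s \<in> {0..l}" for s
    proof -
      have "cmod (f s - f s0) * cmod (mirror_kernel \<omega> s) \<le> cmod (f s - f s0) * (2 / c\<^sup>2 * (?d / (\<bar>s - s0\<bar> + ?d)\<^sup>2))"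
        using K[OF that] by (intro mult_left_mono) auto
      also have "\<dots> = 2 / c\<^sup>2 * (cmod (f s - f s0) * (?d / (\<bar>s - s0\<bar> + ?d)\<^sup>2))" by (simp only: mult_ac)
      finally show ?thesis by (simp only: norm_mult)
    qed
    have int: "set_integrable lborel {0..l} (\<lambda>s. (f s - f s0) * mirror_kernel \<omega> s)"
    proof (rule set_integrable_bound[OF i2 m1])
      show "AE s in lborel. s \<in> {0..l} \<longrightarrow> norm ((f s - f s0) * mirror_kernel \<omega> s) \<le> norm (2 / c\<^sup>2 * (cmod (f s - f s0) * (?d / (\<bar>s - s0\<bar> + ?d)\<^sup>2)))"
      proof (rule AE_I2, rule impI)
        fix s assume "s \<in> {0..l}"
        from b[OF this] show "norm ((f s - f s0) * mirror_kernel \<omega> s) \<le> norm (2 / c\<^sup>2 * (cmod (f s - f s0) * (?d / (\<bar>s - s0\<bar> + ?d)\<^sup>2)))"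
          by (rule order_trans) (simp only: real_norm_def abs_ge_self)
      qed
    qed
    have "cmod (LINT s:{0..l}|lborel. (f s - f s0) * mirror_kernel \<omega> s)
        \<le> (LINT s:{0..l}|lborel. cmod ((f s - f s0) * mirror_kernel \<omega> s))"
      by (rule set_integral_norm_bound[OF int])
    also have "\<dots> \<le> (LINT s:{0..l}|lborel. 2 / c\<^sup>2 * (cmod (f s - f s0) * (?d / (\<bar>s - s0\<bar> + ?d)\<^sup>2)))"
      by (rule set_integral_mono[OF set_integrable_norm[OF int] i2 b])
    also have "\<dots> = 2 / c\<^sup>2 * (LINT s:{0..l}|lborel. cmod (f s - f s0) * (?d / (\<bar>s - s0\<bar> + ?d)\<^sup>2))"
      by (rule set_integral_mult_right)
    also have "\<dots> \<le> 2 / c\<^sup>2 * (e * c\<^sup>2 / 2)" using d2(2)[of ?d] w by (intro mult_left_mono) auto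
    also have "\<dots> = e" using cd by simp
    finally have "cmod (LINT s:{0..l}|lborel. (f s - f s0) * mirror_kernel \<omega> s) \<le> e" .
    then show "pt \<omega> \<notin> \<sigma> ` {0..l} \<and> pt (cnj \<omega>) \<notin> \<sigma> ` {0..l} \<and>
      set_integrable lborel {0..l} (\<lambda>s. (f s - f s0) * mirror_kernel \<omega> s) \<and>
      cmod (LINT s:{0..l}|lborel. (f s - f s0) * mirror_kernel \<omega> s) \<le> e" using int off by blast
  qed (use cd d2 in simp)
qed

text \<open>Integrated against \<open>v\<close>, the kernel reports which of the two mirror points
  lies in \<open>G\<close>; integrated against \<open>\<eta>\<close>, it gives the values of
  \<open>deriv \<phi>\<close> at those that do.\<close>

lemma mirror_kernel_integrals:
  assumes w: "pt \<omega> \<notin> \<sigma> ` {0..l}" "pt (cnj \<omega>) \<notin> \<sigma> ` {0..l}"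
  shows "set_integrable lborel {0..l} (mirror_kernel \<omega>)"
    and "(LINT s:{0..l}|lborel. v s * mirror_kernel \<omega> s) =
      2 * pi * \<i> * ((if pt \<omega> \<in> G then 1 else 0) - (if pt (cnj \<omega>) \<in> G then 1 else 0))"
    and "(LINT s:{0..l}|lborel. \<eta> s * mirror_kernel \<omega> s) =
      2 * pi * \<i> * ((if pt \<omega> \<in> G then deriv \<phi> (pt \<omega>) else 0) - (if pt (cnj \<omega>) \<in> G then deriv \<phi> (pt (cnj \<omega>)) else 0))"
    and "set_integrable lborel {0..l} (\<lambda>s. v s * mirror_kernel \<omega> s)"
    and "set_integrable lborel {0..l} (\<lambda>s. \<eta> s * mirror_kernel \<omega> s)"
proof -
  have ck: "continuous_on {0..l} (\<lambda>s. 1 / (\<sigma> s - u))" if "u \<notin> \<sigma> ` {0..l}" for u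
    using that by (intro continuous_intros cont\<sigma>) auto
  have cK: "continuous_on {0..l} (mirror_kernel \<omega>)"
    unfolding mirror_kernel_def by (intro continuous_on_diff ck w)
  show "set_integrable lborel {0..l} (mirror_kernel \<omega>)" by (rule borel_integrable_atLeastAtMost'[OF cK])
  show "set_integrable lborel {0..l} (\<lambda>s. v s * mirror_kernel \<omega> s)" by (rule set_integrable_mult_v[OF cK])
  have iv: "set_integrable lborel {0..l} (\<lambda>s. v s * (1 / (\<sigma> s - u)))" if "u \<notin> \<sigma> ` {0..l}" for u
    by (rule set_integrable_mult_v[OF ck[OF that]])
  have i\<eta>: "set_integrable lborel {0..l} (\<lambda>s. \<eta> s * k s)" if k: "continuous_on {0..l} k" for k :: "real \<Rightarrow> complex"
  proof -
    have "compact (k ` {0..l})" using k by (simp add: compact_continuous_image)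
    then obtain B where B: "\<And>s. s \<in> {0..l} \<Longrightarrow> cmod (k s) \<le> B" by (meson bounded_iff compact_imp_bounded image_eqI)
    have m: "(\<lambda>s. \<eta> s * (indicator {0..l} s *\<^sub>R k s)) \<in> borel_measurable borel"
      using \<eta>_measurable borel_measurable_continuous_on_indicator[OF _ k] by measurable
    have "set_integrable lborel {0..l} (\<lambda>s. \<eta> s * B)"
      using \<eta>_integrable unfolding set_integrable_def by (intro integrable_mult_indicator) auto
    then show ?thesis
    proof (rule set_integrable_bound)
      show "set_borel_measurable lborel {0..l} (\<lambda>s. \<eta> s * k s)" using m by (simp add: set_borel_measurable_def)
      show "AE s in lborel. s \<in> {0..l} \<longrightarrow> norm (\<eta> s * k s) \<le> norm (\<eta> s * B)"
      proof (rule AE_I2, rule impI)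
        fix s assume "s \<in> {0..l}"
        then have "cmod (k s) \<le> \<bar>B\<bar>" using B by fastforce
        then show "norm (\<eta> s * k s) \<le> norm (\<eta> s * B)" by (simp add: norm_mult mult_left_mono)
      qed
    qed
  qed
  show "set_integrable lborel {0..l} (\<lambda>s. \<eta> s * mirror_kernel \<omega> s)" by (rule i\<eta>[OF cK])
  have Wv: "(LINT s:{0..l}|lborel. v s * (1 / (\<sigma> s - u))) = 2 * pi * \<i> * (if u \<in> G then 1 else 0)"
    if "u \<notin> \<sigma> ` {0..l}" for u
    using winding_inside[of u] winding_outside[of u] that clG by auto
  have C\<eta>: "(LINT s:{0..l}|lborel. \<eta> s * (1 / (\<sigma> s - u))) = 2 * pi * \<i> * (if u \<in> G then deriv \<phi> u else 0)"
    if "u \<notin> \<sigma> ` {0..l}" for u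
    using cauchy_transform_inside[of u] cauchy_transform_outside[of u] that clG by auto
  show "(LINT s:{0..l}|lborel. v s * mirror_kernel \<omega> s) =
      2 * pi * \<i> * ((if pt \<omega> \<in> G then 1 else 0) - (if pt (cnj \<omega>) \<in> G then 1 else 0))"
    unfolding mirror_kernel_def right_diff_distrib set_integral_diff(2)[OF iv[OF w(1)] iv[OF w(2)]] Wv[OF w(1)] Wv[OF w(2)] ..
  show "(LINT s:{0..l}|lborel. \<eta> s * mirror_kernel \<omega> s) =
      2 * pi * \<i> * ((if pt \<omega> \<in> G then deriv \<phi> (pt \<omega>) else 0) - (if pt (cnj \<omega>) \<in> G then deriv \<phi> (pt (cnj \<omega>)) else 0))"
    unfolding mirror_kernel_def right_diff_distrib set_integral_diff(2)[OF i\<eta>[OF ck[OF w(1)]] i\<eta>[OF ck[OF w(2)]]] C\<eta>[OF w(1)] C\<eta>[OF w(2)] ..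
qed

text \<open>Up to the factor in front, the kernel is
  \<open>(Im \<omega> / pi) / (A s * B s)\<close>, and with the curve replaced by its tangent this
  is the Poisson kernel of a half plane. Its part over
  \<open>\<bar>s - s0\<bar> \<le> cmod \<omega>\<close> contributes at least
  \<open>k / (9 * pi)\<close>; what lies beyond \<open>r\<close> can subtract at most
  \<open>k / (100 * pi)\<close>.\<close>

lemma mirror_kernel_positive:
  assumes k: "0 < k" "k \<le> 1"
  obtains d where "d > 0" "\<And>\<omega>. 0 < cmod \<omega> \<Longrightarrow> cmod \<omega> < d \<Longrightarrow> k * cmod \<omega> \<le> Im \<omega> \<Longrightarrow>
     k / (10 * pi) \<le> Re (v s0 * (LINT s:{0..l}|lborel. mirror_kernel \<omega> s) / (2 * pi * \<i>))"
proof -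
  obtain c d where cd: "c > 0" "d > 0" and cdist:
    "\<And>\<omega> s. 0 < cmod \<omega> \<Longrightarrow> cmod \<omega> < d \<Longrightarrow> k * cmod \<omega> \<le> \<bar>Im \<omega>\<bar> \<Longrightarrow> s \<in> {0..l} \<Longrightarrow>
      c * (\<bar>s - s0\<bar> + cmod \<omega>) \<le> cmod (\<sigma> s - pt \<omega>)" using curve_dist_sector[OF k] by blast
  \<comment> \<open>With this slope the deviation from the tangent is at most a sixth of the
    distance \<open>cmod A'\<close>, by the bound \<open>k / 3\<close> of
    \<open>sector_dist\<close>.\<close>
  define q where "q = k / 18"
  have q: "q > 0" using k q_def by simp
  obtain r where r: "r > 0" "r \<le> s0" "r \<le> l - s0" "\<And>s. \<bar>s - s0\<bar> < r \<Longrightarrow> cmod (\<sigma> s - z0 - v s0 * (s - s0)) \<le> q * \<bar>s - s0\<bar>"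
    using tangent[OF q] by blast
  \<comment> \<open>The last term makes the far error \<open>E * l\<close> at most
    \<open>k / (100 * pi)\<close>; the bound \<open>r / 2\<close> keeps the interval of radius
    \<open>cmod \<omega>\<close> inside the region controlled by the tangent.\<close>
  define D where "D = min (min d (r/2)) (k * c\<^sup>2 * r\<^sup>2 / (100 * (l + 1)))"
  have D: "D > 0" using cd r k l by (simp add: D_def)
  show ?thesis
  proof (rule that[OF D])
    fix \<omega> assume w: "0 < cmod \<omega>" "cmod \<omega> < D" "k * cmod \<omega> \<le> Im \<omega>"
    let ?d = "cmod \<omega>"
    have wd: "?d < d" "?d < r/2" "?d < k * c\<^sup>2 * r\<^sup>2 / (100 * (l + 1))" using w by (simp_all add: D_def)
    have y0: "Im \<omega> > 0" using w k by (auto intro: less_le_trans[of 0 "k * cmod \<omega>"])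
    have ya: "k * ?d \<le> \<bar>Im \<omega>\<bar>" "k * cmod (cnj \<omega>) \<le> \<bar>Im (cnj \<omega>)\<bar>" using w y0 by auto
    define A where "A s = (\<sigma> s - pt \<omega>) / v s0" for s
    define B where "B s = (\<sigma> s - pt (cnj \<omega>)) / v s0" for s
    have nA: "cmod (A s) = cmod (\<sigma> s - pt \<omega>)" "cmod (B s) = cmod (\<sigma> s - pt (cnj \<omega>))" for s
      using v0 by (simp_all add: A_def B_def norm_divide)
    have cA: "c * (\<bar>s - s0\<bar> + ?d) \<le> cmod (A s)" "c * (\<bar>s - s0\<bar> + ?d) \<le> cmod (B s)" if "s \<in> {0..l}" for s
      using cdist[of \<omega> s] cdist[of "cnj \<omega>" s] w wd ya that by (simp_all add: nA)
    have P: "0 < c * (\<bar>s - s0\<bar> + ?d)" for s using cd w by (intro mult_pos_pos add_nonneg_pos) auto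
    have nz: "A s \<noteq> 0" "B s \<noteq> 0" if "s \<in> {0..l}" for s using cA[OF that] P[of s] by auto
    have form: "v s0 * mirror_kernel \<omega> s / (2 * pi * \<i>) = (Im \<omega> / pi) / (A s * B s)" if s: "s \<in> {0..l}" for s
    proof -
      have "v s0 * mirror_kernel \<omega> s = 1 / A s - 1 / B s"
        using nz[OF s] v0_nz by (simp add: mirror_kernel_def A_def B_def right_diff_distrib)
      also have "\<dots> = (B s - A s) / (A s * B s)" using nz[OF s] by (simp add: field_simps)
      also have "B s - A s = 2 * \<i> * Im \<omega>"
      proof -
        have "B s - A s = \<omega> - cnj \<omega>" using v0_nz by (simp add: A_def B_def pt_def field_simps)
        then show ?thesis by (simp add: complex_eq_iff)
      qed
      finally show ?thesis by (simp add: field_simps)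
    qed
    \<comment> \<open>On the tangent the product is the positive number \<open>cmod A'\<close>
      squared. The perturbed product \<open>T\<close> differs from it by at most half, so
      \<open>Re T\<close> is at least 1/2 and \<open>cmod T\<close> at most 3/2 of it, and
      \<open>Re (1 / T)\<close> is \<open>Re T\<close> over the square of \<open>cmod T\<close>:
      hence 2/9.\<close>
    have near: "2 / 9 / (cmod (of_real (s - s0) - \<omega>))\<^sup>2 \<le> Re (1 / (A s * B s))" if s: "\<bar>s - s0\<bar> < r" for s
    proof -
      define A' where "A' = of_real (s - s0) - \<omega>"
      define B' where "B' = of_real (s - s0) - cnj \<omega>"
      have B': "B' = cnj A'" by (simp add: A'_def B'_def)
      have sd: "k / 3 * (\<bar>s - s0\<bar> + ?d) \<le> cmod A'" unfolding A'_def by (rule sector_dist[OF k ya(1)])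
      have "k / 3 * \<bar>s - s0\<bar> \<le> k / 3 * (\<bar>s - s0\<bar> + ?d)" using k by (intro mult_left_mono) auto
      then have q6: "q * \<bar>s - s0\<bar> \<le> cmod A' / 6" using sd by (simp add: q_def)
      have "A s - A' = (\<sigma> s - z0 - v s0 * (s - s0)) / v s0" "B s - B' = (\<sigma> s - z0 - v s0 * (s - s0)) / v s0"
        using v0_nz by (simp_all add: A_def B_def A'_def B'_def pt_def field_simps)
      then have "cmod (A s - A') \<le> q * \<bar>s - s0\<bar>" "cmod (B s - B') \<le> q * \<bar>s - s0\<bar>"
        using r(4)[OF s] v0 by (simp_all add: norm_divide)
      then have AA: "cmod (A s - A') \<le> cmod A' / 6" "cmod (B s - B') \<le> cmod A' / 6" using q6 by linarith+
      have A'0: "cmod A' > 0"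
      proof -
        have "0 < k / 3 * (\<bar>s - s0\<bar> + ?d)" using k w by (intro mult_pos_pos add_nonneg_pos) auto
        then show ?thesis using sd by linarith
      qed
      have Bn: "cmod (B s) \<le> 7/6 * cmod A'"
        using AA(2) norm_triangle_ineq[of "B s - B'" B'] B' by simp
      have "A s * B s - A' * B' = (A s - A') * B s + A' * (B s - B')" by (simp add: algebra_simps)
      then have "cmod (A s * B s - A' * B') \<le> cmod (A s - A') * cmod (B s) + cmod A' * cmod (B s - B')"
        by (metis norm_mult norm_triangle_ineq)
      also have "\<dots> \<le> cmod A' / 6 * (7/6 * cmod A') + cmod A' * (cmod A' / 6)"
        using AA Bn by (intro add_mono mult_mono) auto
      also have "\<dots> \<le> (cmod A')\<^sup>2 / 2" by (simp add: power2_eq_square)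
      finally have err: "cmod (A s * B s - A' * B') \<le> (cmod A')\<^sup>2 / 2" .
      have AB': "A' * B' = of_real ((cmod A')\<^sup>2)" unfolding B' by (rule complex_norm_square[symmetric])
      define T where "T = A s * B s"
      have e1: "cmod (T - of_real ((cmod A')\<^sup>2)) \<le> (cmod A')\<^sup>2 / 2" using err by (simp add: T_def AB')
      have "\<bar>Re (T - of_real ((cmod A')\<^sup>2))\<bar> \<le> (cmod A')\<^sup>2 / 2" using abs_Re_le_cmod e1 by (rule order_trans)
      then have "\<bar>Re T - (cmod A')\<^sup>2\<bar> \<le> (cmod A')\<^sup>2 / 2" by simp
      then have ReT: "Re T \<ge> (cmod A')\<^sup>2 / 2" unfolding abs_le_iff by linarith
      have "cmod T \<le> 3/2 * (cmod A')\<^sup>2"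
        using e1 norm_triangle_ineq[of "T - of_real ((cmod A')\<^sup>2)" "of_real ((cmod A')\<^sup>2)"] by (simp add: norm_power)
      then have T2: "(cmod T)\<^sup>2 \<le> (3/2 * (cmod A')\<^sup>2)\<^sup>2" by (intro power_mono) auto
      have T0: "T \<noteq> 0" using ReT A'0 by auto
      have "2 / 9 / (cmod A')\<^sup>2 = ((cmod A')\<^sup>2 / 2) / (3/2 * (cmod A')\<^sup>2)\<^sup>2"
        using A'0 by (simp add: field_simps power2_eq_square)
      also have "\<dots> \<le> Re T / (cmod T)\<^sup>2"
        using ReT T2 T0 order_trans[OF _ ReT, of 0] by (intro frac_le) auto
      also have "\<dots> = Re (1 / T)" by (simp add: Re_divide cmod_power2)
      finally show ?thesis by (simp add: T_def A'_def)
    qed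
    have io: "pt \<omega> \<notin> \<sigma> ` {0..l}" "pt (cnj \<omega>) \<notin> \<sigma> ` {0..l}"
    proof -
      have "\<sigma> s \<noteq> pt \<omega>" "\<sigma> s \<noteq> pt (cnj \<omega>)" if "s \<in> {0..l}" for s
        using nz[OF that] by (auto simp: A_def B_def)
      then show "pt \<omega> \<notin> \<sigma> ` {0..l}" "pt (cnj \<omega>) \<notin> \<sigma> ` {0..l}" by (metis imageE)+
    qed
    define g where "g s = Re (v s0 * mirror_kernel \<omega> s / (2 * pi * \<i>))" for s
    have iK: "set_integrable lborel {0..l} (\<lambda>s. v s0 * mirror_kernel \<omega> s / (2 * pi * \<i>))"
      using mirror_kernel_integrals(1)[OF io] by simp
    have ig: "set_integrable lborel {0..l} g"
      using iK unfolding set_integrable_def g_def by (drule_tac integrable_Re) simp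
    have "Re (v s0 * (LINT s:{0..l}|lborel. mirror_kernel \<omega> s) / (2 * pi * \<i>)) = Re (LINT s:{0..l}|lborel. v s0 * mirror_kernel \<omega> s / (2 * pi * \<i>))"
      by simp
    also have "\<dots> = (LINT s:{0..l}|lborel. g s)"
      using iK unfolding set_lebesgue_integral_def set_integrable_def g_def by (subst integral_Re[symmetric]) auto
    finally have eq: "Re (v s0 * (LINT s:{0..l}|lborel. mirror_kernel \<omega> s) / (2 * pi * \<i>)) = (LINT s:{0..l}|lborel. g s)" .
    define E where "E = ?d / (pi * c\<^sup>2 * r\<^sup>2)"
    have E: "0 \<le> E" "E * l \<le> k / (100 * pi)"
    proof -
      show "0 \<le> E" by (simp add: E_def)
      have "?d * (100 * (l + 1)) < k * c\<^sup>2 * r\<^sup>2" using wd(3) l by (simp add: pos_less_divide_eq)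
      moreover have "?d * (100 * (l + 1)) = 100 * (?d * l) + 100 * ?d" by (simp add: algebra_simps)
      ultimately have "100 * (?d * l) \<le> k * c\<^sup>2 * r\<^sup>2" using norm_ge_zero[of \<omega>] by linarith
      then show "E * l \<le> k / (100 * pi)" using cd r by (simp add: E_def field_simps)
    qed
    let ?I = "{s0 - ?d..s0 + ?d}"
    have pw: "k / (18 * pi * ?d) * indicator ?I s - E \<le> g s" if s: "s \<in> {0..l}" for s
    proof -
      have gs: "g s = (Im \<omega> / pi) * Re (1 / (A s * B s))"
      proof -
        have "(Im \<omega> / pi) / (A s * B s) = of_real (Im \<omega> / pi) * (1 / (A s * B s))" by simp
        then show ?thesis unfolding g_def form[OF s] by (simp only: Re_complex_of_real times_complex.sel Im_complex_of_real)
      qed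
      show ?thesis
      proof (cases "\<bar>s - s0\<bar> < r")
        case True
        have pos: "g s \<ge> 0" unfolding gs using near[OF True] y0
          by (intro mult_nonneg_nonneg) (auto intro: order_trans[of 0 "2 / 9 / (cmod (of_real (s - s0) - \<omega>))\<^sup>2"])
        show ?thesis
        proof (cases "s \<in> ?I")
          case sI: True
          have nrm: "cmod (of_real (s - s0) - \<omega>) \<le> 2 * ?d"
            using norm_triangle_ineq4[of "of_real (s - s0)" \<omega>] sI by (auto simp: abs_le_iff norm_of_real simp flip: of_real_diff)
          have n0: "cmod (of_real (s - s0) - \<omega>) > 0" using y0 by (auto simp: complex_eq_iff)
          have "2 / 9 / (2 * ?d)\<^sup>2 \<le> 2 / 9 / (cmod (of_real (s - s0) - \<omega>))\<^sup>2"
            using nrm n0 by (intro divide_left_mono power_mono mult_pos_pos) auto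
          also note near[OF True]
          finally have "1 / (18 * ?d\<^sup>2) \<le> Re (1 / (A s * B s))" by (simp add: power_mult_distrib)
          then have "(k * ?d / pi) * (1 / (18 * ?d\<^sup>2)) \<le> g s"
            unfolding gs using w k y0 by (intro mult_mono divide_right_mono) auto
          moreover have "(k * ?d / pi) * (1 / (18 * ?d\<^sup>2)) = k / (18 * pi * ?d)"
            using w by (simp add: power2_eq_square field_simps)
          ultimately show ?thesis using sI E by simp
        qed (use pos E in simp)
      next
        case False
        have "s \<notin> ?I" using False wd by (auto simp: abs_if split: if_splits)
        have "\<bar>g s\<bar> \<le> E"
        proof -
          have "r \<le> \<bar>s - s0\<bar> + ?d" using False norm_ge_zero[of \<omega>] by linarith
          then have "c * r \<le> c * (\<bar>s - s0\<bar> + ?d)" using cd by (intro mult_left_mono) auto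
          then have cr: "c * r \<le> cmod (A s)" "c * r \<le> cmod (B s)" using cA[OF s] by linarith+
          have "\<bar>Re (1 / (A s * B s))\<bar> \<le> cmod (1 / (A s * B s))" by (rule abs_Re_le_cmod)
          also have "\<dots> = 1 / (cmod (A s) * cmod (B s))" by (simp add: norm_divide norm_mult)
          also have "\<dots> \<le> 1 / ((c * r) * (c * r))"
          proof (rule divide_left_mono)
            show "(c * r) * (c * r) \<le> cmod (A s) * cmod (B s)" using cr cd r by (intro mult_mono) auto
            show "0 < (cmod (A s) * cmod (B s)) * ((c * r) * (c * r))" using nz[OF s] cd r by simp
          qed simp
          finally have "\<bar>Re (1 / (A s * B s))\<bar> \<le> 1 / (c\<^sup>2 * r\<^sup>2)" by (simp add: power2_eq_square mult_ac)
          then have "(Im \<omega> / pi) * \<bar>Re (1 / (A s * B s))\<bar> \<le> (?d / pi) * (1 / (c\<^sup>2 * r\<^sup>2))"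
            using y0 abs_Im_le_cmod[of \<omega>] by (intro mult_mono divide_right_mono) auto
          moreover have "\<bar>g s\<bar> = (Im \<omega> / pi) * \<bar>Re (1 / (A s * B s))\<bar>" unfolding gs abs_mult using y0 by simp
          ultimately show ?thesis by (simp add: E_def mult_ac)
        qed
        then show ?thesis using \<open>s \<notin> ?I\<close> by simp
      qed
    qed
    have Isub: "?I \<subseteq> {0..l}" using wd r by auto
    have eqI: "indicator {0..l} s *\<^sub>R (k / (18 * pi * ?d) * indicator ?I s) = indicator ?I s *\<^sub>R (k / (18 * pi * ?d))" for s
      using Isub by (auto simp: indicator_def)
    have ii: "set_integrable lborel {0..l} (\<lambda>s. k / (18 * pi * ?d) * indicator ?I s)"
      using borel_integrable_atLeastAtMost'[of "s0 - ?d" "s0 + ?d" "\<lambda>_. k / (18 * pi * ?d)"] unfolding set_integrable_def eqI by simp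
    have iE: "set_integrable lborel {0..l} (\<lambda>s. E)" by (rule borel_integrable_atLeastAtMost') simp
    have "k / (9 * pi) - E * l = (LINT s:?I|lborel. k / (18 * pi * ?d)) - (LINT s:{0..l}|lborel. E)"
      using w l by (simp add: set_lebesgue_integral_def field_simps)
    also have "\<dots> = (LINT s:{0..l}|lborel. k / (18 * pi * ?d) * indicator ?I s - E)"
      unfolding set_integral_diff(2)[OF ii iE] unfolding set_lebesgue_integral_def eqI ..
    also have "\<dots> \<le> (LINT s:{0..l}|lborel. g s)"
      by (rule set_integral_mono[OF set_integral_diff(1)[OF ii iE] ig pw])
    finally have "k / (9 * pi) - k / (100 * pi) \<le> (LINT s:{0..l}|lborel. g s)" using E by linarith
    moreover have "k / (10 * pi) \<le> k / (9 * pi) - k / (100 * pi)" using k by (simp add: field_simps)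
    ultimately show "k / (10 * pi) \<le> Re (v s0 * (LINT s:{0..l}|lborel. mirror_kernel \<omega> s) / (2 * pi * \<i>))"
      unfolding eq by linarith
  qed
qed

end

section \<open>Angular limits at Lebesgue points\<close>

context good_boundary_point
begin

text \<open>Replacing \<open>v\<close> by \<open>v s0\<close> in the kernel integral leaves a real
  part of at least \<open>k / (10 * pi) - k / (20 * pi)\<close>. This decides the side: the number
  \<open>x\<close> is a difference of two indicators and is positive. With only one mirror point
  inside \<open>G\<close>, the kernel integral of \<open>\<eta>\<close> then isolates the value of
  \<open>deriv \<phi>\<close>.\<close>

lemma sector_side:
  assumes k: "0 < k" "k \<le> 1" and e: "e > 0"
  obtains d where "d > 0" "\<And>\<omega>. 0 < cmod \<omega> \<Longrightarrow> cmod \<omega> < d \<Longrightarrow> k * cmod \<omega> \<le> Im \<omega> \<Longrightarrow>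
     pt \<omega> \<in> G \<and> pt (cnj \<omega>) \<notin> closure G \<and> cmod (deriv \<phi> (pt \<omega>) - c0) \<le> e"
proof -
  \<comment> \<open>Subtracting \<open>c0 * v\<close> makes the function vanish at
    \<open>s0\<close>, so its kernel integral is small, and that integral is
    \<open>2 * pi * \<i>\<close> times the difference between \<open>deriv \<phi>\<close> and
    \<open>c0\<close>.\<close>
  define f where "f t = \<eta> t - \<eta> s0 / v s0 * v t" for t
  have f: "integrable lborel f" unfolding f_def using \<eta>_integrable v(2) by simp
  have f0: "f s0 = 0" using v0_nz by (simp add: f_def)
  obtain d1 where d1: "d1 > 0" "\<And>\<omega>. 0 < cmod \<omega> \<Longrightarrow> cmod \<omega> < d1 \<Longrightarrow> k * cmod \<omega> \<le> \<bar>Im \<omega>\<bar> \<Longrightarrow>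
      pt \<omega> \<notin> \<sigma> ` {0..l} \<and> pt (cnj \<omega>) \<notin> \<sigma> ` {0..l} \<and>
      set_integrable lborel {0..l} (\<lambda>s. (v s - v s0) * mirror_kernel \<omega> s) \<and>
      cmod (LINT s:{0..l}|lborel. (v s - v s0) * mirror_kernel \<omega> s) \<le> k / 10"
    using mirror_kernel_integral_small[OF k v(2) leb_v, of "k/10"] k by auto
  obtain d2 where d2: "d2 > 0" "\<And>\<omega>. 0 < cmod \<omega> \<Longrightarrow> cmod \<omega> < d2 \<Longrightarrow> k * cmod \<omega> \<le> \<bar>Im \<omega>\<bar> \<Longrightarrow>
      pt \<omega> \<notin> \<sigma> ` {0..l} \<and> pt (cnj \<omega>) \<notin> \<sigma> ` {0..l} \<and>
      set_integrable lborel {0..l} (\<lambda>s. (f s - f s0) * mirror_kernel \<omega> s) \<and>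
      cmod (LINT s:{0..l}|lborel. (f s - f s0) * mirror_kernel \<omega> s) \<le> 2 * pi * e"
    using mirror_kernel_integral_small[OF k f, of "2*pi*e"] leb_\<eta> e unfolding f_def by auto
  obtain d3 where d3: "d3 > 0" "\<And>\<omega>. 0 < cmod \<omega> \<Longrightarrow> cmod \<omega> < d3 \<Longrightarrow> k * cmod \<omega> \<le> Im \<omega> \<Longrightarrow>
     k / (10 * pi) \<le> Re (v s0 * (LINT s:{0..l}|lborel. mirror_kernel \<omega> s) / (2 * pi * \<i>))"
    using mirror_kernel_positive[OF k] by blast
  show ?thesis
  proof (rule that[of "min d1 (min d2 d3)"])
    fix \<omega> assume w: "0 < cmod \<omega>" "cmod \<omega> < min d1 (min d2 d3)" "k * cmod \<omega> \<le> Im \<omega>"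
    have ya: "k * cmod \<omega> \<le> \<bar>Im \<omega>\<bar>" using w by linarith
    have io: "pt \<omega> \<notin> \<sigma> ` {0..l}" "pt (cnj \<omega>) \<notin> \<sigma> ` {0..l}"
      and i1: "set_integrable lborel {0..l} (\<lambda>s. (v s - v s0) * mirror_kernel \<omega> s)"
      and b1: "cmod (LINT s:{0..l}|lborel. (v s - v s0) * mirror_kernel \<omega> s) \<le> k / 10"
      using d1(2)[of \<omega>] w ya by auto
    note K = mirror_kernel_integrals[OF io]
    let ?I = "LINT s:{0..l}|lborel. mirror_kernel \<omega> s"
    let ?E = "LINT s:{0..l}|lborel. (v s - v s0) * mirror_kernel \<omega> s"
    have iv0: "set_integrable lborel {0..l} (\<lambda>s. v s0 * mirror_kernel \<omega> s)" using K(1) by simp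
    define x where "x = (if pt \<omega> \<in> G then 1 else 0) - (if pt (cnj \<omega>) \<in> G then 1 else (0::real))"
    have "(LINT s:{0..l}|lborel. v s * mirror_kernel \<omega> s) = (LINT s:{0..l}|lborel. v s0 * mirror_kernel \<omega> s + (v s - v s0) * mirror_kernel \<omega> s)"
      by (simp add: algebra_simps)
    also have "\<dots> = v s0 * ?I + ?E" unfolding set_integral_add(2)[OF iv0 i1] by simp
    finally have vx: "(LINT s:{0..l}|lborel. v s * mirror_kernel \<omega> s) = v s0 * ?I + ?E" .
    have xc: "(if pt \<omega> \<in> G then 1 else 0) - (if pt (cnj \<omega>) \<in> G then 1 else 0) = complex_of_real x" by (simp add: x_def)
    have "2 * pi * \<i> * of_real x = v s0 * ?I + ?E" using vx unfolding K(2) xc .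
    then have "of_real x = v s0 * ?I / (2 * pi * \<i>) + ?E / (2 * pi * \<i>)" by (simp add: field_simps)
    then have "x = Re (v s0 * ?I / (2 * pi * \<i>)) + Re (?E / (2 * pi * \<i>))" by (metis Re_complex_of_real plus_complex.sel(1))
    moreover have "k / (10 * pi) \<le> Re (v s0 * ?I / (2 * pi * \<i>))" using d3(2)[of \<omega>] w by simp
    moreover have "\<bar>Re (?E / (2 * pi * \<i>))\<bar> \<le> k / (20 * pi)"
    proof -
      have "\<bar>Re (?E / (2 * pi * \<i>))\<bar> \<le> cmod (?E / (2 * pi * \<i>))" by (rule abs_Re_le_cmod)
      also have "\<dots> = cmod ?E / (2 * pi)" by (simp add: norm_divide norm_mult)
      also have "\<dots> \<le> (k/10) / (2 * pi)" using b1 by (intro divide_right_mono) auto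
      finally show ?thesis by simp
    qed
    moreover have "k / (20 * pi) < k / (10 * pi)" using k by (simp add: field_simps)
    ultimately have "x > 0" by linarith
    then have side: "pt \<omega> \<in> G" "pt (cnj \<omega>) \<notin> G" by (auto simp: x_def split: if_splits)
    have ff: "(f s - f s0) * mirror_kernel \<omega> s = \<eta> s * mirror_kernel \<omega> s - c0 * (v s * mirror_kernel \<omega> s)" for s
      unfolding f0 by (simp add: f_def c0_def algebra_simps)
    have ic0: "set_integrable lborel {0..l} (\<lambda>s. c0 * (v s * mirror_kernel \<omega> s))" using K(4) by simp
    have "(LINT s:{0..l}|lborel. (f s - f s0) * mirror_kernel \<omega> s) = 2 * pi * \<i> * (deriv \<phi> (pt \<omega>) - c0)"
      unfolding ff set_integral_diff(2)[OF K(5) ic0] set_integral_mult_right K(2) K(3) using side by (simp add: algebra_simps)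
    moreover have "cmod (LINT s:{0..l}|lborel. (f s - f s0) * mirror_kernel \<omega> s) \<le> 2 * pi * e"
      using d2(2)[of \<omega>] w ya by simp
    ultimately have "2 * pi * cmod (deriv \<phi> (pt \<omega>) - c0) \<le> 2 * pi * e" by (simp add: norm_mult)
    then have "cmod (deriv \<phi> (pt \<omega>) - c0) \<le> e" by simp
    then show "pt \<omega> \<in> G \<and> pt (cnj \<omega>) \<notin> closure G \<and> cmod (deriv \<phi> (pt \<omega>) - c0) \<le> e"
      using side io clG by auto
  qed (use d1 d2 d3 in simp)
qed

lemma frontierG: "frontier G = \<sigma> ` {0..l}"
  using clG GL openG by (auto simp: frontier_def interior_open)

lemma z0_notin: "z0 \<notin> G" using GL s0 by (auto simp: z0_def)

lemma pt_dist: "dist (pt \<omega>) z0 = cmod \<omega>" using v0 by (simp add: pt_def dist_norm norm_mult)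

lemma pt_surj: "\<exists>\<omega>. w = pt \<omega>" using v0_nz by (intro exI[of _ "(w - z0) / v s0"]) (simp add: pt_def)

text \<open>The foot of the perpendicular on the tangent has a curve point nearby, so the distance
  to the curve is at most \<open>k * cmod \<omega> + \<bar>Im \<omega>\<bar>\<close>. The value of
  \<open>k\<close> makes the first term, multiplied by \<open>1 + \<alpha>\<close>, half of
  \<open>cmod \<omega>\<close>, and that half is absorbed.\<close>

lemma approach_region_sector:
  assumes \<alpha>: "\<alpha> > 0"
  defines "k \<equiv> 1 / (2 * (1 + \<alpha>))"
  obtains d where "d > 0" "\<And>\<omega>. pt \<omega> \<in> approach_region G z0 \<alpha> \<Longrightarrow> cmod \<omega> < d \<Longrightarrow> 0 < cmod \<omega> \<and> k * cmod \<omega> \<le> Im \<omega>"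
proof -
  have k: "0 < k" "k \<le> 1" using \<alpha> by (auto simp: k_def)
  obtain r where r: "r > 0" "r \<le> s0" "r \<le> l - s0" "\<And>s. \<bar>s - s0\<bar> < r \<Longrightarrow> cmod (\<sigma> s - z0 - v s0 * (s - s0)) \<le> k * \<bar>s - s0\<bar>"
    using tangent[OF k(1)] by blast
  obtain d where d: "d > 0" "\<And>\<omega>. 0 < cmod \<omega> \<Longrightarrow> cmod \<omega> < d \<Longrightarrow> k * cmod \<omega> \<le> Im \<omega> \<Longrightarrow>
     pt \<omega> \<in> G \<and> pt (cnj \<omega>) \<notin> closure G \<and> cmod (deriv \<phi> (pt \<omega>) - c0) \<le> 1"
    using sector_side[OF k, of 1] by auto
  show ?thesis
  proof (rule that[of "min r d"])
    fix \<omega> assume w: "pt \<omega> \<in> approach_region G z0 \<alpha>" "cmod \<omega> < min r d"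
    have wG: "pt \<omega> \<in> G" and wd: "cmod \<omega> < (1 + \<alpha>) * infdist (pt \<omega>) (\<sigma> ` {0..l})"
      using w(1) by (auto simp: approach_region_def pt_dist frontierG)
    have w0: "0 < cmod \<omega>" using wG z0_notin by (auto simp: pt_def)
    let ?s = "s0 + Re \<omega>"
    have re: "\<bar>Re \<omega>\<bar> < r" using abs_Re_le_cmod[of \<omega>] w(2) by simp
    then have "?s \<in> {0..l}" using r by (auto simp: abs_less_iff)
    then have "infdist (pt \<omega>) (\<sigma> ` {0..l}) \<le> dist (pt \<omega>) (\<sigma> ?s)" by (intro infdist_le) auto
    also have "\<dots> = cmod (\<sigma> ?s - pt \<omega>)" by (simp add: dist_norm norm_minus_commute)
    also have "\<sigma> ?s - pt \<omega> = (\<sigma> ?s - z0 - v s0 * (?s - s0)) - v s0 * (\<i> * Im \<omega>)"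
      by (simp add: pt_def algebra_simps complex_eq_iff)
    also have "cmod \<dots> \<le> cmod (\<sigma> ?s - z0 - v s0 * (?s - s0)) + cmod (v s0 * (\<i> * Im \<omega>))" by (rule norm_triangle_ineq4)
    also have "cmod (v s0 * (\<i> * Im \<omega>)) = \<bar>Im \<omega>\<bar>" using v0 by (simp add: norm_mult)
    also have "cmod (\<sigma> ?s - z0 - v s0 * (?s - s0)) \<le> k * \<bar>Re \<omega>\<bar>" using r(4)[of ?s] re by simp
    also have "k * \<bar>Re \<omega>\<bar> \<le> k * cmod \<omega>" using k abs_Re_le_cmod by (intro mult_left_mono) auto
    finally have inf: "infdist (pt \<omega>) (\<sigma> ` {0..l}) \<le> k * cmod \<omega> + \<bar>Im \<omega>\<bar>" by simp
    have "cmod \<omega> < (1 + \<alpha>) * (k * cmod \<omega> + \<bar>Im \<omega>\<bar>)"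
      using wd mult_left_mono[OF inf, of "1 + \<alpha>"] \<alpha> by linarith
    also have "\<dots> = cmod \<omega> / 2 + (1 + \<alpha>) * \<bar>Im \<omega>\<bar>" using \<alpha> by (simp add: k_def field_simps)
    finally have "cmod \<omega> < 2 * ((1 + \<alpha>) * \<bar>Im \<omega>\<bar>)" by linarith
    then have kI: "k * cmod \<omega> \<le> \<bar>Im \<omega>\<bar>" using \<alpha> by (simp add: k_def field_simps)
    \<comment> \<open>In the lower sector the point would be the mirror image of one in the upper
      sector, hence outside the closure of \<open>G\<close>.\<close>
    have "Im \<omega> > 0"
    proof (rule ccontr)
      assume "\<not> Im \<omega> > 0"
      then have "k * cmod (cnj \<omega>) \<le> Im (cnj \<omega>)" using kI by simp
      then have "pt (cnj (cnj \<omega>)) \<notin> closure G" using d(2)[of "cnj \<omega>"] w w0 by simp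
      then show False using wG closure_subset[of G] by auto
    qed
    then show "0 < cmod \<omega> \<and> k * cmod \<omega> \<le> Im \<omega>" using kI w0 by simp
  qed (use r d in simp)
qed

lemma tendsto_approach_regionI:
  assumes \<alpha>: "\<alpha> > 0"
    and F: "\<And>e k. e > 0 \<Longrightarrow> 0 < k \<Longrightarrow> k \<le> 1 \<Longrightarrow>
      \<exists>d>0. \<forall>\<omega>. 0 < cmod \<omega> \<longrightarrow> cmod \<omega> < d \<longrightarrow> k * cmod \<omega> \<le> Im \<omega> \<longrightarrow> dist (F (pt \<omega>)) c \<le> e"
  shows "(F \<longlongrightarrow> c) (at z0 within approach_region G z0 \<alpha>)"
proof (rule tendstoI)
  fix e :: real assume e: "e > 0"
  define k where "k = 1 / (2 * (1 + \<alpha>))"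
  have k: "0 < k" "k \<le> 1" using \<alpha> by (auto simp: k_def)
  obtain d1 where d1: "d1 > 0" "\<And>\<omega>. pt \<omega> \<in> approach_region G z0 \<alpha> \<Longrightarrow> cmod \<omega> < d1 \<Longrightarrow> 0 < cmod \<omega> \<and> k * cmod \<omega> \<le> Im \<omega>"
    using approach_region_sector[OF \<alpha>] unfolding k_def by blast
  obtain d2 where d2: "d2 > 0" "\<And>\<omega>. 0 < cmod \<omega> \<Longrightarrow> cmod \<omega> < d2 \<Longrightarrow> k * cmod \<omega> \<le> Im \<omega> \<Longrightarrow> dist (F (pt \<omega>)) c \<le> e/2"
    using F[of "e/2" k] e k by auto
  show "eventually (\<lambda>w. dist (F w) c < e) (at z0 within approach_region G z0 \<alpha>)"
    unfolding eventually_at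
  proof (intro exI[of _ "min d1 d2"] conjI ballI impI)
    fix w assume w: "w \<in> approach_region G z0 \<alpha>" "w \<noteq> z0 \<and> dist w z0 < min d1 d2"
    obtain \<omega> where "w = pt \<omega>" using pt_surj by blast
    then have "dist (F w) c \<le> e/2" using d1(2)[of \<omega>] d2(2)[of \<omega>] w by (auto simp: pt_dist)
    then show "dist (F w) c < e" using e by simp
  qed (use d1 d2 in simp)
qed

lemma deriv_nontangential: "\<alpha> > 0 \<Longrightarrow> (deriv \<phi> \<longlongrightarrow> c0) (at z0 within approach_region G z0 \<alpha>)"
proof (rule tendsto_approach_regionI)
  fix e k :: real assume "e > 0" "0 < k" "k \<le> 1"
  then show "\<exists>d>0. \<forall>\<omega>. 0 < cmod \<omega> \<longrightarrow> cmod \<omega> < d \<longrightarrow> k * cmod \<omega> \<le> Im \<omega> \<longrightarrow> dist (deriv \<phi> (pt \<omega>)) c0 \<le> e"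
    using sector_side[of k e] unfolding dist_norm by metis
qed

text \<open>The inner normal shows that the approach region accumulates at \<open>z0\<close>, so
  that limits within it are unique, and it provides a concrete sequence along which boundary values
  are computed. The curve stays at distance at least \<open>3/4 * y\<close>, which is more than the
  half demanded by aperture 1.\<close>

lemma normal_ray:
  obtains d where "d > 0" "\<And>y. 0 < y \<Longrightarrow> y < d \<Longrightarrow> pt (\<i> * of_real y) \<in> approach_region G z0 1"
proof -
  obtain r where r: "r > 0" "r \<le> s0" "r \<le> l - s0" "\<And>s. \<bar>s - s0\<bar> < r \<Longrightarrow> cmod (\<sigma> s - z0 - v s0 * (s - s0)) \<le> (1/4) * \<bar>s - s0\<bar>"
    using tangent[of "1/4"] by auto
  obtain c where c: "c > 0" "\<And>s. s \<in> {0..l} \<Longrightarrow> c * \<bar>s - s0\<bar> \<le> cmod (\<sigma> s - z0)" using chord_arc by blast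
  obtain d where d: "d > 0" "\<And>\<omega>. 0 < cmod \<omega> \<Longrightarrow> cmod \<omega> < d \<Longrightarrow> 1 * cmod \<omega> \<le> Im \<omega> \<Longrightarrow>
     pt \<omega> \<in> G \<and> pt (cnj \<omega>) \<notin> closure G \<and> cmod (deriv \<phi> (pt \<omega>) - c0) \<le> 1"
    using sector_side[of 1 1] by auto
  show ?thesis
  proof (rule that[of "min d (c * r / 2)"])
    fix y assume y: "0 < y" "y < min d (c * r / 2)"
    let ?w = "\<i> * complex_of_real y"
    have nw: "cmod ?w = y" "Im ?w = y" using y by (simp_all add: norm_mult)
    have G: "pt ?w \<in> G" using d(2)[of ?w] nw y by simp
    have lower: "3/4 * y \<le> dist (pt ?w) z" if "z \<in> \<sigma> ` {0..l}" for z
    proof -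
      obtain s where s: "s \<in> {0..l}" "z = \<sigma> s" using \<open>z \<in> \<sigma> ` {0..l}\<close> by blast
      show ?thesis
      proof (cases "\<bar>s - s0\<bar> < r")
        case True
        let ?t = "s - s0"
        have "cmod (of_real ?t - ?w) \<ge> \<bar>?t\<bar>" using abs_Re_le_cmod[of "of_real ?t - ?w"] by simp
        moreover have "cmod (of_real ?t - ?w) \<ge> y" using abs_Im_le_cmod[of "of_real ?t - ?w"] y by simp
        moreover have "cmod (of_real ?t - ?w) = cmod (v s0 * (of_real ?t - ?w))" using v0 by (simp add: norm_mult)
        moreover have "v s0 * (of_real ?t - ?w) = (\<sigma> s - pt ?w) - (\<sigma> s - z0 - v s0 * ?t)"
          by (simp add: pt_def algebra_simps)
        moreover have "cmod ((\<sigma> s - pt ?w) - (\<sigma> s - z0 - v s0 * ?t)) \<le> cmod (\<sigma> s - pt ?w) + cmod (\<sigma> s - z0 - v s0 * ?t)"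
          by (rule norm_triangle_ineq4)
        moreover have "cmod (\<sigma> s - z0 - v s0 * ?t) \<le> (1/4) * \<bar>?t\<bar>" using r(4)[OF True] by simp
        moreover have "3/4 * y \<le> D" if "\<bar>T\<bar> \<le> N" "y \<le> N" "N = M" "M \<le> D + E" "E \<le> (1/4) * \<bar>T\<bar>" for N M D E T :: real
          using that by linarith
        ultimately have "3/4 * y \<le> cmod (\<sigma> s - pt ?w)" by metis
        then show ?thesis using s by (simp add: dist_norm norm_minus_commute)
      next
        case False
        have "c * r \<le> c * \<bar>s - s0\<bar>" using False c by (intro mult_left_mono) auto
        also have "\<dots> \<le> dist z z0" using c(2)[OF s(1)] s by (simp add: dist_norm)
        also have "\<dots> \<le> dist (pt ?w) z + dist (pt ?w) z0" by (rule dist_triangle3)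
        also have "dist (pt ?w) z0 = y" using nw by (simp add: pt_dist)
        finally show ?thesis using y by simp
      qed
    qed
    have "3/4 * y \<le> infdist (pt ?w) (\<sigma> ` {0..l})"
    proof -
      have ne: "\<sigma> ` {0..l} \<noteq> {}" using l by auto
      show ?thesis unfolding infdist_notempty[OF ne] by (rule cINF_greatest[OF ne lower])
    qed
    then have "dist (pt ?w) z0 < (1 + 1) * infdist (pt ?w) (frontier G)" unfolding frontierG pt_dist nw using y by simp
    then show "pt ?w \<in> approach_region G z0 1" using G by (simp add: approach_region_def)
  qed (use d c r in simp)
qed

lemma normal_ray_filterlim: "filterlim (\<lambda>n. pt (\<i> * of_real (1 / (real n + 1)))) (at z0 within approach_region G z0 1) sequentially"
proof -
  obtain d where d: "d > 0" "\<And>y. 0 < y \<Longrightarrow> y < d \<Longrightarrow> pt (\<i> * of_real y) \<in> approach_region G z0 1" using normal_ray by blast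
  have lim: "(\<lambda>n. 1 / (real n + 1)) \<longlonglongrightarrow> 0" by real_asymp
  show ?thesis
    unfolding filterlim_at
  proof
    have "(\<lambda>n. z0 + v s0 * (\<i> * of_real (1 / (real n + 1)))) \<longlonglongrightarrow> z0 + v s0 * (\<i> * of_real 0)"
      by (intro tendsto_intros lim)
    then show "(\<lambda>n. pt (\<i> * of_real (1 / (real n + 1)))) \<longlonglongrightarrow> z0" by (simp add: pt_def)
    have "eventually (\<lambda>n. 1 / (real n + 1) < d) sequentially" using lim d(1) by (rule order_tendstoD)
    then show "eventually (\<lambda>n. pt (\<i> * of_real (1 / (real n + 1))) \<in> approach_region G z0 1 \<and> pt (\<i> * of_real (1 / (real n + 1))) \<noteq> z0) sequentially"
    proof eventually_elim
      fix n assume n: "1 / (real n + 1) < d"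
      have p: "0 < 1 / (real n + 1)" by simp
      have "pt (\<i> * of_real (1 / (real n + 1))) \<in> approach_region G z0 1" by (rule d(2)[OF p n])
      moreover have "pt (\<i> * of_real (1 / (real n + 1))) \<noteq> z0"
        using calculation z0_notin by (auto simp: approach_region_def)
      ultimately show "pt (\<i> * of_real (1 / (real n + 1))) \<in> approach_region G z0 1 \<and> pt (\<i> * of_real (1 / (real n + 1))) \<noteq> z0" by blast
    qed
  qed
qed

lemma approach_nontrivial: "at z0 within approach_region G z0 1 \<noteq> bot"
proof
  assume b: "at z0 within approach_region G z0 1 = bot"
  have "eventually (\<lambda>n. False) sequentially"
    using filterlim_iff[THEN iffD1, OF normal_ray_filterlim, rule_format, of "\<lambda>_. False"] b by simp
  then show False by simp
qed

lemma boundary_value_eqI: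
  assumes "has_nontangential_limit G f z0 c"
  shows "boundary_value G f z0 = c"
  unfolding boundary_value_def
proof (rule the_equality[where P = "has_nontangential_limit G f z0"], rule assms)
  fix c' assume "has_nontangential_limit G f z0 c'"
  then have "(f \<longlongrightarrow> c') (at z0 within approach_region G z0 1)" "(f \<longlongrightarrow> c) (at z0 within approach_region G z0 1)"
    using assms unfolding has_nontangential_limit_def by simp_all
  then show "c' = c" using tendsto_unique[OF approach_nontrivial] by blast
qed

lemma boundary_value_normal_limit:
  assumes "has_nontangential_limit G f z0 c"
  shows "(\<lambda>n. f (pt (\<i> * of_real (1 / (real n + 1))))) \<longlonglongrightarrow> c"
  using assms unfolding has_nontangential_limit_def
  by (intro filterlim_compose[OF _ normal_ray_filterlim]) simp

text \<open>If \<open>c0\<close> is 0, the modulus of \<open>g\<close> is a p-th root that tends to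
  0. Otherwise \<open>deriv \<phi>\<close> stays near \<open>c0\<close> in a sector, where
  \<open>h\<close> is a constant plus the principal logarithm of \<open>deriv \<phi> / c0\<close>,
  and so \<open>h\<close> itself converges.\<close>

lemma branch_nontangential:
  assumes p: "p \<ge> 1" and h: "continuous_on G h"
    and hg: "\<And>z. z \<in> G \<Longrightarrow> exp (h z) = deriv \<phi> z \<and> g z = exp (of_real (1 / real p) * h z)"
  obtains c where "has_nontangential_limit G g z0 c" "c ^ p = c0"
proof -
  have gp: "g z ^ p = deriv \<phi> z" if "z \<in> G" for z
  proof -
    have "g z ^ p = exp (of_nat p * (of_real (1 / real p) * h z))" using hg[OF that] by (simp only: exp_of_nat_mult)
    also have "of_nat p * (of_real (1 / real p) * h z) = h z" using p by simp
    finally show ?thesis using hg[OF that] by simp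
  qed
  have evG: "eventually (\<lambda>z. z \<in> G) (at z0 within approach_region G z0 \<alpha>)" for \<alpha>
    unfolding eventually_at by (rule exI[of _ 1]) (simp add: approach_region_def)
  have power: "c ^ p = c0" if c: "has_nontangential_limit G g z0 c" for c
  proof -
    have "((\<lambda>z. g z ^ p) \<longlongrightarrow> c ^ p) (at z0 within approach_region G z0 1)"
      using c unfolding has_nontangential_limit_def by (intro tendsto_power) simp
    then have "(deriv \<phi> \<longlongrightarrow> c ^ p) (at z0 within approach_region G z0 1)"
      by (rule Lim_transform_eventually) (use evG[of 1] gp in \<open>auto elim: eventually_mono\<close>)
    then show ?thesis using tendsto_unique[OF approach_nontrivial] deriv_nontangential[of 1] by (metis zero_less_one)
  qed
  show ?thesis
  proof (cases "c0 = 0")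
    case True
    have "has_nontangential_limit G g z0 0" unfolding has_nontangential_limit_def
    proof (intro allI impI)
      fix \<alpha> :: real assume "\<alpha> > 0"
      then have "((\<lambda>z. root p (cmod (deriv \<phi> z))) \<longlongrightarrow> root p (cmod 0)) (at z0 within approach_region G z0 \<alpha>)"
        using deriv_nontangential[of \<alpha>] True by (intro tendsto_real_root tendsto_norm) simp
      then have lim: "((\<lambda>z. root p (cmod (deriv \<phi> z))) \<longlongrightarrow> 0) (at z0 within approach_region G z0 \<alpha>)" by simp
      have "((\<lambda>z. cmod (g z)) \<longlongrightarrow> 0) (at z0 within approach_region G z0 \<alpha>)"
      proof (rule Lim_transform_eventually[OF lim])
        show "eventually (\<lambda>z. root p (cmod (deriv \<phi> z)) = cmod (g z)) (at z0 within approach_region G z0 \<alpha>)"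
          using evG
        proof eventually_elim
          fix z assume "z \<in> G"
          then have "cmod (deriv \<phi> z) = cmod (g z) ^ p" using gp[of z] by (metis norm_power)
          then show "root p (cmod (deriv \<phi> z)) = cmod (g z)" using p by (simp add: real_root_power_cancel)
        qed
      qed
      then show "(g \<longlongrightarrow> 0) (at z0 within approach_region G z0 \<alpha>)" by (rule tendsto_norm_zero_cancel)
    qed
    then show ?thesis using that power by blast
  next
    case False
    \<comment> \<open>\<open>U\<close> is convex, so the continuous function \<open>F\<close>, whose
      exponential is constant, is constant on each segment and hence on all of
      \<open>U\<close>.\<close>
    have logk: "\<exists>C. \<forall>e>0. \<exists>d>0. \<forall>\<omega>. 0 < cmod \<omega> \<longrightarrow> cmod \<omega> < d \<longrightarrow> k * cmod \<omega> \<le> Im \<omega> \<longrightarrow> dist (h (pt \<omega>)) C \<le> e"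
      if k: "0 < k" "k \<le> 1" for k
    proof -
      obtain d where d: "d > 0" "\<And>\<omega>. 0 < cmod \<omega> \<Longrightarrow> cmod \<omega> < d \<Longrightarrow> k * cmod \<omega> \<le> Im \<omega> \<Longrightarrow>
         pt \<omega> \<in> G \<and> pt (cnj \<omega>) \<notin> closure G \<and> cmod (deriv \<phi> (pt \<omega>) - c0) \<le> cmod c0 / 2"
        using sector_side[OF k, of "cmod c0 / 2"] False by auto
      define U where "U = {\<omega>. 0 < cmod \<omega> \<and> cmod \<omega> < d \<and> k * cmod \<omega> \<le> Im \<omega>}"
      have Upos: "U = {\<omega>. 0 < Im \<omega>} \<inter> ball 0 d \<inter> {\<omega>. k * cmod \<omega> \<le> Im \<omega>}"
      proof (intro equalityI subsetI)
        fix \<omega> assume "\<omega> \<in> U"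
        then show "\<omega> \<in> {\<omega>. 0 < Im \<omega>} \<inter> ball 0 d \<inter> {\<omega>. k * cmod \<omega> \<le> Im \<omega>}"
          using mult_pos_pos[OF k(1), of "cmod \<omega>"] by (auto simp: U_def)
      qed (auto simp: U_def)
      have conv: "convex U"
      proof -
        have "convex {\<omega>. k * cmod \<omega> \<le> Im \<omega>}"
        proof (rule convexI)
          fix x y :: complex and a b :: real
          assume xy: "x \<in> {\<omega>. k * cmod \<omega> \<le> Im \<omega>}" "y \<in> {\<omega>. k * cmod \<omega> \<le> Im \<omega>}" and ab: "0 \<le> a" "0 \<le> b" "a + b = 1"
          have "k * cmod (a *\<^sub>R x + b *\<^sub>R y) \<le> k * (a * cmod x + b * cmod y)"
            using k norm_triangle_ineq[of "a *\<^sub>R x" "b *\<^sub>R y"] ab by (intro mult_left_mono) auto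
          also have "\<dots> = a * (k * cmod x) + b * (k * cmod y)" by (simp add: algebra_simps)
          also have "\<dots> \<le> a * Im x + b * Im y" using xy ab by (intro add_mono mult_left_mono) auto
          finally show "a *\<^sub>R x + b *\<^sub>R y \<in> {\<omega>. k * cmod \<omega> \<le> Im \<omega>}" by simp
        qed
        then show ?thesis unfolding Upos by (intro convex_Int convex_halfspace_Im_gt convex_ball)
      qed
      define q where "q \<omega> = deriv \<phi> (pt \<omega>) / c0" for \<omega>
      have ptU: "pt \<omega> \<in> G" and qU: "cmod (q \<omega> - 1) \<le> 1/2" if "\<omega> \<in> U" for \<omega>
      proof -
        have "q \<omega> - 1 = (deriv \<phi> (pt \<omega>) - c0) / c0" using False by (simp add: q_def field_simps)
        then have "cmod (q \<omega> - 1) = cmod (deriv \<phi> (pt \<omega>) - c0) / cmod c0" by (simp add: norm_divide)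
        moreover have "cmod (deriv \<phi> (pt \<omega>) - c0) \<le> cmod c0 / 2" using d(2)[of \<omega>] that by (simp add: U_def)
        ultimately have "cmod (q \<omega> - 1) \<le> (cmod c0 / 2) / cmod c0" by (simp add: divide_right_mono)
        then show "cmod (q \<omega> - 1) \<le> 1/2" using False by simp
        show "pt \<omega> \<in> G" using d(2)[of \<omega>] that by (simp add: U_def)
      qed
      have qnp: "q \<omega> \<notin> \<real>\<^sub>\<le>\<^sub>0" "q \<omega> \<noteq> 0" if "\<omega> \<in> U" for \<omega>
      proof -
        have "\<bar>Re (q \<omega> - 1)\<bar> \<le> 1/2" using abs_Re_le_cmod qU[OF that] by (rule order_trans)
        then have "\<bar>Re (q \<omega>) - 1\<bar> \<le> 1/2" by simp
        then have "Re (q \<omega>) > 0" by linarith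
        then show "q \<omega> \<notin> \<real>\<^sub>\<le>\<^sub>0" "q \<omega> \<noteq> 0" by (auto simp: complex_nonpos_Reals_iff)
      qed
      define F where "F \<omega> = h (pt \<omega>) - Ln (q \<omega>)" for \<omega>
      have cpt: "continuous_on U pt" unfolding pt_def by (intro continuous_intros)
      have cd: "continuous_on G (deriv \<phi>)" by (rule holomorphic_on_imp_continuous_on[OF holomorphic_deriv[OF hol\<phi> openG]])
      have "continuous_on U q" unfolding q_def
        using False by (intro continuous_intros continuous_on_compose2[OF cd cpt]) (use ptU in auto)
      then have contF: "continuous_on U F" unfolding F_def
        using qnp(1) ptU by (intro continuous_intros continuous_on_compose2[OF h cpt]) auto
      have expF: "exp (F \<omega>) = c0" if "\<omega> \<in> U" for \<omega>
        using hg[OF ptU[OF that]] qnp(2)[OF that] False by (simp add: F_def exp_diff) (simp add: q_def)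
      have Fc: "F a = F b" if ab: "a \<in> U" "b \<in> U" for a b
      proof -
        have inU: "linepath a b t \<in> U" if "t \<in> {0..1}" for t
          using conv ab that convex_contains_segment[of U] linepath_in_path[of t a b] by auto
        have "(\<lambda>t. F (linepath a b t)) 1 = (\<lambda>t. F (linepath a b t)) 0"
        proof (rule continuous_exp_const_imp_const)
          show "continuous_on {0..1} (\<lambda>t. F (linepath a b t))"
            by (rule continuous_on_compose2[OF contF]) (use inU in auto)
        qed (use expF inU in auto)
        then show ?thesis by (simp add: linepath_def)
      qed
      define \<omega>0 where "\<omega>0 = \<i> * complex_of_real (d / 2)"
      have \<omega>0: "\<omega>0 \<in> U" using d(1) k by (auto simp: U_def \<omega>0_def norm_mult)
      have "\<exists>d'>0. \<forall>\<omega>. 0 < cmod \<omega> \<longrightarrow> cmod \<omega> < d' \<longrightarrow> k * cmod \<omega> \<le> Im \<omega> \<longrightarrow> dist (h (pt \<omega>)) (F \<omega>0) \<le> e" if e: "e > 0" for e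
      proof -
        have "isCont Ln 1" by (rule continuous_at_Ln) simp
        then obtain d1 where d1: "d1 > 0" "\<And>x. dist x 1 < d1 \<Longrightarrow> dist (Ln x) (Ln 1) < e"
          using e unfolding continuous_at_eps_delta by metis
        have "d1 / 2 * cmod c0 > 0" using d1 False by simp
        then obtain d2 where d2: "d2 > 0" "\<And>\<omega>. 0 < cmod \<omega> \<Longrightarrow> cmod \<omega> < d2 \<Longrightarrow> k * cmod \<omega> \<le> Im \<omega> \<Longrightarrow>
           pt \<omega> \<in> G \<and> pt (cnj \<omega>) \<notin> closure G \<and> cmod (deriv \<phi> (pt \<omega>) - c0) \<le> d1 / 2 * cmod c0"
          using sector_side[OF k] by blast
        show ?thesis
        proof (intro exI[of _ "min d d2"] conjI allI impI)
          fix \<omega> assume w: "0 < cmod \<omega>" "cmod \<omega> < min d d2" "k * cmod \<omega> \<le> Im \<omega>"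
          have "q \<omega> - 1 = (deriv \<phi> (pt \<omega>) - c0) / c0" using False by (simp add: q_def field_simps)
          then have "cmod (q \<omega> - 1) = cmod (deriv \<phi> (pt \<omega>) - c0) / cmod c0" by (simp add: norm_divide)
          also have "\<dots> \<le> d1 / 2" using d2(2)[of \<omega>] w False by (simp add: field_simps)
          finally have "dist (q \<omega>) 1 < d1" using d1(1) by (simp add: dist_norm)
          then have "dist (Ln (q \<omega>)) 0 < e" using d1(2)[of "q \<omega>"] by simp
          moreover have "F \<omega> = F \<omega>0" using w by (intro Fc \<omega>0) (auto simp: U_def)
          then have "h (pt \<omega>) = F \<omega>0 + Ln (q \<omega>)" unfolding F_def[of \<omega>] by (simp add: algebra_simps)
          ultimately show "dist (h (pt \<omega>)) (F \<omega>0) \<le> e" by (simp add: dist_norm)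
        qed (use d(1) d2(1) in simp)
      qed
      then show ?thesis by blast
    qed
    obtain C where C: "\<And>e. e > 0 \<Longrightarrow> \<exists>d>0. \<forall>\<omega>. 0 < cmod \<omega> \<longrightarrow> cmod \<omega> < d \<longrightarrow> 1 * cmod \<omega> \<le> Im \<omega> \<longrightarrow> dist (h (pt \<omega>)) C \<le> e"
      using logk[of 1] by auto
    \<comment> \<open>Every sector contains the inner normal, so the limits found in different
      sectors agree.\<close>
    have Ck: "\<exists>d>0. \<forall>\<omega>. 0 < cmod \<omega> \<longrightarrow> cmod \<omega> < d \<longrightarrow> k * cmod \<omega> \<le> Im \<omega> \<longrightarrow> dist (h (pt \<omega>)) C \<le> e"
      if k: "0 < k" "k \<le> 1" and e: "e > 0" for k e
    proof -
      obtain C' where C': "\<And>e. e > 0 \<Longrightarrow> \<exists>d>0. \<forall>\<omega>. 0 < cmod \<omega> \<longrightarrow> cmod \<omega> < d \<longrightarrow> k * cmod \<omega> \<le> Im \<omega> \<longrightarrow> dist (h (pt \<omega>)) C' \<le> e"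
        using logk[OF k] by auto
      have "dist C' C \<le> 0 + e" if e: "e > 0" for e
      proof -
        obtain d1 where d1: "d1 > 0" "\<And>\<omega>. 0 < cmod \<omega> \<Longrightarrow> cmod \<omega> < d1 \<Longrightarrow> 1 * cmod \<omega> \<le> Im \<omega> \<Longrightarrow> dist (h (pt \<omega>)) C \<le> e/2"
          using C[of "e/2"] e by auto
        obtain d2 where d2: "d2 > 0" "\<And>\<omega>. 0 < cmod \<omega> \<Longrightarrow> cmod \<omega> < d2 \<Longrightarrow> k * cmod \<omega> \<le> Im \<omega> \<Longrightarrow> dist (h (pt \<omega>)) C' \<le> e/2"
          using C'[of "e/2"] e by auto
        define \<omega> where "\<omega> = \<i> * complex_of_real (min d1 d2 / 2)"
        have w: "cmod \<omega> = min d1 d2 / 2" "Im \<omega> = min d1 d2 / 2" using d1(1) d2(1) by (auto simp: \<omega>_def norm_mult)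
        have "dist (h (pt \<omega>)) C \<le> e/2" using w d1(1) d2(1) by (intro d1(2)) auto
        moreover have "dist (h (pt \<omega>)) C' \<le> e/2" using w d1(1) d2(1) k mult_left_le_one_le[of "cmod \<omega>" k] by (intro d2(2)) auto
        ultimately show ?thesis using dist_triangle3[of C' C "h (pt \<omega>)"] by linarith
      qed
      then have "dist C' C \<le> 0" by (rule field_le_epsilon)
      then show ?thesis using C'[OF e] by simp
    qed
    have "has_nontangential_limit G g z0 (exp (of_real (1 / real p) * C))" unfolding has_nontangential_limit_def
    proof (intro allI impI)
      fix \<alpha> :: real assume \<alpha>: "\<alpha> > 0"
      have "(h \<longlongrightarrow> C) (at z0 within approach_region G z0 \<alpha>)"
        by (rule tendsto_approach_regionI[OF \<alpha>]) (use Ck in blast)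
      then have "((\<lambda>z. exp (of_real (1 / real p) * h z)) \<longlongrightarrow> exp (of_real (1 / real p) * C)) (at z0 within approach_region G z0 \<alpha>)"
        by (intro tendsto_intros)
      then show "(g \<longlongrightarrow> exp (of_real (1 / real p) * C)) (at z0 within approach_region G z0 \<alpha>)"
        by (rule Lim_transform_eventually) (use evG[of \<alpha>] hg in \<open>auto elim: eventually_mono\<close>)
    qed
    then show ?thesis using that power by blast
  qed
qed

end

section \<open>Inequalities of Hoelder type\<close>

text \<open>Concavity of the logarithm: the tangent bound \<open>ln t \<le> t - 1\<close> at the
  ratios to the weighted mean \<open>M\<close>, summed with the weights, has right-hand side
  0.\<close>

lemma weighted_am_gm3:
  fixes x y z :: real
  assumes nn: "x \<ge> 0" "y \<ge> 0" "z \<ge> 0" and p: "p = 1 + k + j"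
  shows "x * y ^ k * z ^ j \<le> (x ^ p + k * y ^ p + j * z ^ p) / p"
proof -
  have pos: "x * y ^ k * z ^ j \<le> (x ^ p + k * y ^ p + j * z ^ p) / p" if xyz: "x > 0" "y > 0" "z > 0" for x y z :: real
  proof -
    define M where "M = (x ^ p + k * y ^ p + j * z ^ p) / p"
    have s: "x ^ p + k * y ^ p + j * z ^ p > 0" using xyz by (intro add_pos_nonneg) auto
    have M: "M > 0" using s p by (simp add: M_def)
    have l: "ln t - ln M \<le> t / M - 1" if "t > 0" for t
      using ln_le_minus_one[of "t / M"] that M by (simp add: ln_div)
    have "(ln (x ^ p) - ln M) + k * (ln (y ^ p) - ln M) + j * (ln (z ^ p) - ln M)
       \<le> (x ^ p / M - 1) + k * (y ^ p / M - 1) + j * (z ^ p / M - 1)"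
      using l[of "x ^ p"] l[of "y ^ p"] l[of "z ^ p"] xyz by (intro add_mono mult_left_mono) auto
    also have "\<dots> = (x ^ p + k * y ^ p + j * z ^ p) / M - p" using M p by (simp add: field_simps)
    also have "\<dots> = 0" using s p by (simp add: M_def)
    finally have "(p * ln x - ln M) + k * (p * ln y - ln M) + j * (p * ln z - ln M) \<le> 0"
      using xyz by (simp add: ln_realpow)
    moreover have id: "(P * a - L) + k * (P * b - L) + j * (P * c - L) = P * (a + k * b + j * c) - (1 + k + j) * L"
      for P a b c L :: real by (simp add: algebra_simps)
    ultimately have "p * (ln x + k * ln y + j * ln z) - (1 + real k + real j) * ln M \<le> 0" unfolding id by (simp add: add.assoc)
    moreover have "1 + real k + real j = real p" using p by simp
    ultimately have "p * (ln x + k * ln y + j * ln z) \<le> p * ln M" by (simp only: diff_le_0_iff_le)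
    then have "ln x + k * ln y + j * ln z \<le> ln M" using p by simp
    then have "ln (x * y ^ k * z ^ j) \<le> ln M" using xyz by (simp add: ln_mult_pos ln_realpow)
    then show ?thesis using M xyz unfolding M_def[symmetric] by simp
  qed
  \<comment> \<open>With exponent 0 a vanishing factor does not make the product vanish, since
    \<open>0 ^ 0 = 1\<close>; such a factor is replaced by 1.\<close>
  define y' where "y' = (if k = 0 then 1 else y)"
  define z' where "z' = (if j = 0 then 1 else z)"
  have eq: "y' ^ k = y ^ k" "z' ^ j = z ^ j" "k * y' ^ p = k * y ^ p" "j * z' ^ p = j * z ^ p"
    by (auto simp: y'_def z'_def)
  show ?thesis
  proof (cases "x = 0 \<or> y' = 0 \<or> z' = 0")
    case True
    then have "x * y ^ k * z ^ j = 0" by (auto simp: y'_def z'_def split: if_splits)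
    moreover have "0 \<le> (x ^ p + k * y ^ p + j * z ^ p) / p"
      using nn by (intro divide_nonneg_nonneg add_nonneg_nonneg) auto
    ultimately show ?thesis by linarith
  next
    case False
    moreover have "y' \<ge> 0" "z' \<ge> 0" using nn by (simp_all add: y'_def z'_def)
    ultimately have "x > 0" "y' > 0" "z' > 0" using nn(1) by (simp_all add: less_le)
    from pos[OF this] show ?thesis unfolding eq .
  qed
qed

text \<open>The pointwise inequality is integrated after dividing by the norms. The norms are first
  enlarged by \<open>e > 0\<close>, so that none is 0, and \<open>e\<close> tends to 0 at the
  end.\<close>

lemma holder3:
  fixes x y z :: "'a \<Rightarrow> real"
  assumes m: "x \<in> borel_measurable M" "y \<in> borel_measurable M" "z \<in> borel_measurable M"
    and nn: "\<And>s. x s \<ge> 0" "\<And>s. y s \<ge> 0" "\<And>s. z s \<ge> 0" and p: "p = 1 + k + j"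
    and int: "integrable M (\<lambda>s. x s ^ p)" "integrable M (\<lambda>s. y s ^ p)" "integrable M (\<lambda>s. z s ^ p)"
  shows "integrable M (\<lambda>s. x s * y s ^ k * z s ^ j)"
    and "(LINT s|M. x s * y s ^ k * z s ^ j) \<le>
       (LINT s|M. x s ^ p) powr (1/p) * ((LINT s|M. y s ^ p) powr (1/p)) ^ k * ((LINT s|M. z s ^ p) powr (1/p)) ^ j"
proof -
  have pp: "real p > 0" "p > 0" using p by auto
  show i: "integrable M (\<lambda>s. x s * y s ^ k * z s ^ j)"
  proof (rule Bochner_Integration.integrable_bound)
    show "integrable M (\<lambda>s. (x s ^ p + k * y s ^ p + j * z s ^ p) / p)" using int by simp
    show "(\<lambda>s. x s * y s ^ k * z s ^ j) \<in> borel_measurable M" using m by measurable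
    show "AE s in M. norm (x s * y s ^ k * z s ^ j) \<le> norm ((x s ^ p + k * y s ^ p + j * z s ^ p) / p)"
      using weighted_am_gm3[OF nn p] nn by (intro AE_I2) (auto simp: abs_mult power_abs intro: order_trans)
  qed
  let ?X = "(LINT s|M. x s ^ p) powr (1/p)" and ?Y = "(LINT s|M. y s ^ p) powr (1/p)" and ?Z = "(LINT s|M. z s ^ p) powr (1/p)"
  have pw: "(LINT s|M. u s ^ p) \<le> (((LINT s|M. u s ^ p) powr (1/p)) + e) ^ p"
    if "\<And>s. u s \<ge> 0" "e > 0" for u :: "'a \<Rightarrow> real" and e
  proof -
    have n: "(LINT s|M. u s ^ p) \<ge> 0" using that by (intro integral_nonneg_AE) auto
    then have "(LINT s|M. u s ^ p) = ((LINT s|M. u s ^ p) powr (1/p)) ^ p"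
      using pp by (cases "(LINT s|M. u s ^ p) = 0") (auto simp: powr_powr simp flip: powr_realpow)
    also have "\<dots> \<le> (((LINT s|M. u s ^ p) powr (1/p)) + e) ^ p" using that by (intro power_mono) auto
    finally show ?thesis .
  qed
  have bound: "(LINT s|M. x s * y s ^ k * z s ^ j) \<le> (?X + e) * (?Y + e) ^ k * (?Z + e) ^ j" if e: "e > 0" for e
  proof -
    define X Y Z where "X = ?X + e" "Y = ?Y + e" "Z = ?Z + e"
    have pos: "X > 0" "Y > 0" "Z > 0" using e by (auto simp: X_Y_Z_def intro: add_nonneg_pos)
    have le: "(LINT s|M. x s ^ p) \<le> X ^ p" "(LINT s|M. y s ^ p) \<le> Y ^ p" "(LINT s|M. z s ^ p) \<le> Z ^ p"
      unfolding X_Y_Z_def by (intro pw nn e)+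
    have pt: "x s * y s ^ k * z s ^ j \<le> (X * Y ^ k * Z ^ j) * ((x s ^ p / X ^ p + k * (y s ^ p / Y ^ p) + j * (z s ^ p / Z ^ p)) / p)" for s
    proof -
      have "(x s / X) * (y s / Y) ^ k * (z s / Z) ^ j \<le> ((x s / X) ^ p + k * (y s / Y) ^ p + j * (z s / Z) ^ p) / p"
        using nn[of s] pos by (intro weighted_am_gm3 p) auto
      then have "(X * Y ^ k * Z ^ j) * ((x s / X) * (y s / Y) ^ k * (z s / Z) ^ j) \<le> (X * Y ^ k * Z ^ j) * (((x s / X) ^ p + k * (y s / Y) ^ p + j * (z s / Z) ^ p) / p)"
        using pos by (intro mult_left_mono) auto
      moreover have "(X * Y ^ k * Z ^ j) * ((x s / X) * (y s / Y) ^ k * (z s / Z) ^ j) = x s * y s ^ k * z s ^ j"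
        using pos by (simp add: power_divide)
      ultimately show ?thesis by (simp add: power_divide)
    qed
    have int2: "integrable M (\<lambda>s. (x s ^ p / X ^ p + k * (y s ^ p / Y ^ p) + j * (z s ^ p / Z ^ p)) / p)"
      using int by simp
    have "(LINT s|M. x s * y s ^ k * z s ^ j) \<le> (LINT s|M. (X * Y ^ k * Z ^ j) * ((x s ^ p / X ^ p + k * (y s ^ p / Y ^ p) + j * (z s ^ p / Z ^ p)) / p))"
      by (rule integral_mono[OF i integrable_mult_right[OF int2] pt])
    also have "\<dots> = (X * Y ^ k * Z ^ j) * (((LINT s|M. x s ^ p) / X ^ p + k * ((LINT s|M. y s ^ p) / Y ^ p) + j * ((LINT s|M. z s ^ p) / Z ^ p)) / p)"
      using int by simp
    also have "\<dots> \<le> (X * Y ^ k * Z ^ j) * ((1 + real k * 1 + real j * 1) / p)"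
    proof -
      have d: "(LINT s|M. x s ^ p) / X ^ p \<le> 1" "(LINT s|M. y s ^ p) / Y ^ p \<le> 1" "(LINT s|M. z s ^ p) / Z ^ p \<le> 1"
        using le pos by (simp_all add: pos_divide_le_eq)
      have "(LINT s|M. x s ^ p) / X ^ p + k * ((LINT s|M. y s ^ p) / Y ^ p) + j * ((LINT s|M. z s ^ p) / Z ^ p) \<le> 1 + real k * 1 + real j * 1"
        by (rule add_mono[OF add_mono[OF d(1) mult_left_mono[OF d(2)]] mult_left_mono[OF d(3)]]) auto
      then show ?thesis by (rule mult_left_mono[OF divide_right_mono]) (use pos in auto)
    qed
    also have "\<dots> = X * Y ^ k * Z ^ j"
    proof -
      have "1 + real k * 1 + real j * 1 = real p" using p by simp
      then show ?thesis using pp by simp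
    qed
    finally show ?thesis by (simp add: X_Y_Z_def)
  qed
  have "(\<lambda>n. (?X + 1 / (real n + 1)) * (?Y + 1 / (real n + 1)) ^ k * (?Z + 1 / (real n + 1)) ^ j) \<longlonglongrightarrow> (?X + 0) * (?Y + 0) ^ k * (?Z + 0) ^ j"
  proof -
    have "(\<lambda>n. 1 / (real n + 1)) \<longlonglongrightarrow> 0" by real_asymp
    then show ?thesis by (intro tendsto_intros)
  qed
  then have "(LINT s|M. x s * y s ^ k * z s ^ j) \<le> (?X + 0) * (?Y + 0) ^ k * (?Z + 0) ^ j"
    by (rule LIMSEQ_le_const) (auto intro!: exI[of _ 0] bound)
  then show "(LINT s|M. x s * y s ^ k * z s ^ j) \<le> ?X * ?Y ^ k * ?Z ^ j" by simp
qed

text \<open>Expanding \<open>(y s + z s) ^ (p - 1)\<close> binomially, applying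
  \<open>holder3\<close> to each term and summing again performs Hoelder's and Minkowski's steps at
  once; no conjugate exponent appears, so \<open>p = 1\<close> is no exception.\<close>

lemma holder_add_power:
  fixes x y z :: "'a \<Rightarrow> real"
  assumes m: "x \<in> borel_measurable M" "y \<in> borel_measurable M" "z \<in> borel_measurable M"
    and nn: "\<And>s. x s \<ge> 0" "\<And>s. y s \<ge> 0" "\<And>s. z s \<ge> 0" and p: "p \<ge> 1"
    and int: "integrable M (\<lambda>s. x s ^ p)" "integrable M (\<lambda>s. y s ^ p)" "integrable M (\<lambda>s. z s ^ p)"
  shows "integrable M (\<lambda>s. x s * (y s + z s) ^ (p - 1))"
    and "(LINT s|M. x s * (y s + z s) ^ (p - 1)) \<le>
       (LINT s|M. x s ^ p) powr (1/p) * ((LINT s|M. y s ^ p) powr (1/p) + (LINT s|M. z s ^ p) powr (1/p)) ^ (p - 1)"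
proof -
  have eq: "x s * (y s + z s) ^ (p - 1) = (\<Sum>k\<le>p-1. of_nat ((p - 1) choose k) * (x s * y s ^ k * z s ^ (p - 1 - k)))" for s
    by (simp add: binomial_ring sum_distrib_left mult_ac)
  have pk: "p = 1 + k + (p - 1 - k)" if "k \<le> p - 1" for k using that p by simp
  note h = holder3[OF m nn pk int]
  have ik: "integrable M (\<lambda>s. of_nat ((p - 1) choose k) * (x s * y s ^ k * z s ^ (p - 1 - k)))" if "k \<in> {..p-1}" for k
    using h(1)[of k] that by simp
  show "integrable M (\<lambda>s. x s * (y s + z s) ^ (p - 1))" unfolding eq
    by (rule Bochner_Integration.integrable_sum) (rule ik)
  let ?X = "(LINT s|M. x s ^ p) powr (1/p)" and ?Y = "(LINT s|M. y s ^ p) powr (1/p)" and ?Z = "(LINT s|M. z s ^ p) powr (1/p)"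
  have "(LINT s|M. x s * (y s + z s) ^ (p - 1)) = (\<Sum>k\<le>p-1. (LINT s|M. of_nat ((p - 1) choose k) * (x s * y s ^ k * z s ^ (p - 1 - k))))"
    unfolding eq by (rule Bochner_Integration.integral_sum) (rule ik)
  also have "\<dots> = (\<Sum>k\<le>p-1. of_nat ((p - 1) choose k) * (LINT s|M. x s * y s ^ k * z s ^ (p - 1 - k)))" by simp
  also have "\<dots> \<le> (\<Sum>k\<le>p-1. of_nat ((p - 1) choose k) * (?X * ?Y ^ k * ?Z ^ (p - 1 - k)))"
    using h(2) by (intro sum_mono mult_left_mono) auto
  also have "\<dots> = ?X * (?Y + ?Z) ^ (p - 1)" by (simp add: binomial_ring sum_distrib_left mult_ac)
  finally show "(LINT s|M. x s * (y s + z s) ^ (p - 1)) \<le> ?X * (?Y + ?Z) ^ (p - 1)" .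
qed

lemma AE_eq_imp_lebesgue_measurable:
  fixes f g :: "real \<Rightarrow> real"
  assumes g: "g \<in> borel_measurable borel" and eq: "AE x in lborel. f x = g x"
  shows "f \<in> borel_measurable lebesgue"
proof -
  obtain N where N: "N \<in> null_sets lborel" "{x. f x \<noteq> g x} \<subseteq> N"
    using eq by (auto simp: eventually_ae_filter)
  show ?thesis
  proof (rule measurableI)
    fix A :: "real set" assume A: "A \<in> sets borel"
    have eq': "f -` A = (g -` A - N) \<union> (f -` A \<inter> N)" using N by auto
    have 1: "g -` A - N \<in> sets lebesgue"
      using measurable_sets[OF g A] N by (intro sets_completionI_sets) (auto intro: sets.Diff)
    have 2: "f -` A \<inter> N \<in> sets lebesgue" by (rule sets_completionI_sub[OF N(1)]) auto
    have "f -` A \<in> sets lebesgue" by (subst eq') (rule sets.Un[OF 1 2])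
    then show "f -` A \<inter> space lebesgue \<in> sets lebesgue" by simp
  qed simp
qed

text \<open>Boundary values are defined point by point and come without measurability. Completeness
  of Lebesgue measure supplies it from equality almost everywhere with a Borel function.\<close>

lemma integral_lebesgue_on_AE_eq:
  fixes F f :: "real \<Rightarrow> real"
  assumes f: "set_borel_measurable borel {a..b} f" and eq: "AE s in lborel. s \<in> {a..b} \<longrightarrow> F s = f s"
  shows "integral\<^sup>L (lebesgue_on {a..b}) F = (LINT s:{a..b}|lborel. f s)"
proof -
  let ?F = "\<lambda>s. indicator {a..b} s *\<^sub>R F s" and ?f = "\<lambda>s. indicator {a..b} s *\<^sub>R f s"
  have f': "?f \<in> borel_measurable borel" using f by (simp add: set_borel_measurable_def)
  have eq': "AE s in lborel. ?F s = ?f s" using eq by eventually_elim (auto simp: indicator_def)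
  have F': "?F \<in> borel_measurable lebesgue" by (rule AE_eq_imp_lebesgue_measurable[OF f' eq'])
  have "integral\<^sup>L (lebesgue_on {a..b}) F = integral\<^sup>L lebesgue ?F"
    by (rule integral_restrict_space) auto
  also have "\<dots> = integral\<^sup>L lebesgue ?f"
    using F' f' eq' by (intro integral_cong_AE) (auto intro: measurable_completion AE_completion)
  also have "\<dots> = (LINT s:{a..b}|lborel. f s)"
    unfolding set_lebesgue_integral_def using f' by (intro integral_completion) simp
  finally show ?thesis .
qed

section \<open>The primitives of powers of polynomials\<close>

lemma J_poly_facts:
  shows "(J_poly p \<zeta> P has_field_derivative poly P z ^ p) (at z)" and "J_poly p \<zeta> P \<zeta> = 0"
proof -
  have "(\<lambda>z. poly P z ^ p) holomorphic_on UNIV" by (intro holomorphic_intros)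
  then obtain A where A: "\<And>z. (A has_field_derivative poly P z ^ p) (at z)"
    using holomorphic_convex_primitive'[of UNIV "\<lambda>z. poly P z ^ p"] by auto
  have J: "J_poly p \<zeta> P z = A z - A \<zeta>" for z
    unfolding J_poly_def
    using contour_integral_primitive[of UNIV A "\<lambda>z. poly P z ^ p" "linepath \<zeta> z"] A
    by (intro contour_integral_unique) auto
  show "J_poly p \<zeta> P \<zeta> = 0" unfolding J by simp
  have "((\<lambda>z. A z - A \<zeta>) has_field_derivative poly P z ^ p) (at z)" using A by (auto intro!: derivative_eq_intros)
  then show "(J_poly p \<zeta> P has_field_derivative poly P z ^ p) (at z)" using J by presburger
qed

lemma J_poly_holomorphic: "J_poly p \<zeta> P holomorphic_on S"
  unfolding holomorphic_on_def field_differentiable_def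
  using J_poly_facts(1) has_field_derivative_at_within by blast

text \<open>These are the second order errors that \<open>quadratic_increment_imp_const\<close>
  needs, with one constant for a disk containing the curve.\<close>

lemma J_poly_estimates:
  obtains C where "C > 0" "\<And>z w. cmod z \<le> B \<Longrightarrow> cmod w \<le> B \<Longrightarrow> cmod (poly P w ^ p - poly P z ^ p) \<le> C * cmod (w - z)"
    "\<And>z w. cmod z \<le> B \<Longrightarrow> cmod w \<le> B \<Longrightarrow>
       cmod (J_poly p \<zeta> P w - J_poly p \<zeta> P z - poly P z ^ p * (w - z)) \<le> C * (cmod (w - z))\<^sup>2"
proof -
  let ?q' = "\<lambda>z. poly (pderiv (P ^ p)) z"
  have dq: "((\<lambda>z. poly P z ^ p) has_field_derivative ?q' z) (at z within S)" for z S
    using has_field_derivative_at_within[OF poly_DERIV[of "P ^ p" z]] by (simp add: poly_power)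
  have "compact (?q' ` cball 0 B)" by (intro compact_continuous_image continuous_intros) auto
  then obtain C0 where "\<forall>z\<in>cball 0 B. cmod (?q' z) \<le> C0"
    using compact_imp_bounded[of "?q' ` cball 0 B"] unfolding bounded_iff by auto
  then have C0: "cmod (?q' z) \<le> C0" if "cmod z \<le> B" for z using that by simp
  define C where "C = max C0 1"
  have C: "C > 0" "\<And>z. cmod z \<le> B \<Longrightarrow> cmod (?q' z) \<le> C" using C0 by (force simp: C_def)+
  have lip: "cmod (poly P w ^ p - poly P z ^ p) \<le> C * cmod (w - z)" if "cmod z \<le> B" "cmod w \<le> B" for z w
    by (rule field_differentiable_bound[OF convex_cball[of 0 B] dq]) (use C that in auto)
  have "cmod (J_poly p \<zeta> P w - J_poly p \<zeta> P z - poly P z ^ p * (w - z)) \<le> C * (cmod (w - z))\<^sup>2"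
    if zw: "cmod z \<le> B" "cmod w \<le> B" for z w
  proof -
    let ?S = "closed_segment z w"
    have sub: "cmod x \<le> B \<and> cmod (x - z) \<le> cmod (w - z)" if "x \<in> ?S" for x
    proof -
      have "closed_segment z w \<subseteq> cball 0 B" using zw by (intro closed_segment_subset) auto
      then show ?thesis using that segment_bound1[OF that] by auto
    qed
    have "cmod ((J_poly p \<zeta> P w - poly P z ^ p * w) - (J_poly p \<zeta> P z - poly P z ^ p * z)) \<le> (C * cmod (w - z)) * cmod (w - z)"
    proof (rule field_differentiable_bound[of ?S])
      show "((\<lambda>x. J_poly p \<zeta> P x - poly P z ^ p * x) has_field_derivative poly P x ^ p - poly P z ^ p) (at x within ?S)" for x
        using has_field_derivative_at_within[OF J_poly_facts(1)[of p \<zeta> P x]]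
        by (auto intro!: derivative_eq_intros)
      show "cmod (poly P x ^ p - poly P z ^ p) \<le> C * cmod (w - z)" if "x \<in> ?S" for x
        using lip[of z x] sub[OF that] zw mult_left_mono[of "cmod (x - z)" "cmod (w - z)" C] C(1) by linarith
    qed auto
    then show ?thesis by (simp add: algebra_simps power2_eq_square)
  qed
  then show ?thesis using that C(1) lip by blast
qed

section \<open>The uniform estimate\<close>

lemma power_add_le_two:
  fixes y z :: real
  assumes "y \<ge> 0" "z \<ge> 0"
  shows "(y + z) ^ p \<le> 2 ^ p * (y ^ p + z ^ p)"
proof -
  have "(y + z) ^ p \<le> (2 * max y z) ^ p" using assms by (intro power_mono) auto
  also have "\<dots> = 2 ^ p * (max y z) ^ p" by (rule power_mult_distrib)
  also have "(max y z) ^ p \<le> y ^ p + z ^ p" using assms by (auto simp: max_def)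
  finally show ?thesis by simp
qed

text \<open>The binomial coefficients are at least 1, so the sum from factoring the difference is at
  most the expansion of \<open>(cmod a + cmod b) ^ (p - 1)\<close>. This is where the power of a sum
  in the final constant comes from.\<close>

lemma norm_power_diff_le:
  fixes a b :: complex
  assumes p: "p \<ge> 1"
  shows "cmod (a ^ p - b ^ p) \<le> cmod (a - b) * (cmod a + cmod b) ^ (p - 1)"
proof -
  have "a ^ p - b ^ p = (a - b) * (\<Sum>i<p. b ^ (p - Suc i) * a ^ i)" by (rule power_diff_sumr2)
  then have "cmod (a ^ p - b ^ p) = cmod (a - b) * cmod (\<Sum>i<p. b ^ (p - Suc i) * a ^ i)" by (simp add: norm_mult)
  also have "cmod (\<Sum>i<p. b ^ (p - Suc i) * a ^ i) \<le> (\<Sum>i<p. cmod b ^ (p - Suc i) * cmod a ^ i)"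
    by (rule order_trans[OF norm_sum]) (simp add: norm_mult norm_power)
  also have "\<dots> \<le> (\<Sum>i<p. of_nat ((p - 1) choose i) * (cmod a ^ i * cmod b ^ (p - 1 - i)))"
  proof (rule sum_mono)
    fix i assume "i \<in> {..<p}"
    then have "(p - 1) choose i > 0" by (intro zero_less_binomial) auto
    then have "1 \<le> real ((p - 1) choose i)" by linarith
    then have "1 * (cmod a ^ i * cmod b ^ (p - 1 - i)) \<le> of_nat ((p - 1) choose i) * (cmod a ^ i * cmod b ^ (p - 1 - i))"
      by (intro mult_right_mono) auto
    then show "cmod b ^ (p - Suc i) * cmod a ^ i \<le> of_nat ((p - 1) choose i) * (cmod a ^ i * cmod b ^ (p - 1 - i))"
      by (simp add: mult.commute)
  qed
  also have "\<dots> = (cmod a + cmod b) ^ (p - 1)"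
  proof -
    have "{..<p} = {..p-1}" using p by auto
    then show ?thesis by (simp add: binomial_ring mult.assoc)
  qed
  finally show ?thesis by (simp add: mult_left_mono)
qed

section \<open>Boundary values and increments along the curve\<close>

context jordan_disk_density
begin

text \<open>The quotient \<open>\<eta> s / v s\<close> depends on the point, so the differentiation
  theorem is not applied to the combined function. A common Lebesgue point of \<open>v\<close> and
  \<open>\<eta>\<close> is one for every linear combination.\<close>

lemma good_points_AE: "AE s in lborel. s \<in> {0..l} \<longrightarrow> good_boundary_point \<sigma> l R G \<phi> \<psi> \<tau> \<rho> v s"
  using lebesgue_points_AE[OF v(2)] lebesgue_points_AE[OF \<eta>_integrable] v_norm AE_lborel_singleton[of 0] AE_lborel_singleton[of l]
proof eventually_elim
  fix s
  assume lv: "\<forall>e>0. \<exists>d>0. \<forall>r. 0 < r \<and> r < d \<longrightarrow> (LINT t:{s-r..s+r}|lborel. cmod (v t - v s)) \<le> e * r"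
    and l\<eta>: "\<forall>e>0. \<exists>d>0. \<forall>r. 0 < r \<and> r < d \<longrightarrow> (LINT t:{s-r..s+r}|lborel. cmod (\<eta> t - \<eta> s)) \<le> e * r"
    and n: "s \<in> {0..l} \<longrightarrow> cmod (v s) = 1" and "s \<noteq> 0" "s \<noteq> l"
  show "s \<in> {0..l} \<longrightarrow> good_boundary_point \<sigma> l R G \<phi> \<psi> \<tau> \<rho> v s"
  proof
    assume s: "s \<in> {0..l}"
    define c where "c = \<eta> s / v s"
    have "\<forall>e>0. \<exists>d>0. \<forall>r. 0 < r \<and> r < d \<longrightarrow>
        (LINT t:{s-r..s+r}|lborel. cmod ((\<eta> t - c * v t) - (\<eta> s - c * v s))) \<le> e * r"
    proof (intro allI impI)
      fix e :: real assume e: "e > 0"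
      have e2: "e / (2 * (cmod c + 1)) > 0" using e by (intro divide_pos_pos mult_pos_pos add_nonneg_pos) auto
      obtain d1 where d1: "d1 > 0" "\<And>r. 0 < r \<Longrightarrow> r < d1 \<Longrightarrow> (LINT t:{s-r..s+r}|lborel. cmod (v t - v s)) \<le> (e / (2 * (cmod c + 1))) * r"
        using lv[rule_format, OF e2] by blast
      obtain d2 where d2: "d2 > 0" "\<And>r. 0 < r \<Longrightarrow> r < d2 \<Longrightarrow> (LINT t:{s-r..s+r}|lborel. cmod (\<eta> t - \<eta> s)) \<le> (e / 2) * r"
        using l\<eta> e by (metis half_gt_zero)
      show "\<exists>d>0. \<forall>r. 0 < r \<and> r < d \<longrightarrow>
        (LINT t:{s-r..s+r}|lborel. cmod ((\<eta> t - c * v t) - (\<eta> s - c * v s))) \<le> e * r"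
      proof (intro exI[of _ "min d1 d2"] conjI allI impI)
        fix r assume r: "0 < r \<and> r < min d1 d2"
        have iv: "set_integrable lborel {s-r..s+r} (\<lambda>t. cmod c * cmod (v t - v s))"
          by (rule set_integrable_mult_right) (rule set_integrable_norm_diff_const[OF v(2)])
        have i\<eta>: "set_integrable lborel {s-r..s+r} (\<lambda>t. cmod (\<eta> t - \<eta> s))" by (rule set_integrable_norm_diff_const[OF \<eta>_integrable])
        have "integrable lborel (\<lambda>t. \<eta> t - c * v t)" using \<eta>_integrable v(2) by simp
        from set_integrable_norm_diff_const[OF this]
        have ic: "set_integrable lborel {s-r..s+r} (\<lambda>t. cmod ((\<eta> t - c * v t) - (\<eta> s - c * v s)))" .
        have "(LINT t:{s-r..s+r}|lborel. cmod ((\<eta> t - c * v t) - (\<eta> s - c * v s)))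
           \<le> (LINT t:{s-r..s+r}|lborel. cmod (\<eta> t - \<eta> s) + cmod c * cmod (v t - v s))"
        proof (rule set_integral_mono[OF ic set_integral_add(1)[OF i\<eta> iv]])
          fix t
          have "(\<eta> t - c * v t) - (\<eta> s - c * v s) = (\<eta> t - \<eta> s) - c * (v t - v s)" by (simp add: algebra_simps)
          then show "cmod ((\<eta> t - c * v t) - (\<eta> s - c * v s)) \<le> cmod (\<eta> t - \<eta> s) + cmod c * cmod (v t - v s)"
            by (metis norm_mult norm_triangle_ineq4)
        qed
        also have "\<dots> = (LINT t:{s-r..s+r}|lborel. cmod (\<eta> t - \<eta> s)) + cmod c * (LINT t:{s-r..s+r}|lborel. cmod (v t - v s))"
          unfolding set_integral_add(2)[OF i\<eta> iv] by simp
        also have "\<dots> \<le> (e/2) * r + cmod c * ((e / (2 * (cmod c + 1))) * r)"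
          using d1(2)[of r] d2(2)[of r] r by (intro add_mono mult_left_mono) auto
        also have "cmod c * ((e / (2 * (cmod c + 1))) * r) \<le> (e/2) * r"
        proof -
          have "cmod c * (e / (2 * (cmod c + 1))) = (e/2) * (cmod c / (cmod c + 1))" by simp
          also have "\<dots> \<le> (e/2) * 1" using e by (intro mult_left_mono) (auto simp: divide_le_eq_1 add_nonneg_pos)
          finally have "cmod c * (e / (2 * (cmod c + 1))) * r \<le> (e/2) * 1 * r" using r by (intro mult_right_mono) auto
          then show ?thesis by (simp only: mult.assoc mult_1_left)
        qed
        finally show "(LINT t:{s-r..s+r}|lborel. cmod ((\<eta> t - c * v t) - (\<eta> s - c * v s))) \<le> e * r" by simp
      qed (use d1 d2 in simp)
    qed
    then show "good_boundary_point \<sigma> l R G \<phi> \<psi> \<tau> \<rho> v s"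
      using lv n s \<open>s \<noteq> 0\<close> \<open>s \<noteq> l\<close> unfolding c_def by unfold_locales auto
  qed
qed

text \<open>The Borel function is the limit of \<open>g\<close> at the points \<open>w n s\<close>
  on the inner normal, which depend measurably on \<open>s\<close> because \<open>v\<close> is
  Borel. At a good point they eventually lie in \<open>G\<close>, and the limit along them is the
  angular one.\<close>

lemma boundary_function_exists:
  assumes p: "p \<ge> 1" and h: "continuous_on G h"
    and hg: "\<And>z. z \<in> G \<Longrightarrow> exp (h z) = deriv \<phi> z \<and> g z = exp (of_real (1 / real p) * h z)"
  obtains b where "b \<in> borel_measurable borel"
    "AE s in lborel. s \<in> {0..l} \<longrightarrow> has_nontangential_limit G g (\<sigma> s) (b s) \<and> b s ^ p = \<eta> s / v s"
proof -
  define S where "S = (\<lambda>s. indicator {0..l} s *\<^sub>R \<sigma> s)"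
  have S: "S \<in> borel_measurable borel"
    unfolding S_def by (rule borel_measurable_continuous_on_indicator[OF _ cont\<sigma>]) simp
  have "continuous_on G g"
  proof (rule continuous_on_eq)
    show "continuous_on G (\<lambda>z. exp (of_real (1 / real p) * h z))" by (intro continuous_intros h)
  qed (use hg in auto)
  then have gm: "(\<lambda>z. indicator G z *\<^sub>R g z) \<in> borel_measurable borel"
    using openG by (intro borel_measurable_continuous_on_indicator) auto
  define w where "w n s = S s + v s * (\<i> * of_real (1 / (real n + 1)))" for n :: nat and s
  have wm: "w n \<in> borel_measurable borel" for n unfolding w_def[abs_def] using S v(1) by measurable
  define u where "u n s = indicator G (w n s) *\<^sub>R g (w n s)" for n s
  have um: "u n \<in> borel_measurable borel" for n
    unfolding u_def[abs_def] using measurable_compose[OF wm gm] by simp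
  define b where "b s = lim (\<lambda>n. u n s)" for s
  show ?thesis
  proof
    show "b \<in> borel_measurable borel" unfolding b_def[abs_def] by (rule borel_measurable_lim_metric) (rule um)
    show "AE s in lborel. s \<in> {0..l} \<longrightarrow> has_nontangential_limit G g (\<sigma> s) (b s) \<and> b s ^ p = \<eta> s / v s"
      using good_points_AE
    proof eventually_elim
      fix s assume imp: "s \<in> {0..l} \<longrightarrow> good_boundary_point \<sigma> l R G \<phi> \<psi> \<tau> \<rho> v s"
      show "s \<in> {0..l} \<longrightarrow> has_nontangential_limit G g (\<sigma> s) (b s) \<and> b s ^ p = \<eta> s / v s"
      proof
      assume s: "s \<in> {0..l}"
      interpret s: good_boundary_point \<sigma> l R G \<phi> \<psi> \<tau> \<rho> v s using imp s by simp
      obtain c where c: "has_nontangential_limit G g s.z0 c" "c ^ p = s.c0"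
        using s.branch_nontangential[OF p h hg] by blast
      have weq: "w n s = s.pt (\<i> * of_real (1 / (real n + 1)))" for n
        using s by (simp add: w_def S_def s.pt_def s.z0_def)
      have lim: "(\<lambda>n. g (w n s)) \<longlonglongrightarrow> c" unfolding weq by (rule s.boundary_value_normal_limit[OF c(1)])
      have "eventually (\<lambda>z. z \<in> G) (at s.z0 within approach_region G s.z0 1)"
        unfolding eventually_at by (rule exI[of _ 1]) (simp add: approach_region_def)
      then have "eventually (\<lambda>n. w n s \<in> G) sequentially"
        unfolding weq using s.normal_ray_filterlim[unfolded filterlim_iff, rule_format] by blast
      then have "eventually (\<lambda>n. g (w n s) = u n s) sequentially" by eventually_elim (simp add: u_def)
      then have "(\<lambda>n. u n s) \<longlonglongrightarrow> c" by (rule Lim_transform_eventually[OF lim])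
      then have "b s = c" unfolding b_def by (rule limI)
      then show "has_nontangential_limit G g (\<sigma> s) (b s) \<and> b s ^ p = \<eta> s / v s"
        using c by (simp add: s.z0_def s.c0_def)
      qed
    qed
  qed
qed

text \<open>The difference of the two sides, as a function of the end point, has quadratic
  increments: freezing the polynomial at the left end of a short interval costs second order on both
  sides.\<close>

lemma J_poly_increment:
  assumes ac: "0 \<le> a" "a \<le> c" "c \<le> l"
  shows "J_poly p \<zeta> P (\<sigma> c) - J_poly p \<zeta> P (\<sigma> a) = (LINT s:{a..c}|lborel. v s * poly P (\<sigma> s) ^ p)"
proof -
  let ?J = "J_poly p \<zeta> P" and ?q = "\<lambda>s. poly P (\<sigma> s) ^ p"
  have cq: "continuous_on {x..y} ?q" if "{x..y} \<subseteq> {0..l}" for x y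
    by (intro continuous_intros continuous_on_subset[OF cont\<sigma> that])
  have "compact (\<sigma> ` {0..l})" using cont\<sigma> by (simp add: compact_continuous_image)
  then obtain B where B: "\<And>s. s \<in> {0..l} \<Longrightarrow> cmod (\<sigma> s) \<le> B" by (meson bounded_iff compact_imp_bounded image_eqI)
  obtain C where C: "C > 0" "\<And>z w. cmod z \<le> B \<Longrightarrow> cmod w \<le> B \<Longrightarrow> cmod (poly P w ^ p - poly P z ^ p) \<le> C * cmod (w - z)"
    "\<And>z w. cmod z \<le> B \<Longrightarrow> cmod w \<le> B \<Longrightarrow> cmod (?J w - ?J z - poly P z ^ p * (w - z)) \<le> C * (cmod (w - z))\<^sup>2"
    using J_poly_estimates[of B P p \<zeta>] by metis
  define \<Lambda> where "\<Lambda> t = (LINT s:{0..t}|lborel. v s * ?q s)" for t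
  have inc: "\<Lambda> t = \<Lambda> s + (LINT r:{s..t}|lborel. v r * ?q r)" if "0 \<le> s" "s \<le> t" "t \<le> l" for s t
    unfolding \<Lambda>_def by (rule set_integral_combine[OF set_integrable_mult_v[OF cq]]) (use that in auto)
  define K where "K s = ?J (\<sigma> s) - \<Lambda> s" for s
  have "K c = K a"
  proof (rule quadratic_increment_imp_const[where a = 0 and b = l and d = 1 and C = "2 * C"])
    fix s t assume st: "s \<in> {0..l}" "t \<in> {0..l}" "s \<le> t"
    have le: "cmod (\<sigma> t - \<sigma> s) \<le> t - s" using lip[of t s] st by (simp add: dist_norm)
    have c1: "continuous_on {s..t} (\<lambda>r. ?q r - ?q s)" using cq[of s t] st by (auto intro!: continuous_intros)
    have "(LINT r:{s..t}|lborel. v r * ?q r) = (LINT r:{s..t}|lborel. v r * ?q s + v r * (?q r - ?q s))"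
      by (simp add: algebra_simps)
    also have "\<dots> = (LINT r:{s..t}|lborel. v r * ?q s) + (LINT r:{s..t}|lborel. v r * (?q r - ?q s))"
      by (rule set_integral_add(2)[OF set_integrable_mult_v set_integrable_mult_v[OF c1]]) simp
    also have "(LINT r:{s..t}|lborel. v r * ?q s) = (\<sigma> t - \<sigma> s) * ?q s" using v_int[of s t] st by simp
    finally have L: "\<Lambda> t - \<Lambda> s = (\<sigma> t - \<sigma> s) * ?q s + (LINT r:{s..t}|lborel. v r * (?q r - ?q s))"
      using inc[of s t] st by simp
    have e1: "cmod (LINT r:{s..t}|lborel. v r * (?q r - ?q s)) \<le> (C * (t - s)) * (t - s)"
    proof (rule norm_integral_mult_v_le[OF c1])
      fix r assume r: "r \<in> {s..t}"
      have "cmod (?q r - ?q s) \<le> C * cmod (\<sigma> r - \<sigma> s)" using B r st by (intro C(2)) auto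
      also have "\<dots> \<le> C * (t - s)" using lip[of r s] r st C(1) by (intro mult_left_mono) (auto simp: dist_norm)
      finally show "cmod (?q r - ?q s) \<le> C * (t - s)" .
    qed (use st in simp)
    have e2: "cmod (?J (\<sigma> t) - ?J (\<sigma> s) - ?q s * (\<sigma> t - \<sigma> s)) \<le> C * (t - s)\<^sup>2"
    proof -
      have "cmod (?J (\<sigma> t) - ?J (\<sigma> s) - ?q s * (\<sigma> t - \<sigma> s)) \<le> C * (cmod (\<sigma> t - \<sigma> s))\<^sup>2" using B st by (intro C(3)) auto
      also have "\<dots> \<le> C * (t - s)\<^sup>2" using le C(1) by (intro mult_left_mono power_mono) auto
      finally show ?thesis .
    qed
    have Kst: "K t - K s = (?J (\<sigma> t) - ?J (\<sigma> s) - ?q s * (\<sigma> t - \<sigma> s)) - (LINT r:{s..t}|lborel. v r * (?q r - ?q s))"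
      using L by (simp add: K_def algebra_simps)
    have "cmod (K t - K s) \<le> C * (t - s)\<^sup>2 + (C * (t - s)) * (t - s)"
      unfolding Kst using e1 e2 norm_triangle_ineq4[of "?J (\<sigma> t) - ?J (\<sigma> s) - ?q s * (\<sigma> t - \<sigma> s)" "LINT r:{s..t}|lborel. v r * (?q r - ?q s)"] by linarith
    then show "cmod (K t - K s) \<le> 2 * C * (t - s)\<^sup>2" by (simp add: power2_eq_square)
  qed (use C(1) ac in auto)
  then show ?thesis using inc[of a c] ac by (simp add: K_def algebra_simps)
qed

text \<open>This is the modulus of the derivative of the error function along
  \<open>\<sigma>\<close>, equal almost everywhere to the modulus of the difference of the p-th
  powers of the boundary values (\<open>defect_AE\<close>).\<close>

definition defect :: "nat \<Rightarrow> complex poly \<Rightarrow> real \<Rightarrow> real" where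
  "defect p P s = indicator {0..l} s * cmod (\<eta> s - v s * poly P (\<sigma> s) ^ p)"

lemma set_integrable_v_poly: "set_integrable lborel {0..l} (\<lambda>s. v s * poly P (\<sigma> s) ^ p)"
  by (rule set_integrable_mult_v) (intro continuous_intros cont\<sigma>)

lemma set_integrable_\<eta>: "set_integrable lborel {x..y} \<eta>"
  unfolding set_integrable_def by (rule integrable_mult_indicator[OF _ \<eta>_integrable]) simp

lemma integrable_defect: "integrable lborel (defect p P)"
  using set_integrable_norm[OF set_integral_diff(1)[OF set_integrable_\<eta> set_integrable_v_poly]]
  unfolding set_integrable_def defect_def[abs_def] by simp

lemma \<phi>_minus_J_increment:
  assumes ac: "0 \<le> a" "a \<le> c" "c \<le> l"
  shows "cmod ((\<phi> (\<sigma> c) - J_poly p \<zeta> P (\<sigma> c)) - (\<phi> (\<sigma> a) - J_poly p \<zeta> P (\<sigma> a))) \<le> (LINT s:{a..c}|lborel. defect p P s)"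
proof -
  have i2: "set_integrable lborel {a..c} (\<lambda>s. v s * poly P (\<sigma> s) ^ p)"
    by (rule set_integrable_subset[OF set_integrable_v_poly]) (use ac in auto)
  have "(\<phi> (\<sigma> c) - J_poly p \<zeta> P (\<sigma> c)) - (\<phi> (\<sigma> a) - J_poly p \<zeta> P (\<sigma> a))
      = (\<phi> (\<sigma> c) - \<phi> (\<sigma> a)) - (J_poly p \<zeta> P (\<sigma> c) - J_poly p \<zeta> P (\<sigma> a))" by simp
  also have "\<dots> = (LINT s:{a..c}|lborel. \<eta> s - v s * poly P (\<sigma> s) ^ p)"
    unfolding set_integral_diff(2)[OF set_integrable_\<eta> i2] \<eta>_int[OF ac] J_poly_increment[OF ac] ..
  also have "cmod \<dots> \<le> (LINT s:{a..c}|lborel. cmod (\<eta> s - v s * poly P (\<sigma> s) ^ p))"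
    by (rule set_integral_norm_bound[OF set_integral_diff(1)[OF set_integrable_\<eta> i2]])
  also have "\<dots> = (LINT s:{a..c}|lborel. defect p P s)"
    by (rule set_lebesgue_integral_cong) (use ac in \<open>auto simp: defect_def\<close>)
  finally show ?thesis .
qed

lemma \<phi>_minus_J_bound:
  assumes \<zeta>: "\<zeta> \<in> G" "\<phi> \<zeta> = 0" and bG: "bounded G" and z: "z \<in> closure G"
  shows "cmod (\<phi> z - J_poly p \<zeta> P z) \<le> 1/2 * (LINT s|lborel. defect p P s)"
proof -
  let ?F = "\<lambda>z. \<phi> z - J_poly p \<zeta> P z"
  define T where "T = (LINT s|lborel. defect p P s)"
  have T: "T = (LINT s:{0..l}|lborel. defect p P s)"
    unfolding T_def set_lebesgue_integral_def by (rule Bochner_Integration.integral_cong) (auto simp: defect_def indicator_def)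
  have id: "set_integrable lborel {x..y} (defect p P)" for x y
    unfolding set_integrable_def by (rule integrable_mult_indicator[OF _ integrable_defect]) simp
  have half: "cmod (?F (\<sigma> t) - ?F (\<sigma> s)) \<le> T / 2" if st: "s \<in> {0..l}" "t \<in> {0..l}" "s \<le> t" for s t
  proof -
    have 1: "cmod (?F (\<sigma> t) - ?F (\<sigma> s)) \<le> (LINT s:{s..t}|lborel. defect p P s)"
      by (rule \<phi>_minus_J_increment) (use st in auto)
    have 2: "cmod (?F (\<sigma> s) - ?F (\<sigma> 0)) \<le> (LINT s:{0..s}|lborel. defect p P s)"
      by (rule \<phi>_minus_J_increment) (use st in auto)
    have 3: "cmod (?F (\<sigma> l) - ?F (\<sigma> t)) \<le> (LINT s:{t..l}|lborel. defect p P s)"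
      by (rule \<phi>_minus_J_increment) (use st in auto)
    have "?F (\<sigma> t) - ?F (\<sigma> s) = - ((?F (\<sigma> s) - ?F (\<sigma> 0)) + (?F (\<sigma> l) - ?F (\<sigma> t)))" using loop by simp
    then have "cmod (?F (\<sigma> t) - ?F (\<sigma> s)) \<le> cmod (?F (\<sigma> s) - ?F (\<sigma> 0)) + cmod (?F (\<sigma> l) - ?F (\<sigma> t))"
      by (metis norm_minus_cancel norm_triangle_ineq)
    moreover have "T = (LINT s:{0..s}|lborel. defect p P s) + (LINT s:{s..t}|lborel. defect p P s) + (LINT s:{t..l}|lborel. defect p P s)"
      unfolding T using set_integral_combine[OF id, of 0 s l] set_integral_combine[OF id, of s t l] st l by simp
    ultimately show ?thesis using 1 2 3 by linarith
  qed
  have osc: "cmod (?F (\<sigma> s) - ?F (\<sigma> t)) \<le> T / 2" if st: "s \<in> {0..l}" "t \<in> {0..l}" for s t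
    using half[of s t] half[of t s] st norm_minus_commute[of "?F (\<sigma> s)" "?F (\<sigma> t)"] by (cases "s \<le> t") auto
  have frG: "frontier G = \<sigma> ` {0..l}"
    using clG GL openG by (auto simp: frontier_def interior_open)
  have Fh: "?F holomorphic_on interior G"
    using hol\<phi> J_poly_holomorphic openG by (auto simp: interior_open intro!: holomorphic_intros)
  have Fc: "continuous_on (closure G) ?F"
    by (intro continuous_intros cont\<phi> holomorphic_on_imp_continuous_on J_poly_holomorphic)
  \<comment> \<open>Subtracting a boundary value before using the maximum principle, and evaluating
    at \<open>\<zeta>\<close>, where \<open>?F\<close> vanishes, bounds \<open>?F\<close> on the
    curve by its oscillation without doubling the constant. The second use of the principle carries
    the bound inside.\<close>
  have in1: "cmod (?F \<zeta> - ?F (\<sigma> t)) \<le> T / 2" if t: "t \<in> {0..l}" for t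
  proof (rule maximum_modulus_frontier[where f = "\<lambda>z. ?F z - ?F (\<sigma> t)", OF _ _ bG])
    show "(\<lambda>z. ?F z - ?F (\<sigma> t)) holomorphic_on interior G" by (intro holomorphic_on_diff Fh holomorphic_on_const)
    show "continuous_on (closure G) (\<lambda>z. ?F z - ?F (\<sigma> t))" by (intro continuous_on_diff Fc continuous_on_const)
    show "cmod (?F z - ?F (\<sigma> t)) \<le> T / 2" if "z \<in> frontier G" for z
      using that osc[OF _ t] unfolding frG by blast
  qed (rule \<zeta>)
  have F0: "?F \<zeta> = 0" using \<zeta> J_poly_facts(2) by simp
  have bd: "cmod (?F (\<sigma> t)) \<le> T / 2" if "t \<in> {0..l}" for t
    using in1[OF that] unfolding F0 by (simp add: norm_minus_commute)
  have "cmod (?F z) \<le> T / 2"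
  proof (cases "z \<in> G")
    case True
    show ?thesis
      by (rule maximum_modulus_frontier[OF Fh Fc bG _ True]) (use bd frG in auto)
  next
    case False
    then show ?thesis using z clG bd by auto
  qed
  then show ?thesis by (simp add: T_def)
qed

end

section \<open>Norms on the curve\<close>

locale smirnov_setting = jordan_disk_density +
  fixes p :: nat and g :: "complex \<Rightarrow> complex" and b :: "real \<Rightarrow> complex" and \<zeta> :: complex
  assumes p: "p \<ge> 1" and b_meas: "b \<in> borel_measurable borel"
    and b_lim: "AE s in lborel. s \<in> {0..l} \<longrightarrow> has_nontangential_limit G g (\<sigma> s) (b s) \<and> b s ^ p = \<eta> s / v s"
    and \<zeta>: "\<zeta> \<in> G" "\<phi> \<zeta> = 0" "deriv \<phi> \<zeta> = 1" and bG: "bounded G"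
begin

text \<open>The Smirnov norm, written through \<open>\<sigma>\<close>, which may be the arc length
  parametrization run backwards.\<close>

definition curve_norm :: "(complex \<Rightarrow> complex) \<Rightarrow> real" where
  "curve_norm f = (integral\<^sup>L (lebesgue_on {0..l}) (\<lambda>s. cmod (boundary_value G f (\<sigma> s)) powr p)) powr (1/p)"

definition "branch_bv s = indicator {0..l} s *\<^sub>R b s"
definition "poly_bv P s = indicator {0..l} s *\<^sub>R poly P (\<sigma> s)"

lemma branch_bv_measurable [measurable]: "branch_bv \<in> borel_measurable borel"
  unfolding branch_bv_def[abs_def] using b_meas by measurable

lemma poly_bv_measurable [measurable]: "poly_bv P \<in> borel_measurable borel"
  unfolding poly_bv_def[abs_def]
  by (rule borel_measurable_continuous_on_indicator) (auto intro!: continuous_intros cont\<sigma>)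

lemma poly_nontangential: "has_nontangential_limit G (poly P) z (poly P z)"
  unfolding has_nontangential_limit_def
  by (intro allI impI continuous_within[THEN iffD1] continuous_intros)

lemma boundary_value_AE:
  "AE s in lborel. s \<in> {0..l} \<longrightarrow> boundary_value G (poly P) (\<sigma> s) = poly_bv P s \<and>
      boundary_value G (\<lambda>z. g z - poly P z) (\<sigma> s) = branch_bv s - poly_bv P s"
  using good_points_AE b_lim
proof eventually_elim
  fix s assume imp: "s \<in> {0..l} \<longrightarrow> good_boundary_point \<sigma> l R G \<phi> \<psi> \<tau> \<rho> v s"
    and bl: "s \<in> {0..l} \<longrightarrow> has_nontangential_limit G g (\<sigma> s) (b s) \<and> b s ^ p = \<eta> s / v s"
  show "s \<in> {0..l} \<longrightarrow> boundary_value G (poly P) (\<sigma> s) = poly_bv P s \<and>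
      boundary_value G (\<lambda>z. g z - poly P z) (\<sigma> s) = branch_bv s - poly_bv P s"
  proof
  assume s: "s \<in> {0..l}"
  interpret s: good_boundary_point \<sigma> l R G \<phi> \<psi> \<tau> \<rho> v s using imp s by simp
  have "has_nontangential_limit G (\<lambda>z. g z - poly P z) (\<sigma> s) (b s - poly P (\<sigma> s))"
    using bl s poly_nontangential[of P "\<sigma> s"] unfolding has_nontangential_limit_def by (blast intro: tendsto_diff)
  then show "boundary_value G (poly P) (\<sigma> s) = poly_bv P s \<and> boundary_value G (\<lambda>z. g z - poly P z) (\<sigma> s) = branch_bv s - poly_bv P s"
    using s.boundary_value_eqI[of "poly P" "poly P (\<sigma> s)"] s.boundary_value_eqI[of "\<lambda>z. g z - poly P z" "b s - poly P (\<sigma> s)"]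
      poly_nontangential[of P "\<sigma> s"] s by (simp add: s.z0_def branch_bv_def poly_bv_def)
  qed
qed

lemma curve_norm_eq:
  assumes f: "f \<in> borel_measurable borel" "\<And>s. s \<notin> {0..l} \<Longrightarrow> f s = 0"
    and eq: "AE s in lborel. s \<in> {0..l} \<longrightarrow> boundary_value G F (\<sigma> s) = f s"
  shows "curve_norm F = (LINT s|lborel. cmod (f s) ^ p) powr (1/p)"
proof -
  have pw: "cmod x powr real p = cmod x ^ p" for x :: complex using p by (cases "x = 0") (simp_all add: powr_realpow)
  have "integral\<^sup>L (lebesgue_on {0..l}) (\<lambda>s. cmod (boundary_value G F (\<sigma> s)) powr p) = (LINT s:{0..l}|lborel. cmod (f s) ^ p)"
  proof (rule integral_lebesgue_on_AE_eq)
    show "set_borel_measurable borel {0..l} (\<lambda>s. cmod (f s) ^ p)"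
      unfolding set_borel_measurable_def using f(1) by measurable
    show "AE s in lborel. s \<in> {0..l} \<longrightarrow> cmod (boundary_value G F (\<sigma> s)) powr p = cmod (f s) ^ p"
      using eq by eventually_elim (simp add: pw)
  qed
  also have "\<dots> = (LINT s|lborel. cmod (f s) ^ p)"
    unfolding set_lebesgue_integral_def
    by (rule Bochner_Integration.integral_cong) (use f(2) p in \<open>auto simp: indicator_def\<close>)
  finally show ?thesis by (simp add: curve_norm_def)
qed

lemma curve_norm_poly: "curve_norm (poly P) = (LINT s|lborel. cmod (poly_bv P s) ^ p) powr (1/p)"
proof (rule curve_norm_eq[OF poly_bv_measurable])
  show "AE s in lborel. s \<in> {0..l} \<longrightarrow> boundary_value G (poly P) (\<sigma> s) = poly_bv P s"
    using boundary_value_AE[of P] by eventually_elim simp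
qed (simp add: poly_bv_def)

lemma curve_norm_diff: "curve_norm (\<lambda>z. g z - poly P z) = (LINT s|lborel. cmod (branch_bv s - poly_bv P s) ^ p) powr (1/p)"
proof (rule curve_norm_eq)
  show "(\<lambda>s. branch_bv s - poly_bv P s) \<in> borel_measurable borel" by measurable
  show "AE s in lborel. s \<in> {0..l} \<longrightarrow> boundary_value G (\<lambda>z. g z - poly P z) (\<sigma> s) = branch_bv s - poly_bv P s"
    using boundary_value_AE[of P] by eventually_elim simp
qed (simp add: branch_bv_def poly_bv_def)

lemma branch_bv_power_AE: "AE s in lborel. cmod (branch_bv s) ^ p = indicator {0..l} s * (R * \<rho> s)"
  using b_lim v_norm
proof eventually_elim
  fix s assume s: "s \<in> {0..l} \<longrightarrow> has_nontangential_limit G g (\<sigma> s) (b s) \<and> b s ^ p = \<eta> s / v s"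
    "s \<in> {0..l} \<longrightarrow> cmod (v s) = 1"
  show "cmod (branch_bv s) ^ p = indicator {0..l} s * (R * \<rho> s)"
  proof (cases "s \<in> {0..l}")
    case True
    then have "cmod (branch_bv s) ^ p = cmod (\<eta> s)" using s by (simp add: branch_bv_def norm_divide flip: norm_power)
    then show ?thesis using norm_\<eta>[OF True] True by simp
  qed (use p in \<open>simp add: branch_bv_def\<close>)
qed

lemma integrable_indicator_\<rho>: "integrable lborel (\<lambda>s. indicator {0..l} s * (R * \<rho> s))"
  using integrable_mult_indicator[of "{0..l}" lborel "\<lambda>s. R * \<rho> s"] \<rho>(3) by simp

lemma integrable_branch_bv: "integrable lborel (\<lambda>s. cmod (branch_bv s) ^ p)"
  using integrable_indicator_\<rho> branch_bv_power_AE \<rho>(1) by (subst integrable_cong_AE) auto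

text \<open>The p-th power of the modulus is \<open>R\<close> times the density of the angle, and
  the angle grows by \<open>2 * pi\<close> along the curve. This is the origin of the constant
  \<open>2 * pi * R\<close>.\<close>

lemma integral_branch_bv: "(LINT s|lborel. cmod (branch_bv s) ^ p) = 2 * pi * R"
proof -
  have "(LINT s|lborel. cmod (branch_bv s) ^ p) = (LINT s|lborel. indicator {0..l} s * (R * \<rho> s))"
    using branch_bv_power_AE \<rho>(1) by (intro integral_cong_AE) auto
  also have "\<dots> = R * (LINT s:{0..l}|lborel. \<rho> s)"
    unfolding set_lebesgue_integral_def by (simp add: mult.left_commute)
  also have "\<dots> = 2 * pi * R" using \<rho>_int[of 0 l] l \<tau>l by simp
  finally show ?thesis .
qed

lemma integrable_poly_bv: "integrable lborel (\<lambda>s. cmod (poly_bv P s) ^ p)"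
proof -
  have "set_integrable lborel {0..l} (\<lambda>s. cmod (poly P (\<sigma> s)) ^ p)"
    by (rule borel_integrable_atLeastAtMost') (intro continuous_intros cont\<sigma>)
  moreover have "indicator {0..l} s *\<^sub>R cmod (poly P (\<sigma> s)) ^ p = cmod (poly_bv P s) ^ p" for s
    using p by (simp add: poly_bv_def indicator_def)
  ultimately show ?thesis unfolding set_integrable_def by simp
qed

lemma integrable_diff: "integrable lborel (\<lambda>s. cmod (branch_bv s - poly_bv P s) ^ p)"
proof (rule Bochner_Integration.integrable_bound)
  show "integrable lborel (\<lambda>s. 2 ^ p * (cmod (branch_bv s) ^ p + cmod (poly_bv P s) ^ p))"
    using integrable_branch_bv integrable_poly_bv by simp
  show "AE s in lborel. norm (cmod (branch_bv s - poly_bv P s) ^ p) \<le> norm (2 ^ p * (cmod (branch_bv s) ^ p + cmod (poly_bv P s) ^ p))"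
  proof (rule AE_I2)
    fix s
    have "cmod (branch_bv s - poly_bv P s) ^ p \<le> (cmod (branch_bv s) + cmod (poly_bv P s)) ^ p"
      by (intro power_mono norm_triangle_ineq4) simp
    also have "\<dots> \<le> 2 ^ p * (cmod (branch_bv s) ^ p + cmod (poly_bv P s) ^ p)" by (rule power_add_le_two) auto
    finally show "norm (cmod (branch_bv s - poly_bv P s) ^ p) \<le> norm (2 ^ p * (cmod (branch_bv s) ^ p + cmod (poly_bv P s) ^ p))" by simp
  qed
qed measurable

lemma defect_AE: "AE s in lborel. defect p P s = cmod (branch_bv s ^ p - poly_bv P s ^ p)"
  using b_lim v_norm
proof eventually_elim
  fix s assume s: "s \<in> {0..l} \<longrightarrow> has_nontangential_limit G g (\<sigma> s) (b s) \<and> b s ^ p = \<eta> s / v s"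
    "s \<in> {0..l} \<longrightarrow> cmod (v s) = 1"
  show "defect p P s = cmod (branch_bv s ^ p - poly_bv P s ^ p)"
  proof (cases "s \<in> {0..l}")
    case True
    then have v1: "cmod (v s) = 1" and v0: "v s \<noteq> 0" and bp: "b s ^ p = \<eta> s / v s" using s by auto
    have "\<eta> s - v s * poly P (\<sigma> s) ^ p = v s * (b s ^ p - poly P (\<sigma> s) ^ p)"
      using v0 by (simp add: bp right_diff_distrib)
    then show ?thesis using True v1 by (simp add: defect_def branch_bv_def poly_bv_def norm_mult)
  qed (use p in \<open>simp add: defect_def branch_bv_def poly_bv_def\<close>)
qed

lemma defect_integral_le:
  "(LINT s|lborel. defect p P s) \<le> curve_norm (\<lambda>z. g z - poly P z) * ((2 * pi * R) powr (1/p) + curve_norm (poly P)) ^ (p - 1)"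
proof -
  have h: "integrable lborel (\<lambda>s. cmod (branch_bv s - poly_bv P s) * (cmod (branch_bv s) + cmod (poly_bv P s)) ^ (p - 1))"
    "(LINT s|lborel. cmod (branch_bv s - poly_bv P s) * (cmod (branch_bv s) + cmod (poly_bv P s)) ^ (p - 1)) \<le>
       (LINT s|lborel. cmod (branch_bv s - poly_bv P s) ^ p) powr (1/p) * ((LINT s|lborel. cmod (branch_bv s) ^ p) powr (1/p) + (LINT s|lborel. cmod (poly_bv P s) ^ p) powr (1/p)) ^ (p - 1)"
    by (rule holder_add_power[OF _ _ _ _ _ _ p integrable_diff integrable_branch_bv integrable_poly_bv]; simp)+
  have "(LINT s|lborel. defect p P s) \<le> (LINT s|lborel. cmod (branch_bv s - poly_bv P s) * (cmod (branch_bv s) + cmod (poly_bv P s)) ^ (p - 1))"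
  proof (rule integral_mono_AE[OF integrable_defect h(1)])
    show "AE s in lborel. defect p P s \<le> cmod (branch_bv s - poly_bv P s) * (cmod (branch_bv s) + cmod (poly_bv P s)) ^ (p - 1)"
      using defect_AE[of P] by eventually_elim (simp only: norm_power_diff_le[OF p])
  qed
  also note h(2)
  finally show ?thesis unfolding curve_norm_diff curve_norm_poly integral_branch_bv .
qed

lemma sup_norm_bound:
  "sup_norm_on (closure G) (\<lambda>z. \<phi> z - J_poly p \<zeta> P z) \<le> 1/2 * (LINT s|lborel. defect p P s)"
  unfolding sup_norm_on_def
  by (rule cSUP_least) (use \<zeta>(1) closure_subset \<phi>_minus_J_bound[OF \<zeta>(1,2) bG] in auto)

lemma sup_norm_estimate:
  assumes Q: "curve_norm (poly Q) \<le> curve_norm (poly 1)"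
  shows "sup_norm_on (closure G) (\<lambda>z. \<phi> z - J_poly p \<zeta> Q z)
            \<le> 1/2 * ((2 * pi * R) powr (1 / real p) + l powr (1 / real p)) ^ (p - 1)
                * curve_norm (\<lambda>z. g z - poly Q z)"
proof -
  have "(LINT s|lborel. cmod (poly_bv 1 s) ^ p) = (LINT s:{0..l}|lborel. 1)"
    unfolding set_lebesgue_integral_def by (rule Bochner_Integration.integral_cong) (use p in \<open>auto simp: poly_bv_def indicator_def\<close>)
  then have "curve_norm (poly 1) = l powr (1/p)" using l by (simp add: curve_norm_poly set_lebesgue_integral_def)
  then have le: "curve_norm (poly Q) \<le> l powr (1/p)" using Q by simp
  have "sup_norm_on (closure G) (\<lambda>z. \<phi> z - J_poly p \<zeta> Q z) \<le> 1/2 * (LINT s|lborel. defect p Q s)"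
    by (rule sup_norm_bound)
  also have "\<dots> \<le> 1/2 * (curve_norm (\<lambda>z. g z - poly Q z) * ((2 * pi * R) powr (1/p) + curve_norm (poly Q)) ^ (p - 1))"
    using defect_integral_le[of Q] by simp
  also have "\<dots> \<le> 1/2 * (curve_norm (\<lambda>z. g z - poly Q z) * ((2 * pi * R) powr (1/p) + l powr (1/p)) ^ (p - 1))"
    using le by (intro mult_left_mono power_mono add_left_mono add_nonneg_nonneg) (auto simp: curve_norm_def)
  finally show ?thesis by (simp add: mult_ac)
qed

end

section \<open>Means of zero-free functions\<close>

text \<open>By uniform continuity the derivative is nearly constant on each of many equal
  subintervals, where its integrated modulus is nearly the chord. Polygons with at least two steps
  suffice, which on the circle means arcs shorter than a full turn.\<close>

lemma integral_norm_derivative_le_polygons: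
  fixes x x' :: "real \<Rightarrow> complex"
  assumes L: "L > 0" and d: "\<And>t. t \<in> {0..L} \<Longrightarrow> (x has_vector_derivative x' t) (at t within {0..L})"
    and c: "continuous_on {0..L} x'"
    and N: "\<And>n. n \<ge> 2 \<Longrightarrow> (\<Sum>i<n. cmod (x (real (Suc i) * (L / n)) - x (real i * (L / n)))) \<le> N"
  shows "integral {0..L} (\<lambda>t. cmod (x' t)) \<le> N"
proof (rule field_le_epsilon)
  fix e :: real assume e: "e > 0"
  \<comment> \<open>Each step of length \<open>h\<close> costs \<open>2 * e' * h\<close>, so all of
    them together cost \<open>2 * e' * L\<close>, which is \<open>e\<close>.\<close>
  define e' where "e' = e / (2 * L)"
  have e': "e' > 0" using e L by (simp add: e'_def)
  have "uniformly_continuous_on {0..L} x'" using c compact_uniformly_continuous by blast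
  then obtain \<delta> where \<delta>: "\<delta> > 0" "\<And>s t. s \<in> {0..L} \<Longrightarrow> t \<in> {0..L} \<Longrightarrow> dist s t < \<delta> \<Longrightarrow> dist (x' s) (x' t) < e'"
    using e' unfolding uniformly_continuous_on_def by metis
  obtain m :: nat where m: "L / \<delta> < real m" using reals_Archimedean2 by blast
  define n where "n = m + 2"
  define h where "h = L / n"
  have n: "n \<ge> 2" "real n > 0" by (simp_all add: n_def)
  have h: "h > 0" "real n * h = L" using L n by (simp_all add: h_def)
  have "L / \<delta> < real n" using m by (simp add: n_def)
  then have h\<delta>: "h < \<delta>" using \<delta>(1) n by (simp add: h_def field_simps)
  have io: "(\<lambda>t. cmod (x' t)) integrable_on {a..b}" if "{a..b} \<subseteq> {0..L}" for a b
    by (intro integrable_continuous_interval continuous_intros continuous_on_subset[OF c that])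
  have step: "integral {a..a+h} (\<lambda>t. cmod (x' t)) \<le> cmod (x (a + h) - x a) + 2 * e' * h"
    if a: "0 \<le> a" "a + h \<le> L" for a
  proof -
    have sub: "{a..a+h} \<subseteq> {0..L}" using a by auto
    have near: "cmod (x' t - x' a) \<le> e'" if "t \<in> {a..a+h}" for t
      using \<delta>(2)[of t a] that a h h\<delta> by (simp add: dist_norm)
    have ci: "continuous_on {a..a+h} x'" by (rule continuous_on_subset[OF c sub])
    have "(x' has_integral (x (a + h) - x a)) {a..a+h}"
      
    proof (rule fundamental_theorem_of_calculus)
      show "(x has_vector_derivative x' t) (at t within {a..a + h})" if "t \<in> {a..a + h}" for t
        using has_vector_derivative_within_subset[OF d sub] that sub by blast
    qed (use h in simp)
    then have "((\<lambda>t. x' t - x' a) has_integral (x (a + h) - x a) - h *\<^sub>R x' a) {a..a+h}"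
      using has_integral_const_real[of "x' a" a "a + h"] h by (intro has_integral_diff) auto
    then have "cmod ((x (a + h) - x a) - h *\<^sub>R x' a) \<le> e' * measure lborel {a..a+h}"
      by (rule has_integral_bound_real[OF less_imp_le[OF e'] finite.emptyI]) (use near in auto)
    then have 1: "cmod ((x (a + h) - x a) - h *\<^sub>R x' a) \<le> e' * h" using h by simp
    have "h * cmod (x' a) = cmod (h *\<^sub>R x' a)" using h by simp
    also have "\<dots> \<le> cmod (x (a + h) - x a) + cmod ((x (a + h) - x a) - h *\<^sub>R x' a)"
      using norm_triangle_ineq4[of "x (a + h) - x a" "(x (a + h) - x a) - h *\<^sub>R x' a"] by simp
    finally have 2: "h * cmod (x' a) \<le> cmod (x (a + h) - x a) + e' * h" using 1 by linarith
    have "integral {a..a+h} (\<lambda>t. cmod (x' t)) \<le> integral {a..a+h} (\<lambda>t. cmod (x' a) + e')"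
    proof (rule integral_le)
      fix t assume "t \<in> {a..a+h}"
      then show "cmod (x' t) \<le> cmod (x' a) + e'" using near[of t] norm_triangle_ineq2[of "x' t" "x' a"] by linarith
    qed (use io[OF sub] in auto)
    also have "\<dots> = h * cmod (x' a) + e' * h" using h by (simp add: algebra_simps)
    finally show ?thesis using 2 by simp
  qed
  have "integral {0..real k * h} (\<lambda>t. cmod (x' t)) \<le> (\<Sum>i<k. cmod (x (real (Suc i) * h) - x (real i * h)) + 2 * e' * h)"
    if "k \<le> n" for k
    using that
  proof (induction k)
    case (Suc k)
    have le: "real (Suc k) * h \<le> L" using Suc(2) h mult_right_mono[of "real (Suc k)" "real n" h] by simp
    have eq: "real k * h + h = real (Suc k) * h" by (simp add: algebra_simps)
    have "integral {0..real (Suc k) * h} (\<lambda>t. cmod (x' t)) = integral {0..real k * h} (\<lambda>t. cmod (x' t)) + integral {real k * h..real (Suc k) * h} (\<lambda>t. cmod (x' t))"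
      by (rule Henstock_Kurzweil_Integration.integral_combine[symmetric]) (use h le io eq in \<open>auto simp: algebra_simps\<close>)
    also have "integral {real k * h..real (Suc k) * h} (\<lambda>t. cmod (x' t)) \<le> cmod (x (real (Suc k) * h) - x (real k * h)) + 2 * e' * h"
      using step[of "real k * h"] le h unfolding eq by simp
    finally show ?case using Suc by simp
  qed simp
  from this[of n] have "integral {0..L} (\<lambda>t. cmod (x' t)) \<le> (\<Sum>i<n. cmod (x (real (Suc i) * h) - x (real i * h))) + real n * (2 * e' * h)"
    using h by (simp add: sum.distrib)
  also have "(\<Sum>i<n. cmod (x (real (Suc i) * h) - x (real i * h))) \<le> N" unfolding h_def by (rule N[OF n(1)])
  also have "real n * (2 * e' * h) = e"
  proof -
    have "real n * (2 * e' * h) = 2 * e' * (real n * h)" by (simp only: mult_ac)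
    then show ?thesis using h L by (simp add: e'_def)
  qed
  finally show "integral {0..L} (\<lambda>t. cmod (x' t)) \<le> N + e" by simp
qed

text \<open>Dividing f by a finite Blaschke product gives such a q.\<close>

definition zero_free_majorant :: "real \<Rightarrow> (complex \<Rightarrow> complex) \<Rightarrow> bool" where
  "zero_free_majorant r f \<longleftrightarrow> (\<exists>q r1. r < r1 \<and> q holomorphic_on ball 0 r1 \<and> (\<forall>u\<in>ball 0 r1. q u \<noteq> 0) \<and>
      (\<forall>u. cmod u = r \<longrightarrow> cmod (q u) = cmod (f u)) \<and> cmod (f 0) \<le> cmod (q 0))"

lemma zero_free_majorant_mult:
  assumes "zero_free_majorant r f" "zero_free_majorant r g"
  shows "zero_free_majorant r (\<lambda>u. f u * g u)"
proof -
  obtain q r1 where q: "r < r1" "q holomorphic_on ball 0 r1" "\<And>u. u\<in>ball 0 r1 \<Longrightarrow> q u \<noteq> 0"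
      "\<And>u. cmod u = r \<Longrightarrow> cmod (q u) = cmod (f u)" "cmod (f 0) \<le> cmod (q 0)"
    using assms(1) unfolding zero_free_majorant_def by metis
  obtain k r2 where k: "r < r2" "k holomorphic_on ball 0 r2" "\<And>u. u\<in>ball 0 r2 \<Longrightarrow> k u \<noteq> 0"
      "\<And>u. cmod u = r \<Longrightarrow> cmod (k u) = cmod (g u)" "cmod (g 0) \<le> cmod (k 0)"
    using assms(2) unfolding zero_free_majorant_def by metis
  have "(\<lambda>u. q u * k u) holomorphic_on ball 0 (min r1 r2)"
    by (intro holomorphic_on_mult holomorphic_on_subset[OF q(2)] holomorphic_on_subset[OF k(2)]) auto
  moreover have "cmod (f 0 * g 0) \<le> cmod (q 0 * k 0)" using q(5) k(5) by (simp add: norm_mult mult_mono)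
  ultimately show ?thesis unfolding zero_free_majorant_def
    using q k by (intro exI[of _ "\<lambda>u. q u * k u"] exI[of _ "min r1 r2"]) (auto simp: norm_mult)
qed

lemma zero_free_majorant_self:
  assumes "r < r1" "f holomorphic_on ball 0 r1" "\<And>u. u\<in>ball 0 r1 \<Longrightarrow> f u \<noteq> 0"
  shows "zero_free_majorant r f"
  unfolding zero_free_majorant_def using assms by blast

lemma zero_free_majorant_power:
  assumes "zero_free_majorant r f"
  shows "zero_free_majorant r (\<lambda>u. f u ^ n)"
proof (induction n)
  case 0
  have "zero_free_majorant r (\<lambda>u. 1)" by (rule zero_free_majorant_self[of r "r + 1"]) auto
  then show ?case by simp
qed (use zero_free_majorant_mult[OF assms] in simp)

text \<open>A zero-free function on a disk has a holomorphic square root, and the mean value of that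
  root at 0 is at most the mean of its modulus.\<close>

lemma zero_free_majorant_sqrt_mean:
  assumes Z: "zero_free_majorant r f" and r: "r > 0" and f: "continuous_on {0..2*pi} (\<lambda>t. f (r * cis t))"
  shows "2 * pi * sqrt (cmod (f 0)) \<le> integral {0..2*pi} (\<lambda>t. sqrt (cmod (f (r * cis t))))"
proof -
  obtain q r1 where q: "r < r1" "q holomorphic_on ball 0 r1" "\<And>u. u\<in>ball 0 r1 \<Longrightarrow> q u \<noteq> 0"
      "\<And>u. cmod u = r \<Longrightarrow> cmod (q u) = cmod (f u)" "cmod (f 0) \<le> cmod (q 0)"
    using Z unfolding zero_free_majorant_def by metis
  obtain m where m: "continuous_on (ball 0 r1) m" "\<And>u. u \<in> ball 0 r1 \<Longrightarrow> q u = exp (m u)"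
    using continuous_logarithm_on_ball[OF holomorphic_on_imp_continuous_on[OF q(2)] q(3)] by metis
  have hm: "m holomorphic_on ball 0 r1"
    by (rule continuous_logarithm_holomorphic[OF _ m(1) q(2) m(2)]) auto
  define k where "k u = exp (m u / 2)" for u
  have hk: "k holomorphic_on ball 0 r1" unfolding k_def by (intro holomorphic_intros hm) auto
  have kq: "cmod (k u) = sqrt (cmod (q u))" if "u \<in> ball 0 r1" for u
  proof -
    have "q u = k u * k u" using m(2)[OF that] by (simp add: k_def flip: exp_add)
    then show ?thesis by (simp add: norm_mult)
  qed
  have sub: "cball 0 r \<subseteq> ball 0 r1" using q(1) by auto
  have I: "((\<lambda>t. k (r * cis t)) has_integral (2 * pi * k 0)) {0..0 + 2 * pi}"
    using sub by (intro circle_mean_value holomorphic_on_imp_continuous_on[OF holomorphic_on_subset[OF hk]] holomorphic_on_subset[OF hk] r) auto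
  have nk: "cmod (k (r * cis t)) = sqrt (cmod (f (r * cis t)))" for t
  proof -
    have "cmod (r * cis t) = r" using r by (simp add: norm_mult)
    moreover from this have "r * cis t \<in> ball 0 r1" using q(1) by (simp only: mem_ball_0)
    ultimately show ?thesis using kq[of "r * cis t"] q(4)[of "r * cis t"] by simp
  qed
  have "cmod (integral {0..2*pi} (\<lambda>t. k (r * cis t))) \<le> integral {0..2*pi} (\<lambda>t. sqrt (cmod (f (r * cis t))))"
  proof (rule integral_norm_bound_integral)
    show "(\<lambda>t. k (r * cis t)) integrable_on {0..2*pi}" using I by (auto simp: integrable_on_def)
    show "(\<lambda>t. sqrt (cmod (f (r * cis t)))) integrable_on {0..2*pi}"
      by (intro integrable_continuous_interval continuous_intros f)
  qed (simp add: nk)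
  moreover have "integral {0..2*pi} (\<lambda>t. k (r * cis t)) = 2 * pi * k 0" using integral_unique[OF I] by simp
  moreover have "cmod (2 * pi * k 0) = 2 * pi * sqrt (cmod (q 0))"
  proof -
    have "0 \<in> ball 0 r1" using q(1) r by simp
    then show ?thesis using kq[of 0] by (simp add: norm_mult)
  qed
  ultimately have "2 * pi * sqrt (cmod (q 0)) \<le> integral {0..2*pi} (\<lambda>t. sqrt (cmod (f (r * cis t))))" by simp
  moreover have "2 * pi * sqrt (cmod (f 0)) \<le> 2 * pi * sqrt (cmod (q 0))" using q(5) by (intro mult_left_mono) auto
  ultimately show ?thesis by linarith
qed

text \<open>With \<^term>\<open>a s = sqrt (cmod (H s))\<close>, the distance of H from 1 is at most \<^term>\<open>\<bar>a s - 1\<bar> * (a s + 1)\<close> plus the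
  square root of \<^term>\<open>2 * (cmod (H s) - Re (H s))\<close>; the inequality of arithmetic and geometric means with weight t applies to both.\<close>

lemma mean_one_near_one:
  fixes H :: "real \<Rightarrow> complex"
  assumes c: "continuous_on {0..2*pi} H"
    and one: "(H has_integral (2 * pi)) {0..2*pi}"
    and up: "integral {0..2*pi} (\<lambda>t. cmod (H t)) \<le> 2 * pi + e"
    and low: "2 * pi \<le> integral {0..2*pi} (\<lambda>t. sqrt (cmod (H t)))"
    and t: "0 < t" "t \<le> 1" "e \<le> t\<^sup>2" "0 \<le> e"
  shows "integral {0..2*pi} (\<lambda>s. cmod (1 - H s)) \<le> 20 * t"
proof -
  let ?I = "integral {0..2*pi}"
  define a where "a s = sqrt (cmod (H s))" for s
  have a: "a s \<ge> 0" "(a s)\<^sup>2 = cmod (H s)" for s by (simp_all add: a_def)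
  have ca: "continuous_on {0..2*pi} a" unfolding a_def by (intro continuous_intros c)
  have pt: "cmod (1 - H s) \<le> (cmod (H s) - 2 * a s + 1) / (2 * t) + t * (cmod (H s) + 1) + (cmod (H s) - Re (H s)) / t + t / 2" for s
  proof -
    have sq: "(cmod (1 - H s))\<^sup>2 = (cmod (H s) - 1)\<^sup>2 + 2 * (cmod (H s) - Re (H s))"
      unfolding cmod_power2 by (simp add: power2_eq_square algebra_simps) (metis add.commute cmod_power2 power2_eq_square)
    have re: "0 \<le> cmod (H s) - Re (H s)" using complex_Re_le_cmod[of "H s"] by simp
    have "cmod (1 - H s) = sqrt ((cmod (H s) - 1)\<^sup>2 + 2 * (cmod (H s) - Re (H s)))" 
      unfolding sq[symmetric] by simp
    also have "\<dots> \<le> sqrt ((cmod (H s) - 1)\<^sup>2) + sqrt (2 * (cmod (H s) - Re (H s)))"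
      by (rule sqrt_add_le_add_sqrt) (use re in auto)
    also have "sqrt ((cmod (H s) - 1)\<^sup>2) = \<bar>a s - 1\<bar> * (a s + 1)"
    proof -
      have "cmod (H s) - 1 = (a s - 1) * (a s + 1)" using a(2)[of s] by (simp add: power2_eq_square algebra_simps)
      then show ?thesis using a(1)[of s] by (simp add: abs_mult)
    qed
    also have "\<bar>a s - 1\<bar> * (a s + 1) \<le> ((a s - 1)\<^sup>2 / t + t * (a s + 1)\<^sup>2) / 2"
    proof -
      have *: "(x - t * y)\<^sup>2 = x\<^sup>2 - 2 * t * (x * y) + t\<^sup>2 * y\<^sup>2" for x y :: real
        by (simp add: power2_eq_square algebra_simps)
      have "0 \<le> (\<bar>a s - 1\<bar> - t * (a s + 1))\<^sup>2" by simp
      then have "2 * t * (\<bar>a s - 1\<bar> * (a s + 1)) \<le> (a s - 1)\<^sup>2 + t\<^sup>2 * (a s + 1)\<^sup>2"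
        unfolding * by simp
      then show ?thesis using t by (simp add: field_simps power2_eq_square)
    qed
    also have "(a s + 1)\<^sup>2 \<le> 2 * (cmod (H s) + 1)"
      using a(2)[of s] sum_squares_bound[of "a s" 1] by (simp add: power2_sum)
    also have "(a s - 1)\<^sup>2 = cmod (H s) - 2 * a s + 1" using a(2)[of s] by (simp add: power2_diff)
    also have "sqrt (2 * (cmod (H s) - Re (H s))) \<le> (2 * (cmod (H s) - Re (H s)) / t + t) / 2"
    proof -
      let ?x = "sqrt (2 * (cmod (H s) - Re (H s)))"
      have "0 \<le> (?x - t)\<^sup>2" by simp
      then have "2 * t * ?x \<le> ?x\<^sup>2 + t\<^sup>2" by (simp only: power2_diff) (simp add: algebra_simps)
      then show ?thesis using t re by (simp add: field_simps power2_eq_square)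
    qed
    finally show ?thesis using t by (simp add: field_simps)
  qed
  have i1: "(\<lambda>s. cmod (H s)) integrable_on {0..2*pi}" "a integrable_on {0..2*pi}" "(\<lambda>s. Re (H s)) integrable_on {0..2*pi}"
    "(\<lambda>s. cmod (1 - H s)) integrable_on {0..2*pi}"
    by (intro integrable_continuous_interval continuous_intros c ca)+
  let ?A = "?I (\<lambda>s. cmod (H s))" and ?B = "?I a"
  have Re1: "?I (\<lambda>s. Re (H s)) = 2 * pi" using has_integral_Re[OF one] by (simp add: integral_unique)
  note hA = integrable_integral[OF i1(1)] and hB = integrable_integral[OF i1(2)]
    and hR = integrable_integral[OF i1(3), unfolded Re1] and h1 = has_integral_const_real[of "1::real" 0 "2*pi"]
  have "((\<lambda>s. (cmod (H s) - 2 * a s + 1) / (2 * t) + t * (cmod (H s) + 1) + (cmod (H s) - Re (H s)) / t + t / 2)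
     has_integral (?A - 2 * ?B + 2 * pi) / (2 * t) + t * (?A + 2 * pi) + (?A - 2 * pi) / t + t / 2 * (2 * pi)) {0..2*pi}"
    using h1 has_integral_const_real[of "t/2" 0 "2*pi"]
    by (intro has_integral_add has_integral_divide has_integral_diff has_integral_mult_right hA hB hR) (simp_all add: mult.commute)
  then have "?I (\<lambda>s. cmod (1 - H s)) \<le> (?A - 2 * ?B + 2 * pi) / (2 * t) + t * (?A + 2 * pi) + (?A - 2 * pi) / t + t / 2 * (2 * pi)"
    using has_integral_le[OF integrable_integral[OF i1(4)]] pt by blast
  also have "\<dots> \<le> e / (2 * t) + t * (e + 4 * pi) + e / t + t / 2 * (2 * pi)"
  proof -
    have A: "?A - 2 * ?B + 2 * pi \<le> e" "?A + 2 * pi \<le> e + 4 * pi" "?A - 2 * pi \<le> e"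
      using up low unfolding a_def[symmetric] by linarith+
    have "(?A - 2 * ?B + 2 * pi) / (2 * t) \<le> e / (2 * t)" by (rule divide_right_mono) (use A t in auto)
    moreover have "t * (?A + 2 * pi) \<le> t * (e + 4 * pi)" by (rule mult_left_mono) (use A t in auto)
    moreover have "(?A - 2 * pi) / t \<le> e / t" by (rule divide_right_mono) (use A t in auto)
    ultimately show ?thesis by linarith
  qed
  also have "\<dots> \<le> t / 2 + t * (1 + 4 * pi) + t + t / 2 * (2 * pi)"
  proof -
    have "e \<le> t * t" using t by (simp add: power2_eq_square)
    then have "e / (2 * t) \<le> t / 2" "e / t \<le> t" using t by (simp_all add: field_simps)
    moreover have "e \<le> 1" using t power_le_one[of t 2] by simp
    then have "t * (e + 4 * pi) \<le> t * (1 + 4 * pi)" using t by (intro mult_left_mono) auto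
    ultimately show ?thesis by linarith
  qed
  also have "\<dots> = t * (5/2 + 5 * pi)" by (simp add: algebra_simps)
  \<comment> \<open>\<open>5/2 + 5 * pi\<close> is about 18.2.\<close>
  also have "\<dots> \<le> t * 20" using t pi_less_4 pi_approx(2) by (intro mult_left_mono) auto
  finally show ?thesis by simp
qed

section \<open>Convergence for extremal polynomials\<close>

lemma has_vector_derivative_circle:
  assumes "(F has_field_derivative d) (at (of_real r * cis t))"
  shows "((\<lambda>t. F (of_real r * cis t)) has_vector_derivative (r * \<i> * cis t) * d) (at t within S)"
proof -
  have "((\<lambda>z. of_real r * exp (\<i> * z)) has_field_derivative of_real r * (\<i> * exp (\<i> * of_real t))) (at (of_real t))"
    by (auto intro!: derivative_eq_intros)
  then have "((\<lambda>t. of_real r * exp (\<i> * of_real t)) has_vector_derivative of_real r * (\<i> * exp (\<i> * of_real t))) (at t)"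
    using has_vector_derivative_real_field by blast
  then have "((\<lambda>t. of_real r * cis t) has_vector_derivative r * \<i> * cis t) (at t)"
    by (simp add: cis_conv_exp mult_ac)
  from field_vector_diff_chain_at[OF this assms] show ?thesis
    by (simp add: o_def has_vector_derivative_at_within)
qed

context smirnov_setting
begin

definition "mass P = (LINT s|lborel. cmod (poly_bv P s) ^ p)"
definition "J_disk P u = J_poly p \<zeta> P (\<psi> u)"
text \<open>This is the function H of the overview, for the polynomial \<open>P\<close>.\<close>

definition "J_disk' P u = poly P (\<psi> u) ^ p * deriv \<psi> u"

lemma mass_nonneg: "mass P \<ge> 0" unfolding mass_def by (rule Bochner_Integration.integral_nonneg) simp

lemma J_disk_deriv: "cmod u < R \<Longrightarrow> (J_disk P has_field_derivative J_disk' P u) (at u)"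
  unfolding J_disk_def[abs_def] J_disk'_def
  by (rule DERIV_chain2[OF J_poly_facts(1)]) (use hol\<psi> in \<open>auto intro!: holomorphic_derivI\<close>)

lemma J_disk_cont: "continuous_on (cball 0 R) (J_disk P)"
  unfolding J_disk_def[abs_def]
  by (rule continuous_on_compose2[OF holomorphic_on_imp_continuous_on[OF J_poly_holomorphic] cont\<psi>]) auto

lemma J_disk_hol: "J_disk P holomorphic_on ball 0 R"
  using J_disk_deriv by (force simp: holomorphic_on_open)

lemma J_disk'_hol: "J_disk' P holomorphic_on ball 0 R"
  unfolding J_disk'_def[abs_def] by (intro holomorphic_intros hol\<psi> holomorphic_deriv) auto

lemma \<psi>0: "\<psi> 0 = \<zeta>" "deriv \<psi> 0 = 1"
proof -
  show "\<psi> 0 = \<zeta>" using \<psi>\<phi>[of \<zeta>] \<zeta> clG by auto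
  show "deriv \<psi> 0 = 1" using deriv_inverse[OF \<zeta>(1)] \<zeta> by simp
qed

lemma deriv_\<psi>_nz_ball: "cmod u < R \<Longrightarrow> deriv \<psi> u \<noteq> 0"
  using deriv_inverse[OF \<psi>G[of u]] \<phi>\<psi>[of u] by auto

text \<open>Each side of the polygon is an increment of the primitive over an arc, bounded by the
  integral of \<open>cmod (poly_bv P s) ^ p\<close> over the corresponding piece of the curve. The
  pieces are disjoint.\<close>

lemma polygons_on_circle:
  assumes n: "n \<ge> 2" and u: "cmod u = R"
  shows "(\<Sum>i<n. cmod (J_disk P (cis (real (Suc i) * (2 * pi / n)) * u) - J_disk P (cis (real i * (2 * pi / n)) * u))) \<le> mass P"
proof -
  define h where "h = 2 * pi / n"
  have h: "0 < h" "h < 2 * pi" "real n * h = 2 * pi" using n by (simp_all add: h_def field_simps)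
  define \<theta> where "\<theta> = Arg u"
  have u\<theta>: "cis (x * h) * u = R * cis (\<theta> + x * h)" for x
    using rcis_cmod_Arg[of u] u by (simp add: \<theta>_def rcis_def cis_mult[symmetric] mult_ac)
  let ?w = "\<lambda>s. cmod (poly_bv P s) ^ p"
  let ?A = "\<lambda>i::nat. arc_preimage (\<theta> + real i * h) h"
  have J: "cmod (J_poly p \<zeta> P (\<sigma> c) - J_poly p \<zeta> P (\<sigma> a)) \<le> (LINT s:{a..c}|lborel. ?w s)" if ac: "0 \<le> a" "a \<le> c" "c \<le> l" for a c
  proof -
    have "(LINT s:{a..c}|lborel. v s * poly P (\<sigma> s) ^ p) = (LINT s|lborel. indicator {a..c} s *\<^sub>R (v s * poly P (\<sigma> s) ^ p))"
      unfolding set_lebesgue_integral_def ..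
    also have "cmod \<dots> \<le> (LINT s|lborel. cmod (indicator {a..c} s *\<^sub>R (v s * poly P (\<sigma> s) ^ p)))"
      by (rule Bochner_Integration.integral_norm_bound)
    also have "\<dots> \<le> (LINT s|lborel. indicator {a..c} s *\<^sub>R ?w s)"
    proof (rule integral_mono_AE[OF integrable_norm])
      show "integrable lborel (\<lambda>s. indicator {a..c} s *\<^sub>R (v s * poly P (\<sigma> s) ^ p))"
        using set_integrable_subset[OF set_integrable_v_poly, of "{a..c}"] ac by (simp add: set_integrable_def)
      show "integrable lborel (\<lambda>s. indicator {a..c} s *\<^sub>R ?w s)"
        by (rule integrable_mult_indicator[OF _ integrable_poly_bv]) simp
      show "AE s in lborel. cmod (indicator {a..c} s *\<^sub>R (v s * poly P (\<sigma> s) ^ p)) \<le> indicator {a..c} s *\<^sub>R ?w s"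
        using v_norm by eventually_elim (use ac in \<open>auto simp: indicator_def poly_bv_def norm_mult norm_power\<close>)
    qed
    finally show ?thesis unfolding J_poly_increment[OF ac] by (simp add: set_lebesgue_integral_def)
  qed
  have step: "cmod (J_disk P (cis (real (Suc i) * h) * u) - J_disk P (cis (real i * h) * u)) \<le> (LINT s:?A i|lborel. ?w s)" for i
  proof -
    have "\<theta> + real (Suc i) * h = (\<theta> + real i * h) + h" by (simp add: algebra_simps)
    then show ?thesis
      unfolding u\<theta> J_disk_def using arc_increment_le[OF integrable_poly_bv _ J h(1,2), of "\<theta> + real i * h"] by (simp add: add.assoc)
  qed
  have "(\<Sum>i<n. cmod (J_disk P (cis (real (Suc i) * h) * u) - J_disk P (cis (real i * h) * u))) \<le> (\<Sum>i<n. LINT s:?A i|lborel. ?w s)"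
    by (intro sum_mono step)
  also have "\<dots> = (LINT s|lborel. (\<Sum>i<n. indicator (?A i) s *\<^sub>R ?w s))"
    unfolding set_lebesgue_integral_def
    by (rule Bochner_Integration.integral_sum[symmetric]) (intro integrable_mult_indicator integrable_poly_bv, simp)
  also have "\<dots> \<le> (LINT s|lborel. ?w s)"
  proof (rule integral_mono[OF Bochner_Integration.integrable_sum integrable_poly_bv])
    show "integrable lborel (\<lambda>s. indicator (?A i) s *\<^sub>R ?w s)" for i
      by (intro integrable_mult_indicator integrable_poly_bv) simp
    show "(\<Sum>i<n. indicator (?A i) s *\<^sub>R ?w s) \<le> ?w s" for s
    proof (cases "\<exists>i<n. s \<in> ?A i")
      case True
      then obtain j where j: "j < n" "s \<in> ?A j" by blast
      then have "(\<Sum>i<n. indicator (?A i) s *\<^sub>R ?w s) = (\<Sum>i<n. if i = j then ?w s else 0)"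
        using arc_preimage_disjoint[OF _ _ h(1,3)] by (intro sum.cong refl) (auto simp: indicator_def)
      also have "\<dots> = ?w s" using j by simp
      finally show ?thesis by (rule eq_refl)
    next
      case False
      then have "(\<Sum>i<n. indicator (?A i) s *\<^sub>R ?w s) = 0" by (intro sum.neutral) (auto simp: indicator_def)
      also have "0 \<le> ?w s" by simp
      finally show ?thesis .
    qed
  qed
  finally show ?thesis by (simp add: h_def mass_def)
qed

text \<open>The sum of moduli at \<open>u\<close> is linearized: with the constants
  \<open>c i\<close> that turn the sides at \<open>u\<close> into positive numbers it becomes the
  value of a holomorphic function \<open>F\<close>. The maximum principle for \<open>F\<close> takes
  the bound from the circle to the interior.\<close>

lemma polygons_in_disk:
  assumes n: "n \<ge> 2" and u: "cmod u \<le> R"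
  shows "(\<Sum>i<n. cmod (J_disk P (cis (real (Suc i) * (2 * pi / n)) * u) - J_disk P (cis (real i * (2 * pi / n)) * u))) \<le> mass P"
proof -
  define d where "d i x = J_disk P (cis (real (Suc i) * (2 * pi / n)) * x) - J_disk P (cis (real i * (2 * pi / n)) * x)" for i :: nat and x
  define c where "c i = cnj (sgn (d i u))" for i
  define F where "F x = (\<Sum>i<n. c i * d i x)" for x
  have c1: "cmod (c i) \<le> 1" for i by (simp add: c_def norm_sgn)
  have cd: "c i * d i u = of_real (cmod (d i u))" for i
  proof -
    have "cnj (sgn z) * z = of_real (cmod z)" for z
    proof (cases "z = 0")
      case False
      have "cnj (sgn z) * z = (z * cnj z) / of_real (cmod z)" by (simp add: sgn_eq)
      then show ?thesis using False by (simp add: complex_norm_square[symmetric] power2_eq_square)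
    qed simp
    then show ?thesis by (simp add: c_def)
  qed
  have "continuous_on (cball 0 R) F"
    unfolding F_def[abs_def] d_def
    by (intro continuous_intros continuous_on_compose2[OF J_disk_cont]) (auto simp: norm_mult)
  moreover have "F holomorphic_on ball 0 R"
    unfolding F_def[abs_def] d_def
    by (intro holomorphic_intros holomorphic_on_compose_gen[OF _ J_disk_hol, unfolded o_def]) (auto simp: norm_mult)
  moreover have "cmod (F x) \<le> mass P" if "cmod x = R" for x
  proof -
    have "cmod (F x) \<le> (\<Sum>i<n. cmod (c i * d i x))" unfolding F_def by (rule norm_sum)
    also have "\<dots> \<le> (\<Sum>i<n. cmod (d i x))"
      by (intro sum_mono) (use c1 in \<open>auto simp: norm_mult intro: mult_left_le_one_le\<close>)
    also have "\<dots> \<le> mass P" unfolding d_def by (rule polygons_on_circle[OF n that])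
    finally show ?thesis .
  qed
  ultimately have "cmod (F u) \<le> mass P"
    by - (rule maximum_modulus_frontier[of F "cball 0 R"]; use R u in simp)
  moreover have "F u = of_real (\<Sum>i<n. cmod (d i u))" by (simp add: F_def cd)
  moreover have "(\<Sum>i<n. cmod (d i u)) \<ge> 0" by (simp add: sum_nonneg)
  ultimately show ?thesis unfolding d_def by (simp only: norm_of_real abs_of_nonneg)
qed

text \<open>The left-hand side is the length of the image under \<open>J_disk P\<close> of the
  circle of radius \<open>r\<close>, a limit of inscribed polygons. Working with polygons uses only
  the continuity of the primitive up to the boundary, not boundary values of its derivative.\<close>

lemma J_disk'_circle_integral:
  assumes r: "0 < r" "r < R"
  shows "r * integral {0..2*pi} (\<lambda>t. cmod (J_disk' P (r * cis t))) \<le> mass P"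
proof -
  have nr: "cmod (r * cis t) < R" for t using r by (simp add: norm_mult)
  have cH: "continuous_on S (\<lambda>t. J_disk' P (r * cis t))" for S
    by (rule continuous_on_compose2[OF holomorphic_on_imp_continuous_on[OF J_disk'_hol]]) (use nr in \<open>auto intro!: continuous_intros\<close>)
  have "integral {0..2*pi} (\<lambda>t. cmod ((r * \<i> * cis t) * J_disk' P (r * cis t))) \<le> mass P"
  proof (rule integral_norm_derivative_le_polygons)
    show "((\<lambda>t. J_disk P (r * cis t)) has_vector_derivative (r * \<i> * cis t) * J_disk' P (r * cis t)) (at t within {0..2*pi})" for t
      by (rule has_vector_derivative_circle[OF J_disk_deriv[OF nr]])
    show "continuous_on {0..2*pi} (\<lambda>t. (r * \<i> * cis t) * J_disk' P (r * cis t))" by (intro continuous_intros cH)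
    show "(\<Sum>i<n. cmod (J_disk P (r * cis (real (Suc i) * (2*pi / n))) - J_disk P (r * cis (real i * (2*pi / n))))) \<le> mass P" if "n \<ge> 2" for n
      using polygons_in_disk[OF that, of "of_real r" P] r by (simp only: mult.commute[of "of_real r"]) simp
  qed simp
  also have "(\<lambda>t. cmod ((r * \<i> * cis t) * J_disk' P (r * cis t))) = (\<lambda>t. r * cmod (J_disk' P (r * cis t)))"
    using r by (simp add: norm_mult)
  finally show ?thesis by simp
qed

text \<open>If \<open>a\<close> lies outside \<open>G\<close> there is no zero. Otherwise the zero
  at \<open>b = \<phi> a\<close> is removed by dividing by the Blaschke factor of the disk of radius
  \<open>r\<close>: on its circle \<open>r^2 - cnj b * u\<close> has modulus
  \<open>r * cmod (u - b)\<close>, and at 0 the value grows by the factor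
  \<open>r / cmod b\<close>.\<close>

lemma majorant_factor:
  assumes r: "0 < r" "r < R" and a: "a \<in> G \<Longrightarrow> cmod (\<phi> a) < r"
  shows "zero_free_majorant r (\<lambda>u. \<psi> u - a)"
proof (cases "a \<in> G")
  case False
  then show ?thesis
    using \<psi>G by (intro zero_free_majorant_self[OF r(2)] holomorphic_intros hol\<psi>) auto
next
  case True
  define b where "b = \<phi> a"
  have b: "cmod b < r" "\<psi> b = a" using a[OF True] \<psi>\<phi>[of a] True clG by (auto simp: b_def)
  \<comment> \<open>The new factor vanishes only at the mirror point of \<open>b\<close>, at
    distance \<open>r^2 / cmod b\<close> from 0; the radius has to stay below that.\<close>
  obtain r1 where r1: "r < r1" "r1 \<le> R" "cmod b * r1 < r\<^sup>2"
  proof (cases "b = 0")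
    case True
    then show ?thesis using that[of R] r by simp
  next
    case False
    define r1 where "r1 = min R ((r + r\<^sup>2 / cmod b) / 2)"
    have "r * cmod b < r * r" using b r by (intro mult_strict_left_mono)
    then have lt: "r < r\<^sup>2 / cmod b" using False by (simp add: field_simps power2_eq_square)
    moreover have "r1 < r\<^sup>2 / cmod b" using lt unfolding r1_def min_def by (auto simp: field_simps)
    then have "cmod b * r1 < cmod b * (r\<^sup>2 / cmod b)" using False by (intro mult_strict_left_mono) auto
    moreover have "cmod b * (r\<^sup>2 / cmod b) = r\<^sup>2" using False by simp
    ultimately show ?thesis using r that[of r1] by (auto simp: r1_def)
  qed
  define D where "D u = (if u = b then deriv \<psi> b else (\<psi> u - \<psi> b) / (u - b))" for u
  define q where "q u = D u * ((r\<^sup>2 - cnj b * u) / r)" for u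
  have hD: "D holomorphic_on ball 0 R"
    using removable_quotient(2)[OF cont\<psi> hol\<psi>, of b] b r unfolding D_def[abs_def] by simp
  have "q holomorphic_on ball 0 r1"
    unfolding q_def[abs_def] using r1 r by (intro holomorphic_intros holomorphic_on_subset[OF hD]) auto
  moreover have "q u \<noteq> 0" if "u \<in> ball 0 r1" for u
  proof -
    have u: "cmod u < r1" "cmod u < R" using that r1 by auto
    have "D u \<noteq> 0" using \<phi>\<psi>[of u] \<phi>\<psi>[of b] deriv_\<psi>_nz_ball[of b] u b r by (auto simp: D_def)
    moreover have "cmod (cnj b * u) < r\<^sup>2"
      using mult_left_mono[of "cmod u" r1 "cmod b"] u r1(3) by (simp add: norm_mult)
    then have "r\<^sup>2 - cnj b * u \<noteq> 0"
      using r by (metis abs_of_nonneg eq_iff_diff_eq_0 less_irrefl norm_of_real of_real_power zero_le_power2)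
    ultimately show ?thesis using r by (simp add: q_def)
  qed
  moreover have "cmod (q u) = cmod (\<psi> u - a)" if u: "cmod u = r" for u
  proof -
    have "u \<noteq> b" using u b by auto
    have "of_real (r\<^sup>2) - cnj b * u = u * cnj (u - b)"
      using complex_norm_square[of u] u by (simp add: algebra_simps)
    then have "cmod (r\<^sup>2 - cnj b * u) = r * cmod (u - b)" using u by (simp add: norm_mult flip: complex_cnj_diff)
    then show ?thesis using \<open>u \<noteq> b\<close> r b by (simp add: q_def D_def norm_mult norm_divide)
  qed
  moreover have "cmod (\<psi> 0 - a) \<le> cmod (q 0)"
  proof (cases "b = 0")
    case False
    have "cmod (\<psi> 0 - a) * cmod b \<le> cmod (\<psi> 0 - a) * r" using b by (intro mult_left_mono) auto
    then have "cmod (\<psi> 0 - a) \<le> cmod (\<psi> 0 - a) * r / cmod b" using False by (simp add: pos_le_divide_eq)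
    also have "\<dots> = cmod (q 0)" using False r b by (simp add: q_def D_def norm_mult norm_divide power2_eq_square)
    finally show ?thesis .
  qed (use b in simp)
  ultimately show ?thesis unfolding zero_free_majorant_def using r1(1) by blast
qed

text \<open>Roots are split off one by one by induction on the degree. Roots in \<open>G\<close>
  must be mapped inside the circle of radius \<open>r\<close>, because a zero on that circle cannot
  be divided out.\<close>

lemma majorant_poly:
  assumes r: "0 < r" "r < R"
  shows "P \<noteq> 0 \<Longrightarrow> (\<And>a. poly P a = 0 \<Longrightarrow> a \<in> G \<Longrightarrow> cmod (\<phi> a) < r) \<Longrightarrow> zero_free_majorant r (\<lambda>u. poly P (\<psi> u))"
proof (induction "degree P" arbitrary: P)
  case 0
  then obtain c where "P = [:c:]" "c \<noteq> 0" by (metis degree_eq_zeroE pCons_0_0)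
  then show ?case by (intro zero_free_majorant_self[OF r(2)]) auto
next
  case (Suc n)
  then have "\<not> constant (poly P)" by (simp add: constant_degree)
  from Fundamental_Theorem_Algebra.fundamental_theorem_of_algebra[OF this] obtain a where a: "poly P a = 0" by auto
  then obtain P' where P': "P = [:-a, 1:] * P'" by (metis dvdE poly_eq_0_iff_dvd)
  then have "P' \<noteq> 0" using Suc by auto
  then have "degree P = 1 + degree P'" unfolding P' by (subst degree_mult_eq) auto
  then have "zero_free_majorant r (\<lambda>u. poly P' (\<psi> u))" using Suc P' \<open>P' \<noteq> 0\<close> by (intro Suc(1)) auto
  moreover have "zero_free_majorant r (\<lambda>u. \<psi> u - a)" by (rule majorant_factor[OF r]) (use Suc a in auto)
  ultimately have "zero_free_majorant r (\<lambda>u. (\<psi> u - a) * poly P' (\<psi> u))" by (intro zero_free_majorant_mult)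
  moreover have "(\<lambda>u. poly P (\<psi> u)) = (\<lambda>u. (\<psi> u - a) * poly P' (\<psi> u))" unfolding P' by (simp add: algebra_simps)
  ultimately show ?case by simp
qed

text \<open>The hypothesis on the mass bounds the mean of the modulus from above, the zero-free
  majorants bound the mean of its square root from below, and the value 1 at the centre gives the
  mean itself.\<close>

lemma J_disk'_near_one:
  assumes r: "0 < r" "r < R" and Q: "poly Q \<zeta> = 1" "\<And>a. poly Q a = 0 \<Longrightarrow> a \<in> G \<Longrightarrow> cmod (\<phi> a) < r"
    and t: "0 < t" "t \<le> 1" "mass Q \<le> r * (2 * pi + t\<^sup>2)"
  shows "integral {0..2*pi} (\<lambda>s. cmod (1 - J_disk' Q (r * cis s))) \<le> 20 * t"
proof (rule mean_one_near_one[where e = "t\<^sup>2"])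
  have sub: "cball 0 r \<subseteq> ball (0::complex) R" using r by auto
  have H0: "J_disk' Q 0 = 1" using \<psi>0 Q by (simp add: J_disk'_def)
  have cH: "continuous_on (cball 0 r) (J_disk' Q)" "J_disk' Q holomorphic_on ball 0 r"
    using holomorphic_on_imp_continuous_on holomorphic_on_subset[OF J_disk'_hol] sub ball_subset_cball by blast+
  show c: "continuous_on {0..2*pi} (\<lambda>s. J_disk' Q (r * cis s))"
    by (rule continuous_on_compose2[OF cH(1)]) (use r in \<open>auto intro!: continuous_intros simp: norm_mult\<close>)
  show "((\<lambda>s. J_disk' Q (r * cis s)) has_integral 2 * pi) {0..2*pi}"
    using circle_mean_value[OF cH r(1), of 0] H0 by simp
  have "r * integral {0..2*pi} (\<lambda>s. cmod (J_disk' Q (r * cis s))) \<le> r * (2 * pi + t\<^sup>2)"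
    using J_disk'_circle_integral[OF r, of Q] t by linarith
  then show "integral {0..2*pi} (\<lambda>s. cmod (J_disk' Q (r * cis s))) \<le> 2 * pi + t\<^sup>2" using r by simp
  have "Q \<noteq> 0" using Q by auto
  have "zero_free_majorant r (deriv \<psi>)"
    using deriv_\<psi>_nz_ball by (intro zero_free_majorant_self[OF r(2)] holomorphic_deriv hol\<psi>) auto
  then have "zero_free_majorant r (J_disk' Q)"
    unfolding J_disk'_def[abs_def]
    by (intro zero_free_majorant_mult zero_free_majorant_power majorant_poly[OF r \<open>Q \<noteq> 0\<close> Q(2)])
  then show "2 * pi \<le> integral {0..2*pi} (\<lambda>s. sqrt (cmod (J_disk' Q (r * cis s))))"
    using zero_free_majorant_sqrt_mean[OF _ r(1) c] H0 by simp
qed (use t in auto)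

lemma disk_bound:
  assumes r: "0 < r" "r < R" and Q: "poly Q \<zeta> = 1" "\<And>a. poly Q a = 0 \<Longrightarrow> a \<in> G \<Longrightarrow> cmod (\<phi> a) < r"
    and t: "0 < t" "t \<le> 1" "mass Q \<le> r * (2 * pi + t\<^sup>2)" and u: "cmod u \<le> r"
  shows "cmod (u - J_disk Q u) \<le> 40 * R * t"
proof -
  define E where "E u = u - J_disk Q u" for u
  \<comment> \<open>\<open>T\<close> bounds the variation of \<open>E\<close> around the circle. As
    \<open>E\<close> is 0 at the centre, the maximum principle for \<open>E w - E r\<close> bounds
    \<open>E r\<close> by \<open>T\<close> too, and hence \<open>E\<close> by \<open>2 * T\<close>:
    the origin of the 40.\<close>
  define T where "T = r * (20 * t)"
  have E0: "E 0 = 0" using \<psi>0 by (simp add: E_def J_disk_def J_poly_facts(2))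
  have dE: "(E has_field_derivative 1 - J_disk' Q u) (at u)" if "cmod u < R" for u
    unfolding E_def[abs_def] by (auto intro!: derivative_eq_intros J_disk_deriv that)
  have nr: "cmod (r * cis s) < R" for s using r by (simp add: norm_mult)
  let ?d = "\<lambda>s. (r * \<i> * cis s) * (1 - J_disk' Q (r * cis s))"
  have cH: "continuous_on S (\<lambda>t. J_disk' Q (r * cis t))" for S
    by (rule continuous_on_compose2[OF holomorphic_on_imp_continuous_on[OF J_disk'_hol]]) (use nr in \<open>auto intro!: continuous_intros\<close>)
  have cd: "continuous_on S ?d" for S by (intro continuous_intros cH)
  have circ: "cmod (E (r * cis s) - E r) \<le> T" if s: "0 \<le> s" "s \<le> 2 * pi" for s
  proof -
    have "(?d has_integral (E (r * cis s) - E (r * cis 0))) {0..s}"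
      by (rule fundamental_theorem_of_calculus[OF s(1)]) (rule has_vector_derivative_circle[OF dE[OF nr]])
    then have "E (r * cis s) - E r = integral {0..s} ?d" by (simp add: integral_unique)
    also have "cmod \<dots> \<le> integral {0..s} (\<lambda>s. cmod (?d s))"
      by (rule integral_norm_bound_integral) (intro integrable_continuous_interval continuous_intros cd | simp)+
    also have "\<dots> \<le> integral {0..2*pi} (\<lambda>s. cmod (?d s))"
      by (rule integral_subset_le) (use s in \<open>auto intro!: integrable_continuous_interval continuous_on_norm cd\<close>)
    also have "(\<lambda>s. cmod (?d s)) = (\<lambda>s. r * cmod (1 - J_disk' Q (r * cis s)))" using r by (simp add: norm_mult)
    also have "integral {0..2*pi} \<dots> \<le> T"
      using J_disk'_near_one[OF r Q t] r by (simp add: T_def)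
    finally show ?thesis .
  qed
  have hE: "E holomorphic_on ball 0 R" using dE by (force simp: holomorphic_on_open)
  have disk: "cmod (E w - E r) \<le> T" if "cmod w \<le> r" for w
  proof (rule maximum_modulus_frontier[of "\<lambda>w. E w - E r" "cball 0 r"])
    have "(\<lambda>w. E w - E r) holomorphic_on cball 0 r"
      using r by (intro holomorphic_intros holomorphic_on_subset[OF hE]) auto
    then show "(\<lambda>w. E w - E r) holomorphic_on interior (cball 0 r)" "continuous_on (closure (cball 0 r)) (\<lambda>w. E w - E r)"
      using holomorphic_on_imp_continuous_on holomorphic_on_subset interior_subset by (blast, simp)
    show "cmod (E x - E r) \<le> T" if "x \<in> frontier (cball 0 r)" for x
    proof -
      have "cmod x = r" using that r by simp
      then have "x = r * cis (Arg2pi x)" using Arg2pi_eq[of x] by (simp add: cis_conv_exp)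
      then show ?thesis using circ[of "Arg2pi x"] Arg2pi[of x] by (simp add: less_imp_le)
    qed
  qed (use that in auto)
  have "cmod (E r) \<le> T" using disk[of 0] r E0 by simp
  then have "cmod (E u) \<le> 2 * T" using disk[OF u] norm_triangle_ineq[of "E u - E r" "E r"] by simp
  also have "\<dots> \<le> 40 * R * t" using r t mult_right_mono[of r R t] by (simp add: T_def)
  finally show ?thesis by (simp add: E_def)
qed

lemma closure_bound:
  assumes Q: "poly Q \<zeta> = 1" and t: "0 < t" "t \<le> 1" "mass Q < R * (2 * pi + t\<^sup>2)" and z: "z \<in> closure G"
  shows "cmod (\<phi> z - J_poly p \<zeta> Q z) \<le> 40 * R * t"
proof -
  have "cmod (\<phi> z - J_poly p \<zeta> Q z) \<le> 40 * R * t" if z: "z \<in> G" for z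
  proof -
    have pt: "2 * pi + t\<^sup>2 > 0" using pi_gt_zero by (simp add: add_pos_nonneg)
    \<comment> \<open>The circle must be larger than all images of roots and than
      \<open>\<phi> z\<close>, and large enough for the bound on the mass to hold with
      \<open>r\<close> in place of \<open>R\<close>. These are finitely many strict conditions, so
      some \<open>r < R\<close> meets them all.\<close>
    define A where "A = insert 0 (insert (mass Q / (2 * pi + t\<^sup>2)) (insert (cmod (\<phi> z)) ((\<lambda>a. cmod (\<phi> a)) ` ({a. poly Q a = 0} \<inter> G))))"
    have "Q \<noteq> 0" using Q by auto
    then have fA: "finite A" "A \<noteq> {}" unfolding A_def using poly_roots_finite[of Q] by auto
    have "\<forall>x\<in>A. x < R" unfolding A_def using R t(3) pt \<phi>G z by (auto simp: field_simps)
    then have "Max A < R" using fA by simp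
    define r where "r = (Max A + R) / 2"
    have r: "r < R" "\<And>x. x \<in> A \<Longrightarrow> x < r" using \<open>Max A < R\<close> Max_ge[OF fA(1)] by (force simp: r_def)+
    have "cmod (\<phi> z - J_disk Q (\<phi> z)) \<le> 40 * R * t"
    proof (rule disk_bound[OF _ r(1) Q _ t(1,2)])
      show "0 < r" "cmod (\<phi> z) \<le> r" using r(2)[of 0] r(2)[of "cmod (\<phi> z)"] by (simp_all add: A_def)
      show "mass Q \<le> r * (2 * pi + t\<^sup>2)" using r(2)[of "mass Q / (2 * pi + t\<^sup>2)"] pt by (simp add: A_def field_simps)
      show "cmod (\<phi> a) < r" if "poly Q a = 0" "a \<in> G" for a using r(2)[of "cmod (\<phi> a)"] that by (simp add: A_def)
    qed
    then show ?thesis using \<psi>\<phi>[of z] z clG by (simp add: J_disk_def)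
  qed
  then show ?thesis
    using continuous_on_closure_norm_le[of G "\<lambda>z. \<phi> z - J_poly p \<zeta> Q z" "40 * R * t" z] z
    by (simp add: continuous_on_diff cont\<phi> holomorphic_on_imp_continuous_on[OF J_poly_holomorphic])
qed

section \<open>Competing polynomials and the limit\<close>

lemma curve_norm_mass: "curve_norm (poly P) = mass P powr (1 / p)"
  by (simp add: curve_norm_poly mass_def)

lemma mass_le_defect: "mass P \<le> 2 * pi * R + (LINT s|lborel. defect p P s)"
proof -
  have "mass P \<le> (LINT s|lborel. cmod (branch_bv s) ^ p + defect p P s)"
    unfolding mass_def
  proof (rule integral_mono_AE[OF integrable_poly_bv Bochner_Integration.integrable_add[OF integrable_branch_bv integrable_defect]])
    show "AE s in lborel. cmod (poly_bv P s) ^ p \<le> cmod (branch_bv s) ^ p + defect p P s"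
      using defect_AE[of P]
    proof eventually_elim
      fix s assume "defect p P s = cmod (branch_bv s ^ p - poly_bv P s ^ p)"
      then show "cmod (poly_bv P s) ^ p \<le> cmod (branch_bv s) ^ p + defect p P s"
        using norm_triangle_ineq4[of "branch_bv s ^ p" "branch_bv s ^ p - poly_bv P s ^ p"] by (simp add: norm_power)
    qed
  qed
  also have "\<dots> = 2 * pi * R + (LINT s|lborel. defect p P s)"
    by (simp add: Bochner_Integration.integral_add[OF integrable_branch_bv integrable_defect] integral_branch_bv)
  finally show ?thesis .
qed

text \<open>The Hoelder bound contains the norm of \<open>P\<close> as well as its distance from
  \<open>g\<close>. Polynomials at distance less than 1 have mass at most \<open>K\<close>, so the
  second factor is at most \<open>C\<close> whatever \<open>P\<close> is, and the first can then be
  made small.\<close>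

lemma small_defect:
  assumes dens: "\<And>\<epsilon>. \<epsilon> > 0 \<Longrightarrow> \<exists>P. curve_norm (\<lambda>z. g z - poly P z) < \<epsilon>" and \<delta>: "\<delta> > 0"
  obtains P where "(LINT s|lborel. defect p P s) \<le> \<delta>"
proof -
  define K where "K = 2 ^ p * (2 ^ p * (2 * pi * R + 1))"
  define C where "C = ((2 * pi * R) powr (1/p) + K powr (1/p)) ^ (p - 1)"
  have C: "C \<ge> 0" by (simp add: C_def)
  define \<epsilon> where "\<epsilon> = min 1 (\<delta> / (C + 1))"
  have \<epsilon>: "\<epsilon> > 0" using \<delta> C by (simp add: \<epsilon>_def add_nonneg_pos)
  obtain P where P: "curve_norm (\<lambda>z. g z - poly P z) < \<epsilon>" using dens[OF \<epsilon>] by blast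
  define A where "A = curve_norm (\<lambda>z. g z - poly P z)"
  have A: "0 \<le> A" "A < 1" "A \<le> \<delta> / (C + 1)" using P by (simp_all add: A_def curve_norm_def \<epsilon>_def)
  let ?I = "LINT s|lborel. cmod (branch_bv s - poly_bv P s) ^ p"
  have I: "?I \<le> 1"
  proof (rule ccontr)
    assume "\<not> ?I \<le> 1"
    then have "?I powr (1/p) \<ge> 1" by (intro ge_one_powr_ge_zero) auto
    then show False using A by (simp add: A_def curve_norm_diff)
  qed
  have "mass P \<le> (LINT s|lborel. 2 ^ p * (cmod (branch_bv s) ^ p + cmod (branch_bv s - poly_bv P s) ^ p))"
    unfolding mass_def
  proof (rule integral_mono[OF integrable_poly_bv])
    show "integrable lborel (\<lambda>s. 2 ^ p * (cmod (branch_bv s) ^ p + cmod (branch_bv s - poly_bv P s) ^ p))"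
      using integrable_branch_bv integrable_diff by simp
    fix s
    have "cmod (poly_bv P s) \<le> cmod (branch_bv s) + cmod (branch_bv s - poly_bv P s)"
      using norm_triangle_ineq4[of "branch_bv s" "branch_bv s - poly_bv P s"] by simp
    then have "cmod (poly_bv P s) ^ p \<le> (cmod (branch_bv s) + cmod (branch_bv s - poly_bv P s)) ^ p" by (intro power_mono) auto
    also have "\<dots> \<le> 2 ^ p * (cmod (branch_bv s) ^ p + cmod (branch_bv s - poly_bv P s) ^ p)" by (rule power_add_le_two) auto
    finally show "cmod (poly_bv P s) ^ p \<le> 2 ^ p * (cmod (branch_bv s) ^ p + cmod (branch_bv s - poly_bv P s) ^ p)" .
  qed
  also have "\<dots> = 2 ^ p * (2 * pi * R + ?I)" using integrable_branch_bv integrable_diff by (simp add: integral_branch_bv)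
  also have "\<dots> \<le> 2 ^ p * (2 * pi * R + 1)" using I by simp
  also have "\<dots> \<le> K" unfolding K_def using R mult_right_mono[of 1 "2 ^ p" "2 ^ p * (2 * pi * R + 1)"] by simp
  finally have "mass P \<le> K" .
  have "(LINT s|lborel. defect p P s) \<le> A * ((2 * pi * R) powr (1/p) + curve_norm (poly P)) ^ (p - 1)"
    using defect_integral_le[of P] by (simp add: A_def)
  also have "\<dots> \<le> A * C"
    unfolding C_def curve_norm_mass using \<open>mass P \<le> K\<close> mass_nonneg A
    by (intro mult_left_mono power_mono add_left_mono powr_mono2) auto
  also have "\<dots> \<le> \<delta> / (C + 1) * C" using A C by (intro mult_right_mono)
  also have "\<dots> \<le> \<delta>" using \<delta> C by (simp add: field_simps)
  finally show ?thesis using that by blast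
qed

text \<open>\<open>1 - poly P \<zeta> ^ p\<close> is the derivative of the error function at
  \<open>\<zeta>\<close>, so Cauchy's inequality on a circle in \<open>G\<close> applies. It
  controls only the p-th power, which is enough for a normalization by modulus.\<close>

lemma poly_at_centre:
  assumes d: "d > 0" "cball \<zeta> d \<subseteq> G"
  shows "cmod (1 - poly P \<zeta> ^ p) \<le> (LINT s|lborel. defect p P s) / (2 * d)"
proof -
  let ?F = "\<lambda>z. \<phi> z - J_poly p \<zeta> P z"
  have hF: "?F holomorphic_on G" by (intro holomorphic_intros hol\<phi> J_poly_holomorphic)
  have bd: "cmod (?F x) \<le> 1/2 * (LINT s|lborel. defect p P s)" if "cmod (\<zeta> - x) = d" for x
  proof -
    have "x \<in> cball \<zeta> d" using that by (simp add: dist_norm)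
    then show ?thesis using d(2) closure_subset \<phi>_minus_J_bound[OF \<zeta>(1,2) bG] by blast
  qed
  have sub: "ball \<zeta> d \<subseteq> G" using d ball_subset_cball by blast
  have "cmod ((deriv ^^ 1) ?F \<zeta>) \<le> fact 1 * (1/2 * (LINT s|lborel. defect p P s)) / d ^ 1"
    by (rule Cauchy_inequality[OF holomorphic_on_subset[OF hF sub]
          holomorphic_on_imp_continuous_on[OF holomorphic_on_subset[OF hF d(2)]] d(1) bd])
  moreover have "deriv ?F \<zeta> = 1 - poly P \<zeta> ^ p"
    using holomorphic_derivI[OF hol\<phi> openG \<zeta>(1)] \<zeta>(3)
    by (intro DERIV_imp_deriv DERIV_diff J_poly_facts(1)) simp
  ultimately show ?thesis by simp
qed

lemma mass_smult: "mass (smult c P) = cmod c ^ p * mass P"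
proof -
  have "cmod (poly_bv (smult c P) s) ^ p = cmod c ^ p * cmod (poly_bv P s) ^ p" for s
    by (simp add: poly_bv_def norm_mult power_mult_distrib mult_ac)
  then show ?thesis by (simp add: mass_def)
qed

text \<open>Dividing by the value \<open>c\<close> at the centre normalizes the polynomial and
  divides the mass by \<open>cmod c ^ p\<close>, which is close to 1. \<open>\<delta>\<close> is
  chosen small enough for the resulting quotient to stay below the target.\<close>

lemma competitor:
  assumes dens: "\<And>\<epsilon>. \<epsilon> > 0 \<Longrightarrow> \<exists>P. curve_norm (\<lambda>z. g z - poly P z) < \<epsilon>" and e: "e > 0"
  obtains P where "poly P \<zeta> = 1" "mass P < 2 * pi * R + e"
proof -
  obtain d where d: "d > 0" "cball \<zeta> d \<subseteq> G" using openG \<zeta>(1) open_contains_cball by blast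
  have "((\<lambda>x. (2 * pi * R + x) / (1 - x / (2 * d))) \<longlongrightarrow> 2 * pi * R) (at_right 0)"
    using d by (auto intro!: tendsto_eq_intros)
  then have "\<forall>\<^sub>F x in at_right 0. (2 * pi * R + x) / (1 - x / (2 * d)) < 2 * pi * R + e"
    by (rule order_tendstoD) (use e in simp)
  moreover have "\<forall>\<^sub>F x in at_right 0. x \<in> {0<..<2 * d}" by (rule eventually_at_right_real) (use d in simp)
  ultimately have "\<forall>\<^sub>F x in at_right 0. (2 * pi * R + x) / (1 - x / (2 * d)) < 2 * pi * R + e \<and> x \<in> {0<..<2 * d}"
    by (rule eventually_conj)
  then obtain \<delta> where \<delta>: "(2 * pi * R + \<delta>) / (1 - \<delta> / (2 * d)) < 2 * pi * R + e" "0 < \<delta>" "\<delta> < 2 * d"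
    using eventually_happens'[OF trivial_limit_at_right_real] by (metis (no_types, lifting) greaterThanLessThan_iff)
  obtain P where P: "(LINT s|lborel. defect p P s) \<le> \<delta>" using small_defect[OF dens \<delta>(2)] by blast
  define c where "c = poly P \<zeta>"
  have k: "1 - \<delta> / (2 * d) > 0" using \<delta> d by (simp add: field_simps)
  have "cmod (1 - c ^ p) \<le> \<delta> / (2 * d)"
    unfolding c_def by (rule order_trans[OF poly_at_centre[OF d] divide_right_mono[OF P]]) (use d in simp)
  then have cp: "1 - \<delta> / (2 * d) \<le> cmod c ^ p" using norm_triangle_ineq2[of 1 "1 - c ^ p"] by (simp add: norm_power)
  then have c0: "c \<noteq> 0" "cmod c ^ p > 0" using k p by (auto intro: ccontr simp: power_0_left split: if_splits)
  have "mass (smult (1/c) P) = mass P / cmod c ^ p" by (simp add: mass_smult norm_divide power_divide)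
  also have "\<dots> \<le> (2 * pi * R + \<delta>) / (1 - \<delta> / (2 * d))"
    using mass_le_defect[of P] P mass_nonneg[of P] cp k by (intro frac_le) auto
  finally have "mass (smult (1/c) P) < 2 * pi * R + e" using \<delta>(1) by simp
  moreover have "poly (smult (1/c) P) \<zeta> = 1" using c0 by (simp add: c_def)
  ultimately show ?thesis using that by blast
qed

lemma sup_norm_tendsto_0:
  assumes dens: "\<And>\<epsilon>. \<epsilon> > 0 \<Longrightarrow> \<exists>P. curve_norm (\<lambda>z. g z - poly P z) < \<epsilon>"
    and Q: "\<And>n. n \<ge> 1 \<Longrightarrow> poly (Q n) \<zeta> = 1"
      "\<And>n P. n \<ge> 1 \<Longrightarrow> degree P \<le> n \<Longrightarrow> poly P \<zeta> = 1 \<Longrightarrow> curve_norm (poly (Q n)) \<le> curve_norm (poly P)"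
  shows "(\<lambda>n. sup_norm_on (closure G) (\<lambda>z. \<phi> z - J_poly p \<zeta> (Q n) z)) \<longlonglongrightarrow> 0"
proof (rule LIMSEQ_I)
  fix e :: real assume e: "e > 0"
  \<comment> \<open>The bound \<open>40 * R * t\<close> of \<open>closure_bound\<close> is then at
    most \<open>e / 2\<close>.\<close>
  define t where "t = min 1 (e / (80 * R))"
  have t: "0 < t" "t \<le> 1" "40 * R * t < e"
  proof -
    show "0 < t" "t \<le> 1" using e R by (simp_all add: t_def)
    have "40 * R * t \<le> 40 * R * (e / (80 * R))" unfolding t_def using R by (intro mult_left_mono) auto
    also have "\<dots> = e / 2" using R by simp
    finally show "40 * R * t < e" using e by simp
  qed
  obtain P where P: "poly P \<zeta> = 1" "mass P < 2 * pi * R + R * t\<^sup>2"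
    using competitor[OF dens, of "R * t\<^sup>2"] R t by auto
  have "norm (sup_norm_on (closure G) (\<lambda>z. \<phi> z - J_poly p \<zeta> (Q n) z) - 0) < e" if n: "n \<ge> max 1 (degree P)" for n
  proof -
    have n1: "n \<ge> 1" "degree P \<le> n" using n by auto
    have "mass (Q n) \<le> mass P"
      using Q(2)[OF n1 P(1)] mass_nonneg p unfolding curve_norm_mass
      by (smt (verit) divide_pos_pos of_nat_0_less_iff less_le_trans zero_less_one powr_less_mono2 Suc_le_eq One_nat_def)
    then have "mass (Q n) < R * (2 * pi + t\<^sup>2)" using P(2) by (simp add: algebra_simps)
    note bd = closure_bound[OF Q(1)[OF n1(1)] t(1,2) this]
    have \<zeta>c: "\<zeta> \<in> closure G" using \<zeta>(1) closure_subset by auto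
    have "sup_norm_on (closure G) (\<lambda>z. \<phi> z - J_poly p \<zeta> (Q n) z) \<le> 40 * R * t"
      unfolding sup_norm_on_def by (rule cSUP_least) (use \<zeta>c bd in auto)
    moreover have "0 \<le> sup_norm_on (closure G) (\<lambda>z. \<phi> z - J_poly p \<zeta> (Q n) z)"
      unfolding sup_norm_on_def
      by (rule cSUP_upper2[OF _ \<zeta>c]) (use bd in \<open>auto intro!: bdd_aboveI2\<close>)
    ultimately show ?thesis using t(3) by simp
  qed
  then show "\<exists>no. \<forall>n\<ge>no. norm (sup_norm_on (closure G) (\<lambda>z. \<phi> z - J_poly p \<zeta> (Q n) z) - 0) < e" by blast
qed

end

section \<open>Orientation and the Smirnov space\<close>

text \<open>Holds without measurability, since both integrals are 0 if f is not measurable.\<close>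

lemma integral_lebesgue_on_reflect:
  fixes f :: "real \<Rightarrow> real"
  shows "integral\<^sup>L (lebesgue_on {0..l}) (\<lambda>s. f (l - s)) = integral\<^sup>L (lebesgue_on {0..l}) f"
proof -
  have T: "(\<lambda>x. l - x) \<in> lebesgue \<rightarrow>\<^sub>M lebesgue"
    using lebesgue_affine_measurable[of "\<lambda>_. -1" l] by simp
  have D: "distr lebesgue lebesgue (\<lambda>x. l - x) = lebesgue"
    using lebesgue_real_affine[of "-1" l] by (simp add: density_1)
  define F where "F s = indicator {0..l} s *\<^sub>R f s" for s
  have *: "integral\<^sup>L lebesgue (\<lambda>s. F (l - s)) = integral\<^sup>L lebesgue F"
  proof (cases "F \<in> borel_measurable lebesgue")
    case True
    then show ?thesis using integral_distr[OF T True] D by simp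
  next
    case False
    moreover have "(\<lambda>s. F (l - s)) \<notin> borel_measurable lebesgue"
      using measurable_compose[OF T, of "\<lambda>s. F (l - s)" borel] False by auto
    ultimately show ?thesis by (metis borel_measurable_integrable not_integrable_integral_eq)
  qed
  have "integral\<^sup>L (lebesgue_on {0..l}) (\<lambda>s. f (l - s)) = integral\<^sup>L lebesgue (\<lambda>s. indicator {0..l} s *\<^sub>R f (l - s))"
    by (rule integral_restrict_space) auto
  also have "(\<lambda>s. indicator {0..l} s *\<^sub>R f (l - s)) = (\<lambda>s. F (l - s))" by (auto simp: F_def indicator_def)
  also note *
  also have "integral\<^sup>L lebesgue F = integral\<^sup>L (lebesgue_on {0..l}) f"
    unfolding F_def by (rule integral_restrict_space[symmetric]) auto
  finally show ?thesis .
qed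

text \<open>A continuous injective real function is monotone, and a closed curve on the circle turns
  by a multiple of \<open>2 * pi\<close>. If it turned more than once, the angle
  \<open>\<tau> 0 + 2 * pi\<close> would occur before the end and contradict injectivity.\<close>

lemma increasing_circle_lift:
  fixes \<tau> :: "real \<Rightarrow> real"
  assumes l: "l > 0" and c: "continuous_on {0..l} \<tau>" and inj: "inj_on (\<lambda>s. cis (\<tau> s)) {0..<l}"
    and loop: "cis (\<tau> l) = cis (\<tau> 0)" and lt: "\<tau> 0 < \<tau> l"
  shows "\<And>x y. 0 \<le> x \<Longrightarrow> x < y \<Longrightarrow> y \<le> l \<Longrightarrow> \<tau> x < \<tau> y" and "\<tau> l = \<tau> 0 + 2 * pi"
proof -
  have eqD: "x = y" if "x \<in> {0..<l}" "y \<in> {0..<l}" "cis (\<tau> x) = cis (\<tau> y)" for x y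
    using inj_onD[OF inj that(3,1,2)] .
  have injl: "inj_on \<tau> {0..l}"
  proof (rule inj_onI)
    fix x y assume xy: "x \<in> {0..l}" "y \<in> {0..l}" "\<tau> x = \<tau> y"
    have end_point: False if "z \<in> {0..<l}" "\<tau> z = \<tau> l" for z
    proof -
      have "cis (\<tau> z) = cis (\<tau> 0)" using loop that by simp
      then have "z = 0" using eqD[of z 0] that(1) l by auto
      then show False using that lt by simp
    qed
    show "x = y"
      using end_point[of x] end_point[of y] eqD[of x y] xy by (cases "x = l"; cases "y = l") auto
  qed
  have above: "\<tau> 0 < \<tau> x" if "0 < x" "x \<le> l" for x
    using continuous_inj_imp_mono[OF that(1) _ c injl] that lt by (cases "x = l") auto
  show strict: "\<tau> x < \<tau> y" if "0 \<le> x" "x < y" "y \<le> l" for x y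
  proof (cases "x = 0")
    case False
    have "continuous_on {0..y} \<tau>" "inj_on \<tau> {0..y}"
      using continuous_on_subset[OF c] inj_on_subset[OF injl] that by auto
    from continuous_inj_imp_mono[OF _ that(2) this] show ?thesis using False that above[of x] by auto
  qed (use above that in auto)
  have "cis (\<tau> l - \<tau> 0) = 1" using loop by (simp add: cis_divide[symmetric])
  then have "cos (\<tau> l - \<tau> 0) = 1" by (metis cis.sel(1) one_complex.sel(1))
  then obtain k :: int where k: "\<tau> l - \<tau> 0 = real_of_int k * (2 * pi)" using cos_one_2pi_int[of "\<tau> l - \<tau> 0"] by auto
  have "real_of_int k * (2 * pi) > 0" using k lt by linarith
  then have "k > 0" by (simp add: zero_less_mult_iff)
  moreover have "\<not> k \<ge> 2"
  proof
    assume "k \<ge> 2"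
    then have "real_of_int k * (2 * pi) \<ge> 2 * (2 * pi)" by (intro mult_right_mono) auto
    then have g: "\<tau> l > \<tau> 0 + 2 * pi" using k pi_gt_zero by linarith
    then obtain x where x: "0 \<le> x" "x \<le> l" "\<tau> x = \<tau> 0 + 2 * pi"
      using IVT'[of \<tau> 0 "\<tau> 0 + 2 * pi" l] c l by auto
    then have "x < l" using g by (cases "x = l") auto
    moreover have "cis (\<tau> x) = cis (\<tau> 0)" using x(3) by (simp add: cis_mult[symmetric])
    ultimately have "x = 0" using eqD[of x 0] x l by auto
    then show False using x(3) pi_gt_zero by simp
  qed
  ultimately have "k = 1" by simp
  then show "\<tau> l = \<tau> 0 + 2 * pi" using k by simp
qed

text \<open>The extended map is injective: interior and frontier have disjoint images, and on the
  curve \<open>boundary_injective\<close> applies. Its image is compact and contains the open disk,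
  hence the closed one, and a continuous bijection of compact sets is a homeomorphism.\<close>

lemma conformal_inverse_extension:
  assumes gam: "simple_path \<gamma>" "pathfinish \<gamma> = pathstart \<gamma>" and G: "G = inside (path_image \<gamma>)"
    and hol: "\<phi> holomorphic_on G" and bij: "bij_betw \<phi> G (ball 0 R)" and cont: "continuous_on (closure G) \<phi>"
  obtains \<psi> where "\<psi> holomorphic_on ball 0 R" "continuous_on (cball 0 R) \<psi>" "\<And>z. z \<in> closure G \<Longrightarrow> \<psi> (\<phi> z) = z"
    "\<And>u. u \<in> cball 0 R \<Longrightarrow> \<phi> (\<psi> u) = u" "\<And>u. cmod u < R \<Longrightarrow> \<psi> u \<in> G" "R > 0"
proof -
  note J = Jordan_inside_outside[OF gam]
  have oG: "open G" and bG: "bounded G" and fG: "frontier G = path_image \<gamma>" and neG: "G \<noteq> {}" using J G by auto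
  have im: "\<phi> ` G = ball 0 R" and injG: "inj_on \<phi> G" using bij by (auto simp: bij_betw_def)
  have R: "R > 0" using im neG by (metis ball_eq_empty image_is_empty not_less)
  have clG: "closure G = G \<union> frontier G" using oG by (simp add: closure_Un_frontier)
  note sph = frontier_to_sphere[OF oG hol bij cont]
  have inside: "cmod (\<phi> z) < R" if "z \<in> G" for z using im that by auto
  have inj: "inj_on \<phi> (closure G)"
  proof (rule inj_onI)
    fix x y assume xy: "x \<in> closure G" "y \<in> closure G" "\<phi> x = \<phi> y"
    show "x = y"
    proof (cases "x \<in> G \<longleftrightarrow> y \<in> G")
      case True
      show ?thesis
      proof (cases "x \<in> G")
        case False
        then have "x \<in> path_image \<gamma>" "y \<in> path_image \<gamma>" using True xy clG fG by auto
        then show ?thesis using boundary_injective[OF gam G hol bij cont, of x y] xy(3) by auto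
      qed (use True xy inj_onD[OF injG] in auto)
    next
      case False
      then show ?thesis using sph[of x] sph[of y] inside[of x] inside[of y] xy clG by auto
    qed
  qed
  have cmp: "compact (closure G)" using bG by simp
  have imc: "\<phi> ` closure G = cball 0 R"
  proof
    show "\<phi> ` closure G \<subseteq> cball 0 R" using sph inside clG by (force simp: less_imp_le)
    have "closed (\<phi> ` closure G)" by (intro compact_imp_closed compact_continuous_image cont cmp)
    moreover have "ball 0 R \<subseteq> \<phi> ` closure G" using im closure_subset by blast
    ultimately have "closure (ball 0 R) \<subseteq> \<phi> ` closure G" by (simp add: closure_minimal)
    then show "cball 0 R \<subseteq> \<phi> ` closure G" using R by simp
  qed
  define \<psi> where "\<psi> = inv_into (closure G) \<phi>"
  have \<psi>\<phi>: "\<psi> (\<phi> z) = z" if "z \<in> closure G" for z using inv_into_f_f[OF inj that] by (simp add: \<psi>_def)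
  have \<phi>\<psi>: "\<phi> (\<psi> u) = u" if "u \<in> cball 0 R" for u using f_inv_into_f[of u \<phi> "closure G"] imc that by (simp add: \<psi>_def)
  have c\<psi>: "continuous_on (cball 0 R) \<psi>" using continuous_on_inv[OF cont cmp] \<psi>\<phi> imc by auto
  have \<psi>G: "\<psi> u \<in> G" if "cmod u < R" for u
  proof -
    have "u \<in> \<phi> ` G" using im that by auto
    then show ?thesis using \<psi>\<phi> closure_subset by fastforce
  qed
  obtain \<psi>' where \<psi>': "\<psi>' holomorphic_on (\<phi> ` G)" "\<And>z. z \<in> G \<Longrightarrow> \<psi>' (\<phi> z) = z"
    using holomorphic_has_inverse[OF hol oG injG] by metis
  have "\<psi> holomorphic_on ball 0 R"
  proof (rule holomorphic_transform[OF \<psi>'(1)[unfolded im]])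
    fix u :: complex assume u: "u \<in> ball 0 R"
    then have "\<phi> (\<psi> u) = u" "\<psi> u \<in> G" using \<phi>\<psi>[of u] \<psi>G[of u] by auto
    then show "\<psi>' u = \<psi> u" using \<psi>'(2) by metis
  qed
  then show ?thesis using that c\<psi> \<psi>\<phi> \<phi>\<psi> \<psi>G R by blast
qed

text \<open>For the root of \<open>deriv \<psi>\<close> with logarithm
  \<open>- h (\<psi> w)\<close>, the product defining membership is the constant 1, so all its
  circular means are \<open>2 * pi\<close>.\<close>

lemma branch_in_smirnov_space:
  assumes oG: "open G" and hol: "\<phi> holomorphic_on G" and bij: "bij_betw \<phi> G (ball 0 R)"
    and branch: "power_branch_on G (deriv \<phi>) (1 / p) g"
  shows "g \<in> smirnov_space p G \<phi> R"
proof -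
  have im: "\<phi> ` G = ball 0 R" and injG: "inj_on \<phi> G" using bij by (auto simp: bij_betw_def)
  define \<psi> where "\<psi> = inv_into G \<phi>"
  have \<psi>: "\<psi> u \<in> G" "\<phi> (\<psi> u) = u" if "u \<in> ball 0 R" for u
    using inv_into_into[of u \<phi> G] f_inv_into_f[of u \<phi> G] im that by (simp_all add: \<psi>_def)
  obtain \<psi>' where \<psi>': "\<psi>' holomorphic_on ball 0 R" "\<And>z. z \<in> G \<Longrightarrow> deriv \<phi> z * deriv \<psi>' (\<phi> z) = 1"
      "\<And>z. z \<in> G \<Longrightarrow> \<psi>' (\<phi> z) = z"
    using holomorphic_has_inverse[OF hol oG injG] unfolding im by metis
  have eq: "\<psi>' u = \<psi> u" if "u \<in> ball 0 R" for u using \<psi>'(3)[of "\<psi> u"] \<psi>[OF that] by simp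
  have hol\<psi>: "\<psi> holomorphic_on ball 0 R" by (rule holomorphic_transform[OF \<psi>'(1) eq])
  have deq: "deriv \<psi> u = deriv \<psi>' u" if u: "u \<in> ball 0 R" for u
  proof (rule deriv_cong_ev[OF _ refl])
    show "\<forall>\<^sub>F x in nhds u. \<psi> x = \<psi>' x"
      using eventually_nhds_in_open[OF open_ball u] by eventually_elim (simp add: eq)
  qed
  obtain h where h: "h holomorphic_on G" "\<And>z. z \<in> G \<Longrightarrow> exp (h z) = deriv \<phi> z" "\<And>z. z \<in> G \<Longrightarrow> g z = exp (of_real (1/p) * h z)"
    using branch unfolding power_branch_on_def by blast
  have holh: "(\<lambda>w. - h (\<psi> w)) holomorphic_on ball 0 R"
  proof -
    have "\<psi> ` ball 0 R \<subseteq> G" using \<psi>(1) by blast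
    then show ?thesis using holomorphic_on_minus[OF holomorphic_on_compose_gen[OF hol\<psi> h(1)]] by (simp add: o_def)
  qed
  define k where "k w = exp (of_real (1/p) * (- h (\<psi> w)))" for w
  have "exp (- h (\<psi> w)) = deriv \<psi> w" if w: "w \<in> ball 0 R" for w
  proof -
    have "exp (h (\<psi> w)) * deriv \<psi> w = 1" using \<psi>'(2)[OF \<psi>(1)[OF w]] h(2)[OF \<psi>(1)[OF w]] \<psi>(2)[OF w] deq[OF w] by simp
    then show ?thesis by (simp add: exp_minus inverse_unique)
  qed
  then have "power_branch_on (ball 0 R) (deriv \<psi>) (1/p) k"
    unfolding power_branch_on_def k_def using holh by blast
  moreover have one: "g (\<psi> w) * k w = 1" if "w \<in> ball 0 R" for w
    using h(3)[OF \<psi>(1)[OF that]] by (simp add: k_def flip: exp_add)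
  have "(\<lambda>w. g (\<psi> w) * k w) \<in> hardy_space p R"
    unfolding hardy_space_def
  proof (intro CollectI conjI)
    show "(\<lambda>w. g (\<psi> w) * k w) holomorphic_on ball 0 R"
      by (rule holomorphic_transform[OF holomorphic_on_const[of 1]]) (simp add: one)
    have "integral {0..2*pi} (\<lambda>\<theta>. cmod (g (\<psi> (of_real r * cis \<theta>)) * k (of_real r * cis \<theta>)) powr p) = 2 * pi" if "r \<in> {0<..<R}" for r
    proof -
      have "of_real r * cis \<theta> \<in> ball 0 R" for \<theta> using that by (simp add: norm_mult)
      then show ?thesis by (simp add: one)
    qed
    then show "bdd_above ((\<lambda>r. integral {0..2*pi} (\<lambda>\<theta>. cmod (g (\<psi> (of_real r * cis \<theta>)) * k (of_real r * cis \<theta>)) powr p)) ` {0<..<R})"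
      by (intro bdd_aboveI2[where M = "2 * pi"]) simp
  qed
  moreover have "g holomorphic_on G"
    by (rule holomorphic_transform[of "\<lambda>z. exp (of_real (1/p) * h z)"]) (use h in \<open>auto intro!: holomorphic_intros\<close>)
  ultimately show ?thesis unfolding smirnov_space_def Let_def \<psi>_def by blast
qed

text \<open>Everything is assembled here for a parametrization that \<open>\<phi>\<close> carries
  around the circle in the positive direction. The norm enters only through its formula in
  \<open>\<sigma>\<close>, so that both orientations of the given curve can use the result.\<close>

lemma approximation_by_positive_lift:
  fixes p :: nat
  assumes gam: "simple_path \<gamma>" "pathfinish \<gamma> = pathstart \<gamma>" and G: "G = inside (path_image \<gamma>)"
    and l: "l > 0" and lip: "\<And>a b. a \<in> {0..l} \<Longrightarrow> b \<in> {0..l} \<Longrightarrow> dist (\<sigma> a) (\<sigma> b) \<le> \<bar>a - b\<bar>"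
    and loop: "\<sigma> l = \<sigma> 0" and inj: "inj_on \<sigma> {0..<l}" and im: "\<sigma> ` {0..l} = path_image \<gamma>"
    and len: "\<And>W. (\<And>a b. 0 \<le> a \<Longrightarrow> a \<le> b \<Longrightarrow> b \<le> l \<Longrightarrow> dist (\<sigma> a) (\<sigma> b) \<le> W b - W a) \<Longrightarrow> l \<le> W l - (W 0 :: real)"
    and \<tau>: "continuous_on {0..l} \<tau>" "\<tau> 0 < \<tau> l" and \<phi>\<sigma>: "\<And>s. s \<in> {0..l} \<Longrightarrow> \<phi> (\<sigma> s) = R * cis (\<tau> s)"
    and zeta: "\<zeta> \<in> G" and conformal: "conformal_onto_disk \<phi> G R" and normalized: "\<phi> \<zeta> = 0" "deriv \<phi> \<zeta> = 1"
    and cont: "continuous_on (closure G) \<phi>" and p: "p \<ge> 1"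
    and branch: "power_branch_on G (deriv \<phi>) (1 / real p) g"
    and Nm: "\<And>f. Nm f = (integral\<^sup>L (lebesgue_on {0..l}) (\<lambda>s. cmod (boundary_value G f (\<sigma> s)) powr real p)) powr (1 / real p)"
    and Q: "\<And>n. n \<ge> 1 \<Longrightarrow> poly (Q n) \<zeta> = 1"
      "\<And>n P. n \<ge> 1 \<Longrightarrow> degree P \<le> n \<Longrightarrow> poly P \<zeta> = 1 \<Longrightarrow> Nm (poly (Q n)) \<le> Nm (poly P)"
  shows "n \<ge> 1 \<Longrightarrow> sup_norm_on (closure G) (\<lambda>z. \<phi> z - J_poly p \<zeta> (Q n) z)
      \<le> 1/2 * ((2 * pi * R) powr (1 / real p) + l powr (1 / real p)) ^ (p - 1) * Nm (\<lambda>z. g z - poly (Q n) z)"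
    and "(\<And>\<epsilon>. \<epsilon> > 0 \<Longrightarrow> \<exists>P. Nm (\<lambda>z. g z - poly P z) < \<epsilon>) \<Longrightarrow>
      (\<lambda>n. sup_norm_on (closure G) (\<lambda>z. \<phi> z - J_poly p \<zeta> (Q n) z)) \<longlonglongrightarrow> 0"
proof -
  note J = Jordan_inside_outside[OF gam]
  have oG: "open G" and bG: "bounded G" and fG: "frontier G = path_image \<gamma>" using J G by auto
  have hol: "\<phi> holomorphic_on G" and bij: "bij_betw \<phi> G (ball 0 R)" using conformal by (auto simp: conformal_onto_disk_def)
  obtain \<psi> where \<psi>: "\<psi> holomorphic_on ball 0 R" "continuous_on (cball 0 R) \<psi>" "\<And>z. z \<in> closure G \<Longrightarrow> \<psi> (\<phi> z) = z"
    "\<And>u. u \<in> cball 0 R \<Longrightarrow> \<phi> (\<psi> u) = u" "\<And>u. cmod u < R \<Longrightarrow> \<psi> u \<in> G" "R > 0"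
    using conformal_inverse_extension[OF gam G hol bij cont] by metis
  have clG: "closure G = G \<union> \<sigma> ` {0..l}" unfolding im fG[symmetric] by (rule closure_Un_frontier)
  have GL: "G \<inter> \<sigma> ` {0..l} = {}" unfolding im fG[symmetric] using oG by (auto simp: frontier_def interior_open)
  have cisinj: "inj_on (\<lambda>s. cis (\<tau> s)) {0..<l}"
  proof (rule inj_onI)
    fix x y assume xy: "x \<in> {0..<l}" "y \<in> {0..<l}" "cis (\<tau> x) = cis (\<tau> y)"
    then have "\<phi> (\<sigma> x) = \<phi> (\<sigma> y)" using \<phi>\<sigma>[of x] \<phi>\<sigma>[of y] by simp
    moreover have "\<sigma> x \<in> closure G" "\<sigma> y \<in> closure G" using clG xy by auto
    ultimately have "\<sigma> x = \<sigma> y" using \<psi>(3) by metis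
    then show "x = y" using inj_onD[OF inj _ xy(1,2)] by simp
  qed
  have "cis (\<tau> l) = cis (\<tau> 0)" using \<phi>\<sigma>[of l] \<phi>\<sigma>[of 0] l loop \<psi>(6) by simp
  note lift = increasing_circle_lift[OF l \<tau>(1) cisinj this \<tau>(2)]
  have \<phi>ball: "cmod (\<phi> z) < R" if "z \<in> G" for z using bij that by (auto simp: bij_betw_def)
  interpret jordan_disk \<sigma> l R G \<phi> \<psi> \<tau>
    by unfold_locales fact+
  obtain \<rho> v where d: "jordan_disk_density \<sigma> l R G \<phi> \<psi> \<tau> \<rho> v" using density_exists by blast
  interpret jordan_disk_density \<sigma> l R G \<phi> \<psi> \<tau> \<rho> v by (rule d)
  obtain h where h: "h holomorphic_on G" "\<And>z. z \<in> G \<Longrightarrow> exp (h z) = deriv \<phi> z \<and> g z = exp (of_real (1 / real p) * h z)"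
    using branch unfolding power_branch_on_def by blast
  obtain b where b: "b \<in> borel_measurable borel"
    "AE s in lborel. s \<in> {0..l} \<longrightarrow> has_nontangential_limit G g (\<sigma> s) (b s) \<and> b s ^ p = \<eta> s / v s"
    by (rule boundary_function_exists[OF p holomorphic_on_imp_continuous_on[OF h(1)] h(2)])
  interpret smirnov_setting \<sigma> l R G \<phi> \<psi> \<tau> \<rho> v p g b \<zeta>
    by unfold_locales (use p b zeta normalized bG in auto)
  have N: "Nm f = curve_norm f" for f by (simp add: Nm curve_norm_def)
  show "sup_norm_on (closure G) (\<lambda>z. \<phi> z - J_poly p \<zeta> (Q n) z)
      \<le> 1/2 * ((2 * pi * R) powr (1 / real p) + l powr (1 / real p)) ^ (p - 1) * Nm (\<lambda>z. g z - poly (Q n) z)" if "n \<ge> 1"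
    unfolding N by (rule sup_norm_estimate) (use Q(2)[OF that, of 1] N in simp)
  show "(\<lambda>n. sup_norm_on (closure G) (\<lambda>z. \<phi> z - J_poly p \<zeta> (Q n) z)) \<longlonglongrightarrow> 0"
    if "\<And>\<epsilon>. \<epsilon> > 0 \<Longrightarrow> \<exists>P. Nm (\<lambda>z. g z - poly P z) < \<epsilon>"
    by (rule sup_norm_tendsto_0) (use that Q N in auto)
qed

theorem theorem1p1:
  fixes \<gamma> :: "real \<Rightarrow> complex" and G :: "complex set" and l R :: real
    and \<zeta> :: complex and \<phi> g :: "complex \<Rightarrow> complex"
    and p :: nat and Q :: "nat \<Rightarrow> complex poly"
  assumes curve: "rectifiable_jordan_curve \<gamma>"
    and G: "G = inside (path_image \<gamma>)"
    and l: "l = curve_length \<gamma> 0 1"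
    and zeta: "\<zeta> \<in> G"
    and conformal: "conformal_onto_disk \<phi> G R"
    and normalized: "\<phi> \<zeta> = 0" "deriv \<phi> \<zeta> = 1"
    and extended: "continuous_on (closure G) \<phi>"
    and p: "p \<ge> 1"
    and branch: "power_branch_on G (deriv \<phi>) (1 / real p) g" "g \<zeta> = 1"
    and Q: "\<And>n. n \<ge> 1 \<Longrightarrow> extremal_poly (real p) \<gamma> \<zeta> n (Q n)"
  shows "(\<forall>n\<ge>1. sup_norm_on (closure G) (\<lambda>z. \<phi> z - J_poly p \<zeta> (Q n) z)
            \<le> 1/2 * ((2 * pi * R) powr (1 / real p) + l powr (1 / real p)) ^ (p - 1)
                * smirnov_norm (real p) \<gamma> (\<lambda>z. g z - poly (Q n) z)) \<and>
         (smirnov_domain (real p) \<gamma> \<phi> R \<longrightarrow>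
            (\<lambda>n. sup_norm_on (closure G) (\<lambda>z. \<phi> z - J_poly p \<zeta> (Q n) z)) \<longlonglongrightarrow> 0)"
proof -
  define \<sigma> where "\<sigma> = arc_length_param \<gamma>"
  note \<sigma> = arc_length_param_properties[OF curve l \<sigma>_def]
  have gam: "simple_path \<gamma>" "pathfinish \<gamma> = pathstart \<gamma>" using curve by (auto simp: rectifiable_jordan_curve_def)
  have hol: "\<phi> holomorphic_on G" and bij: "bij_betw \<phi> G (ball 0 R)" using conformal by (auto simp: conformal_onto_disk_def)
  note J = Jordan_inside_outside[OF gam]
  have oG: "open G" and fG: "frontier G = path_image \<gamma>" using J G by auto
  have R: "R > 0" using conformal_inverse_extension[OF gam G hol bij extended] by metis
  have \<sigma>F: "\<sigma> s \<in> frontier G" if "s \<in> {0..l}" for s using \<sigma>(5) fG that by auto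
  then have \<sigma>C: "\<sigma> s \<in> closure G" if "s \<in> {0..l}" for s using that by (auto simp: frontier_def)
  have c\<sigma>: "continuous_on {0..l} \<sigma>"
  proof (rule lipschitz_on_continuous_on)
    show "1-lipschitz_on {0..l} \<sigma>" using \<sigma>(2) by (auto simp: lipschitz_on_def dist_real_def)
  qed
  have c\<phi>\<sigma>: "continuous_on {0..l} (\<lambda>s. \<phi> (\<sigma> s) / R)"
    using R by (intro continuous_intros continuous_on_compose2[OF extended c\<sigma>]) (use \<sigma>F in \<open>auto simp: frontier_def\<close>)
  have n\<phi>\<sigma>: "cmod (\<phi> (\<sigma> s)) = R" if "s \<in> {0..l}" for s by (rule frontier_to_sphere[OF oG hol bij extended \<sigma>F[OF that]])
  then have "\<phi> (\<sigma> s) / R \<noteq> 0" if "s \<in> {0..l}" for s using R that by force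
  \<comment> \<open>The angle along the curve is the imaginary part of a continuous logarithm of the
    image, which exists because the parameter interval is contractible.\<close>
  then obtain L where L: "continuous_on {0..l} L" "\<And>s. s \<in> {0..l} \<Longrightarrow> \<phi> (\<sigma> s) / R = exp (L s)"
    using continuous_logarithm_on_contractible[OF c\<phi>\<sigma>] convex_imp_contractible[of "{0..l}"] by (metis convex_real_interval(5))
  define \<tau> where "\<tau> s = Im (L s)" for s
  have \<phi>\<sigma>: "\<phi> (\<sigma> s) = R * cis (\<tau> s)" if "s \<in> {0..l}" for s
  proof -
    have "cmod (exp (L s)) = 1" using L(2)[OF that] n\<phi>\<sigma>[OF that] R by (metis abs_of_pos divide_self_if less_numeral_extra(3) norm_divide norm_of_real)
    then have "Re (L s) = 0" by (simp add: norm_exp_eq_Re)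
    then have "exp (L s) = cis (\<tau> s)" by (simp add: exp_eq_polar \<tau>_def)
    then show ?thesis using L(2)[OF that] R by (simp add: field_simps)
  qed
  have c\<tau>: "continuous_on {0..l} \<tau>" unfolding \<tau>_def by (intro continuous_intros L)
  have Nm: "smirnov_norm (real p) \<gamma> f = (integral\<^sup>L (lebesgue_on {0..l}) (\<lambda>s. cmod (boundary_value G f (\<sigma> s)) powr real p)) powr (1 / real p)" for f
    by (simp add: smirnov_norm_def arc_length_integral_def G l \<sigma>_def)
  have Nm': "smirnov_norm (real p) \<gamma> f = (integral\<^sup>L (lebesgue_on {0..l}) (\<lambda>s. cmod (boundary_value G f (\<sigma> (l - s))) powr real p)) powr (1 / real p)" for f
    unfolding Nm using integral_lebesgue_on_reflect[of l "\<lambda>s. cmod (boundary_value G f (\<sigma> s)) powr real p"] by simp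
  have Q1: "poly (Q n) \<zeta> = 1" if "n \<ge> 1" for n using Q[OF that] by (simp add: extremal_poly_def)
  have Q2: "smirnov_norm (real p) \<gamma> (poly (Q n)) \<le> smirnov_norm (real p) \<gamma> (poly P)"
    if "n \<ge> 1" "degree P \<le> n" "poly P \<zeta> = 1" for n P using Q[OF that(1)] that by (simp add: extremal_poly_def)
  have dens: "\<exists>P. smirnov_norm (real p) \<gamma> (\<lambda>z. g z - poly P z) < \<epsilon>" if "smirnov_domain (real p) \<gamma> \<phi> R" "\<epsilon> > 0" for \<epsilon>
    using that branch_in_smirnov_space[OF oG hol bij branch(1)] unfolding smirnov_domain_def G by blast
  have l0: "0 \<in> {0..l}" "l \<in> {0..l}" using \<sigma>(1) by auto
  \<comment> \<open>If the angle returned to its initial value, the value halfway between those at 0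
    and at \<open>l / 2\<close> would be taken on both halves of the interval, against injectivity
    on the curve.\<close>
  have "\<tau> 0 < \<tau> l \<or> \<tau> l < \<tau> 0"
  proof (rule ccontr)
    assume "\<not> ?thesis"
    then have eq: "\<tau> l = \<tau> 0" by simp
    obtain \<psi> where \<psi>: "\<And>z. z \<in> closure G \<Longrightarrow> \<psi> (\<phi> z) = z"
      using conformal_inverse_extension[OF gam G hol bij extended] by metis
    have inj: "x = y" if "x \<in> {0..<l}" "y \<in> {0..<l}" "\<tau> x = \<tau> y" for x y
    proof -
      have "\<phi> (\<sigma> x) = \<phi> (\<sigma> y)" using \<phi>\<sigma>[of x] \<phi>\<sigma>[of y] that by simp
      moreover have "x \<in> {0..l}" "y \<in> {0..l}" using that by auto
      ultimately have "\<sigma> x = \<sigma> y" using \<psi>[OF \<sigma>C] by metis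
      then show ?thesis using inj_onD[OF \<sigma>(4)] that by blast
    qed
    let ?m = "l / 2" and ?c = "(\<tau> 0 + \<tau> (l / 2)) / 2"
    have ne: "\<tau> ?m \<noteq> \<tau> 0" using inj[of ?m 0] \<sigma>(1) by auto
    have c: "continuous_on {0..?m} \<tau>" "continuous_on {?m..l} \<tau>" using continuous_on_subset[OF c\<tau>] \<sigma>(1) by auto
    obtain x where x: "0 \<le> x" "x \<le> ?m" "\<tau> x = ?c"
      using IVT'[of \<tau> 0 ?c ?m] IVT2'[of \<tau> ?m ?c 0] c(1) \<sigma>(1) by (cases "\<tau> 0 \<le> \<tau> ?m") auto
    obtain y where y: "?m \<le> y" "y \<le> l" "\<tau> y = ?c"
      using IVT'[of \<tau> ?m ?c l] IVT2'[of \<tau> l ?c ?m] c(2) eq \<sigma>(1) by (cases "\<tau> ?m \<le> \<tau> l") auto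
    have "x \<noteq> ?m" "y \<noteq> l" using x y ne eq by auto
    then have "x = y" using inj[of x y] x y \<sigma>(1) by auto
    then show False using x y \<open>x \<noteq> ?m\<close> by simp
  qed
  then show ?thesis
  proof
    assume "\<tau> 0 < \<tau> l"
    note rules = approximation_by_positive_lift[where \<sigma> = \<sigma> and \<tau> = \<tau> and Nm = "smirnov_norm (real p) \<gamma>", OF gam G]
    show ?thesis
    proof (intro conjI allI impI)
      fix n :: nat assume "n \<ge> 1"
      show "sup_norm_on (closure G) (\<lambda>z. \<phi> z - J_poly p \<zeta> (Q n) z)
            \<le> 1/2 * ((2 * pi * R) powr (1 / real p) + l powr (1 / real p)) ^ (p - 1)
                * smirnov_norm (real p) \<gamma> (\<lambda>z. g z - poly (Q n) z)"
        by (rule rules(1); fact)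
    next
      assume "smirnov_domain (real p) \<gamma> \<phi> R"
      note dens = dens[OF this]
      show "(\<lambda>n. sup_norm_on (closure G) (\<lambda>z. \<phi> z - J_poly p \<zeta> (Q n) z)) \<longlonglongrightarrow> 0"
        by (rule rules(2); fact)
    qed
  next
    \<comment> \<open>The curve may be parametrized clockwise. It is then run backwards; the norm
      does not change, as \<open>Nm'\<close> states.\<close>
    assume lt: "\<tau> l < \<tau> 0"
    let ?\<sigma> = "\<lambda>s. \<sigma> (l - s)" and ?\<tau> = "\<lambda>s. \<tau> (l - s)"
    have lip: "dist (?\<sigma> a) (?\<sigma> b) \<le> \<bar>a - b\<bar>" if "a \<in> {0..l}" "b \<in> {0..l}" for a b
      using \<sigma>(2)[of "l - a" "l - b"] that by (simp add: abs_minus_commute)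
    have loop: "?\<sigma> l = ?\<sigma> 0" using \<sigma>(3) by simp
    have inj: "inj_on ?\<sigma> {0..<l}"
    proof (rule inj_onI)
      have refl: "\<sigma> (l - x) = \<sigma> (if x = 0 then 0 else l - x)" for x using \<sigma>(3) by simp
      fix x y assume xy: "x \<in> {0..<l}" "y \<in> {0..<l}" "?\<sigma> x = ?\<sigma> y"
      then have "\<sigma> (if x = 0 then 0 else l - x) = \<sigma> (if y = 0 then 0 else l - y)" using refl by metis
      then have "(if x = 0 then 0 else l - x) = (if y = 0 then 0 else l - y)"
        by (rule inj_onD[OF \<sigma>(4)]) (use xy in auto)
      then show "x = y" using xy by (auto split: if_splits)
    qed
    have "(\<lambda>s. l - s) ` {0..l} = {0..l}" by simp
    then have im: "?\<sigma> ` {0..l} = path_image \<gamma>" using \<sigma>(5) image_image[of \<sigma> "\<lambda>s. l - s" "{0..l}"] by simp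
    have len: "l \<le> W l - W 0" if W: "\<And>a b. 0 \<le> a \<Longrightarrow> a \<le> b \<Longrightarrow> b \<le> l \<Longrightarrow> dist (?\<sigma> a) (?\<sigma> b) \<le> W b - W a" for W :: "real \<Rightarrow> real"
    proof -
      \<comment> \<open>Minimality of the length is applied to the reflected function
        \<open>- W (l - s)\<close>, whose increments along the original direction are those of
        \<open>W\<close> along the reversed one.\<close>
      have "l \<le> (- W (l - l)) - (- W (l - 0))"
        by (rule \<sigma>(6)) (use W[of "l - _" "l - _"] in \<open>force simp: dist_commute\<close>)
      then show ?thesis by simp
    qed
    have c\<tau>': "continuous_on {0..l} ?\<tau>" by (rule continuous_on_compose2[OF c\<tau>]) (auto intro!: continuous_intros)
    have lt': "?\<tau> 0 < ?\<tau> l" using lt by simp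
    have \<phi>\<sigma>': "\<phi> (?\<sigma> s) = R * cis (?\<tau> s)" if "s \<in> {0..l}" for s using \<phi>\<sigma>[of "l - s"] that by simp
    note rules = approximation_by_positive_lift[where \<sigma> = ?\<sigma> and \<tau> = ?\<tau> and Nm = "smirnov_norm (real p) \<gamma>", OF gam G]
    show ?thesis
    proof (intro conjI allI impI)
      fix n :: nat assume "n \<ge> 1"
      show "sup_norm_on (closure G) (\<lambda>z. \<phi> z - J_poly p \<zeta> (Q n) z)
            \<le> 1/2 * ((2 * pi * R) powr (1 / real p) + l powr (1 / real p)) ^ (p - 1)
                * smirnov_norm (real p) \<gamma> (\<lambda>z. g z - poly (Q n) z)"
        by (rule rules(1); fact)
    next
      assume "smirnov_domain (real p) \<gamma> \<phi> R"
      note dens = dens[OF this]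
      show "(\<lambda>n. sup_norm_on (closure G) (\<lambda>z. \<phi> z - J_poly p \<zeta> (Q n) z)) \<longlonglongrightarrow> 0"
        by (rule rules(2); fact)
    qed
  qed
qed

end
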